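(* Let $n\geq 1$ and let $\beta_{n,m}=B_m(\mathbb{R}P^2\setminus\{x_1,\dots,x_n\})$. Then: (1) if $m\geq 3$, then $\Gamma_2(\beta_{n,m})=\Gamma_3(\beta_{n,m})$; (2) if $m\geq 5$, then $\beta_{n,m}^{(1)}=\beta_{n,m}^{(2)}$. In particular, for $m\geq 3$ the group $\beta_{n,m}$ is not residually nilpotent, and for $m\geq 5$ it is not residually solvable.
   Context: $B_m(\mathbb{R}P^2\setminus\{x_1,\dots,x_n\})=\pi_1(F_m(\mathbb{R}P^2\setminus\{x_1,\dots,x_n\})/S_m)$ is the $m$-string braid group of the projective plane with $n$ points removed, where $F_m(X)$ denotes the ordered configuration space of $m$ distinct points of $X$. For a group $G$, the lower central series is $\Gamma_1(G)=G$, $\Gamma_i(G)=[\Gamma_{i-1}(G),G]$, and the derived series is $G^{(0)}=G$, $G^{(i)}=[G^{(i-1)},G^{(i-1)}]$. *)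

theory Defs
  imports "HOL-Analysis.Analysis" "HOL-Algebra.Algebra"
begin

definition quotient_topology :: "'a topology \<Rightarrow> ('a \<Rightarrow> 'b) \<Rightarrow> 'b topology" where
  "quotient_topology T q = topology (\<lambda>U. U \<subseteq> q ` topspace T \<and> openin T {x \<in> topspace T. q x \<in> U})"

definition RP2 :: "(real^3) set topology" where
  "RP2 = quotient_topology (top_of_set (sphere (0::real^3) 1)) (\<lambda>x. {x, -x})"

definition ordered_conf :: "'a topology \<Rightarrow> nat \<Rightarrow> (nat \<Rightarrow> 'a) topology" where
  "ordered_conf T m = subtopology (product_topology (\<lambda>i. T) {..<m}) {g. inj_on g {..<m}}"

definition unordered_conf :: "'a topology \<Rightarrow> nat \<Rightarrow> 'a set topology" where
  "unordered_conf T m = quotient_topology (ordered_conf T m) (\<lambda>g. g ` {..<m})"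

definition loop_at :: "'a topology \<Rightarrow> 'a \<Rightarrow> (real \<Rightarrow> 'a) \<Rightarrow> bool" where
  "loop_at T b g \<longleftrightarrow> pathin T g \<and> g 0 = b \<and> g 1 = b"

definition path_homotopic :: "'a topology \<Rightarrow> (real \<Rightarrow> 'a) \<Rightarrow> (real \<Rightarrow> 'a) \<Rightarrow> bool" where
  "path_homotopic T p q \<longleftrightarrow>
     homotopic_with (\<lambda>r. r 0 = p 0 \<and> r 1 = p 1) (top_of_set {0..1}) T p q"

definition loop_class :: "'a topology \<Rightarrow> 'a \<Rightarrow> (real \<Rightarrow> 'a) \<Rightarrow> (real \<Rightarrow> 'a) set" where
  "loop_class T b g = {h. loop_at T b h \<and> path_homotopic T g h}"

text \<open>Concatenation of paths (as joinpaths, but for arbitrary carrier types).\<close>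
definition path_join :: "(real \<Rightarrow> 'a) \<Rightarrow> (real \<Rightarrow> 'a) \<Rightarrow> real \<Rightarrow> 'a" where
  "path_join p q = (\<lambda>t. if t \<le> 1/2 then p (2 * t) else q (2 * t - 1))"

definition fundamental_group :: "'a topology \<Rightarrow> 'a \<Rightarrow> (real \<Rightarrow> 'a) set monoid" where
  "fundamental_group T b =
    \<lparr> carrier = {loop_class T b g | g. loop_at T b g},
      mult = (\<lambda>A B. loop_class T b (path_join (SOME a. a \<in> A) (SOME c. c \<in> B))),
      one = loop_class T b (\<lambda>t. b) \<rparr>"

definition punctured_RP2 :: "(real^3) set set \<Rightarrow> (real^3) set topology" where
  "punctured_RP2 P = subtopology RP2 (topspace RP2 - P)"

definition braid_group_RP2 :: "(real^3) set set \<Rightarrow> nat \<Rightarrow> (real^3) set set \<Rightarrow> _" where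
  "braid_group_RP2 P m c = fundamental_group (unordered_conf (punctured_RP2 P) m) c"

text \<open>Gamma_1(G) = G, Gamma_(i+1)(G) = [Gamma_i(G), G]; index 0 is set equal to G as well.\<close>
fun lower_central :: "('a, 'b) monoid_scheme \<Rightarrow> nat \<Rightarrow> 'a set" where
  "lower_central G 0 = carrier G"
| "lower_central G (Suc 0) = carrier G"
| "lower_central G (Suc (Suc i)) =
     generate G {x \<otimes>\<^bsub>G\<^esub> y \<otimes>\<^bsub>G\<^esub> inv\<^bsub>G\<^esub> x \<otimes>\<^bsub>G\<^esub> inv\<^bsub>G\<^esub> y
                 | x y. x \<in> lower_central G (Suc i) \<and> y \<in> carrier G}"

definition derived_series :: "('a, 'b) monoid_scheme \<Rightarrow> nat \<Rightarrow> 'a set" where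
  "derived_series G i = (derived G ^^ i) (carrier G)"

definition residually_nilpotent :: "('a, 'b) monoid_scheme \<Rightarrow> bool" where
  "residually_nilpotent G \<longleftrightarrow> (\<Inter>i\<in>{1..}. lower_central G i) = {\<one>\<^bsub>G\<^esub>}"

definition residually_solvable :: "('a, 'b) monoid_scheme \<Rightarrow> bool" where
  "residually_solvable G \<longleftrightarrow> (\<Inter>i. derived_series G i) = {\<one>\<^bsub>G\<^esub>}"

end

theory Submission
  imports Defs
begin

text \<open>
  Points of the projective plane are represented by vectors of \<open>\<real>\<^sup>3\<close> up to sign, so a configuration is a set of
  pairwise non-parallel vectors and homotopies are given by straight-line interpolation. Every loop of
  configurations is a product of moves of single tokens along segments between configurations in general position,
  and two tokens spanning a triangle without further tokens or punctures give rise to half twists.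

  Let \<open>N\<close> be \<open>\<Gamma>\<^sub>3(G)\<close>, or \<open>G''\<close> if \<open>m \<ge> 5\<close>, and work modulo \<open>N\<close>. The half twists \<open>a\<close> and \<open>b\<close> along adjacent segments satisfy
  the braid relation, so they are conjugate and are equal as soon as they commute. They commute modulo \<open>\<Gamma>\<^sub>3\<close>, where
  commutators are central. Modulo \<open>G''\<close> commutators commute with each other; if \<open>m \<ge> 5\<close>, two further tokens
  provide a conjugate \<open>h\<close> of \<open>a\<close> and \<open>b\<close> commuting with both, so that \<open>a - h\<close> and \<open>b - h\<close> are commutators and \<open>a\<close>
  commutes with \<open>b\<close>. Hence all half twists are equal to a single element \<open>s0\<close>. It is central, and it is equal to its
  inverse because the projective plane is not orientable: the sense of rotation is reversed when a token is carried
  across a line. Therefore tokens can be moved past each other, conjugation by \<open>s0\<close> turns a loop of one token into a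
  loop of another one, loops of different tokens commute, and \<open>G/N\<close> is abelian. So \<open>\<Gamma>\<^sub>2 = \<Gamma>\<^sub>3\<close> and \<open>G' = G''\<close>, and
  both series are constant from there on. They do not reach the trivial group since \<open>G\<close> is not abelian: two adjacent
  half twists permute the points by transpositions that do not commute.
\<close>

subsection \<open>Projective segments and triangles\<close>

text \<open>No presentation of the braid group is used. What enters of it is a map to a group in
  which straight moves of one token satisfy two relations, one for an empty triangle and one for two
  disjoint segments. The sign of a vector is not part of the data: negating all representatives
  reverses the triple product and hence the apparent sense of a half twist. This forces the
  bookkeeping of signs, and it is the source of \<open>s0 = - s0\<close>. As the full twist
  vanishes, a segment may be swept across a resting token, so moves of different tokens commute even
  if their segments cross.

  Commuting loops alone do not show that \<open>G/N\<close> is abelian, because a loop of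
  configurations permutes the tokens. Therefore a generic labelled configuration \<open>w\<close> is
  joined to the base configuration by moves; a closed chain or a relabelling changes the joining
  element only by a product of \<open>s0\<close> and loops of single tokens at \<open>w\<close>. Two
  loops of the same token commute because one of them can be handed over to another token.
  \<open>w\<close> has to be generic for all configurations on the way, so it is chosen
  last.\<close>

definition dt :: "real^3 \<Rightarrow> real^3 \<Rightarrow> real^3 \<Rightarrow> real" where
  "dt a b c = inner a (cross3 b c)"

lemma dt_linear [simp]:
  "dt (x + y) b c = dt x b c + dt y b c" "dt a (x + y) c = dt a x c + dt a y c" "dt a b (x + y) = dt a b x + dt a b y"
  "dt (x - y) b c = dt x b c - dt y b c" "dt a (x - y) c = dt a x c - dt a y c" "dt a b (x - y) = dt a b x - dt a b y"
  "dt (k *\<^sub>R a) b c = k * dt a b c" "dt a (k *\<^sub>R b) c = k * dt a b c" "dt a b (k *\<^sub>R c) = k * dt a b c"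
  "dt (- a) b c = - dt a b c" "dt a (- b) c = - dt a b c" "dt a b (- c) = - dt a b c"
  "dt 0 b c = 0" "dt a 0 c = 0" "dt a b 0 = 0"
  "dt a a b = 0" "dt a b a = 0" "dt b a a = 0"
  by (simp_all add: dt_def cross3_simps)

lemma dt_swap: "dt b a c = - dt a b c" "dt a c b = - dt a b c" "dt c b a = - dt a b c"
  by (simp_all add: dt_def cross3_simps)

lemma dt_rot: "dt b c a = dt a b c" "dt c a b = dt a b c"
  by (simp_all add: dt_def cross3_simps)

lemma coord_zero:
  assumes "dt u w z \<noteq> 0" "a *\<^sub>R u + b *\<^sub>R w + c *\<^sub>R z = 0"
  shows "a = 0 \<and> b = 0 \<and> c = 0"
proof -
  have "dt (a *\<^sub>R u + b *\<^sub>R w + c *\<^sub>R z) w z = 0" "dt u (a *\<^sub>R u + b *\<^sub>R w + c *\<^sub>R z) z = 0"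
    "dt u w (a *\<^sub>R u + b *\<^sub>R w + c *\<^sub>R z) = 0"
    unfolding assms(2) by simp_all
  then show ?thesis using assms(1) by simp
qed

lemma coord_eq:
  assumes "dt u w z \<noteq> 0"
  shows "a *\<^sub>R u + b *\<^sub>R w + c *\<^sub>R z = a' *\<^sub>R u + b' *\<^sub>R w + c' *\<^sub>R z \<longleftrightarrow> a = a' \<and> b = b' \<and> c = c'"
proof
  assume "a *\<^sub>R u + b *\<^sub>R w + c *\<^sub>R z = a' *\<^sub>R u + b' *\<^sub>R w + c' *\<^sub>R z"
  then have "(a - a') *\<^sub>R u + (b - b') *\<^sub>R w + (c - c') *\<^sub>R z = 0"
    by (simp add: algebra_simps)
  from coord_zero[OF assms this] show "a = a' \<and> b = b' \<and> c = c'" by simp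
qed simp

text \<open>Cramer's rule: each coefficient is the determinant with one vector replaced by
  \<open>x\<close>, divided by \<open>dt u w z\<close>.\<close>

lemma coord_ex:
  assumes "dt u w z \<noteq> 0"
  obtains a b c where "x = a *\<^sub>R u + b *\<^sub>R w + c *\<^sub>R z"
proof -
  have "dt u w z *\<^sub>R x = dt x w z *\<^sub>R u + dt u x z *\<^sub>R w + dt u w x *\<^sub>R z"
    by (simp add: dt_def cross3_simps forall_3)
  moreover have "x = (1 / dt u w z) *\<^sub>R (dt u w z *\<^sub>R x)" using assms by simp
  ultimately have "x = (1 / dt u w z) *\<^sub>R (dt x w z *\<^sub>R u + dt u x z *\<^sub>R w + dt u w x *\<^sub>R z)" by simp
  then have "x = (dt x w z / dt u w z) *\<^sub>R u + (dt u x z / dt u w z) *\<^sub>R w + (dt u w x / dt u w z) *\<^sub>R z"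
    by (simp add: scaleR_add_right)
  then show thesis using that by blast
qed

text \<open>Lagrange's identity turns \<open>cross3 p q = 0\<close> into
  \<open>inner q q *\<^sub>R p = inner q p *\<^sub>R q\<close>. Two nonzero vectors thus represent
  the same point of the projective plane iff their cross product vanishes.\<close>

lemma cross3_eq_0_iff: "cross3 p q = 0 \<longleftrightarrow> q = 0 \<or> (\<exists>k. p = k *\<^sub>R q)"
proof
  assume 0: "cross3 p q = 0"
  have *: "inner q q *\<^sub>R p = inner q p *\<^sub>R q"
    using Lagrange[of q p q] 0 by simp
  show "q = 0 \<or> (\<exists>k. p = k *\<^sub>R q)"
  proof (cases "q = 0")
    case False
    then have "p = (1 / inner q q) *\<^sub>R (inner q q *\<^sub>R p)" by simp
    then have "p = (inner q p / inner q q) *\<^sub>R q" unfolding * by simp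
    then show ?thesis by blast
  qed simp
qed (auto simp: cross_mult_left)

lemma dt_imp_cross: "dt a b c \<noteq> 0 \<Longrightarrow> cross3 a b \<noteq> 0" "dt a b c \<noteq> 0 \<Longrightarrow> cross3 b c \<noteq> 0" "dt a b c \<noteq> 0 \<Longrightarrow> cross3 a c \<noteq> 0"
  by (auto simp: cross3_eq_0_iff)

lemma cross3_commute_0: "cross3 a b = 0 \<longleftrightarrow> cross3 b a = 0"
  by (subst cross_skew) simp

text \<open>Only the trivial combination is excluded, so the zero vector belongs to the cone of
  badly placed vertices, as for \<open>b = - a\<close>. Then \<open>sep\<close> fails against every
  nonempty set, and such a triangle is never clear.\<close>

definition cone3 :: "real^3 \<Rightarrow> real^3 \<Rightarrow> real^3 \<Rightarrow> (real^3) set" where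
  "cone3 a b c = {\<alpha> *\<^sub>R a + \<beta> *\<^sub>R b + \<gamma> *\<^sub>R c | \<alpha> \<beta> \<gamma>. 0 \<le> \<alpha> \<and> 0 \<le> \<beta> \<and> 0 \<le> \<gamma> \<and> 0 < \<alpha> + \<beta> + \<gamma>}"

definition sep :: "(real^3) set \<Rightarrow> (real^3) set \<Rightarrow> bool" where
  "sep A B \<longleftrightarrow> (\<forall>p\<in>A. \<forall>q\<in>B. cross3 p q \<noteq> 0)"

text \<open>The projective triangle with vertices \<open>a\<close>, \<open>b\<close>, \<open>c\<close> contains no point represented in \<open>Q\<close>;
  the segment from \<open>a\<close> to \<open>b\<close> is the degenerate triangle \<open>a\<close>, \<open>b\<close>, \<open>b\<close>.\<close>
definition clr :: "(real^3) set \<Rightarrow> real^3 \<Rightarrow> real^3 \<Rightarrow> real^3 \<Rightarrow> bool" where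
  "clr Q a b c \<longleftrightarrow> sep (cone3 a b c) Q"

definition dj :: "real^3 \<Rightarrow> real^3 \<Rightarrow> real^3 \<Rightarrow> real^3 \<Rightarrow> bool" where
  "dj a a' b b' \<longleftrightarrow> sep (cone3 a a' a') (cone3 b b' b')"

lemma cone3I: "0 \<le> \<alpha> \<Longrightarrow> 0 \<le> \<beta> \<Longrightarrow> 0 \<le> \<gamma> \<Longrightarrow> 0 < \<alpha> + \<beta> + \<gamma> \<Longrightarrow>
    x = \<alpha> *\<^sub>R a + \<beta> *\<^sub>R b + \<gamma> *\<^sub>R c \<Longrightarrow> x \<in> cone3 a b c"
  unfolding cone3_def by blast

lemma cone3_vertex [simp]: "a \<in> cone3 a b c" "b \<in> cone3 a b c" "c \<in> cone3 a b c"
  by (rule cone3I[of 1 0 0] cone3I[of 0 1 0] cone3I[of 0 0 1]; simp)+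

lemma cone3_add: assumes "x \<in> cone3 a b c" "y \<in> cone3 a b c" shows "x + y \<in> cone3 a b c"
proof -
  obtain \<alpha> \<beta> \<gamma> where *: "x = \<alpha> *\<^sub>R a + \<beta> *\<^sub>R b + \<gamma> *\<^sub>R c" "0 \<le> \<alpha>" "0 \<le> \<beta>" "0 \<le> \<gamma>" "0 < \<alpha> + \<beta> + \<gamma>"
    using assms(1) unfolding cone3_def by blast
  obtain \<alpha>' \<beta>' \<gamma>' where **: "y = \<alpha>' *\<^sub>R a + \<beta>' *\<^sub>R b + \<gamma>' *\<^sub>R c" "0 \<le> \<alpha>'" "0 \<le> \<beta>'" "0 \<le> \<gamma>'" "0 < \<alpha>' + \<beta>' + \<gamma>'"
    using assms(2) unfolding cone3_def by blast
  show ?thesis using * **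
    by (intro cone3I[of "\<alpha> + \<alpha>'" "\<beta> + \<beta>'" "\<gamma> + \<gamma>'"]) (simp_all add: algebra_simps)
qed

lemma cone3_scale: assumes "x \<in> cone3 a b c" "0 < k" shows "k *\<^sub>R x \<in> cone3 a b c"
proof -
  obtain \<alpha> \<beta> \<gamma> where *: "x = \<alpha> *\<^sub>R a + \<beta> *\<^sub>R b + \<gamma> *\<^sub>R c" "0 \<le> \<alpha>" "0 \<le> \<beta>" "0 \<le> \<gamma>" "0 < \<alpha> + \<beta> + \<gamma>"
    using assms(1) unfolding cone3_def by blast
  have "0 < k * (\<alpha> + \<beta> + \<gamma>)" using * assms(2) by simp
  then show ?thesis using * assms(2)
    by (intro cone3I[of "k * \<alpha>" "k * \<beta>" "k * \<gamma>"]) (simp_all add: algebra_simps)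
qed

lemma cone3_scaled_sum:
  assumes "x \<in> cone3 a b c" "y \<in> cone3 a b c" "0 \<le> k" "0 \<le> l" "0 < k + l"
  shows "k *\<^sub>R x + l *\<^sub>R y \<in> cone3 a b c"
proof (cases "k = 0 \<or> l = 0")
  case True then show ?thesis using assms by (auto intro: cone3_scale)
next
  case False then show ?thesis using assms by (intro cone3_add cone3_scale) auto
qed

lemma cone3_subset:
  assumes "a' \<in> cone3 a b c" "b' \<in> cone3 a b c" "c' \<in> cone3 a b c"
  shows "cone3 a' b' c' \<subseteq> cone3 a b c"
proof
  fix x assume "x \<in> cone3 a' b' c'"
  then obtain \<alpha> \<beta> \<gamma> where x: "x = \<alpha> *\<^sub>R a' + \<beta> *\<^sub>R b' + \<gamma> *\<^sub>R c'" and
    p: "0 \<le> \<alpha>" "0 \<le> \<beta>" "0 \<le> \<gamma>" "0 < \<alpha> + \<beta> + \<gamma>" unfolding cone3_def by blast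
  show "x \<in> cone3 a b c"
  proof (cases "\<alpha> + \<beta> = 0")
    case True
    then have "\<alpha> = 0" "\<beta> = 0" using p by auto
    then show ?thesis using x p assms by (auto intro: cone3_scale)
  next
    case False
    then have "\<alpha> *\<^sub>R a' + \<beta> *\<^sub>R b' \<in> cone3 a b c" using assms p by (intro cone3_scaled_sum) auto
    then show ?thesis using x p assms cone3_scaled_sum[of "\<alpha> *\<^sub>R a' + \<beta> *\<^sub>R b'" a b c c' 1 \<gamma>] by auto
  qed
qed

lemma cone3_perm: "cone3 b a c = cone3 a b c" "cone3 a c b = cone3 a b c" "cone3 a a b = cone3 a b b" "cone3 a b a = cone3 a b b"
  "cone3 b a a = cone3 a b b"
  by (intro equalityI cone3_subset; simp)+

lemma cone3_minus: "cone3 (-a) (-b) (-c) = uminus ` cone3 a b c"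
proof -
  have *: "cone3 (-a) (-b) (-c) \<subseteq> uminus ` cone3 a b c" for a b c
  proof
    fix x assume "x \<in> cone3 (-a) (-b) (-c)"
    then obtain \<alpha> \<beta> \<gamma> where x: "x = \<alpha> *\<^sub>R - a + \<beta> *\<^sub>R - b + \<gamma> *\<^sub>R - c" "0 \<le> \<alpha>" "0 \<le> \<beta>" "0 \<le> \<gamma>" "0 < \<alpha> + \<beta> + \<gamma>"
      unfolding cone3_def by blast
    then have "- x \<in> cone3 a b c" by (intro cone3I[of \<alpha> \<beta> \<gamma>]) auto
    then show "x \<in> uminus ` cone3 a b c" by force
  qed
  show ?thesis using *[of a b c] *[of "-a" "-b" "-c"] by (auto simp: image_subset_iff)
qed

lemma sep_mono: "sep A B \<Longrightarrow> A' \<subseteq> A \<Longrightarrow> B' \<subseteq> B \<Longrightarrow> sep A' B'"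
  unfolding sep_def by blast

lemma sep_commute: "sep A B \<longleftrightarrow> sep B A"
  unfolding sep_def using cross3_commute_0 by blast

lemma sep_uminus: "sep (uminus ` A) B \<longleftrightarrow> sep A B" "sep A (uminus ` B) \<longleftrightarrow> sep A B"
  unfolding sep_def by auto

lemma clr_mono: "clr Q a b c \<Longrightarrow> a' \<in> cone3 a b c \<Longrightarrow> b' \<in> cone3 a b c \<Longrightarrow> c' \<in> cone3 a b c \<Longrightarrow> clr Q a' b' c'"
  unfolding clr_def by (erule sep_mono) (simp_all add: cone3_subset)

lemma clr_perm: "clr Q b a c = clr Q a b c" "clr Q a c b = clr Q a b c" "clr Q a a b = clr Q a b b" "clr Q a b a = clr Q a b b"
  "clr Q b a a = clr Q a b b"
  unfolding clr_def by (rule arg_cong[where f = "\<lambda>A. sep A Q"], rule cone3_perm)+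

lemma clr_minus: "clr Q (-a) (-b) (-c) = clr Q a b c"
  unfolding clr_def cone3_minus sep_uminus by simp

lemma clr_edges: assumes "clr Q a b c" shows "clr Q a b b" "clr Q b c c" "clr Q a c c" "clr Q a a a" "clr Q b b b" "clr Q c c c"
  by (rule clr_mono[OF assms]; simp)+

lemma clr_insert: "clr (insert x Q) a b c \<longleftrightarrow> clr {x} a b c \<and> clr Q a b c"
  unfolding clr_def sep_def by auto

lemma clr_insert_simps [simp]:
  "clr (insert x (Q \<union> R)) a b c \<longleftrightarrow> clr {x} a b c \<and> clr (Q \<union> R) a b c"
  "clr (insert x (insert z Q)) a b c \<longleftrightarrow> clr {x} a b c \<and> clr (insert z Q) a b c"
  unfolding clr_def sep_def by auto

lemma clr_neg1 [simp]: "clr {- x} a b c = clr {x} a b c"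
  unfolding clr_def sep_def by auto

lemma clr_subset: "clr Q a b c \<Longrightarrow> Q' \<subseteq> Q \<Longrightarrow> clr Q' a b c"
  unfolding clr_def using sep_mono by blast

lemma clrI:
  assumes "0 \<notin> Q" and "\<And>x \<alpha> \<beta> \<gamma> k. x \<in> Q \<Longrightarrow> 0 \<le> \<alpha> \<Longrightarrow> 0 \<le> \<beta> \<Longrightarrow> 0 \<le> \<gamma> \<Longrightarrow> 0 < \<alpha> + \<beta> + \<gamma> \<Longrightarrow>
      \<alpha> *\<^sub>R a + \<beta> *\<^sub>R b + \<gamma> *\<^sub>R c = k *\<^sub>R x \<Longrightarrow> False"
  shows "clr Q a b c"
  unfolding clr_def sep_def cone3_def using assms by (auto simp: cross3_eq_0_iff)

lemma clr_point [simp]: "clr {x} a a a \<longleftrightarrow> cross3 a x \<noteq> 0"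
proof
  assume "clr {x} a a a" then show "cross3 a x \<noteq> 0" unfolding clr_def sep_def by auto
next
  assume a: "cross3 a x \<noteq> 0"
  then have "x \<noteq> 0" by auto
  then show "clr {x} a a a"
  proof (intro clrI)
    fix y \<alpha> \<beta> \<gamma> k assume *: "y \<in> {x}" "0 < \<alpha> + \<beta> + \<gamma>" "\<alpha> *\<^sub>R a + \<beta> *\<^sub>R a + \<gamma> *\<^sub>R a = k *\<^sub>R y"
    then have "(\<alpha> + \<beta> + \<gamma>) *\<^sub>R a = k *\<^sub>R x" by (simp add: scaleR_add_left)
    then have "(\<alpha> + \<beta> + \<gamma>) *\<^sub>R cross3 a x = 0" by (metis cross_mult_left cross_refl scaleR_zero_right)
    then show False using * a by simp
  qed simp
qed

text \<open>The plane spanned by \<open>x\<close> and \<open>c\<close> has \<open>a\<close> and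
  \<open>b\<close> strictly on one side. A point of the triangle in this plane is therefore a
  multiple of \<open>c\<close>, and \<open>c\<close> is not parallel to \<open>x\<close>.\<close>

lemma clr_side: assumes "dt a x c * dt b x c > 0" shows "clr {x} a b c"
proof (rule clrI)
  show "0 \<notin> {x}" using assms by auto
  fix y \<alpha> \<beta> \<gamma> k assume y: "y \<in> {x}" and p: "0 \<le> \<alpha>" "0 \<le> \<beta>" "0 \<le> \<gamma>" "0 < \<alpha> + \<beta> + \<gamma>"
    and e: "\<alpha> *\<^sub>R a + \<beta> *\<^sub>R b + \<gamma> *\<^sub>R c = k *\<^sub>R y"
  have "dt (\<alpha> *\<^sub>R a + \<beta> *\<^sub>R b + \<gamma> *\<^sub>R c) x c = 0" using e y by simp
  then have "\<alpha> * dt a x c + \<beta> * dt b x c = 0" by simp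
  then have "\<alpha> * (dt a x c * dt a x c) + \<beta> * (dt a x c * dt b x c) = 0"
    by (metis distrib_left mult.left_commute mult_zero_right)
  moreover have "dt a x c * dt a x c > 0" using assms by (auto simp: zero_less_mult_iff)
  ultimately have "\<alpha> = 0" "\<beta> = 0" using p assms
    by (smt (verit) mult_nonneg_nonneg mult_pos_pos)+
  have "dt a (\<alpha> *\<^sub>R a + \<beta> *\<^sub>R b + \<gamma> *\<^sub>R c) c = dt a (k *\<^sub>R x) c" using e y by simp
  then have "k = 0" using assms \<open>\<alpha> = 0\<close> \<open>\<beta> = 0\<close> by auto
  then have "c = 0" using e y p \<open>\<alpha> = 0\<close> \<open>\<beta> = 0\<close> by auto
  then show False using assms by simp
qed

text \<open>Points are compared up to a factor of either sign. The condition
  \<open>0 \<le> \<gamma> * \<delta>\<close> describes the segment from \<open>b\<close> to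
  \<open>b'\<close> together with its negative.\<close>

lemma djI:
  assumes "cross3 b b' \<noteq> 0" and "\<And>\<alpha> \<beta> \<gamma> \<delta>. 0 \<le> \<alpha> \<Longrightarrow> 0 \<le> \<beta> \<Longrightarrow> 0 < \<alpha> + \<beta> \<Longrightarrow> 0 \<le> \<gamma> * \<delta> \<Longrightarrow>
      \<alpha> *\<^sub>R a + \<beta> *\<^sub>R a' = \<gamma> *\<^sub>R b + \<delta> *\<^sub>R b' \<Longrightarrow> False"
  shows "dj a a' b b'"
  unfolding dj_def sep_def
proof (intro ballI notI)
  fix p q assume p: "p \<in> cone3 a a' a'" and q: "q \<in> cone3 b b' b'" and 0: "cross3 p q = 0"
  obtain \<alpha> \<beta> \<beta>' where 1: "p = \<alpha> *\<^sub>R a + \<beta> *\<^sub>R a' + \<beta>' *\<^sub>R a'" "0 \<le> \<alpha>" "0 \<le> \<beta>" "0 \<le> \<beta>'" "0 < \<alpha> + \<beta> + \<beta>'"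
    using p unfolding cone3_def by blast
  obtain \<gamma> \<delta> \<delta>' where 2: "q = \<gamma> *\<^sub>R b + \<delta> *\<^sub>R b' + \<delta>' *\<^sub>R b'" "0 \<le> \<gamma>" "0 \<le> \<delta>" "0 \<le> \<delta>'" "0 < \<gamma> + \<delta> + \<delta>'"
    using q unfolding cone3_def by blast
  have q': "q = \<gamma> *\<^sub>R b + (\<delta> + \<delta>') *\<^sub>R b'" using 2 by (simp add: algebra_simps)
  have "q \<noteq> 0"
  proof
    assume "q = 0"
    then have "cross3 q b' = 0" "cross3 b q = 0" by auto
    then have "\<gamma> = 0" "\<delta> + \<delta>' = 0" unfolding q' using assms(1)
      by (simp_all add: cross_add_left cross_add_right cross_mult_left cross_mult_right)
    then show False using 2 by auto
  qed
  then obtain k where k: "p = k *\<^sub>R q" using 0 by (auto simp: cross3_eq_0_iff)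
  have "\<alpha> *\<^sub>R a + (\<beta> + \<beta>') *\<^sub>R a' = (k * \<gamma>) *\<^sub>R b + (k * (\<delta> + \<delta>')) *\<^sub>R b'"
    using k 1(1) q' by (simp add: algebra_simps)
  moreover have "0 \<le> (k * \<gamma>) * (k * (\<delta> + \<delta>'))"
  proof -
    have "(k * \<gamma>) * (k * (\<delta> + \<delta>')) = (k * k) * (\<gamma> * (\<delta> + \<delta>'))" by simp
    then show ?thesis using 2 by (metis add_nonneg_nonneg mult_nonneg_nonneg zero_le_square)
  qed
  ultimately show False using assms(2) 1 by (metis add_nonneg_nonneg add.assoc)
qed

lemma dj_commute: "dj a a' b b' = dj b b' a a'"
  unfolding dj_def by (rule sep_commute)

lemma dj_sym: "dj a' a b b' = dj a a' b b'" "dj a a' b' b = dj a a' b b'"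
  unfolding dj_def by (simp_all add: cone3_perm(3,5) cone3_perm(1,2)[of _ a] cone3_perm(1,2)[of _ b])

lemma sep_cone3_mono: "sep (cone3 a b c) (cone3 d e f) \<Longrightarrow> x \<in> cone3 a b c \<Longrightarrow> x' \<in> cone3 a b c \<Longrightarrow> y \<in> cone3 d e f \<Longrightarrow> y' \<in> cone3 d e f \<Longrightarrow>
   dj x x' y y'"
  unfolding dj_def by (erule sep_mono; simp add: cone3_subset)

text \<open>An instance of the tube lemma. It makes separation of triangles an open condition on the
  vertices, on which all perturbation arguments rest.\<close>

lemma open_nonvanishing_on_compact:
  fixes f :: "'a::topological_space \<times> 'b::topological_space \<Rightarrow> 'c::t2_space"
  assumes "compact K" "continuous_on UNIV f"
  shows "open {x. \<forall>k\<in>K. f (x, k) \<noteq> z}"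
proof -
  let ?W = "{y. f y \<noteq> z}"
  have W: "open ?W" by (intro open_Collect_neq assms continuous_on_const)
  show ?thesis
  proof (subst open_subopen, clarify)
    fix x assume x: "\<forall>k\<in>K. f (x, k) \<noteq> z"
    have "{x} \<times> K \<subseteq> ?W" using x by auto
    from Elementary_Topology.tube_lemma[OF assms(1) W this] have "\<exists>X0. x \<in> X0 \<and> open X0 \<and> X0 \<times> K \<subseteq> ?W" .
    then show "\<exists>T. open T \<and> x \<in> T \<and> T \<subseteq> {x. \<forall>k\<in>K. f (x, k) \<noteq> z}" by blast
  qed
qed

definition simplex3 :: "(real \<times> real \<times> real) set" where
  "simplex3 = {(\<alpha>, \<beta>, \<gamma>). 0 \<le> \<alpha> \<and> 0 \<le> \<beta> \<and> 0 \<le> \<gamma> \<and> \<alpha> + \<beta> + \<gamma> = 1}"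

lemma compact_simplex3: "compact simplex3"
proof -
  have *: "simplex3 = ({0..1} \<times> {0..1} \<times> {0..1}) \<inter> {p. fst p + fst (snd p) + snd (snd p) = 1}"
    unfolding simplex3_def by auto
  show ?thesis unfolding *
    by (intro compact_Int_closed compact_Times compact_Icc closed_Collect_eq continuous_intros)
qed

text \<open>Cones are not compact, but coefficients normalised to sum 1 range over a compact
  simplex, and positive factors do not affect the vanishing of a cross product.\<close>

lemma sep_cone3_simplex:
  "sep (cone3 a b c) (cone3 d e f) \<longleftrightarrow> (\<forall>k\<in>simplex3 \<times> simplex3. 
     cross3 (fst (fst k) *\<^sub>R a + fst (snd (fst k)) *\<^sub>R b + snd (snd (fst k)) *\<^sub>R c)
            (fst (snd k) *\<^sub>R d + fst (snd (snd k)) *\<^sub>R e + snd (snd (snd k)) *\<^sub>R f) \<noteq> 0)" (is "_ \<longleftrightarrow> ?R")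
proof
  assume s: "sep (cone3 a b c) (cone3 d e f)"
  show ?R
  proof (intro ballI, clarsimp simp: simplex3_def)
    fix \<alpha> \<beta> \<gamma> \<delta> \<epsilon> \<zeta> :: real
    assume *: "cross3 (\<alpha> *\<^sub>R a + \<beta> *\<^sub>R b + \<gamma> *\<^sub>R c) (\<delta> *\<^sub>R d + \<epsilon> *\<^sub>R e + \<zeta> *\<^sub>R f) = 0" "0 \<le> \<alpha>" "0 \<le> \<beta>" "0 \<le> \<gamma>" "0 \<le> \<delta>" "0 \<le> \<epsilon>" "0 \<le> \<zeta>"
      "\<alpha> + \<beta> + \<gamma> = 1" "\<delta> + \<epsilon> + \<zeta> = 1"
    have "\<alpha> *\<^sub>R a + \<beta> *\<^sub>R b + \<gamma> *\<^sub>R c \<in> cone3 a b c" "\<delta> *\<^sub>R d + \<epsilon> *\<^sub>R e + \<zeta> *\<^sub>R f \<in> cone3 d e f"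
      using * by (intro cone3I[of \<alpha> \<beta> \<gamma>] cone3I[of \<delta> \<epsilon> \<zeta>]; simp)+
    then show False using s * unfolding sep_def by blast
  qed
next
  assume R: ?R
  have norm: "\<exists>k\<in>simplex3. \<exists>r>0. x = r *\<^sub>R (fst k *\<^sub>R a + fst (snd k) *\<^sub>R b + snd (snd k) *\<^sub>R c)" if x: "x \<in> cone3 a b c" for x a b c
  proof -
    obtain \<alpha> \<beta> \<gamma> where *: "x = \<alpha> *\<^sub>R a + \<beta> *\<^sub>R b + \<gamma> *\<^sub>R c" "0 \<le> \<alpha>" "0 \<le> \<beta>" "0 \<le> \<gamma>" "0 < \<alpha> + \<beta> + \<gamma>"
      using x unfolding cone3_def by blast
    let ?r = "\<alpha> + \<beta> + \<gamma>"
    show ?thesis using *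
      by (intro bexI[of _ "(\<alpha> / ?r, \<beta> / ?r, \<gamma> / ?r)"] exI[of _ ?r])
        (auto simp: simplex3_def scaleR_add_right add_divide_distrib[symmetric])
  qed
  show "sep (cone3 a b c) (cone3 d e f)" unfolding sep_def
  proof (intro ballI)
    fix p q assume "p \<in> cone3 a b c" "q \<in> cone3 d e f"
    then obtain k l r s where k: "k \<in> simplex3" "l \<in> simplex3" "r > 0" "s > 0"
      "p = r *\<^sub>R (fst k *\<^sub>R a + fst (snd k) *\<^sub>R b + snd (snd k) *\<^sub>R c)"
      "q = s *\<^sub>R (fst l *\<^sub>R d + fst (snd l) *\<^sub>R e + snd (snd l) *\<^sub>R f)" using norm by metis
    have "(k, l) \<in> simplex3 \<times> simplex3" using k by simp
    from R[rule_format, OF this] show "cross3 p q \<noteq> 0"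
      using k by (simp add: cross_mult_left cross_mult_right)
  qed
qed

lemma sep_eventually:
  assumes "sep (cone3 a0 b0 c0) (cone3 d0 e0 f0)" "tendsto a a0 F" "tendsto b b0 F" "tendsto c c0 F" "tendsto d d0 F" "tendsto e e0 F" "tendsto f f0 F"
  shows "eventually (\<lambda>t. sep (cone3 (a t) (b t) (c t)) (cone3 (d t) (e t) (f t))) F"
proof -
  let ?g = "\<lambda>(x, k). case x of (a, b, c, d, e, f) \<Rightarrow>
     cross3 (fst (fst k) *\<^sub>R a + fst (snd (fst k)) *\<^sub>R b + snd (snd (fst k)) *\<^sub>R c)
            (fst (snd k) *\<^sub>R d + fst (snd (snd k)) *\<^sub>R e + snd (snd (snd k)) *\<^sub>R (f::real^3))"
  have "open {x. \<forall>k\<in>simplex3 \<times> simplex3. ?g (x, k) \<noteq> 0}"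
    by (intro open_nonvanishing_on_compact compact_Times compact_simplex3)
       (auto simp: case_prod_unfold intro!: continuous_on_cross continuous_intros)
  moreover have "(a0, b0, c0, d0, e0, f0) \<in> {x. \<forall>k\<in>simplex3 \<times> simplex3. ?g (x, k) \<noteq> 0}"
    using assms(1)[unfolded sep_cone3_simplex] by simp
  moreover have "tendsto (\<lambda>t. (a t, b t, c t, d t, e t, f t)) (a0, b0, c0, d0, e0, f0) F"
    by (intro tendsto_Pair assms)
  ultimately have "eventually (\<lambda>t. (a t, b t, c t, d t, e t, f t) \<in> {x. \<forall>k\<in>simplex3 \<times> simplex3. ?g (x, k) \<noteq> 0}) F"
    using topological_tendstoD by fast
  then show ?thesis by (rule eventually_mono) (simp add: sep_cone3_simplex)
qed

text \<open>A point is written as a degenerate triangle so that \<open>sep_eventually\<close>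
  applies to it as well.\<close>

lemma clr_singleton: "clr {x} a b c \<longleftrightarrow> sep (cone3 a b c) (cone3 x x x)"
proof -
  have *: "\<exists>k. q = k *\<^sub>R x \<and> k > 0" if q: "q \<in> cone3 x x x" for q
  proof -
    obtain \<alpha> \<beta> \<gamma> where "q = \<alpha> *\<^sub>R x + \<beta> *\<^sub>R x + \<gamma> *\<^sub>R x" "0 < \<alpha> + \<beta> + \<gamma>"
      using q unfolding cone3_def by blast
    then show ?thesis by (intro exI[of _ "\<alpha> + \<beta> + \<gamma>"]) (simp add: scaleR_add_left)
  qed
  have "x \<in> cone3 x x x" by (rule cone3_vertex)
  show ?thesis unfolding clr_def sep_def
  proof
    assume l: "\<forall>p\<in>cone3 a b c. \<forall>q\<in>{x}. cross3 p q \<noteq> 0"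
    show "\<forall>p\<in>cone3 a b c. \<forall>q\<in>cone3 x x x. cross3 p q \<noteq> 0"
    proof (intro ballI)
      fix p q assume "p \<in> cone3 a b c" "q \<in> cone3 x x x"
      then obtain k where "q = k *\<^sub>R x" "k > 0" using * by blast
      then show "cross3 p q \<noteq> 0" using l \<open>p \<in> cone3 a b c\<close> by (simp add: cross_mult_right)
    qed
  qed (use \<open>x \<in> cone3 x x x\<close> in blast)
qed

lemma clr1_eventually:
  assumes "clr {x0} a0 b0 c0" "tendsto a a0 F" "tendsto b b0 F" "tendsto c c0 F" "tendsto x x0 F"
  shows "eventually (\<lambda>t. clr {x t} (a t) (b t) (c t)) F"
  using sep_eventually[OF assms(1)[unfolded clr_singleton] assms(2-4) assms(5) assms(5) assms(5)]
  by (simp add: clr_singleton)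

lemma clr_eventually:
  assumes "finite Q" "clr Q a0 b0 c0" "tendsto a a0 F" "tendsto b b0 F" "tendsto c c0 F"
  shows "eventually (\<lambda>t. clr Q (a t) (b t) (c t)) F"
proof -
  have *: "clr Q a b c \<longleftrightarrow> (\<forall>x\<in>Q. clr {x} a b c)" for a b c unfolding clr_def sep_def by auto
  show ?thesis using assms unfolding * by (auto intro!: eventually_ball_finite clr1_eventually)
qed

lemma dj_eventually:
  assumes "dj a0 b0 d0 e0" "tendsto a a0 F" "tendsto b b0 F" "tendsto d d0 F" "tendsto e e0 F"
  shows "eventually (\<lambda>t. dj (a t) (b t) (d t) (e t)) F"
  using assms unfolding dj_def by (intro sep_eventually)

lemma tendsto_dt [tendsto_intros]:
  "tendsto a a0 F \<Longrightarrow> tendsto b b0 F \<Longrightarrow> tendsto c c0 F \<Longrightarrow> tendsto (\<lambda>t. dt (a t) (b t) (c t)) (dt a0 b0 c0) F"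
proof -
  assume *: "tendsto a a0 F" "tendsto b b0 F" "tendsto c c0 F"
  have "tendsto (\<lambda>t. cross3 (b t) (c t)) (cross3 b0 c0) F"
    by (rule Lim_bilinear[OF *(2,3)]) (simp add: bilinear_conv_bounded_bilinear[symmetric] bilinear_cross)
  then show "tendsto (\<lambda>t. dt (a t) (b t) (c t)) (dt a0 b0 c0) F"
    unfolding dt_def by (intro tendsto_inner *)
qed

lemma clr_side1: "dt b x a * dt c x a > 0 \<Longrightarrow> clr {x} a b c"
  using clr_side[of b x a c] by (metis clr_perm(1,2))

lemma dt_nz: assumes "dt a b c \<noteq> 0"
  shows "dt a c b \<noteq> 0" "dt b a c \<noteq> 0" "dt b c a \<noteq> 0" "dt c a b \<noteq> 0" "dt c b a \<noteq> 0"
  using assms dt_swap(1)[of b a c] dt_swap(2)[of a c b] dt_swap(3)[of c b a] dt_rot(1)[of b c a] dt_rot(2)[of c a b] by auto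

lemma dt_perm_eq: "dt c a b = dt a b c" "dt c b a = - dt a b c" "dt b c a = dt a b c" "dt b a c = - dt a b c" "dt a c b = - dt a b c"
  by (rule dt_rot dt_swap)+

lemma clr_dt: assumes "dt x a b \<noteq> 0" shows "clr {x} a b b"
proof (rule clr_side1)
  have "dt b x a \<noteq> 0" using dt_nz[OF assms] by simp
  then show "dt b x a * dt b x a > 0" by (metis not_real_square_gt_zero)
qed

text \<open>The linear form \<open>\<lambda>x. dt x b b'\<close> vanishes on the plane of
  \<open>b\<close> and \<open>b'\<close> and has constant nonzero sign along the segment from
  \<open>a\<close> to \<open>a'\<close>.\<close>

lemma dj_side: assumes "dt a b b' * dt a' b b' > 0" shows "dj a a' b b'"
proof (rule djI)
  show "cross3 b b' \<noteq> 0" using assms by (auto simp: dt_def)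
  fix \<alpha> \<beta> \<gamma> \<delta> :: real assume p: "0 \<le> \<alpha>" "0 \<le> \<beta>" "0 < \<alpha> + \<beta>" and e: "\<alpha> *\<^sub>R a + \<beta> *\<^sub>R a' = \<gamma> *\<^sub>R b + \<delta> *\<^sub>R b'"
  have "dt (\<alpha> *\<^sub>R a + \<beta> *\<^sub>R a') b b' = 0" unfolding e by simp
  then have *: "\<alpha> * dt a b b' + \<beta> * dt a' b b' = 0" by simp
  consider "dt a b b' > 0" "dt a' b b' > 0" | "dt a b b' < 0" "dt a' b b' < 0"
    using assms by (auto simp: zero_less_mult_iff)
  then show False
  proof cases
    case 1
    then show False using * p
      by (metis add_nonneg_eq_0_iff add.right_neutral less_irrefl mult_eq_0_iff mult_nonneg_nonneg order_less_imp_le)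
  next
    case 2
    then have "\<alpha> * (- dt a b b') + \<beta> * (- dt a' b b') = 0" using * by simp
    then show False using 2 p
      by (metis add_nonneg_eq_0_iff add.right_neutral less_irrefl mult_eq_0_iff mult_nonneg_nonneg order_less_imp_le neg_0_less_iff_less)
  qed
qed

text \<open>Only \<open>T\<close> is reduced by \<open>x\<close>, not \<open>D\<close>; as
  \<open>cross3 x x = 0\<close>, admissible sets are therefore disjoint from
  \<open>D\<close>.\<close>

definition adm :: "(real^3) set \<Rightarrow> (real^3) set \<Rightarrow> bool" where
  "adm D T \<longleftrightarrow> finite T \<and> (\<forall>x\<in>T. \<forall>y\<in>(T - {x}) \<union> D. cross3 x y \<noteq> 0)"

lemma adm_insert:
  assumes "adm D T" "clr (T \<union> D) x a b"
  shows "x \<notin> T" "adm D (insert x T)"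
proof -
  have *: "cross3 x y \<noteq> 0" if "y \<in> T \<union> D" for y
    using assms(2) that unfolding clr_def sep_def by auto
  show "x \<notin> T" using *[of x] by auto
  show "adm D (insert x T)"
    using assms(1) * unfolding adm_def by (auto simp: cross3_commute_0[of _ x])
qed

subsection \<open>Half twists\<close>

text \<open>\<open>mv T a b\<close> stands for the class of the motion that carries one token
  straight from \<open>a\<close> to \<open>b\<close> while the tokens in \<open>T\<close> rest. Sums
  are read from left to right, and the group is additive in notation only. \<open>D\<close>
  represents the punctures, and \<open>H\<close> will be the image of the group of loops.
  \<open>mv_tri0\<close> and \<open>mv_comm0\<close> are the relations of an empty triangle and of
  two disjoint segments; the last two axioms say that the signs of vectors are invisible.\<close>

locale moves =
  fixes D :: "(real^3) set" and m :: nat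
    and mv :: "(real^3) set \<Rightarrow> real^3 \<Rightarrow> real^3 \<Rightarrow> 'g::group_add" and H :: "'g set"
  assumes fin_D: "finite D" and D_nonempty: "D \<noteq> {}" and zero_D: "0 \<notin> D"
    and D_cross: "d \<in> D \<Longrightarrow> e \<in> D \<Longrightarrow> d \<noteq> e \<Longrightarrow> cross3 d e \<noteq> 0"
    and H_zero: "0 \<in> H" and H_add: "g \<in> H \<Longrightarrow> h \<in> H \<Longrightarrow> g + h \<in> H" and H_minus: "g \<in> H \<Longrightarrow> - g \<in> H"
    and mv_H: "mv T a b \<in> H"
    and mv_tri0: "adm D T \<Longrightarrow> card T + 1 = m \<Longrightarrow> clr (T \<union> D) a b c \<Longrightarrow> mv T a b + mv T b c = mv T a c"
    and mv_comm0: "adm D T \<Longrightarrow> card T + 2 = m \<Longrightarrow> clr (T \<union> D) a a' a' \<Longrightarrow> clr (T \<union> D) b b' b' \<Longrightarrow> dj a a' b b' \<Longrightarrow>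
       mv (insert b T) a a' + mv (insert a' T) b b' = mv (insert a T) b b' + mv (insert b' T) a a'"
    and mv_neg: "mv T (- a) (- b) = mv T a b"
    and mv_neg_ctx: "mv (insert (- t) T) a b = mv (insert t T) a b"
begin

text \<open>\<open>k\<close> is the number of tokens that are still to be added to
  \<open>T\<close>.\<close>

definition okT :: "nat \<Rightarrow> (real^3) set \<Rightarrow> bool" where
  "okT k T \<longleftrightarrow> adm D T \<and> card T + k = m"

lemma okT_insert: "okT (Suc k) T \<Longrightarrow> clr (T \<union> D) x a b \<Longrightarrow> okT k (insert x T)"
  unfolding okT_def using adm_insert[of D T x a b] by (auto simp: adm_def)

lemma okT_insert1: "okT 2 T \<Longrightarrow> clr (T \<union> D) x a b \<Longrightarrow> okT 1 (insert x T)"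
  using okT_insert[of 1 T x a b] by (simp add: numeral_2_eq_2)

lemma okT_insert2: "okT 3 T \<Longrightarrow> clr (T \<union> D) x a b \<Longrightarrow> okT 2 (insert x T)"
  using okT_insert[of 2 T x a b] by (simp add: numeral_3_eq_3 numeral_2_eq_2)

lemma finite_okT: "okT k T \<Longrightarrow> finite (T \<union> D)"
  unfolding okT_def adm_def using fin_D by simp

lemma mv_tri: "okT 1 T \<Longrightarrow> clr (T \<union> D) a b c \<Longrightarrow> mv T a b + mv T b c = mv T a c"
  using mv_tri0 by (simp add: okT_def)

lemma mv_refl: "okT 1 T \<Longrightarrow> clr (T \<union> D) a x y \<Longrightarrow> mv T a a = 0"
  using mv_tri[of T a a a] clr_edges(4)[of "T \<union> D" a x y] by (metis add_0_right add_left_cancel)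

lemma mv_rev: "okT 1 T \<Longrightarrow> clr (T \<union> D) a b x \<Longrightarrow> mv T b a = - mv T a b"
  using mv_tri[of T a b a] mv_refl[of T a b x] clr_mono[of "T \<union> D" a b x a b a]
  by (simp add: minus_unique)

lemma mv_tri2: "okT 2 T \<Longrightarrow> clr (T \<union> D) v x y \<Longrightarrow> clr {v} a b c \<Longrightarrow> clr (T \<union> D) a b c \<Longrightarrow>
    mv (insert v T) a b + mv (insert v T) b c = mv (insert v T) a c"
  by (rule mv_tri) (simp_all add: okT_insert1[of T v x y, simplified])

lemma mv_rev2: "okT 2 T \<Longrightarrow> clr (T \<union> D) v x y \<Longrightarrow> clr {v} a b b \<Longrightarrow> clr (T \<union> D) a b b \<Longrightarrow>
    mv (insert v T) b a = - mv (insert v T) a b"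
  by (rule mv_rev[of _ _ _ b]) (simp_all add: okT_insert1[of T v x y, simplified])

lemma mv_comm: "okT 2 T \<Longrightarrow> clr (T \<union> D) a a' a' \<Longrightarrow> clr (T \<union> D) b b' b' \<Longrightarrow> dj a a' b b' \<Longrightarrow>
   mv (insert b T) a a' + mv (insert a' T) b b' = mv (insert a T) b b' + mv (insert b' T) a a'"
  using mv_comm0 by (simp add: okT_def)

text \<open>The half twist exchanging the tokens \<open>u\<close> and \<open>v\<close> around the triangle \<open>u\<close>, \<open>v\<close>, \<open>z\<close>.\<close>
definition ht :: "(real^3) set \<Rightarrow> real^3 \<Rightarrow> real^3 \<Rightarrow> real^3 \<Rightarrow> 'g" where
  "ht T u v z = mv (insert v T) u z + mv (insert z T) v u + mv (insert u T) z v"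

lemma y_H: "ht T u v z \<in> H"
  unfolding ht_def by (intro H_add mv_H)

text \<open>Prolonging the first move from \<open>z\<close> to \<open>z'\<close> produces an extra
  move of that token. It passes the second move, which runs along a disjoint segment, and is
  absorbed by the third.\<close>

lemma y_zind:
  assumes T: "okT 2 T" and c: "clr (T \<union> D) u v z" "clr (T \<union> D) u z z'" "clr (T \<union> D) v z z'"
    and d: "dt u v z * dt u v z' > 0"
  shows "ht T u v z' = ht T u v z"
proof -
  note e = clr_edges[OF c(1)] clr_edges[OF c(2)] clr_edges[OF c(3)]
  have d2: "dt z u v * dt z' u v > 0" "dt z v u * dt z' v u > 0"
    using d by (simp_all only: dt_perm_eq(1)[of z u v] dt_perm_eq(1)[of z' u v] dt_perm_eq(2)[of z v u] dt_perm_eq(2)[of z' v u] minus_mult_minus)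
  have 1: "mv (insert v T) u z' = mv (insert v T) u z + mv (insert v T) z z'"
    by (rule mv_tri2[OF T e(2) clr_side1[OF d2(2)] c(2), symmetric])
  have 2: "mv (insert v T) z z' + mv (insert z' T) v u = mv (insert z T) v u + mv (insert u T) z z'"
    by (rule mv_comm[OF T e(8) _ dj_side[OF d2(2)]]) (rule clr_mono[OF c(1)]; simp)
  have 3: "mv (insert u T) z z' + mv (insert u T) z' v = mv (insert u T) z v"
    by (rule mv_tri2[OF T e(1) clr_side[OF d2(1)]]) (rule clr_mono[OF c(3)]; simp)
  have "ht T u v z' = mv (insert v T) u z + (mv (insert v T) z z' + mv (insert z' T) v u) + mv (insert u T) z' v"
    unfolding ht_def 1 by (simp only: add.assoc)
  also have "\<dots> = mv (insert v T) u z + mv (insert z T) v u + (mv (insert u T) z z' + mv (insert u T) z' v)"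
    unfolding 2 by (simp only: add.assoc)
  finally show ?thesis unfolding 3 ht_def .
qed

text \<open>With \<open>u\<close> and \<open>v\<close> exchanged, the three moves are the inverses
  of the former ones in the reverse order.\<close>

lemma y_inv:
  assumes T: "okT 2 T" and c: "clr (T \<union> D) u v z" and d: "dt u v z \<noteq> 0"
  shows "ht T v u z = - ht T u v z"
proof -
  note e = clr_edges[OF c]
  have c': "clr (T \<union> D) v u z" "clr (T \<union> D) u z z" "clr (T \<union> D) z v v" "clr (T \<union> D) v u u"
    by (rule clr_mono[OF c]; simp)+
  have 1: "mv (insert v T) z u = - mv (insert v T) u z"
    by (rule mv_rev2[OF T e(2) clr_dt c'(2)]) (use dt_nz[OF d] in simp)
  have 2: "mv (insert z T) u v = - mv (insert z T) v u"
    by (rule mv_rev2[OF T e(6) clr_dt c'(4)]) (use dt_nz[OF d] in simp)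
  have 3: "mv (insert u T) v z = - mv (insert u T) z v"
    by (rule mv_rev2[OF T e(1) clr_dt c'(3)]) (use dt_nz[OF d] in simp)
  show ?thesis unfolding ht_def 1 2 3 by (simp add: minus_add add.assoc)
qed

text \<open>Both sides are the rotation in which \<open>u\<close> passes on the side of
  \<open>z\<close> and \<open>v\<close> on the side of \<open>z'\<close>. The direct move of
  \<open>v\<close> to \<open>u\<close> is bent through \<open>z'\<close>, moves along disjoint
  segments are interchanged, and the path of the other token through \<open>z\<close> is
  straightened.\<close>

lemma y_opposite:
  assumes T: "okT 2 T" and c: "clr (T \<union> D) u v z" "clr (T \<union> D) u v z'"
    and d: "dt u v z \<noteq> 0" and z': "z' = p *\<^sub>R u + q *\<^sub>R v - r *\<^sub>R z" and pqr: "0 < p" "0 < q" "0 < r"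
  shows "ht T v u z' = ht T u v z"
proof -
  have eq: "a = a' \<and> b = b' \<and> c = c'" if "a *\<^sub>R u + b *\<^sub>R v + c *\<^sub>R z = a' *\<^sub>R u + b' *\<^sub>R v + c' *\<^sub>R z" for a b c a' b' c'
    using that coord_eq[OF d] by blast
  have nz: "z \<noteq> 0" using d by auto
  have d': "dt u v z' \<noteq> 0" using d pqr by (simp add: z')
  have nz': "z' \<noteq> 0" using d' by auto
  have c1: "clr {z} v z' u"
  proof (rule clrI)
    fix x \<alpha> \<beta> \<gamma> k assume *: "x \<in> {z}" "0 \<le> \<alpha>" "0 \<le> \<beta>" "0 \<le> \<gamma>" "0 < \<alpha> + \<beta> + \<gamma>" "\<alpha> *\<^sub>R v + \<beta> *\<^sub>R z' + \<gamma> *\<^sub>R u = k *\<^sub>R x"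
    then have "(\<beta> * p + \<gamma>) *\<^sub>R u + (\<alpha> + \<beta> * q) *\<^sub>R v + (- \<beta> * r) *\<^sub>R z = 0 *\<^sub>R u + 0 *\<^sub>R v + k *\<^sub>R z"
      by (simp add: z' algebra_simps)
    from eq[OF this] * pqr show False
      by (smt (verit) mult_nonneg_nonneg mult_pos_pos)
  qed (use nz in simp)
  have c2: "clr {z'} u z v"
  proof (rule clrI)
    fix x \<alpha> \<beta> \<gamma> k assume *: "x \<in> {z'}" "0 \<le> \<alpha>" "0 \<le> \<beta>" "0 \<le> \<gamma>" "0 < \<alpha> + \<beta> + \<gamma>" "\<alpha> *\<^sub>R u + \<beta> *\<^sub>R z + \<gamma> *\<^sub>R v = k *\<^sub>R x"
    then have "\<alpha> *\<^sub>R u + \<beta> *\<^sub>R z + \<gamma> *\<^sub>R v = k *\<^sub>R z'" by simp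
    then have "\<alpha> *\<^sub>R u + \<gamma> *\<^sub>R v + \<beta> *\<^sub>R z = (k * p) *\<^sub>R u + (k * q) *\<^sub>R v + (- k * r) *\<^sub>R z"
      by (simp add: z' algebra_simps)
    from eq[OF this] have "\<alpha> = k * p" "\<gamma> = k * q" "\<beta> = - k * r" by auto
    moreover from this * pqr have "k = 0"
      by (auto simp: zero_le_mult_iff mult_le_0_iff)
    ultimately show False using * by simp
  qed (use nz' in simp)
  have d1: "dj u z v z'"
  proof (rule djI)
    show "cross3 v z' \<noteq> 0" using d' dt_imp_cross by blast
    fix \<alpha> \<beta> \<gamma> \<delta> :: real assume *: "0 \<le> \<alpha>" "0 \<le> \<beta>" "0 < \<alpha> + \<beta>" "0 \<le> \<gamma> * \<delta>" "\<alpha> *\<^sub>R u + \<beta> *\<^sub>R z = \<gamma> *\<^sub>R v + \<delta> *\<^sub>R z'"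
    then have "\<alpha> *\<^sub>R u + 0 *\<^sub>R v + \<beta> *\<^sub>R z = (\<delta> * p) *\<^sub>R u + (\<gamma> + \<delta> * q) *\<^sub>R v + (- \<delta> * r) *\<^sub>R z"
      by (simp add: z' algebra_simps)
    from eq[OF this] have "\<alpha> = \<delta> * p" "0 = \<gamma> + \<delta> * q" "\<beta> = - \<delta> * r" by auto
    moreover from this * pqr have "\<delta> = 0"
      by (auto simp: zero_le_mult_iff mult_le_0_iff)
    ultimately show False using * by simp
  qed
  have d2: "dj z' u z v"
  proof (rule djI)
    show "cross3 z v \<noteq> 0" using d dt_imp_cross cross3_commute_0 by blast
    fix \<alpha> \<beta> \<gamma> \<delta> :: real assume *: "0 \<le> \<alpha>" "0 \<le> \<beta>" "0 < \<alpha> + \<beta>" "0 \<le> \<gamma> * \<delta>" "\<alpha> *\<^sub>R z' + \<beta> *\<^sub>R u = \<gamma> *\<^sub>R z + \<delta> *\<^sub>R v"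
    then have "(\<alpha> * p + \<beta>) *\<^sub>R u + (\<alpha> * q) *\<^sub>R v + (- \<alpha> * r) *\<^sub>R z = 0 *\<^sub>R u + \<delta> *\<^sub>R v + \<gamma> *\<^sub>R z"
      by (simp add: z' algebra_simps)
    from eq[OF this] * pqr show False
      by (smt (verit) mult_nonneg_nonneg mult_pos_pos zero_le_mult_iff)
  qed
  note e = clr_edges[OF c(1)] clr_edges[OF c(2)]
  have s: "clr (T \<union> D) z v v" "clr (T \<union> D) z' u u" "clr (T \<union> D) v z' u" "clr (T \<union> D) u z v"
    by (rule clr_mono[OF c(1)] clr_mono[OF c(2)]; simp)+
  have 1: "mv (insert z T) v u = mv (insert z T) v z' + mv (insert z T) z' u"
    by (rule mv_tri2[OF T e(6) c1 s(3), symmetric])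
  have 2: "mv (insert v T) u z + mv (insert z T) v z' = mv (insert u T) v z' + mv (insert z' T) u z"
    by (rule mv_comm[OF T e(3) e(8) d1])
  have 3: "mv (insert z T) z' u + mv (insert u T) z v = mv (insert z' T) z v + mv (insert v T) z' u"
    by (rule mv_comm[OF T s(2) s(1) d2])
  have 4: "mv (insert z' T) u z + mv (insert z' T) z v = mv (insert z' T) u v"
    by (rule mv_tri2[OF T e(12) c2 s(4)])
  have "ht T u v z = (mv (insert v T) u z + mv (insert z T) v z') + (mv (insert z T) z' u + mv (insert u T) z v)"
    unfolding ht_def 1 by (simp add: add.assoc)
  also have "\<dots> = mv (insert u T) v z' + (mv (insert z' T) u z + mv (insert z' T) z v) + mv (insert v T) z' u"
    unfolding 2 3 by (simp add: add.assoc)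
  finally show ?thesis unfolding 4 ht_def by simp
qed

text \<open>Naturality under a motion of a twisted token: the move from \<open>u\<close> to
  \<open>u'\<close> passes the third move of the half twist, merges with the second and splits the
  first.\<close>

lemma y_slide:
  assumes T: "okT 2 T" and c: "clr (T \<union> D) u u' z" "clr (T \<union> D) u u' v" "clr (T \<union> D) u v z" "clr (T \<union> D) u' v z"
    and d: "dt u v z * dt u' v z > 0"
  shows "ht T u v z + mv (insert v T) u u' = mv (insert v T) u u' + ht T u' v z"
proof -
  have d2: "dt u z v * dt u' z v > 0" using d by (simp only: dt_perm_eq(5)[of u z v] dt_perm_eq(5)[of u' z v] minus_mult_minus)
  note e = clr_edges[OF c(1)] clr_edges[OF c(2)] clr_edges[OF c(3)] clr_edges[OF c(4)]
  have s: "clr (T \<union> D) u u' u'" "clr (T \<union> D) z v v" "clr (T \<union> D) v u u'"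
    by (rule clr_mono[OF c(1)] clr_mono[OF c(2)] clr_mono[OF c(3)]; simp)+
  have 1: "mv (insert u T) z v + mv (insert v T) u u' = mv (insert z T) u u' + mv (insert u' T) z v"
    by (rule mv_comm[OF T s(2) s(1)]) (simp only: dj_commute[of z v] dj_side[OF d2])
  have 2: "mv (insert z T) v u + mv (insert z T) u u' = mv (insert z T) v u'"
    by (rule mv_tri2[OF T e(6) clr_side1[OF d2] s(3)])
  have 3: "mv (insert v T) u z = mv (insert v T) u u' + mv (insert v T) u' z"
    by (rule mv_tri2[OF T e(12) clr_side[OF d] c(1), symmetric])
  have "ht T u v z + mv (insert v T) u u' = mv (insert v T) u z + mv (insert z T) v u + (mv (insert u T) z v + mv (insert v T) u u')"
    unfolding ht_def by (simp only: add.assoc)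
  also have "\<dots> = mv (insert v T) u z + (mv (insert z T) v u + mv (insert z T) u u') + mv (insert u' T) z v"
    unfolding 1 by (simp only: add.assoc)
  also have "\<dots> = mv (insert v T) u u' + (mv (insert v T) u' z + mv (insert z T) v u' + mv (insert u' T) z v)"
    unfolding 2 3 by (simp only: add.assoc)
  finally show ?thesis unfolding ht_def .
qed

text \<open>Naturality under a motion of a bystander: a token moving outside the triangle passes
  each of the three moves.\<close>

lemma y_move:
  assumes T: "okT 3 T" and c: "clr (T \<union> D) u v z" "clr (T \<union> D) x x' x'" and d: "dt u v z \<noteq> 0"
    and s: "sep (cone3 u v z) (cone3 x x' x')"
  shows "ht (insert x T) u v z + mv (insert u (insert v T)) x x' = mv (insert u (insert v T)) x x' + ht (insert x' T) u v z"
proof -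
  note e = clr_edges[OF c(1)] clr_edges[OF c(2)]
  have p: "clr {p} x x' x'" if "p \<in> cone3 u v z" for p
    using s that unfolding clr_def sep_def by (metis cross3_commute_0 singletonD)
  have comm: "mv (insert a (insert x T)) b b' + mv (insert a (insert b' T)) x x' = mv (insert a (insert b T)) x x' + mv (insert a (insert x' T)) b b'"
    if a: "a \<in> cone3 u v z" and b: "b \<in> cone3 u v z" "b' \<in> cone3 u v z" and ab: "clr {a} b b' b'" for a b b'
  proof -
    have ca: "clr (T \<union> D) a a a" "clr (T \<union> D) b b' b'" by (rule clr_mono[OF c(1)]; use a b in simp)+
    have "mv (insert x (insert a T)) b b' + mv (insert b' (insert a T)) x x' = mv (insert b (insert a T)) x x' + mv (insert x' (insert a T)) b b'"
    proof (rule mv_comm)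
      show "okT 2 (insert a T)" by (rule okT_insert2[OF T ca(1)])
      show "clr (insert a T \<union> D) b b' b'" using ca ab by simp
      show "clr (insert a T \<union> D) x x' x'" using p[OF a] c(2) by simp
      show "dj b b' x x'" by (rule sep_cone3_mono[OF s]) (use b in simp_all)
    qed
    then show ?thesis by (simp add: insert_commute)
  qed
  have dd: "clr {v} u z z" "clr {z} v u u" "clr {u} z v v" by (rule clr_dt; use dt_nz[OF d] in simp)+
  let ?X = "\<lambda>a b. mv (insert a (insert b T)) x x'"
  have 1: "mv (insert v (insert x T)) u z + ?X v z = ?X v u + mv (insert v (insert x' T)) u z"
    by (rule comm[OF _ _ _ dd(1)]) simp_all
  have 2: "mv (insert z (insert x T)) v u + ?X z u = ?X z v + mv (insert z (insert x' T)) v u"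
    by (rule comm[OF _ _ _ dd(2)]) simp_all
  have 3: "mv (insert u (insert x T)) z v + ?X u v = ?X u z + mv (insert u (insert x' T)) z v"
    by (rule comm[OF _ _ _ dd(3)]) simp_all
  have X: "?X z u = ?X u z" "?X v u = ?X u v" "?X z v = ?X v z" by (simp_all add: insert_commute)
  note 1 = 1[unfolded X] and 2 = 2[unfolded X]
  have "ht (insert x T) u v z + ?X u v = mv (insert v (insert x T)) u z + mv (insert z (insert x T)) v u + (mv (insert u (insert x T)) z v + ?X u v)"
    unfolding ht_def by (simp only: add.assoc)
  also have "\<dots> = mv (insert v (insert x T)) u z + (mv (insert z (insert x T)) v u + ?X u z) + mv (insert u (insert x' T)) z v"
    unfolding 3 by (simp only: add.assoc)
  also have "\<dots> = (mv (insert v (insert x T)) u z + ?X v z) + mv (insert z (insert x' T)) v u + mv (insert u (insert x' T)) z v"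
    unfolding 2 by (simp only: add.assoc)
  also have "\<dots> = ?X u v + ht (insert x' T) u v z"
    unfolding 1 ht_def by (simp only: add.assoc)
  finally show ?thesis .
qed

end

lemma cone3_2I: "0 \<le> \<alpha> \<Longrightarrow> 0 \<le> \<beta> \<Longrightarrow> 0 < \<alpha> + \<beta> \<Longrightarrow> x = \<alpha> *\<^sub>R a + \<beta> *\<^sub>R b \<Longrightarrow> x \<in> cone3 a b b"
  by (rule cone3I[of \<alpha> \<beta> 0]) simp_all

lemma tendsto_perturb: "tendsto (\<lambda>t. p + t *\<^sub>R x) p (at_right (0::real))" for p x :: "'a::real_normed_vector"
  by (rule tendsto_eq_intros refl tendsto_ident_at | simp)+

lemma ev_pos: "eventually (\<lambda>t::real. 0 < t) (at_right 0)"
  by (simp add: eventually_at_right_less)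

text \<open>Supplies the direction in which an auxiliary point is pushed off the line of
  \<open>u\<close> and \<open>v\<close> to the side prescribed by \<open>s\<close>.\<close>

lemma dt_cross_pos:
  assumes "cross3 u v \<noteq> 0" "s \<noteq> 0" shows "s * dt u v (s *\<^sub>R cross3 u v) > 0"
proof -
  have "dt (cross3 u v) u v = inner (cross3 u v) (cross3 u v)" by (simp add: dt_def)
  then have "dt u v (s *\<^sub>R cross3 u v) = s * inner (cross3 u v) (cross3 u v)"
    using dt_rot(2)[of "cross3 u v" u v] by simp
  then have "s * dt u v (s *\<^sub>R cross3 u v) = (s * s) * inner (cross3 u v) (cross3 u v)" by simp
  then show ?thesis using assms by (metis inner_gt_zero_iff mult_pos_pos not_real_square_gt_zero)
qed

lemma cone3_2_nz: assumes "q \<in> cone3 x x' x'" "cross3 x x' \<noteq> 0" shows "q \<noteq> 0"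
proof
  assume "q = 0"
  obtain \<gamma> \<delta> \<delta>' where 2: "q = \<gamma> *\<^sub>R x + \<delta> *\<^sub>R x' + \<delta>' *\<^sub>R x'" "0 \<le> \<gamma>" "0 \<le> \<delta>" "0 \<le> \<delta>'" "0 < \<gamma> + \<delta> + \<delta>'"
    using assms(1) unfolding cone3_def by blast
  have "q = \<gamma> *\<^sub>R x + (\<delta> + \<delta>') *\<^sub>R x'" using 2 by (simp add: algebra_simps)
  then have "cross3 q x' = \<gamma> *\<^sub>R cross3 x x'" "cross3 x q = (\<delta> + \<delta>') *\<^sub>R cross3 x x'"
    by (simp_all add: cross_add_left cross_add_right cross_mult_left cross_mult_right)
  then have "\<gamma> = 0" "\<delta> + \<delta>' = 0" using \<open>q = 0\<close> assms(2) by auto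
  then show False using 2 by simp
qed

lemma cone3_pos:
  assumes "p \<in> cone3 a b c" "inner n a > 0" "inner n b > 0" "inner n c > 0" shows "inner n p > 0"
proof -
  obtain \<alpha> \<beta> \<gamma> where *: "p = \<alpha> *\<^sub>R a + \<beta> *\<^sub>R b + \<gamma> *\<^sub>R c" "0 \<le> \<alpha>" "0 \<le> \<beta>" "0 \<le> \<gamma>" "0 < \<alpha> + \<beta> + \<gamma>"
    using assms(1) unfolding cone3_def by blast
  then have "inner n p = \<alpha> * inner n a + \<beta> * inner n b + \<gamma> * inner n c" by (simp add: inner_right_distrib)
  moreover have "0 \<le> \<alpha> * inner n a" "0 \<le> \<beta> * inner n b" "0 \<le> \<gamma> * inner n c" using * assms by simp_all
  moreover have "0 < \<alpha> * inner n a \<or> 0 < \<beta> * inner n b \<or> 0 < \<gamma> * inner n c" using * assms by (auto simp: zero_less_mult_iff)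
  ultimately show ?thesis by linarith
qed

lemma clr_fun:
  assumes "x \<noteq> 0" "inner n x = 0" "inner n a > 0" "inner n b > 0" "inner n c > 0" shows "clr {x} a b c"
  unfolding clr_def sep_def
proof (intro ballI notI)
  fix p q assume "p \<in> cone3 a b c" "q \<in> {x}" "cross3 p q = 0"
  then show False using cone3_pos[OF _ assms(3-5)] assms(1,2) by (force simp: cross3_eq_0_iff)
qed

lemma sep_fun:
  assumes "inner n a > 0" "inner n b > 0" "inner n c > 0" "inner n x = 0" "inner n x' = 0" "cross3 x x' \<noteq> 0"
  shows "sep (cone3 a b c) (cone3 x x' x')"
  unfolding sep_def
proof (intro ballI notI)
  fix p q assume *: "p \<in> cone3 a b c" "q \<in> cone3 x x' x'" "cross3 p q = 0"
  have "inner n q = 0" using *(2) assms(4,5) unfolding cone3_def by (auto simp: inner_right_distrib)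
  then show False using cone3_pos[OF *(1) assms(1-3)] cone3_2_nz[OF *(2) assms(6)] *(3) by (auto simp: cross3_eq_0_iff)
qed

context moves begin

text \<open>\<open>y_zind\<close> asks for clear triangles containing both auxiliary points. They
  are pulled towards the midpoint \<open>u + v\<close>, where these triangles degenerate to parts of
  the segment, which is clear.\<close>

lemma y_unique:
  assumes T: "okT 2 T" and c: "clr (T \<union> D) u v z" "clr (T \<union> D) u v z'" and d: "dt u v z * dt u v z' > 0"
  shows "ht T u v z = ht T u v z'"
proof -
  let ?z = "\<lambda>z t. (u + v) + t *\<^sub>R z"
  have sh: "ht T u v (?z z t) = ht T u v z" if "t > 0" "clr (T \<union> D) u v z" "dt u v z \<noteq> 0" for t z
  proof (rule y_zind[OF T that(2)])
    have m: "?z z t \<in> cone3 u v z" using that by (intro cone3I[of 1 1 t]) auto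
    show "clr (T \<union> D) u z (?z z t)" "clr (T \<union> D) v z (?z z t)"
      by (rule clr_mono[OF that(2)]; simp add: m)+
    have "dt u v (?z z t) = t * dt u v z" by simp
    then have "dt u v z * dt u v (?z z t) = t * (dt u v z * dt u v z)" by simp
    then show "dt u v z * dt u v (?z z t) > 0" using that by (metis mult_pos_pos not_real_square_gt_zero)
  qed
  have m: "u + v \<in> cone3 u v v" by (rule cone3_2I[of 1 1]) auto
  have c0: "clr (T \<union> D) u v v" by (rule clr_edges[OF c(1)])
  have cc: "clr (T \<union> D) u (u + v) (u + v)" "clr (T \<union> D) v (u + v) (u + v)"
    by (rule clr_mono[OF c0]; simp add: m)+
  have "eventually (\<lambda>t. clr (T \<union> D) u (?z z t) (?z z' t)) (at_right 0)"
    "eventually (\<lambda>t. clr (T \<union> D) v (?z z t) (?z z' t)) (at_right 0)"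
    by (rule clr_eventually[OF finite_okT[OF T] _ tendsto_const tendsto_perturb tendsto_perturb], rule cc)+
  then have "eventually (\<lambda>t. clr (T \<union> D) u (?z z t) (?z z' t) \<and> clr (T \<union> D) v (?z z t) (?z z' t) \<and> t > 0) (at_right 0)"
    using ev_pos by (intro eventually_conj)
  then obtain t where t: "clr (T \<union> D) u (?z z t) (?z z' t)" "clr (T \<union> D) v (?z z t) (?z z' t)" "t > 0"
    using eventually_happens[of _ "at_right (0::real)"] by auto
  have "?z z t \<in> cone3 u v z" using t by (intro cone3I[of 1 1 t]) auto
  then have cz: "clr (T \<union> D) u v (?z z t)" by (intro clr_mono[OF c(1)]) simp_all
  have "ht T u v (?z z' t) = ht T u v (?z z t)"
  proof (rule y_zind[OF T cz t(1,2)])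
    have "dt u v (?z z t) * dt u v (?z z' t) = (t * t) * (dt u v z * dt u v z')" by simp
    then show "dt u v (?z z t) * dt u v (?z z' t) > 0" using d t(3) by (metis mult_pos_pos)
  qed
  moreover have "ht T u v (?z z t) = ht T u v z" "ht T u v (?z z' t) = ht T u v z'"
    using d by (auto intro!: sh t c)
  ultimately show ?thesis by simp
qed

text \<open>The half twist along the segment from \<open>u\<close> to \<open>v\<close>; the sign of \<open>s\<close> is its direction of rotation.\<close>
definition Y :: "(real^3) set \<Rightarrow> real^3 \<Rightarrow> real^3 \<Rightarrow> real \<Rightarrow> 'g" where
  "Y T u v s = ht T u v (SOME z. clr (T \<union> D) u v z \<and> s * dt u v z > 0)"

lemma Y_H: "Y T u v s \<in> H"
  unfolding Y_def by (rule y_H)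

lemma Y_eq:
  assumes T: "okT 2 T" and c: "clr (T \<union> D) u v z" and d: "s * dt u v z > 0"
  shows "Y T u v s = ht T u v z"
proof -
  define z' where "z' = (SOME z. clr (T \<union> D) u v z \<and> s * dt u v z > 0)"
  have z': "clr (T \<union> D) u v z'" "s * dt u v z' > 0"
    unfolding z'_def using someI[of "\<lambda>z. clr (T \<union> D) u v z \<and> s * dt u v z > 0" z] c d by auto
  have "ht T u v z' = ht T u v z"
    by (rule y_unique[OF T z'(1) c]) (use z'(2) d in \<open>auto simp: zero_less_mult_iff\<close>)
  then show ?thesis unfolding Y_def z'_def .
qed

text \<open>The auxiliary point may be taken arbitrarily close to any point \<open>p\<close> of the
  segment. Being an eventuality, this can be combined with any other open condition on the
  triangle.\<close>

lemma Y_near: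
  assumes T: "okT 2 T" and c: "clr (T \<union> D) u v v" and p: "p \<in> cone3 u v v" and x: "s * dt u v x > 0"
  shows "eventually (\<lambda>t. clr (T \<union> D) u v (p + t *\<^sub>R x) \<and> s * dt u v (p + t *\<^sub>R x) > 0 \<and> Y T u v s = ht T u v (p + t *\<^sub>R x)) (at_right 0)"
proof -
  obtain \<alpha> \<beta> \<beta>' where "p = \<alpha> *\<^sub>R u + \<beta> *\<^sub>R v + \<beta>' *\<^sub>R v" using p unfolding cone3_def by blast
  then have dp: "dt u v (p + t *\<^sub>R x) = t * dt u v x" for t by simp
  have "clr (T \<union> D) u v p" by (rule clr_mono[OF c]) (use p in auto)
  then have "eventually (\<lambda>t. clr (T \<union> D) u v (p + t *\<^sub>R x)) (at_right 0)"
    by (rule clr_eventually[OF finite_okT[OF T] _ tendsto_const tendsto_const tendsto_perturb])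
  then show ?thesis using ev_pos
  proof eventually_elim
    case (elim t)
    have "s * dt u v (p + t *\<^sub>R x) = t * (s * dt u v x)" unfolding dp by simp
    then have "s * dt u v (p + t *\<^sub>R x) > 0" using elim(2) x by (metis mult_pos_pos)
    then show ?case using Y_eq[OF T elim(1)] elim(1) by blast
  qed
qed

lemma ex_right: "eventually P (at_right (0::real)) \<Longrightarrow> \<exists>t. P t"
  using eventually_happens[of P "at_right (0::real)"] by auto

text \<open>The triple product is odd under simultaneous negation of its three arguments, so the
  same projective half twist has the opposite sense with respect to \<open>- u\<close> and
  \<open>- v\<close>. This is how non-orientability enters.\<close>

lemma Y_flip: "Y T (- u) (- v) (- s) = Y T u v s"
  if T: "okT 2 T" and c: "clr (T \<union> D) u v v" and d: "cross3 u v \<noteq> 0" "s \<noteq> 0"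
proof -
  obtain z where z: "clr (T \<union> D) u v z" "s * dt u v z > 0" "Y T u v s = ht T u v z"
    using ex_right[OF Y_near[OF T c cone3_vertex(1) dt_cross_pos[OF d]]] by blast
  have "Y T (- u) (- v) (- s) = ht T (- u) (- v) (- z)"
  proof (rule Y_eq[OF T])
    show "clr (T \<union> D) (- u) (- v) (- z)" using z(1) by (simp only: clr_minus)
    show "- s * dt (- u) (- v) (- z) > 0" using z(2) by simp
  qed
  also have "\<dots> = ht T u v z" unfolding ht_def by (simp add: mv_neg mv_neg_ctx)
  finally show ?thesis using z by simp
qed

lemma Y_ctx_flip: "Y (insert (- t) T) u v s = Y (insert t T) u v s"
proof -
  have "ht (insert (- t) T) u v z = ht (insert t T) u v z" for z
    unfolding ht_def by (simp only: insert_commute[of _ "- t" T] insert_commute[of _ t T] mv_neg_ctx)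
  then show ?thesis unfolding Y_def by simp
qed

text \<open>The symmetry is \<open>y_opposite\<close>, with auxiliary points on both sides of the
  midpoint of the segment. Together with \<open>y_inv\<close> it shows that the opposite sense gives
  the inverse.\<close>

lemma Y_swap:
  assumes T: "okT 2 T" and c: "clr (T \<union> D) u v v" and d: "cross3 u v \<noteq> 0" "s \<noteq> 0"
  shows "Y T v u s = Y T u v s" and "Y T u v (- s) = - Y T u v s"
proof -
  have inv: "Y T v u (- s) = - Y T u v s" if c: "clr (T \<union> D) u v v" and d: "cross3 u v \<noteq> 0" "s \<noteq> 0" for u v s
  proof -
    obtain z where z: "clr (T \<union> D) u v z" "s * dt u v z > 0" "Y T u v s = ht T u v z"
      using ex_right[OF Y_near[OF T c cone3_vertex(1) dt_cross_pos[OF d]]] by blast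
    have "Y T v u (- s) = ht T v u z"
      by (rule Y_eq[OF T]) (use z in \<open>simp_all add: clr_perm(1) dt_swap(1)[of v u z]\<close>)
    moreover have "dt u v z \<noteq> 0" using z(2) by auto
    ultimately show ?thesis using y_inv[OF T z(1)] z(3) by simp
  qed
  let ?x = "s *\<^sub>R cross3 u v" let ?z = "\<lambda>t. (u + v) + t *\<^sub>R ?x" and ?z' = "\<lambda>t. (u + v) + t *\<^sub>R (- ?x)"
  have m: "u + v \<in> cone3 u v v" by (rule cone3_2I[of 1 1]) auto
  have "eventually (\<lambda>t. clr (T \<union> D) u v (?z' t)) (at_right 0)"
    by (rule clr_eventually[OF finite_okT[OF T] clr_mono[OF c] tendsto_const tendsto_const tendsto_perturb]) (use m in auto)
  with Y_near[OF T c m dt_cross_pos[OF d]]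
  have "eventually (\<lambda>t. clr (T \<union> D) u v (?z t) \<and> s * dt u v (?z t) > 0 \<and> Y T u v s = ht T u v (?z t) \<and> clr (T \<union> D) u v (?z' t)) (at_right 0)"
    by eventually_elim blast
  from ex_right[OF this] obtain t where t: "clr (T \<union> D) u v (?z t)" "s * dt u v (?z t) > 0" "Y T u v s = ht T u v (?z t)" "clr (T \<union> D) u v (?z' t)"
    by blast
  \<comment> \<open>The two auxiliary points add up to \<open>2 *\<^sub>R (u + v)\<close>, which
    yields the coefficients 2, 2 and 1.\<close>
  have "ht T v u (?z' t) = ht T u v (?z t)"
    by (rule y_opposite[OF T t(1) t(4), of 2 2 1]) (use t(2) in \<open>auto simp: algebra_simps scaleR_2\<close>)
  moreover have "Y T v u s = ht T v u (?z' t)"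
    by (rule Y_eq[OF T]) (use t in \<open>simp_all add: clr_perm(1) dt_swap(1)[of v u]\<close>)
  ultimately show 1: "Y T v u s = Y T u v s" using t by simp
  have "Y T u v (- s) = - Y T v u s"
    by (rule inv) (use c d in \<open>auto simp: cross3_commute_0[of v] intro: clr_mono[OF c]\<close>)
  then show "Y T u v (- s) = - Y T u v s" using 1 by simp
qed

lemma Y_sign:
  assumes T: "okT 2 T" and c: "clr (T \<union> D) u v v" and d: "cross3 u v \<noteq> 0" and s: "s * s' > 0"
  shows "Y T u v s = Y T u v s'"
proof -
  have "s \<noteq> 0" using s by auto
  then obtain z where z: "clr (T \<union> D) u v z" "s * dt u v z > 0" "Y T u v s = ht T u v z"
    using ex_right[OF Y_near[OF T c cone3_vertex(1) dt_cross_pos[OF d]]] by blast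
  have "Y T u v s' = ht T u v z"
    by (rule Y_eq[OF T z(1)]) (use s z(2) in \<open>auto simp: zero_less_mult_iff\<close>)
  then show ?thesis using z by simp
qed

lemma Y_move:
  assumes T: "okT 3 T" and c: "clr (T \<union> D) u v v" "clr (T \<union> D) x x' x'" and d: "cross3 u v \<noteq> 0" "s \<noteq> 0"
    and s: "dj u v x x'"
  shows "Y (insert x T) u v s + mv (insert u (insert v T)) x x' = mv (insert u (insert v T)) x x' + Y (insert x' T) u v s"
proof -
  let ?w = "s *\<^sub>R cross3 u v" let ?z = "\<lambda>t. u + t *\<^sub>R ?w"
  have x: "clr {x} u v v" "clr {x'} u v v" using s by (simp_all add: dj_def clr_def sep_def)
  have T2: "okT 2 (insert x T)" "okT 2 (insert x' T)"
    using okT_insert2[OF T] clr_edges[OF c(2)] by blast+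
  have c2: "clr (insert x T \<union> D) u v v" "clr (insert x' T \<union> D) u v v" using x c by simp_all
  have s0: "sep (cone3 u v u) (cone3 x x' x')" using s cone3_perm(4)[of u v] unfolding dj_def by metis
  have "eventually (\<lambda>t. sep (cone3 u v (?z t)) (cone3 x x' x')) (at_right 0)"
    by (rule sep_eventually[OF s0 tendsto_const tendsto_const tendsto_perturb tendsto_const tendsto_const tendsto_const])
  with Y_near[OF T2(1) c2(1) cone3_vertex(1) dt_cross_pos[OF d]] Y_near[OF T2(2) c2(2) cone3_vertex(1) dt_cross_pos[OF d]]
  have "eventually (\<lambda>t. (clr (insert x T \<union> D) u v (?z t) \<and> s * dt u v (?z t) > 0 \<and> Y (insert x T) u v s = ht (insert x T) u v (?z t)) \<and>
     Y (insert x' T) u v s = ht (insert x' T) u v (?z t) \<and> sep (cone3 u v (?z t)) (cone3 x x' x')) (at_right 0)"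
    by eventually_elim blast
  from ex_right[OF this] obtain t where t: "clr (insert x T \<union> D) u v (?z t)" "s * dt u v (?z t) > 0" "Y (insert x T) u v s = ht (insert x T) u v (?z t)"
     "Y (insert x' T) u v s = ht (insert x' T) u v (?z t)" "sep (cone3 u v (?z t)) (cone3 x x' x')" by blast
  show ?thesis unfolding t(3,4)
    by (rule y_move[OF T _ c(2) _ t(5)]) (use t in auto)
qed

text \<open>The direction \<open>x\<close> fits both segments, so one auxiliary point close to the
  common end \<open>v\<close> serves for \<open>u\<close> and for \<open>u'\<close>.\<close>

lemma Y_slide:
  assumes T: "okT 2 T" and c: "clr (T \<union> D) u u' v" and x: "s * dt u v x > 0" "s * dt u' v x > 0"
  shows "Y T u v s + mv (insert v T) u u' = mv (insert v T) u u' + Y T u' v s"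
proof -
  let ?z = "\<lambda>t. v + t *\<^sub>R x"
  have c': "clr (T \<union> D) u v v" "clr (T \<union> D) u' v v" by (rule clr_mono[OF c]; simp)+
  have "eventually (\<lambda>t. clr (T \<union> D) u u' (?z t)) (at_right 0)"
    by (intro clr_eventually[OF finite_okT[OF T] c] tendsto_const tendsto_perturb)
  with Y_near[OF T c'(1) cone3_vertex(2) x(1)] Y_near[OF T c'(2) cone3_vertex(2) x(2)]
  have "eventually (\<lambda>t. (clr (T \<union> D) u v (?z t) \<and> s * dt u v (?z t) > 0 \<and> Y T u v s = ht T u v (?z t)) \<and>
     (clr (T \<union> D) u' v (?z t) \<and> s * dt u' v (?z t) > 0 \<and> Y T u' v s = ht T u' v (?z t)) \<and> clr (T \<union> D) u u' (?z t)) (at_right 0)"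
    by eventually_elim blast
  from ex_right[OF this] obtain t where t: "clr (T \<union> D) u v (?z t)" "s * dt u v (?z t) > 0" "Y T u v s = ht T u v (?z t)"
     "clr (T \<union> D) u' v (?z t)" "s * dt u' v (?z t) > 0" "Y T u' v s = ht T u' v (?z t)" "clr (T \<union> D) u u' (?z t)" by blast
  show ?thesis unfolding t(3,6)
    by (rule y_slide[OF T t(7) c t(1,4)]) (use t(2,5) in \<open>auto simp: zero_less_mult_iff\<close>)
qed

lemma y_slide2:
  assumes T: "okT 2 T" and c: "clr (T \<union> D) v v' z" "clr (T \<union> D) v v' u" "clr (T \<union> D) u v z" "clr (T \<union> D) u v' z"
    and d: "dt u v z * dt u v' z > 0"
  shows "ht T u v z + mv (insert u T) v v' = mv (insert u T) v v' + ht T u v' z"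
proof -
  have d': "dt v u z * dt v' u z > 0" "dt u v z \<noteq> 0" "dt u v' z \<noteq> 0"
    using d by (auto simp: dt_swap(1)[of v u z] dt_swap(1)[of v' u z])
  have c': "clr (T \<union> D) v u z" "clr (T \<union> D) v' u z" by (rule clr_mono[OF c(3)] clr_mono[OF c(4)]; simp)+
  have 1: "ht T v u z + mv (insert u T) v v' = mv (insert u T) v v' + ht T v' u z"
    by (rule y_slide[OF T c(1,2) c' d'(1)])
  have 2: "ht T v u z = - ht T u v z" "ht T v' u z = - ht T u v' z"
    by (rule y_inv[OF T c(3) d'(2)] y_inv[OF T c(4) d'(3)])+
  have "- ht T u v z + mv (insert u T) v v' + ht T u v' z = mv (insert u T) v v'"
    using 1 unfolding 2 by (simp add: add.assoc)
  then show ?thesis by (metis add.assoc add_minus_cancel)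
qed

text \<open>A special position, with \<open>v\<close> inside the triangle \<open>u\<close>,
  \<open>w\<close>, \<open>z2\<close>. Let \<open>e\<close> and \<open>f\<close> be the half twists
  along \<open>u v\<close> and \<open>v w\<close>. If both use \<open>z2\<close>, the last move of
  \<open>e\<close> cancels against the first move of \<open>f\<close>, and \<open>e + f\<close>
  consists of four moves. Carrying \<open>f\<close> along them yields
  \<open>f + (e + f) = (e + f) + e\<close>.\<close>

lemma Y_braid:
  assumes T: "okT 3 T" and r: "0 < r" and s: "s * dt u w z2 > 0" and c: "clr (T \<union> D) u w z2"
    and v: "v = (2 * r) *\<^sub>R u + (2 * r) *\<^sub>R w + z2"
  shows "Y (insert w T) u v s + Y (insert u T) v w s + Y (insert w T) u v s =
    Y (insert u T) v w s + Y (insert w T) u v s + Y (insert u T) v w s"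
proof -
  \<comment> \<open>\<open>2 *\<^sub>R z1 = v + z2\<close>. So \<open>z1\<close> lies on the same
    side as \<open>z2\<close> of the lines \<open>u v\<close>, \<open>v w\<close> and
    \<open>u w\<close>, and it can remain the auxiliary point while the tokens move.\<close>
  define z1 where z1: "z1 = r *\<^sub>R u + r *\<^sub>R w + z2"
  have d: "dt u w z2 \<noteq> 0" using s by auto
  have eq: "a = a' \<and> b = b' \<and> c = c'" if "a *\<^sub>R u + b *\<^sub>R w + c *\<^sub>R z2 = a' *\<^sub>R u + b' *\<^sub>R w + c' *\<^sub>R z2" for a b c a' b' c'
    using that coord_eq[OF d] by blast
  have dd: "dt u v z1 = r * dt u w z2" "dt v w z1 = r * dt u w z2" "dt u v z2 = (2 * r) * dt u w z2" "dt v w z2 = (2 * r) * dt u w z2"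
    "dt u w z1 = dt u w z2" "dt u w z1 = 1 * dt u w z2"
    unfolding z1 v by (simp_all add: dt_swap(2)[of u z2 w] dt_swap(1)[of w u] dt_swap(3)[of z2 w u] dt_rot algebra_simps)
  have nz: "z2 \<noteq> 0" "u \<noteq> 0" "w \<noteq> 0" using d by auto
  have m: "u \<in> cone3 u w z2" "w \<in> cone3 u w z2" "z2 \<in> cone3 u w z2" "z1 \<in> cone3 u w z2" "v \<in> cone3 u w z2"
    using r cone3I[of r r 1 z1 u w z2] cone3I[of "2*r" "2*r" 1 v u w z2] by (simp_all add: z1 v)
  have cl: "clr (T \<union> D) a b c'" if "a \<in> cone3 u w z2" "b \<in> cone3 u w z2" "c' \<in> cone3 u w z2" for a b c'
    by (rule clr_mono[OF c that])
  have cp: "clr (T \<union> D) a a a" if "a \<in> cone3 u w z2" for a using cl that by blast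
  have pos: "a * b > 0" if "a = k * dt u w z2" "b = l * dt u w z2" "0 < k" "0 < l" for a b k l
  proof -
    have "a * b = (k * l) * (dt u w z2 * dt u w z2)" using that by simp
    then show ?thesis using that d by (metis mult_pos_pos not_real_square_gt_zero)
  qed
  have Tu: "okT 2 (insert u T)" and Tw: "okT 2 (insert w T)" and Tz: "okT 2 (insert z2 T)"
    using okT_insert2[OF T cp] m by blast+
  have Du: "dt u v z1 \<noteq> 0" "dt v w z1 \<noteq> 0" "dt u v z2 \<noteq> 0" "dt v w z2 \<noteq> 0" "dt u w z1 \<noteq> 0" using dd r d by auto
  let ?d = "dt u w z2"
  \<comment> \<open>The dual basis of \<open>u\<close>, \<open>w\<close>, \<open>z2\<close>. The sum
    of two of its members vanishes at one of these vectors and is positive at the other points in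
    play, which certifies that the required triangles are clear.\<close>
  define nu nw nz where "nu = (1 / ?d) *\<^sub>R cross3 w z2" and "nw = (1 / ?d) *\<^sub>R cross3 z2 u" and "nz = (1 / ?d) *\<^sub>R cross3 u w"
  have N: "inner nu u = 1" "inner nu w = 0" "inner nu z2 = 0" "inner nw u = 0" "inner nw w = 1" "inner nw z2 = 0"
    "inner nz u = 0" "inner nz w = 0" "inner nz z2 = 1"
    using d dt_rot[of u w z2] unfolding nu_def nw_def nz_def
    by (simp_all add: dot_cross_self inner_commute[of "cross3 _ _"] flip: dt_def)
  have N1: "inner nu v = 2 * r" "inner nu z1 = r" "inner nw v = 2 * r" "inner nw z1 = r" "inner nz v = 1" "inner nz z1 = 1"
    unfolding v z1 by (simp_all add: inner_right_distrib N)
  have cu: "clr {u} a b c'" if "a \<in> {w, z2, v, z1}" "b \<in> {w, z2, v, z1}" "c' \<in> {w, z2, v, z1}" for a b c'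
  proof -
    have "inner (nw + nz) p > 0" if "p \<in> {w, z2, v, z1}" for p using that r by (auto simp: inner_left_distrib N N1)
    then show ?thesis using that nz by (intro clr_fun[of _ "nw + nz"]) (simp_all add: inner_left_distrib N)
  qed
  have cw: "clr {w} a b c'" if "a \<in> {u, z2, v, z1}" "b \<in> {u, z2, v, z1}" "c' \<in> {u, z2, v, z1}" for a b c'
  proof -
    have "inner (nu + nz) p > 0" if "p \<in> {u, z2, v, z1}" for p using that r by (auto simp: inner_left_distrib N N1)
    then show ?thesis using that nz by (intro clr_fun[of _ "nu + nz"]) (simp_all add: inner_left_distrib N)
  qed
  have cz: "clr {z2} a b c'" if "a \<in> {u, w, v, z1}" "b \<in> {u, w, v, z1}" "c' \<in> {u, w, v, z1}" for a b c'
  proof -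
    have "inner (nu + nw) p > 0" if "p \<in> {u, w, v, z1}" for p using that r by (auto simp: inner_left_distrib N N1)
    then show ?thesis using that nz by (intro clr_fun[of _ "nu + nw"]) (simp_all add: inner_left_distrib N)
  qed
  have Cu: "clr (insert u T \<union> D) a b c'" if "a \<in> {w, z2, v, z1}" "b \<in> {w, z2, v, z1}" "c' \<in> {w, z2, v, z1}" for a b c'
    using cu[OF that] cl[of a b c'] that m by auto
  have Cw: "clr (insert w T \<union> D) a b c'" if "a \<in> {u, z2, v, z1}" "b \<in> {u, z2, v, z1}" "c' \<in> {u, z2, v, z1}" for a b c'
    using cw[OF that] cl[of a b c'] that m by auto
  have Cz: "clr (insert z2 T \<union> D) a b c'" if "a \<in> {u, w, v, z1}" "b \<in> {u, w, v, z1}" "c' \<in> {u, w, v, z1}" for a b c'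
    using cz[OF that] cl[of a b c'] that m by auto
  have e: "ht (insert w T) u v z2 = ht (insert w T) u v z1"
    by (rule y_zind[OF Tw Cw Cw Cw]) (use pos[OF dd(1,3)] r in auto)
  have f: "ht (insert u T) v w z2 = ht (insert u T) v w z1"
    by (rule y_zind[OF Tu Cu Cu Cu]) (use pos[OF dd(2,4)] r in auto)
  let ?A = "mv (insert v (insert w T)) u z2" and ?B = "mv (insert w (insert z2 T)) v u"
    and ?C = "mv (insert u (insert z2 T)) w v" and ?E = "mv (insert u (insert v T)) z2 w"
  have Tuw: "okT 1 (insert u (insert w T))"
    by (rule okT_insert1[OF Tw, of u u u]) (rule Cw; simp)
  have 0: "mv (insert u (insert w T)) z2 v = - mv (insert u (insert w T)) v z2"
  proof (rule mv_rev[OF Tuw])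
    show "clr (insert u (insert w T) \<union> D) v z2 z2" using cu[of v z2 z2] cw[of v z2 z2] cl[of v z2 z2] m by simp
  qed
  have ic: "insert w (insert u T) = insert u (insert w T)" "insert z2 (insert w T) = insert w (insert z2 T)"
    "insert z2 (insert u T) = insert u (insert z2 T)" "insert v (insert u T) = insert u (insert v T)" by auto
  have g: "a + b + - x + (x + c + e) = a + b + c + e" for a b x c e :: 'g
    by (simp only: add.assoc minus_add_cancel)
  have ef: "ht (insert w T) u v z2 + ht (insert u T) v w z2 = ?A + ?B + ?C + ?E"
    unfolding ht_def 0 ic by (rule g)
  \<comment> \<open>The half twist along \<open>v w\<close> is carried through the four moves: a
    bystander moves, then the first twisted token, then the second one, then a bystander
    again.\<close>
  have 1: "ht (insert u T) v w z1 + ?A = ?A + ht (insert z2 T) v w z1"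
    by (rule y_move[OF T cl cl Du(2) sep_fun[of nw]]) (use m r N N1 dt_imp_cross(3)[OF d] in auto)
  have 2: "ht (insert z2 T) v w z1 + ?B = ?B + ht (insert z2 T) u w z1"
    by (rule y_slide[OF Tz Cz Cz Cz Cz]) (use pos[OF dd(2,6)] r in auto)
  have 3: "ht (insert z2 T) u w z1 + ?C = ?C + ht (insert z2 T) u v z1"
    by (rule y_slide2[OF Tz Cz Cz Cz Cz]) (use pos[OF dd(6,1)] r in auto)
  have 4: "ht (insert z2 T) u v z1 + ?E = ?E + ht (insert w T) u v z1"
    by (rule y_move[OF T cl cl Du(1) sep_fun[of nu]]) (use m r N N1 dt_imp_cross(2)[OF d] in \<open>auto simp: cross3_commute_0[of z2]\<close>)
  have "ht (insert u T) v w z1 + (?A + ?B + ?C + ?E) = ?A + (ht (insert z2 T) v w z1 + ?B) + ?C + ?E"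
    using 1 by (simp only: add.assoc[symmetric])
  also have "\<dots> = ?A + ?B + (ht (insert z2 T) u w z1 + ?C) + ?E" unfolding 2 by (simp only: add.assoc)
  also have "\<dots> = ?A + ?B + ?C + (ht (insert z2 T) u v z1 + ?E)" unfolding 3 by (simp only: add.assoc)
  also have "\<dots> = (?A + ?B + ?C + ?E) + ht (insert w T) u v z1" unfolding 4 by (simp only: add.assoc)
  finally have 5: "ht (insert w T) u v z1 + ht (insert u T) v w z1 + ht (insert w T) u v z1 =
    ht (insert u T) v w z1 + ht (insert w T) u v z1 + ht (insert u T) v w z1"
    unfolding ef[symmetric] e f by (simp add: add.assoc)
  have s': "s * (r * dt u w z2) > 0" using s r by (simp add: mult.left_commute)
  have "Y (insert w T) u v s = ht (insert w T) u v z1"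
    by (rule Y_eq[OF Tw Cw]) (use s' in \<open>simp_all only: dd(1), auto\<close>)
  moreover have "Y (insert u T) v w s = ht (insert u T) v w z1"
    by (rule Y_eq[OF Tu Cu]) (use s' in \<open>simp_all only: dd(2), auto\<close>)
  ultimately show ?thesis using 5 by simp
qed

end

lemma add_conj: fixes k :: "'g::group_add" assumes "e + k = k + e'" shows "e = k + e' + - k"
  using assms by (metis add.assoc add.right_inverse add_0_right)

lemma conj_add: fixes k :: "'g::group_add" shows "(k + a + - k) + (k + b + - k) = k + (a + b) + - k"
  by (simp only: add.assoc minus_add_cancel)

lemma braid_conj:
  fixes k :: "'g::group_add"
  assumes "e + k = k + e'" "f + k = k + f'" "e' + f' + e' = f' + e' + f'"
  shows "e + f + e = f + e + f"
  unfolding add_conj[OF assms(1)] add_conj[OF assms(2)] conj_add assms(3) ..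

context moves begin

subsection \<open>General position\<close>

text \<open>Points of \<open>E\<close> in general position with respect to each other and to the punctures
  (collinear punctures are allowed).\<close>
definition gp :: "(real^3) set \<Rightarrow> bool" where
  "gp E \<longleftrightarrow> adm D E \<and> (\<forall>x\<in>E. \<forall>y\<in>E \<union> D. \<forall>z\<in>E \<union> D. x \<noteq> y \<longrightarrow> x \<noteq> z \<longrightarrow> y \<noteq> z \<longrightarrow> dt x y z \<noteq> 0)"

lemma gp_finite: "gp E \<Longrightarrow> finite E"
  unfolding gp_def adm_def by simp

lemma gp_disjoint: assumes "gp E" "x \<in> E" shows "x \<notin> D"
proof
  assume "x \<in> D"
  then have "cross3 x x \<noteq> 0" using assms unfolding gp_def adm_def by blast
  then show False by simp
qed

lemma gp_cross: "gp E \<Longrightarrow> x \<in> E \<Longrightarrow> y \<in> E \<union> D \<Longrightarrow> x \<noteq> y \<Longrightarrow> cross3 x y \<noteq> 0"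
  unfolding gp_def adm_def by blast

lemma gp_dt: "gp E \<Longrightarrow> x \<in> E \<Longrightarrow> y \<in> E \<union> D \<Longrightarrow> z \<in> E \<union> D \<Longrightarrow> x \<noteq> y \<Longrightarrow> x \<noteq> z \<Longrightarrow> y \<noteq> z \<Longrightarrow> dt x y z \<noteq> 0"
  unfolding gp_def by blast

lemma gp_dt2: "gp E \<Longrightarrow> x \<in> E \<union> D \<Longrightarrow> y \<in> E \<Longrightarrow> z \<in> E \<union> D \<Longrightarrow> x \<noteq> y \<Longrightarrow> x \<noteq> z \<Longrightarrow> y \<noteq> z \<Longrightarrow> dt x y z \<noteq> 0"
  using gp_dt[of E y x z] dt_nz(2) by blast

lemma gp_subset: "gp E \<Longrightarrow> E' \<subseteq> E \<Longrightarrow> gp E'"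
  unfolding gp_def adm_def by (meson Diff_mono Un_mono finite_subset order_refl subset_iff)

lemma gp_adm: "gp E \<Longrightarrow> adm D E"
  unfolding gp_def by simp

lemma gp_insertI:
  assumes E: "gp E" and x: "\<And>y. y \<in> E \<union> D \<Longrightarrow> cross3 x y \<noteq> 0"
    and d: "\<And>y z. y \<in> E \<union> D \<Longrightarrow> z \<in> E \<union> D \<Longrightarrow> y \<noteq> z \<Longrightarrow> dt x y z \<noteq> 0"
  shows "gp (insert x E)" "x \<notin> E" "x \<notin> D"
proof -
  show x': "x \<notin> E" "x \<notin> D" using x[of x] by auto
  show "gp (insert x E)" unfolding gp_def
  proof (intro conjI ballI impI)
    show "adm D (insert x E)" using gp_adm[OF E] x x' unfolding adm_def
      by (auto simp: cross3_commute_0[of _ x])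
    fix a b c assume *: "a \<in> insert x E" "b \<in> insert x E \<union> D" "c \<in> insert x E \<union> D" "a \<noteq> b" "a \<noteq> c" "b \<noteq> c"
    consider "a = x" | "a \<in> E" "b = x" | "a \<in> E" "c = x" | "a \<in> E" "b \<in> E \<union> D" "c \<in> E \<union> D" using * by auto
    then show "dt a b c \<noteq> 0"
    proof cases
      case 1 then show ?thesis using * x' d by auto
    next
      case 2 then have "dt x a c \<noteq> 0" using * d by auto
      then show ?thesis using 2 dt_nz(2) by blast
    next
      case 3 then have "dt x a b \<noteq> 0" using * d by auto
      then show ?thesis using 3 dt_nz(3) by blast
    next
      case 4 then show ?thesis using gp_dt[OF E] * by auto
    qed
  qed
qed

lemma gp_minus:
  assumes "gp (insert x E)" "x \<notin> E" shows "gp (insert (- x) E)" "- x \<notin> E"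
proof -
  have E: "gp E" using gp_subset[OF assms(1)] by auto
  have x: "x \<notin> D" using gp_disjoint[OF assms(1)] by auto
  show "gp (insert (- x) E)" "- x \<notin> E"
    by (rule gp_insertI[OF E]; use gp_cross[OF assms(1), of x] gp_dt[OF assms(1), of x] assms(2) x in auto)+
qed

text \<open>In general position a third point never lies on the line of the other two, so segments
  are automatically clear.\<close>

lemma gp_clr:
  assumes "gp E" "a \<in> E" "b \<in> E" "a \<noteq> b" "Q \<subseteq> (E \<union> D) - {a, b}"
  shows "clr Q a b b"
proof -
  have "clr {x} a b b" if "x \<in> Q" for x
    by (rule clr_dt, rule gp_dt2[OF assms(1)]) (use assms that in auto)
  then show ?thesis unfolding clr_def sep_def by blast
qed

lemma gp_clr_point: "gp E \<Longrightarrow> a \<in> E \<Longrightarrow> Q \<subseteq> (E \<union> D) - {a} \<Longrightarrow> clr Q a a a"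
proof -
  assume *: "gp E" "a \<in> E" "Q \<subseteq> (E \<union> D) - {a}"
  have "clr {x} a a a" if "x \<in> Q" for x using gp_cross[OF *(1,2), of x] * that by auto
  then show ?thesis unfolding clr_def sep_def by blast
qed

lemma gp_okT: "gp E \<Longrightarrow> T \<subseteq> E \<Longrightarrow> card T + k = m \<Longrightarrow> okT k T"
  unfolding okT_def using gp_adm gp_subset by blast

lemma eventually_cross: "tendsto x x0 F \<Longrightarrow> cross3 x0 y \<noteq> 0 \<Longrightarrow> eventually (\<lambda>t. cross3 (x t) y \<noteq> 0) F"
  using clr1_eventually[of y x0 x0 x0 x F x x "\<lambda>_. y"] by simp

lemma eventually_dt: "tendsto x x0 F \<Longrightarrow> dt x0 y z \<noteq> 0 \<Longrightarrow> eventually (\<lambda>t. dt (x t) y z \<noteq> 0) F"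
  using tendsto_dt[of x x0 F "\<lambda>_. y" y "\<lambda>_. z" z] tendsto_imp_eventually_ne by fastforce

text \<open>For \<open>v + t *\<^sub>R u\<close>, products and determinants that involve
  \<open>v\<close> are \<open>t\<close> times those of \<open>u\<close>, and all others are close to
  those of \<open>v\<close>.\<close>

lemma gp_shrink:
  assumes g: "gp (insert u (insert v T))" and n: "u \<noteq> v" "u \<notin> T" "v \<notin> T"
  shows "eventually (\<lambda>t. gp (insert (v + t *\<^sub>R u) (insert v T)) \<and> v + t *\<^sub>R u \<notin> insert v T) (at_right 0)"
proof -
  have E: "gp (insert v T)" using gp_subset[OF g] by auto
  have f: "finite (insert v T \<union> D)" using gp_finite[OF E] fin_D by auto
  have vD: "v \<notin> D" "u \<notin> D" using gp_disjoint[OF g] by auto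
  have "eventually (\<lambda>t. cross3 (v + t *\<^sub>R u) y \<noteq> 0) (at_right 0)" if y: "y \<in> insert v T \<union> D" for y
  proof (cases "y = v")
    case True
    show ?thesis using ev_pos
    proof eventually_elim
      case (elim t)
      then show ?case using gp_cross[OF g, of u v] n True by (simp add: cross_add_left cross_mult_left)
    qed
  next
    case False
    then show ?thesis using gp_cross[OF g, of v y] y by (intro eventually_cross[OF tendsto_perturb]) auto
  qed
  then have 1: "eventually (\<lambda>t. \<forall>y\<in>insert v T \<union> D. cross3 (v + t *\<^sub>R u) y \<noteq> 0) (at_right 0)"
    using f by (intro eventually_ball_finite) auto
  have "eventually (\<lambda>t. y \<noteq> z \<longrightarrow> dt (v + t *\<^sub>R u) y z \<noteq> 0) (at_right 0)" if yz: "y \<in> insert v T \<union> D" "z \<in> insert v T \<union> D" for y z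
  proof (cases "y = z")
    case False
    consider "y = v" | "z = v" | "y \<noteq> v" "z \<noteq> v" by auto
    then show ?thesis
    proof cases
      case 1
      then have "dt u v z \<noteq> 0" using gp_dt[OF g, of u v z] yz n False vD by auto
      then show ?thesis using 1 ev_pos by (auto elim: eventually_mono)
    next
      case 2
      then have "dt u y v \<noteq> 0" using gp_dt[OF g, of u y v] yz n False vD by auto
      then show ?thesis using 2 ev_pos by (auto elim: eventually_mono)
    next
      case 3
      have "dt v y z \<noteq> 0" using gp_dt[OF g, of v y z] yz 3 False by auto
      from eventually_dt[OF tendsto_perturb[of v u] this] show ?thesis by (rule eventually_mono) simp
    qed
  qed simp
  then have 2: "eventually (\<lambda>t. \<forall>y\<in>insert v T \<union> D. \<forall>z\<in>insert v T \<union> D. y \<noteq> z \<longrightarrow> dt (v + t *\<^sub>R u) y z \<noteq> 0) (at_right 0)"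
    using f by (intro eventually_ball_finite ballI) auto
  show ?thesis using 1 2
  proof eventually_elim
    case (elim t)
    show ?case using gp_insertI(1,2)[OF E elim(1)[rule_format] elim(2)[rule_format]] by simp
  qed
qed

text \<open>Moving \<open>w\<close> along its own segment towards \<open>v\<close> conjugates both
  half twists by the same element. Relations between them may thus be verified for short
  segments.\<close>

lemma Y_shrink:
  assumes T: "okT 3 T" and g: "gp (insert u (insert v (insert w T)))" and n: "distinct [u, v, w]" "u \<notin> T" "v \<notin> T" "w \<notin> T"
    and s: "s \<noteq> 0" and t: "0 < t"
  shows "Y (insert w T) u v s + mv (insert u (insert v T)) w (v + t *\<^sub>R w) = mv (insert u (insert v T)) w (v + t *\<^sub>R w) + Y (insert (v + t *\<^sub>R w) T) u v s"
    "Y (insert u T) v w s + mv (insert u (insert v T)) w (v + t *\<^sub>R w) = mv (insert u (insert v T)) w (v + t *\<^sub>R w) + Y (insert u T) v (v + t *\<^sub>R w) s"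
proof -
  let ?w = "v + t *\<^sub>R w"
  have D: "u \<notin> D" "v \<notin> D" "w \<notin> D" using gp_disjoint[OF g] by auto
  have m: "?w \<in> cone3 v w w" by (rule cone3_2I[of 1 t]) (use t in auto)
  have cvw: "clr (insert u T \<union> D) v w w" by (rule gp_clr[OF g]) (use n D in auto)
  have cuv: "clr (T \<union> D) u v v" by (rule gp_clr[OF g]) (use n D in auto)
  have c3: "clr (insert u T \<union> D) w ?w v" by (rule clr_mono[OF cvw]) (use m in auto)
  have c3': "clr (T \<union> D) w ?w ?w" by (rule clr_mono[OF clr_subset[OF cvw]]) (use m in auto)
  have nd: "dt w u v \<noteq> 0" using gp_dt[OF g, of w u v] n by auto
  have x: "cross3 u v \<noteq> 0" "cross3 w v \<noteq> 0" using gp_cross[OF g] n by auto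
  have "dt w u v * dt ?w u v = t * (dt w u v * dt w u v)" by simp
  then have "dt w u v * dt ?w u v > 0" using nd t by (metis mult_pos_pos not_real_square_gt_zero)
  then have "dj u v w ?w" unfolding dj_commute[of u v] by (rule dj_side)
  then show "Y (insert w T) u v s + mv (insert u (insert v T)) w ?w = mv (insert u (insert v T)) w ?w + Y (insert ?w T) u v s"
    by (intro Y_move[OF T cuv c3' x(1) s])
  have Tu: "okT 2 (insert u T)" by (rule okT_insert2[OF T cuv])
  have c1: "clr (insert u T \<union> D) w v v" "clr (insert u T \<union> D) ?w v v" by (rule clr_mono[OF c3]; simp)+
  have x': "cross3 ?w v \<noteq> 0" using x t by (simp add: cross_add_left cross_mult_left)
  have "s * dt ?w v (s *\<^sub>R cross3 w v) = t * (s * dt w v (s *\<^sub>R cross3 w v))" by simp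
  then have "s * dt ?w v (s *\<^sub>R cross3 w v) > 0" using dt_cross_pos[OF x(2) s] t by (metis mult_pos_pos)
  from Y_slide[OF Tu c3 dt_cross_pos[OF x(2) s] this]
  have "Y (insert u T) w v s + mv (insert v (insert u T)) w ?w = mv (insert v (insert u T)) w ?w + Y (insert u T) ?w v s" .
  then show "Y (insert u T) v w s + mv (insert u (insert v T)) w ?w = mv (insert u (insert v T)) w ?w + Y (insert u T) v ?w s"
    unfolding Y_swap(1)[OF Tu c1(1) x(2) s, symmetric] Y_swap(1)[OF Tu c1(2) x' s, symmetric] by (simp add: insert_commute)
qed

text \<open>Once \<open>w\<close> is close to \<open>v\<close>, the special position of
  \<open>Y_braid\<close> is available for one sense of rotation. For the other sense the relation is
  inverted.\<close>

lemma braid_relation: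
  assumes T: "okT 3 T" and g: "gp (insert u (insert v (insert w T)))" and n: "distinct [u, v, w]" "u \<notin> T" "v \<notin> T" "w \<notin> T"
    and s: "s \<noteq> 0"
  shows "Y (insert w T) u v s + Y (insert u T) v w s + Y (insert w T) u v s =
    Y (insert u T) v w s + Y (insert w T) u v s + Y (insert u T) v w s"
proof -
  have D: "u \<notin> D" "v \<notin> D" "w \<notin> D" using gp_disjoint[OF g] by auto
  have c: "clr (T \<union> D) u v v" "clr (insert w T \<union> D) u v v" "clr (insert u T \<union> D) v w w" "clr (T \<union> D) v w w"
    by (rule gp_clr[OF g]; use n D in auto)+
  have x: "cross3 u v \<noteq> 0" "cross3 v w \<noteq> 0" using gp_cross[OF g] n by auto
  have nd: "dt u v w \<noteq> 0" using gp_dt[OF g, of u v w] n by auto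
  have main: "Y (insert w T) u v s + Y (insert u T) v w s + Y (insert w T) u v s =
    Y (insert u T) v w s + Y (insert w T) u v s + Y (insert u T) v w s" if s: "s * dt u v w < 0" for s
  proof -
    \<comment> \<open>\<open>?z t\<close> is the solution \<open>z2\<close> of
      \<open>v = (2 * t) *\<^sub>R u + (2 * t) *\<^sub>R ?w t + z2\<close>, as
      \<open>Y_braid\<close> requires for \<open>r = t\<close>. It tends to \<open>v\<close>, so the
      triangle tends to the clear segment from \<open>u\<close> to \<open>v\<close>.\<close>
    let ?w = "\<lambda>t::real. v + t *\<^sub>R w" let ?z = "\<lambda>t. v + t *\<^sub>R ((- 2) *\<^sub>R (u + v) + (- 2 * t) *\<^sub>R w)"
    have s0: "s \<noteq> 0" using s by auto
    have "tendsto ?z v (at_right 0)"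
      by (rule tendsto_eq_intros refl tendsto_ident_at | simp)+
    then have "eventually (\<lambda>t. clr (T \<union> D) u (?w t) (?z t)) (at_right 0)"
      by (rule clr_eventually[OF finite_okT[OF T] c(1) tendsto_const tendsto_perturb])
    with ev_pos have "eventually (\<lambda>t. clr (T \<union> D) u (?w t) (?z t) \<and> t > 0) (at_right 0)" by eventually_elim blast
    from ex_right[OF this] obtain t where t: "clr (T \<union> D) u (?w t) (?z t)" "t > 0" by blast
    have "dt u (?w t) (?z t) = - t * dt u v w"
      by (simp add: dt_swap(2)[of u w v] algebra_simps)
    then have "s * dt u (?w t) (?z t) = t * (- (s * dt u v w))" by simp
    then have "s * dt u (?w t) (?z t) > 0" using s t(2) by (metis mult_pos_pos neg_0_less_iff_less)
    note b = Y_braid[OF T t(2) this t(1), of v]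
    show ?thesis
      by (rule braid_conj[OF Y_shrink[OF T g n s0 t(2)] b]) (simp add: algebra_simps)
  qed
  show ?thesis
  proof (cases "s * dt u v w < 0")
    case False
    then have "- s * dt u v w < 0" using nd s by (auto simp: not_less le_less)
    note m = main[OF this]
    have Y: "Y (insert w T) u v (- s) = - Y (insert w T) u v s" "Y (insert u T) v w (- s) = - Y (insert u T) v w s"
      by (rule Y_swap(2)[OF okT_insert2[OF T c(4)[THEN clr_edges(2)]] c(2) x(1) s] Y_swap(2)[OF okT_insert2[OF T c(1)] c(3) x(2) s])+
    let ?e = "Y (insert w T) u v s" and ?f = "Y (insert u T) v w s"
    have "- (?e + ?f + ?e) = - (?f + ?e + ?f)" using m unfolding Y by (simp add: minus_add add.assoc)
    then show ?thesis by (metis minus_minus)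
  qed (rule main)
qed

end

lemma commute_uminus: fixes e h :: "'g::group_add" assumes "e + h = h + e" shows "- e + h = h + - e"
proof -
  have "- e + h = - e + (h + e) + - e" by (simp only: add.assoc add.right_inverse add_0_right)
  then show ?thesis unfolding assms[symmetric] by (simp only: add.assoc[symmetric] add.left_inverse add_0_left)
qed

lemma commute_translate: fixes e f :: "'g::group_add" assumes "f = c + e" "c + e = e + c" shows "e + f = f + e"
  using assms by (metis add.assoc)

section \<open>Comparison of half twists along different segments\<close>

context moves begin

text \<open>The passage from adjacent segments to arbitrary ones is needed for two relations,
  conjugacy under \<open>H\<close> and equality; \<open>sw_rel\<close> treats them together.\<close>

definition adjrel :: "('g \<Rightarrow> 'g \<Rightarrow> bool) \<Rightarrow> bool" where
  "adjrel R \<longleftrightarrow> reflp R \<and> symp R \<and> transp R \<and>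
    (\<forall>T u v w s. okT 3 T \<longrightarrow> gp (insert u (insert v (insert w T))) \<longrightarrow> distinct [u, v, w] \<longrightarrow> u \<notin> T \<longrightarrow> v \<notin> T \<longrightarrow> w \<notin> T \<longrightarrow> s \<noteq> 0 \<longrightarrow>
       R (Y (insert w T) u v s) (Y (insert u T) v w s))"

definition sw :: "(real^3) set \<Rightarrow> real^3 \<Rightarrow> real^3 \<Rightarrow> real \<Rightarrow> 'g" where
  "sw S u v s = Y (S - {u, v}) u v s"

lemma card_minus3:
  assumes "finite S" "card S = m" "u \<in> S" "v \<in> S" "w \<in> S" "distinct [u, v, w]"
  shows "card (S - {u, v, w}) + 3 = m"
proof -
  have "card {u, v, w} = 3" using assms(6) by auto
  moreover have "card (S - {u, v, w}) = card S - card {u, v, w}" using assms by (intro card_Diff_subset) auto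
  moreover have "card {u, v, w} \<le> card S" using assms by (intro card_mono) auto
  ultimately show ?thesis using assms(2) by linarith
qed

lemma card_minus2:
  assumes "finite S" "card S = m" "u \<in> S" "v \<in> S" "u \<noteq> v"
  shows "card (S - {u, v}) + 2 = m"
proof -
  have "card {u, v} = 2" using assms(5) by auto
  moreover have "card (S - {u, v}) = card S - card {u, v}" using assms by (intro card_Diff_subset) auto
  moreover have "card {u, v} \<le> card S" using assms by (intro card_mono) auto
  ultimately show ?thesis using assms(2) by linarith
qed

lemma sw_pre:
  assumes g: "gp S" "card S = m" and uv: "u \<in> S" "v \<in> S" "u \<noteq> v"
  shows "okT 2 (S - {u, v})" "clr (S - {u, v} \<union> D) u v v" "cross3 u v \<noteq> 0"
proof -
  show "okT 2 (S - {u, v})" using card_minus2[OF gp_finite[OF g(1)] g(2) uv] by (intro gp_okT[OF g(1)]) auto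
  have "u \<notin> D" "v \<notin> D" using gp_disjoint[OF g(1)] uv by auto
  then show "clr (S - {u, v} \<union> D) u v v" by (intro gp_clr[OF g(1) uv]) auto
  show "cross3 u v \<noteq> 0" using gp_cross[OF g(1)] uv by auto
qed

lemma sw_sym:
  assumes "gp S" "card S = m" "u \<in> S" "v \<in> S" "u \<noteq> v" "s \<noteq> 0" shows "sw S v u s = sw S u v s"
  unfolding sw_def insert_commute[of v u] by (rule Y_swap(1)[OF sw_pre[OF assms(1-5)] assms(6)])

lemma sw_adj:
  assumes R: "adjrel R" and g: "gp S" "card S = m" and u: "u \<in> S" "v \<in> S" "w \<in> S" "distinct [u, v, w]" and s: "s \<noteq> 0"
  shows "R (sw S u v s) (sw S v w s)"
proof -
  let ?T = "S - {u, v, w}"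
  have T: "okT 3 ?T" using card_minus3[OF gp_finite[OF g(1)] g(2) u] by (intro gp_okT[OF g(1)]) auto
  have e: "insert u (insert v (insert w ?T)) = S" "S - {u, v} = insert w ?T" "S - {v, w} = insert u ?T" using u by auto
  have "R (Y (insert w ?T) u v s) (Y (insert u ?T) v w s)"
    using R T u g s e(1) unfolding adjrel_def by auto
  then show ?thesis unfolding sw_def e .
qed

text \<open>The half twist is passed around a projective line of tokens, from \<open>u v\<close> to
  \<open>v w\<close>, to \<open>w (- u)\<close> and to \<open>(- u) (- v)\<close>. Between these
  steps the resting token is replaced by its negative, which changes nothing. By
  \<open>Y_flip\<close> the final half twist is the original one with the opposite sense.\<close>

lemma sw_sign:
  assumes R: "adjrel R" and g: "gp S" "card S = m" and m: "m \<ge> 3" and u: "u \<in> S" "v \<in> S" "u \<noteq> v" and s: "s \<noteq> 0"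
  shows "R (sw S u v s) (sw S u v (- s))"
proof -
  have "card (S - {u, v}) > 0" using card_minus2[OF gp_finite[OF g(1)] g(2) u] m by linarith
  then obtain w where w: "w \<in> S" "w \<noteq> u" "w \<noteq> v" by (metis Diff_iff card_gt_0_iff ex_in_conv insertCI)
  let ?T = "S - {u, v, w}"
  have T: "okT 3 ?T" using card_minus3[OF gp_finite[OF g(1)] g(2) u(1,2) w(1)] w u by (intro gp_okT[OF g(1)]) auto
  have fT: "finite ?T" using gp_finite[OF g(1)] by simp
  have cT: "card ?T + 3 = m" using T unfolding okT_def by simp
  have S: "S = insert u (insert v (insert w ?T))" "S - {u, v} = insert w ?T" "S - {v, w} = insert u ?T" using u w by auto
  have g': "gp (insert u (insert v (insert w ?T)))" using g(1) S(1) by argo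
  have 1: "gp (insert (- u) (insert v (insert w ?T)))" "- u \<notin> insert v (insert w ?T)"
    using gp_minus[OF g'] u w by auto
  have gg1: "gp (insert v (insert (- u) (insert w ?T)))" using 1 by (simp add: insert_commute)
  have 2: "gp (insert (- v) (insert (- u) (insert w ?T)))" "- v \<notin> insert (- u) (insert w ?T)"
    using gp_minus[OF gg1] u w 1 by auto
  have rule: "R (Y (insert w T) u v s) (Y (insert u T) v w s)"
    if "okT 3 T" "gp (insert u (insert v (insert w T)))" "distinct [u, v, w]" "u \<notin> T" "v \<notin> T" "w \<notin> T" for T u v w
    using R that s unfolding adjrel_def by blast
  have r1: "R (Y (insert w ?T) u v s) (Y (insert u ?T) v w s)"
    by (rule rule[OF T g']) (use u w in auto)
  have r2: "R (Y (insert (- u) ?T) v w s) (Y (insert v ?T) w (- u) s)"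
    by (rule rule[OF T]) (use 1 u w in \<open>auto simp: insert_commute\<close>)
  have r3: "R (Y (insert (- v) ?T) w (- u) s) (Y (insert w ?T) (- u) (- v) s)"
    by (rule rule[OF T]) (use 2 1 u w in \<open>auto simp: insert_commute\<close>)
  have r4: "Y (insert w ?T) (- u) (- v) s = Y (insert w ?T) u v (- s)"
    using Y_flip[OF sw_pre[OF g u], of "- s"] s unfolding S(2) by simp
  have tr: "R a b \<Longrightarrow> R b c \<Longrightarrow> R a c" for a b c using R unfolding adjrel_def by (meson transpD)
  have "R (Y (insert w ?T) u v s) (Y (insert w ?T) u v (- s))"
    using tr[OF r1 tr[OF r2[unfolded Y_ctx_flip[of u ?T]] r3[unfolded Y_ctx_flip[of v ?T] r4]]] .
  then show ?thesis unfolding sw_def S(2) .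
qed

lemma sw_rel:
  assumes R: "adjrel R" and g: "gp S" "card S = m" and m: "m \<ge> 3" and u: "u \<in> S" "v \<in> S" "u \<noteq> v" and u': "u' \<in> S" "v' \<in> S" "u' \<noteq> v'"
    and s: "s \<noteq> 0" "s' \<noteq> 0"
  shows "R (sw S u v s) (sw S u' v' s')"
proof -
  have tr: "R a b \<Longrightarrow> R b c \<Longrightarrow> R a c" for a b c using R unfolding adjrel_def by (meson transpD)
  have rf: "R a a" for a using R unfolding adjrel_def by (meson reflpD)
  have share: "R (sw S a b s) (sw S b c s)" if "a \<in> S" "b \<in> S" "c \<in> S" "a \<noteq> b" "b \<noteq> c" for a b c
  proof (cases "a = c")
    case True then show ?thesis using sw_sym[OF g that(1,2,4) s(1)] rf by simp
  next
    case False then show ?thesis using sw_adj[OF R g that(1-3)] that s by auto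
  qed
  have "R (sw S u v s) (sw S u' v' s)"
  proof (cases "v = u'")
    case True then show ?thesis using share u u' by auto
  next
    case False
    then show ?thesis using share[of u v u'] share[of v u' v'] u u' tr by blast
  qed
  moreover have "R (sw S u' v' s) (sw S u' v' s')"
  proof (cases "s * s' > 0")
    case True
    then show ?thesis using Y_sign[OF sw_pre[OF g u']] rf unfolding sw_def by metis
  next
    case False
    then have "(- s) * s' > 0" using s by (simp add: mult_less_0_iff not_less le_less)
    then have "sw S u' v' (- s) = sw S u' v' s'" using Y_sign[OF sw_pre[OF g u']] unfolding sw_def by metis
    then show ?thesis using sw_sign[OF R g m u' s(1)] by simp
  qed
  ultimately show ?thesis by (rule tr)
qed

text \<open>The braid relation says \<open>f + (e + f) = (e + f) + e\<close>, so
  \<open>e + f\<close> conjugates \<open>e\<close> into \<open>f\<close>.\<close>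

lemma adjrel_conj: "adjrel (\<lambda>g h. \<exists>k\<in>H. h = k + g + - k)"
  unfolding adjrel_def
proof (intro conjI allI impI)
  show "reflp (\<lambda>g h. \<exists>k\<in>H. h = k + g + - k)"
    by (rule reflpI, rule bexI[of _ 0]) (simp_all add: H_zero)
  show "symp (\<lambda>g h. \<exists>k\<in>H. h = k + g + - k)"
  proof (rule sympI, elim bexE)
    fix g h k assume "k \<in> H" "h = k + g + - k"
    then have "g = - k + h + - (- k)" by (simp add: add.assoc)
    then show "\<exists>k\<in>H. g = k + h + - k" using H_minus[OF \<open>k \<in> H\<close>] by blast
  qed
  show "transp (\<lambda>g h. \<exists>k\<in>H. h = k + g + - k)"
  proof (rule transpI, elim bexE)
    fix g h i k l assume "k \<in> H" "h = k + g + - k" "l \<in> H" "i = l + h + - l"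
    then have "i = (l + k) + g + - (l + k)" by (simp add: add.assoc minus_add flip: add_uminus_conv_diff)
    then show "\<exists>k\<in>H. i = k + g + - k" using H_add \<open>k \<in> H\<close> \<open>l \<in> H\<close> by blast
  qed
  fix T u v w and s :: real
  assume *: "okT 3 T" "gp (insert u (insert v (insert w T)))" "distinct [u, v, w]" "u \<notin> T" "v \<notin> T" "w \<notin> T" "s \<noteq> 0"
  let ?e = "Y (insert w T) u v s" and ?f = "Y (insert u T) v w s"
  have "?f + (?e + ?f) = (?e + ?f) + ?e" using braid_relation[OF *] by (simp only: add.assoc)
  then have "?f = (?e + ?f) + ?e + - (?e + ?f)" by (rule add_conj)
  then show "\<exists>k\<in>H. ?f = k + ?e + - k" using H_add Y_H by blast
qed

lemma adjrel_eqI: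
  assumes "\<And>T u v w s. okT 3 T \<Longrightarrow> gp (insert u (insert v (insert w T))) \<Longrightarrow> distinct [u, v, w] \<Longrightarrow> u \<notin> T \<Longrightarrow> v \<notin> T \<Longrightarrow> w \<notin> T \<Longrightarrow> s \<noteq> 0 \<Longrightarrow>
     Y (insert w T) u v s + Y (insert u T) v w s = Y (insert u T) v w s + Y (insert w T) u v s"
  shows "adjrel (=)"
  unfolding adjrel_def
proof (intro conjI allI impI)
  fix T u v w and s :: real
  assume *: "okT 3 T" "gp (insert u (insert v (insert w T)))" "distinct [u, v, w]" "u \<notin> T" "v \<notin> T" "w \<notin> T" "s \<noteq> 0"
  let ?e = "Y (insert w T) u v s" and ?f = "Y (insert u T) v w s"
  have "(?f + ?e) + ?e = (?f + ?e) + ?f" using braid_relation[OF *] unfolding assms[OF *] .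
  then show "?e = ?f" by (rule add_left_imp_eq)
qed (auto intro: reflpI sympI transpI)

text \<open>Since \<open>f\<close> is \<open>e\<close> conjugated by \<open>e + f\<close>, it equals
  \<open>c + e\<close> for the commutator \<open>c\<close> of \<open>e + f\<close> and
  \<open>e\<close>. As \<open>c\<close> is central, \<open>e\<close> and \<open>f\<close>
  commute.\<close>

lemma adjrel_nil:
  assumes "\<And>a b c. a \<in> H \<Longrightarrow> b \<in> H \<Longrightarrow> c \<in> H \<Longrightarrow> (a + b + - a + - b) + c = c + (a + b + - a + - b)"
  shows "adjrel (=)"
proof (rule adjrel_eqI)
  fix T u v w and s :: real
  assume *: "okT 3 T" "gp (insert u (insert v (insert w T)))" "distinct [u, v, w]" "u \<notin> T" "v \<notin> T" "w \<notin> T" "s \<noteq> 0"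
  let ?e = "Y (insert w T) u v s" and ?f = "Y (insert u T) v w s" let ?p = "?e + ?f" let ?c = "?p + ?e + - ?p + - ?e"
  have "?f + ?p = ?p + ?e" using braid_relation[OF *] by (simp only: add.assoc)
  then have f: "?f = ?p + ?e + - ?p" by (rule add_conj)
  have fc: "?f = ?c + ?e" using f by (metis add.assoc add.left_inverse add_0_right)
  have "?c + ?e = ?e + ?c" using assms[OF H_add[OF Y_H Y_H] Y_H Y_H] .
  then show "?e + ?f = ?f + ?e" using commute_translate[OF fc] by simp
qed

text \<open>The half twist along \<open>p q\<close> is carried past each of the three moves that
  make up the half twist along \<open>u v\<close>.\<close>

lemma Y_comm:
  assumes T: "okT 4 T" and c: "clr (T \<union> D) u v v" "clr (T \<union> D) p q q" and x: "cross3 u v \<noteq> 0" "cross3 p q \<noteq> 0" and d: "dj u v p q" and s: "s \<noteq> 0"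
  shows "Y (insert p (insert q T)) u v s + Y (insert u (insert v T)) p q s = Y (insert u (insert v T)) p q s + Y (insert p (insert q T)) u v s"
proof -
  have T3: "okT 3 (insert a T)" if "clr (T \<union> D) a a a" for a
    using okT_insert[of 3 T a a a] T that by (simp add: numeral_eq_Suc)
  have cp: "clr {p} u v v" "clr {q} u v v" using d by (simp_all add: dj_def clr_def sep_def)
  have Tq: "okT 3 (insert q T)" by (rule T3, rule clr_edges[OF c(2)])
  have "okT 2 (insert p (insert q T))"
    by (rule okT_insert2[OF Tq, of p p p]) (use x c in \<open>auto intro: clr_edges\<close>)
  moreover have "clr (insert p (insert q T) \<union> D) u v v" using cp c by simp
  ultimately have ev: "eventually (\<lambda>t. clr (insert p (insert q T) \<union> D) u v (u + t *\<^sub>R (s *\<^sub>R cross3 u v)) \<and> s * dt u v (u + t *\<^sub>R (s *\<^sub>R cross3 u v)) > 0 \<and>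
      Y (insert p (insert q T)) u v s = ht (insert p (insert q T)) u v (u + t *\<^sub>R (s *\<^sub>R cross3 u v))) (at_right 0)"
    by (rule Y_near[OF _ _ cone3_vertex(1) dt_cross_pos[OF x(1) s]])
  have s0: "sep (cone3 u v u) (cone3 p q q)" using d cone3_perm(4)[of u v] unfolding dj_def by metis
  have "eventually (\<lambda>t. sep (cone3 u v (u + t *\<^sub>R (s *\<^sub>R cross3 u v))) (cone3 p q q)) (at_right 0)"
    by (rule sep_eventually[OF s0 tendsto_const tendsto_const tendsto_perturb tendsto_const tendsto_const tendsto_const])
  from ex_right[OF eventually_conj[OF ev this]] obtain z where
    z: "clr (insert p (insert q T) \<union> D) u v z" "s * dt u v z > 0" "Y (insert p (insert q T)) u v s = ht (insert p (insert q T)) u v z"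
      "sep (cone3 u v z) (cone3 p q q)" by blast
  have cz: "clr (T \<union> D) u v z" using z(1) by simp
  have dz: "dt u v z \<noteq> 0" using z(2) by auto
  have mvc: "Y (insert a (insert b T)) p q s + mv (insert b (insert p (insert q T))) a a' = mv (insert b (insert p (insert q T))) a a' + Y (insert a' (insert b T)) p q s"
    if m: "a \<in> cone3 u v z" "a' \<in> cone3 u v z" "b \<in> cone3 u v z" and n: "dt b a a' \<noteq> 0" for a a' b
  proof -
    have sep': "clr {b} p q q" using z(4) m(3) unfolding clr_def sep_def by (metis cross3_commute_0 singletonD)
    have "Y (insert a (insert b T)) p q s + mv (insert p (insert q (insert b T))) a a' = mv (insert p (insert q (insert b T))) a a' + Y (insert a' (insert b T)) p q s"
    proof (rule Y_move[OF T3 _ _ x(2) s])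
      show "clr (T \<union> D) b b b" by (rule clr_mono[OF cz m(3) m(3) m(3)])
      show "clr (insert b T \<union> D) p q q" using sep' c by simp
      show "clr (insert b T \<union> D) a a' a'" using clr_mono[OF cz m(1,2,2)] clr_dt[OF n] by simp
      show "dj p q a a'" unfolding dj_commute[of p q] by (rule sep_cone3_mono[OF z(4)]) (use m in simp_all)
    qed
    moreover have "insert p (insert q (insert b T)) = insert b (insert p (insert q T))" by auto
    ultimately show ?thesis by simp
  qed
  let ?h = "\<lambda>a b. Y (insert a (insert b T)) p q s"
  let ?P = "insert p (insert q T)"
  have 1: "?h u v + mv (insert v ?P) u z = mv (insert v ?P) u z + ?h z v"
    by (rule mvc) (use dt_nz[OF dz] in simp_all)
  have 2: "?h v z + mv (insert z ?P) v u = mv (insert z ?P) v u + ?h u z"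
    by (rule mvc) (use dt_nz[OF dz] in simp_all)
  have 3: "?h z u + mv (insert u ?P) z v = mv (insert u ?P) z v + ?h v u"
    by (rule mvc) (use dt_nz[OF dz] in simp_all)
  have h: "?h z v = ?h v z" "?h u z = ?h z u" "?h v u = ?h u v" by (simp_all add: insert_commute)
  have "?h u v + (mv (insert v ?P) u z + mv (insert z ?P) v u + mv (insert u ?P) z v) = mv (insert v ?P) u z + (?h v z + mv (insert z ?P) v u) + mv (insert u ?P) z v"
    using 1 h by (simp only: add.assoc[symmetric])
  also have "\<dots> = mv (insert v ?P) u z + mv (insert z ?P) v u + (?h z u + mv (insert u ?P) z v)"
    unfolding 2 h(2) by (simp only: add.assoc)
  also have "\<dots> = (mv (insert v ?P) u z + mv (insert z ?P) v u + mv (insert u ?P) z v) + ?h u v"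
    unfolding 3 h(3) by (simp only: add.assoc)
  finally show ?thesis unfolding z(3) ht_def by simp
qed

text \<open>Tokens \<open>p\<close> and \<open>q\<close> other than \<open>u\<close>,
  \<open>v\<close>, \<open>w\<close> exist because \<open>m \<ge> 5\<close>. Commutation is
  invariant under the common conjugation of \<open>Y_shrink\<close>, so \<open>u\<close> and
  \<open>w\<close> are first drawn so close to \<open>v\<close> that the triangle of
  \<open>u'\<close>, \<open>v\<close>, \<open>w'\<close> misses the segment from \<open>p\<close> to
  \<open>q\<close>.\<close>

lemma adjrel_met:
  assumes m: "m \<ge> 5"
    and met: "\<And>a b c d. a \<in> H \<Longrightarrow> b \<in> H \<Longrightarrow> c \<in> H \<Longrightarrow> d \<in> H \<Longrightarrow>
      (a + b + - a + - b) + (c + d + - c + - d) = (c + d + - c + - d) + (a + b + - a + - b)"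
  shows "adjrel (=)"
proof (rule adjrel_eqI)
  fix T u v w and s :: real
  assume T: "okT 3 T" and g: "gp (insert u (insert v (insert w T)))" and n: "distinct [u, v, w]" "u \<notin> T" "v \<notin> T" "w \<notin> T" and s: "s \<noteq> 0"
  have cT: "card T + 3 = m" "finite T" using T unfolding okT_def adm_def by auto
  have "card T \<ge> 2" using cT m by linarith
  then obtain p q where pq: "p \<in> T" "q \<in> T" "p \<noteq> q" by (meson card_2_iff' obtain_subset_with_card_n subsetD)
  define T5 where "T5 = T - {p, q}"
  have TT: "T = insert p (insert q T5)" "p \<notin> T5" "q \<notin> T5" unfolding T5_def using pq by auto
  have D: "u \<notin> D" "v \<notin> D" "w \<notin> D" using gp_disjoint[OF g] by auto
  have g1: "gp (insert w (insert v (insert u T)))" using g by (simp add: insert_commute)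
  have g2: "gp (insert u (insert v (insert w T)))" by (rule g)
  have n1: "distinct [w, v, u]" using n by auto
  have cpq: "clr {v} p q q" by (rule gp_clr[OF g]) (use pq n in auto)
  have "dj v v p q" using cpq unfolding clr_singleton dj_def by (simp add: sep_commute)
  then have "eventually (\<lambda>t. dj (v + t *\<^sub>R u) v p q) (at_right 0)"
    by (rule dj_eventually[OF _ tendsto_perturb tendsto_const tendsto_const tendsto_const])
  moreover have "eventually (\<lambda>t. gp (insert (v + t *\<^sub>R u) (insert v (insert w T))) \<and> v + t *\<^sub>R u \<notin> insert v (insert w T)) (at_right 0)"
    by (rule gp_shrink[OF g2]) (use n in auto)
  ultimately have "eventually (\<lambda>t. dj (v + t *\<^sub>R u) v p q \<and> gp (insert (v + t *\<^sub>R u) (insert v (insert w T))) \<and> v + t *\<^sub>R u \<notin> insert v (insert w T) \<and> 0 < t) (at_right 0)"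
    using ev_pos by eventually_elim blast
  from ex_right[OF this] obtain t where t: "dj (v + t *\<^sub>R u) v p q" "gp (insert (v + t *\<^sub>R u) (insert v (insert w T)))" "v + t *\<^sub>R u \<notin> insert v (insert w T)" "0 < t" by blast
  define u' where "u' = v + t *\<^sub>R u"
  note t = t[folded u'_def]
  have t2: "gp (insert w (insert v (insert u' T)))" using t(2) by (simp add: insert_commute)
  have "sep (cone3 u' v v) (cone3 p q q)" using t(1) by (simp add: dj_def)
  then have "eventually (\<lambda>r. sep (cone3 u' v (v + r *\<^sub>R w)) (cone3 p q q)) (at_right 0)"
    by (rule sep_eventually[OF _ tendsto_const tendsto_const tendsto_perturb tendsto_const tendsto_const tendsto_const])
  moreover have "eventually (\<lambda>r. gp (insert (v + r *\<^sub>R w) (insert v (insert u' T))) \<and> v + r *\<^sub>R w \<notin> insert v (insert u' T)) (at_right 0)"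
    by (rule gp_shrink[OF t2]) (use n t in auto)
  ultimately have "eventually (\<lambda>r. sep (cone3 u' v (v + r *\<^sub>R w)) (cone3 p q q) \<and> gp (insert (v + r *\<^sub>R w) (insert v (insert u' T))) \<and> v + r *\<^sub>R w \<notin> insert v (insert u' T) \<and> 0 < r) (at_right 0)"
    using ev_pos by eventually_elim blast
  from ex_right[OF this] obtain r where r: "sep (cone3 u' v (v + r *\<^sub>R w)) (cone3 p q q)" "gp (insert (v + r *\<^sub>R w) (insert v (insert u' T)))" "v + r *\<^sub>R w \<notin> insert v (insert u' T)" "0 < r" by blast
  define w' where "w' = v + r *\<^sub>R w"
  note r = r[folded w'_def]
  define S where "S = insert w' (insert v (insert u' T))"
  have nS: "distinct [u', v, w']" "u' \<notin> T" "w' \<notin> T" "p \<noteq> u'" "q \<noteq> u'" "p \<noteq> w'" "q \<noteq> w'" "p \<noteq> v" "q \<noteq> v" using t r n pq by auto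
  have gS: "gp S" "card S = m" unfolding S_def using r(2) nS n cT by auto
  define e f h where "e = Y (insert w' T) u' v s" and "f = Y (insert u' T) v w' s" and "h = Y (S - {p, q}) p q s"
  have eS: "S - {u', v} = insert w' T" "S - {v, w'} = insert u' T" "S - {p, q} = insert u' (insert v (insert w' T5))"
    unfolding S_def T5_def using nS n pq by auto
  have T4: "okT 4 (insert w' T5)" "okT 4 (insert u' T5)"
  proof -
    have "finite T5" unfolding T5_def using cT by simp
    moreover from this have "card T = Suc (Suc (card T5))" unfolding TT(1) using TT(2,3) pq(3) by simp
    ultimately have "finite T5" "card T5 + 5 = m" using cT by auto
    then have "card (insert w' T5) + 4 = m" "card (insert u' T5) + 4 = m" using nS TT by auto
    moreover have "insert w' T5 \<subseteq> S" "insert u' T5 \<subseteq> S" unfolding S_def T5_def by auto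
    ultimately show "okT 4 (insert w' T5)" "okT 4 (insert u' T5)" using gp_okT[OF gS(1)] by blast+
  qed
  have DS: "x \<notin> D" if "x \<in> S" for x using gp_disjoint[OF gS(1) that] .
  have inS: "u' \<in> S" "v \<in> S" "w' \<in> S" "p \<in> S" "q \<in> S" "T5 \<subseteq> S" unfolding S_def using TT by auto
  have cl: "clr (insert w' T5 \<union> D) u' v v" "clr (insert w' T5 \<union> D) p q q" "clr (insert u' T5 \<union> D) v w' w'" "clr (insert u' T5 \<union> D) p q q"
    by (rule gp_clr[OF gS(1)]; use inS nS n TT DS pq in auto)+
  have x: "cross3 u' v \<noteq> 0" "cross3 p q \<noteq> 0" "cross3 v w' \<noteq> 0" using gp_cross[OF gS(1)] inS nS pq by auto
  have eh: "e + h = h + e"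
    using Y_comm[OF T4(1) cl(1,2) x(1,2) sep_cone3_mono[OF r(1)] s] unfolding e_def h_def eS
    by (simp add: TT insert_commute)
  have fh: "f + h = h + f"
    using Y_comm[OF T4(2) cl(3,4) x(3,2) sep_cone3_mono[OF r(1)] s] unfolding f_def h_def eS
    by (simp add: TT insert_commute)
  have m3: "m \<ge> 3" using m by simp
  \<comment> \<open>Conjugacy under \<open>H\<close> is itself an instance of \<open>adjrel\<close>,
    so \<open>sw_rel\<close> makes \<open>h\<close> conjugate to \<open>e\<close> and to
    \<open>f\<close> although the segment of \<open>h\<close> shares no token with theirs.\<close>
  have "\<exists>k\<in>H. h = k + e + - k" "\<exists>k\<in>H. h = k + f + - k"
    using sw_rel[OF adjrel_conj gS m3, of u' v p q s s] sw_rel[OF adjrel_conj gS m3, of v w' p q s s] inS nS pq s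
    unfolding sw_def eS(1,2) e_def f_def h_def by auto
  then obtain k l where kl: "k \<in> H" "h = k + e + - k" "l \<in> H" "h = l + f + - l" by blast
  have "(h + - e) + (h + - f) = (h + - f) + (h + - e)"
    using met[OF kl(1) Y_H[of "insert w' T" u' v s] kl(3) Y_H[of "insert u' T" v w' s], folded e_def f_def] kl(2,4) by metis
  moreover have "(h + - e) + (h + - f) = h + h + (- e + - f)" "(h + - f) + (h + - e) = h + h + (- f + - e)"
    using commute_uminus[OF eh] commute_uminus[OF fh] by (metis add.assoc)+
  ultimately have "- e + - f = - f + - e" by (metis add_left_cancel)
  then have ef: "f + e = e + f" by (metis minus_add minus_minus)
  note k1 = Y_shrink[OF T g1 n1 n(4,3,2) s t(4), folded u'_def]
  have T2: "okT 2 (insert w T)" "okT 2 (insert u T)" "okT 2 (insert u' T)"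
    by (rule okT_insert2[OF T gp_clr_point[OF g2]] okT_insert2[OF T gp_clr_point[OF t(2)]]; use n t gp_disjoint[OF g] gp_disjoint[OF t(2)] in auto)+
  have sy: "Y (insert u T) w v s = Y (insert u T) v w s" "Y (insert u' T) w v s = Y (insert u' T) v w s"
    "Y (insert w T) v u s = Y (insert w T) u v s" "Y (insert w T) v u' s = Y (insert w T) u' v s"
    by (rule Y_swap(1)[OF T2(2) gp_clr[OF g2] gp_cross[OF g2] s] Y_swap(1)[OF T2(3) gp_clr[OF t(2)] gp_cross[OF t(2)] s]
        Y_swap(1)[OF T2(1) gp_clr[OF g2] gp_cross[OF g2] s] Y_swap(1)[OF T2(1) gp_clr[OF t(2)] gp_cross[OF t(2)] s];
       use n t D gp_disjoint[OF t(2)] in auto)+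
  note k1 = k1[unfolded sy]
  have k2': "Y (insert w T) u' v s + mv (insert u' (insert v T)) w w' = mv (insert u' (insert v T)) w w' + e"
    "Y (insert u' T) v w s + mv (insert u' (insert v T)) w w' = mv (insert u' (insert v T)) w w' + f"
    unfolding e_def f_def w'_def by (rule Y_shrink[OF T t(2) _ _ _ _ s r(4)]; use n t in auto)+
  have "Y (insert w T) u' v s + Y (insert u' T) v w s = Y (insert u' T) v w s + Y (insert w T) u' v s"
    unfolding add_conj[OF k2'(1)] add_conj[OF k2'(2)] conj_add ef ..
  then show "Y (insert w T) u v s + Y (insert u T) v w s = Y (insert u T) v w s + Y (insert w T) u v s"
    unfolding add_conj[OF k1(1)] add_conj[OF k1(2)] conj_add by simp
qed

end

section \<open>Generic points and chains of moves\<close>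

lemma ev_linear: assumes "c \<noteq> 0" shows "eventually (\<lambda>t. d + t * c \<noteq> (0::real)) (at_right 0)"
proof (cases "d = 0")
  case True then show ?thesis using assms ev_pos by (auto elim: eventually_mono)
next
  case False
  have "tendsto (\<lambda>t. d + t * c) d (at_right 0)" by (rule tendsto_eq_intros refl tendsto_ident_at | simp)+
  from tendsto_imp_eventually_ne[OF this False] show ?thesis .
qed

text \<open>A finite union of planes through the origin has measure zero, and a nonempty open set
  has not.\<close>

lemma hyperplane_avoid:
  assumes "finite N" "0 \<notin> N" "open U" "U \<noteq> {}"
  shows "\<exists>x\<in>U. \<forall>n\<in>N. inner n (x::real^3) \<noteq> 0"
proof -
  have "negligible (\<Union>n\<in>N. {x. inner n x = 0})"
    using assms(1,2) by (intro negligible_Union finite_imageI) (auto intro!: negligible_hyperplane)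
  moreover have "\<not> negligible U" using open_not_negligible[OF assms(3,4)] .
  ultimately have "\<not> U \<subseteq> (\<Union>n\<in>N. {x. inner n x = 0})" using negligible_subset by blast
  then show ?thesis by blast
qed

context moves begin

lemma sw_neg:
  assumes "gp S" "card S = m" "u \<in> S" "v \<in> S" "u \<noteq> v" "s \<noteq> 0" shows "sw S u v (- s) = - sw S u v s"
  unfolding sw_def by (rule Y_swap(2)[OF sw_pre[OF assms(1-5)] assms(6)])

text \<open>The bad positions of \<open>x\<close> are covered by finitely many planes: those spanned
  by two of the given points, and for each point some plane containing it.\<close>

lemma gp_normals:
  assumes g: "gp E" 
  obtains N where "finite N" "0 \<notin> N" "\<And>x. (\<forall>n\<in>N. inner n x \<noteq> 0) \<Longrightarrow> gp (insert x E) \<and> x \<notin> E \<and> x \<notin> D"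
proof -
  have fin: "finite (E \<union> D)" using gp_finite[OF g] fin_D by simp
  have c: "cross3 y z \<noteq> 0" if "y \<in> E \<union> D" "z \<in> E \<union> D" "y \<noteq> z" for y z
    using that gp_cross[OF g, of y z] gp_cross[OF g, of z y] D_cross[of y z] cross3_commute_0 by blast
  have "\<exists>n. n \<noteq> 0 \<and> inner n y = 0" for y :: "real^3"
    using orthogonal_to_vector_exists[of y] by (auto simp: orthogonal_def inner_commute)
  then obtain f where f: "\<And>y::real^3. f y \<noteq> 0" "\<And>y. inner (f y) y = 0" by metis
  let ?N = "f ` (E \<union> D) \<union> (\<lambda>(y, z). cross3 y z) ` {p \<in> (E \<union> D) \<times> (E \<union> D). fst p \<noteq> snd p}"
  show thesis
  proof
    show "finite ?N" using fin by simp
    show "0 \<notin> ?N" using f(1) c by (auto simp: image_iff)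
    fix x assume x: "\<forall>n\<in>?N. inner n x \<noteq> 0"
    have 1: "cross3 x y \<noteq> 0" if y: "y \<in> E \<union> D" for y
    proof
      assume "cross3 x y = 0"
      moreover have "y \<noteq> 0" using gp_cross[OF g, of y] y zero_D D_nonempty by (metis UnCI UnE cross_zero_left all_not_in_conv gp_disjoint[OF g])
      ultimately obtain k where "x = k *\<^sub>R y" by (auto simp: cross3_eq_0_iff)
      then have "inner (f y) x = 0" using f(2) by simp
      then show False using x y by blast
    qed
    have 2: "dt x y z \<noteq> 0" if "y \<in> E \<union> D" "z \<in> E \<union> D" "y \<noteq> z" for y z
    proof -
      have "cross3 y z \<in> ?N" using that by force
      then show ?thesis using x by (auto simp: dt_def inner_commute)
    qed
    show "gp (insert x E) \<and> x \<notin> E \<and> x \<notin> D" using gp_insertI[OF g 1 2] by blast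
  qed
qed

lemma gp_generic:
  assumes F: "finite F" "\<And>E. E \<in> F \<Longrightarrow> gp E" and U: "open U" "U \<noteq> {}"
  shows "\<exists>x\<in>U. \<forall>E\<in>F. gp (insert x E) \<and> x \<notin> E"
proof -
  have "\<forall>E\<in>F. \<exists>N. finite N \<and> 0 \<notin> N \<and> (\<forall>x. (\<forall>n\<in>N. inner n x \<noteq> 0) \<longrightarrow> gp (insert x E) \<and> x \<notin> E)"
    using gp_normals F(2) by metis
  then obtain N where N: "\<And>E. E \<in> F \<Longrightarrow> finite (N E) \<and> 0 \<notin> N E \<and> (\<forall>x. (\<forall>n\<in>N E. inner n x \<noteq> 0) \<longrightarrow> gp (insert x E) \<and> x \<notin> E)"
    by metis
  have "\<exists>x\<in>U. \<forall>n\<in>(\<Union>E\<in>F. N E). inner n x \<noteq> 0"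
    by (rule hyperplane_avoid[OF _ _ U]) (use F N in auto)
  then show ?thesis using N by blast
qed

text \<open>\<open>chain_flip\<close> changes the vector that represents a token and contributes
  nothing to the group element. \<open>chain_move\<close> asks for general position of the old and
  the new place of the token together.\<close>

inductive chain :: "(real^3) set \<Rightarrow> 'g \<Rightarrow> (real^3) set \<Rightarrow> bool" for S where
  chain_refl: "gp S \<Longrightarrow> card S = m \<Longrightarrow> chain S 0 S"
| chain_move: "chain S g S' \<Longrightarrow> x \<in> S' \<Longrightarrow> x' \<notin> S' \<Longrightarrow> gp (insert x' S') \<Longrightarrow>
    chain S (g + mv (S' - {x}) x x') (insert x' (S' - {x}))"
| chain_flip: "chain S g S' \<Longrightarrow> x \<in> S' \<Longrightarrow> chain S g (insert (- x) (S' - {x}))"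

lemma chain_props: "chain S g S' \<Longrightarrow> gp S' \<and> card S' = m \<and> g \<in> H \<and> gp S \<and> card S = m"
proof (induction rule: chain.induct)
  case (chain_move g S' x x')
  have "insert x' (S' - {x}) \<subseteq> insert x' S'" by auto
  then have "gp (insert x' (S' - {x}))" by (rule gp_subset[OF chain_move.hyps(4)])
  moreover have "card (insert x' (S' - {x})) = m" using chain_move gp_finite[of S']
    by (metis Diff_iff card_Suc_Diff1 card_insert_disjoint finite_Diff)
  ultimately show ?case using chain_move H_add mv_H by auto
next
  case (chain_flip g S' x)
  have "gp (insert x (S' - {x}))" using chain_flip by (simp add: insert_absorb)
  from gp_minus[OF this] have "gp (insert (- x) (S' - {x}))" "- x \<notin> S' - {x}" by auto
  moreover from this have "card (insert (- x) (S' - {x})) = m" using chain_flip gp_finite[of S']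
    by (metis card_Suc_Diff1 card_insert_disjoint finite_Diff)
  ultimately show ?case using chain_flip by auto
qed (auto simp: H_zero)

lemma chain_trans: "chain S' h S'' \<Longrightarrow> chain S g S' \<Longrightarrow> chain S (g + h) S''"
proof (induction rule: chain.induct)
  case (chain_move h S'' x x')
  show ?case using chain.chain_move[OF chain_move.IH[OF chain_move.prems] chain_move.hyps(2-4)] by (simp add: add.assoc)
next
  case (chain_flip h S'' x)
  then show ?case using chain.chain_flip by blast
qed simp

text \<open>General position of \<open>W \<union> S\<close> is inherited by all mixtures of the two
  sets, so the tokens outside \<open>W\<close> can be exchanged one at a time.\<close>

lemma chain_replace:
  assumes "chain S g S1" "S1 \<subseteq> W \<union> S" "gp (W \<union> S)" "card W = m" "card S = m"
  shows "\<exists>h. chain S h W"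
  using assms
proof (induction "card (S1 - W)" arbitrary: S1 g)
  case 0
  have f: "finite S1" "card S1 = m" using chain_props[OF 0(2)] gp_finite by auto
  then have "S1 \<subseteq> W" using 0 by auto
  moreover have "finite W" using gp_finite[OF 0(4)] by auto
  ultimately have "S1 = W" using card_subset_eq f 0(5) by metis
  then show ?case using 0 by auto
next
  case (Suc n)
  have f: "finite S1" "card S1 = m" using chain_props[OF Suc(3)] gp_finite by auto
  have fW: "finite W" using gp_finite[OF Suc(5)] by auto
  obtain x where x: "x \<in> S1" "x \<notin> W" using Suc(2) by (metis Diff_iff card.empty ex_in_conv nat.distinct(1))
  have "\<not> W \<subseteq> S1" using card_subset_eq[OF f(1)] f x Suc(6) by metis
  then obtain x' where x': "x' \<in> W" "x' \<notin> S1" by auto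
  have "gp (insert x' S1)" using gp_subset[OF Suc(5)] x' Suc(4) by auto
  from chain_move[OF Suc(3) x(1) x'(2) this] have "chain S (g + mv (S1 - {x}) x x') (insert x' (S1 - {x}))" .
  moreover have "n = card (insert x' (S1 - {x}) - W)"
  proof -
    have "insert x' (S1 - {x}) - W = (S1 - W) - {x}" using x' by auto
    then show ?thesis using Suc(2) x f by auto
  qed
  ultimately show ?case using Suc(1)[of "insert x' (S1 - {x})"] Suc(4-7) x' by auto
qed

text \<open>\<open>S \<union> S'\<close> need not be in general position. The chain makes a detour
  over a configuration \<open>W\<close> that is generic with respect to each of the two.\<close>

lemma chain_connect:
  assumes S: "gp S" "card S = m" "gp S'" "card S' = m"
  shows "\<exists>g. chain S g S'"
proof -
  have "\<exists>W. finite W \<and> card W = k \<and> gp (W \<union> S) \<and> gp (W \<union> S') \<and> W \<inter> (S \<union> S') = {}" for k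
  proof (induction k)
    case 0 then show ?case using S by (intro exI[of _ "{}"]) auto
  next
    case (Suc k)
    then obtain W where W: "finite W" "card W = k" "gp (W \<union> S)" "gp (W \<union> S')" "W \<inter> (S \<union> S') = {}" by blast
    have "\<exists>x\<in>UNIV. \<forall>E\<in>{W \<union> S, W \<union> S'}. gp (insert x E) \<and> x \<notin> E"
      by (rule gp_generic) (use W in auto)
    then obtain x where "gp (insert x (W \<union> S))" "gp (insert x (W \<union> S'))" "x \<notin> W \<union> S" "x \<notin> W \<union> S'" by auto
    then show ?case using W by (intro exI[of _ "insert x W"]) auto
  qed
  then obtain W where W: "finite W" "card W = m" "gp (W \<union> S)" "gp (W \<union> S')" "W \<inter> (S \<union> S') = {}" by blast
  have gW: "gp W" using gp_subset[OF W(3)] by auto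
  obtain g where g: "chain S g W" using chain_replace[OF chain_refl[OF S(1,2)], of W] W S by auto
  obtain h where h: "chain W h S'" using chain_replace[OF chain_refl[OF gW W(2)], of S'] W S by (auto simp: Un_commute)
  show ?thesis using chain_trans[OF h g] by blast
qed

end

text \<open>\<open>adj\<close> is what \<open>adjrel_nil\<close> and \<open>adjrel_met\<close>
  provide. \<open>H_chain\<close> says that all elements of \<open>H\<close> are values of closed
  chains at one configuration; for braids this means that loops can be decomposed into
  moves.\<close>

locale moves_adj = moves D m mv H
  for D m and mv :: "(real^3) set \<Rightarrow> real^3 \<Rightarrow> real^3 \<Rightarrow> 'g::group_add" and H +
  assumes m3: "m \<ge> 3" and adj: "adjrel (=)" and H_chain: "\<exists>b. \<forall>g\<in>H. chain b g b"
begin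

section \<open>The common central half twist\<close>

lemma sw_const:
  assumes "gp S" "card S = m" "u \<in> S" "v \<in> S" "u \<noteq> v" "u' \<in> S" "v' \<in> S" "u' \<noteq> v'" "s \<noteq> 0" "s' \<noteq> 0"
  shows "sw S u v s = sw S u' v' s'"
  using sw_rel[OF adj assms(1,2) m3 assms(3-10)] .

lemma two_others:
  assumes "finite S" "card S = m" "x \<in> S"
  obtains u v where "u \<in> S" "v \<in> S" "u \<noteq> v" "u \<noteq> x" "v \<noteq> x"
proof -
  have "card (S - {x}) \<ge> 2" using assms m3 by simp
  then obtain u v where "u \<in> S - {x}" "v \<in> S - {x}" "u \<noteq> v" by (meson card_2_iff' obtain_subset_with_card_n subsetD)
  then show thesis using that by auto
qed

lemma sw_flip:
  assumes S: "gp S" "card S = m" and x: "x \<in> S" and u: "u \<in> S" "v \<in> S" "u \<noteq> v"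
    and u': "u' \<in> insert (- x) (S - {x})" "v' \<in> insert (- x) (S - {x})" "u' \<noteq> v'" and s: "s \<noteq> 0" "s' \<noteq> 0"
  shows "sw (insert (- x) (S - {x})) u' v' s' = sw S u v s"
proof -
  let ?S = "insert (- x) (S - {x})"
  have c: "chain S 0 ?S" by (rule chain_flip[OF chain_refl[OF S] x])
  have S': "gp ?S" "card ?S = m" using chain_props[OF c] by auto
  obtain p q where pq: "p \<in> S" "q \<in> S" "p \<noteq> q" "p \<noteq> x" "q \<noteq> x" using two_others[OF gp_finite[OF S(1)] S(2) x] .
  have "insert x (S - {x}) = S" using x by auto
  then have mx: "- x \<notin> S - {x}" using gp_minus[of x "S - {x}"] S by auto
  have e: "S - {p, q} = insert x (S - {p, q, x})" "?S - {p, q} = insert (- x) (S - {p, q, x})" using pq x mx by auto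
  have "sw ?S p q s = sw S p q s" unfolding sw_def e by (rule Y_ctx_flip)
  moreover have "sw ?S u' v' s' = sw ?S p q s" by (rule sw_const[OF S' u']) (use pq s in auto)
  moreover have "sw S u v s = sw S p q s" by (rule sw_const[OF S u]) (use pq s in auto)
  ultimately show ?thesis by simp
qed

lemma sw_move_step:
  assumes S: "gp S" "card S = m" and x: "x \<in> S" "x' \<notin> S" "gp (insert x' S)" and pq: "p \<in> S" "q \<in> S" "p \<noteq> q" "p \<noteq> x" "q \<noteq> x"
    and dj: "dj p q x x'" and s: "s \<noteq> 0"
  shows "sw S p q s + mv (S - {x}) x x' = mv (S - {x}) x x' + sw (insert x' (S - {x})) p q s"
proof -
  let ?T = "S - {p, q, x}"
  have D: "y \<notin> D" if "y \<in> insert x' S" for y using gp_disjoint[OF x(3) that] .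
  have T: "okT 3 ?T" by (rule gp_okT[OF S(1)]) (use card_minus3[OF gp_finite[OF S(1)] S(2) pq(1,2) x(1)] pq in auto)
  have e: "S - {p, q} = insert x ?T" "S - {x} = insert p (insert q ?T)" "insert x' (S - {x}) - {p, q} = insert x' ?T"
    using pq x by auto
  have "Y (insert x ?T) p q s + mv (insert p (insert q ?T)) x x' = mv (insert p (insert q ?T)) x x' + Y (insert x' ?T) p q s"
  proof (rule Y_move[OF T _ _ _ s dj])
    show "clr (?T \<union> D) p q q" "clr (?T \<union> D) x x' x'"
      by (rule gp_clr[OF x(3)]; use pq x D in auto)+
    show "cross3 p q \<noteq> 0" using gp_cross[OF S(1)] pq by auto
  qed
  then show ?thesis unfolding sw_def unfolding e(1,3) unfolding e(2) .
qed

text \<open>All half twists of one configuration agree, so before each move the pair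
  \<open>p\<close>, \<open>q\<close> may be chosen afresh among the resting tokens. Then the move
  only has to avoid the segment between them.\<close>

lemma sw_chain:
  assumes "chain S g S'" "u \<in> S" "v \<in> S" "u \<noteq> v" "u' \<in> S'" "v' \<in> S'" "u' \<noteq> v'" "s \<noteq> 0" "s' \<noteq> 0"
  shows "sw S u v s + g = g + sw S' u' v' s'"
  using assms
proof (induction arbitrary: u' v' s' rule: chain.induct)
  case chain_refl
  then show ?case using sw_const[of S u v u' v' s s'] by simp
next
  case (chain_flip g S' x)
  have S': "gp S'" "card S' = m" using chain_props[OF chain_flip(1)] by auto
  obtain p q where pq: "p \<in> S'" "q \<in> S'" "p \<noteq> q" using two_others[OF gp_finite[OF S'(1)] S'(2) chain_flip(2)] by metis
  have "sw S u v s + g = g + sw S' p q s" using chain_flip pq by auto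
  then show ?case using sw_flip[OF S' chain_flip(2) pq chain_flip.prems(4-6)] chain_flip.prems by simp
next
  case (chain_move g S' x x')
  let ?S = "insert x' (S' - {x})"
  have S': "gp S'" "card S' = m" using chain_props[OF chain_move(1)] by auto
  have gS: "gp ?S" "card ?S = m" using chain_props[OF chain.chain_move[OF chain_move(1-4)]] by auto
  obtain p q where pq: "p \<in> S'" "q \<in> S'" "p \<noteq> q" "p \<noteq> x" "q \<noteq> x" using two_others[OF gp_finite[OF S'(1)] S'(2) chain_move(2)] by metis
  have pS: "p \<in> ?S" "q \<in> ?S" using pq by auto
  have IH: "sw S u v s + g = g + sw S' p q s" by (rule chain_move.IH) (use chain_move.prems pq in auto)
  have nx: "x \<noteq> x'" "p \<noteq> x'" "q \<noteq> x'" using chain_move pq by auto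
  have dp: "dt p x x' \<noteq> 0" "dt q x x' \<noteq> 0" using gp_dt[OF chain_move(4)] pq nx chain_move(2) by auto
  have "sw S' p q s + mv (S' - {x}) x x' = mv (S' - {x}) x x' + sw ?S p q s"
  proof (cases "dt p x x' * dt q x x' > 0")
    case True
    show ?thesis by (rule sw_move_step[OF S' chain_move(2-4) pq dj_side[OF True] \<open>s \<noteq> 0\<close>])
  next
    case False
    then have "dt p x x' * dt q x x' < 0" using dp by (metis linorder_neqE_linordered_idom mult_eq_0_iff)
    then have neg: "dt p x x' * dt (- q) x x' > 0" by simp
    \<comment> \<open>The line of \<open>x\<close> and \<open>x'\<close> separates \<open>p\<close>
      from \<open>q\<close>. Replacing \<open>q\<close> by its negative brings both to one side; in
      projective terms the complementary segment between the two tokens is used.\<close>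
    let ?F = "insert (- q) (S' - {q})"
    have F: "gp ?F" "card ?F = m" using chain_props[OF chain_flip[OF chain_refl[OF S'] pq(2)]] by auto
    have mq: "- q \<notin> S' - {q}" "gp (insert (- q) (insert x' (S' - {q})))" "- q \<notin> insert x' (S' - {q})"
    proof -
      have i: "insert q (S' - {q}) = S'" "insert q (insert x' (S' - {q})) = insert x' S'" using pq by auto
      show "- q \<notin> S' - {q}" using gp_minus(2)[of q "S' - {q}"] S' i by simp
      show "gp (insert (- q) (insert x' (S' - {q})))" "- q \<notin> insert x' (S' - {q})"
        using gp_minus[of q "insert x' (S' - {q})"] chain_move(4) i nx by simp_all
    qed
    have nq: "- q \<noteq> x" "- q \<noteq> x'" "- q \<noteq> p" using mq pq chain_move(2) by auto
    have "sw ?F p (- q) s + mv (?F - {x}) x x' = mv (?F - {x}) x x' + sw (insert x' (?F - {x})) p (- q) s"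
      by (rule sw_move_step[OF F _ _ _ _ _ _ _ _ dj_side[OF neg] \<open>s \<noteq> 0\<close>])
        (use chain_move(2,3) pq mq in \<open>auto simp: insert_commute\<close>)
    moreover have "mv (?F - {x}) x x' = mv (S' - {x}) x x'"
    proof -
      have "?F - {x} = insert (- q) (S' - {q, x})" "S' - {x} = insert q (S' - {q, x})" using pq mq chain_move(2) by auto
      then show ?thesis by (simp add: mv_neg_ctx)
    qed
    moreover have "sw ?F p (- q) s = sw S' p q s"
      by (rule sw_flip[OF S' pq(2,1,2,3)]) (use pq mq \<open>s \<noteq> 0\<close> in auto)
    moreover have "sw (insert x' (?F - {x})) p (- q) s = sw ?S p q s"
    proof -
      have e: "insert x' (?F - {x}) = insert (- q) (?S - {q})" using pq(5) nx(3) nq by auto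
      show ?thesis unfolding e
        by (rule sw_flip[OF gS pS(2,1,2) pq(3)]) (use pS pq(3) nq \<open>s \<noteq> 0\<close> in auto)
    qed
    ultimately show ?thesis by simp
  qed
  note step = this
  have c: "sw ?S p q s = sw ?S u' v' s'" by (rule sw_const[OF gS pS pq(3) chain_move.prems(4-6)]) (use chain_move.prems in auto)
  have "sw S u v s + (g + mv (S' - {x}) x x') = g + (sw S' p q s + mv (S' - {x}) x x')"
    using IH by (simp only: add.assoc[symmetric])
  then show ?case unfolding step c by (simp only: add.assoc)
qed

definition s0 :: 'g where
  "s0 = (SOME g. \<exists>S u v. gp S \<and> card S = m \<and> u \<in> S \<and> v \<in> S \<and> u \<noteq> v \<and> g = sw S u v 1)"

text \<open>A closed chain carries the half twist of the base configuration to itself, so this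
  element commutes with \<open>H\<close>, and transport along a chain to another configuration
  leaves it unchanged. Both senses of rotation then give the same element, and they are inverse to
  each other.\<close>

lemma s0_facts: "gp S \<Longrightarrow> card S = m \<Longrightarrow> u \<in> S \<Longrightarrow> v \<in> S \<Longrightarrow> u \<noteq> v \<Longrightarrow> s \<noteq> 0 \<Longrightarrow> sw S u v s = s0"
  and s0_central: "g \<in> H \<Longrightarrow> s0 + g = g + s0" and s0_double: "s0 + s0 = 0" and s0_H: "s0 \<in> H"
proof -
  obtain b where b: "\<forall>g\<in>H. chain b g b" using H_chain by blast
  have gb: "gp b" "card b = m" using b H_zero chain_props by auto
  have "b \<noteq> {}" using gb m3 by auto
  then obtain x where "x \<in> b" by auto
  then obtain p q where pq: "p \<in> b" "q \<in> b" "p \<noteq> q" using two_others[OF gp_finite[OF gb(1)] gb(2)] by metis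
  have "\<exists>g S u v. gp S \<and> card S = m \<and> u \<in> S \<and> v \<in> S \<and> u \<noteq> v \<and> g = sw S u v 1" using gb pq by blast
  from someI_ex[OF this, folded s0_def] obtain S' u' v' where
    S': "gp S'" "card S' = m" "u' \<in> S'" "v' \<in> S'" "u' \<noteq> v'" "s0 = sw S' u' v' 1" by blast
  obtain k where k: "chain b k S'" using chain_connect[OF gb S'(1,2)] by auto
  have kH: "k \<in> H" using chain_props[OF k] by auto
  have bc: "sw b p q 1 + g = g + sw b p q 1" if "g \<in> H" for g
    by (rule sw_chain[of b g b]) (use b that pq in auto)
  have "sw b p q 1 + k = k + s0" unfolding S'(6) by (rule sw_chain[OF k]) (use pq S' in auto)
  then have s0: "s0 = sw b p q 1" using bc[OF kH] by simp
  show cen: "s0 + g = g + s0" if "g \<in> H" for g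
    unfolding s0 by (rule bc[OF that])
  have eq: "sw S u v s = s0" if S: "gp S" "card S = m" "u \<in> S" "v \<in> S" "u \<noteq> v" "s \<noteq> 0" for S u v s
  proof -
    obtain g where g: "chain b g S" using chain_connect[OF gb S(1,2)] by auto
    have "s0 + g = g + sw S u v s" unfolding s0 by (rule sw_chain[OF g]) (use pq S in auto)
    moreover have "s0 + g = g + s0" using cen chain_props[OF g] by auto
    ultimately show ?thesis by simp
  qed
  then show "gp S \<Longrightarrow> card S = m \<Longrightarrow> u \<in> S \<Longrightarrow> v \<in> S \<Longrightarrow> u \<noteq> v \<Longrightarrow> s \<noteq> 0 \<Longrightarrow> sw S u v s = s0" .
  have "s0 = sw b p q (- 1)" by (rule eq[OF gb pq, symmetric]) simp
  also have "\<dots> = - s0" unfolding s0 using sw_neg[OF gb pq, of 1] by simp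
  finally show "s0 + s0 = 0" by (metis add.left_inverse)
  show "s0 \<in> H" unfolding s0 sw_def by (rule Y_H)
qed

end

section \<open>Moves along crossing segments\<close>

lemma mult_neg_if: "x \<noteq> 0 \<Longrightarrow> y \<noteq> 0 \<Longrightarrow> \<not> x * y > 0 \<Longrightarrow> x * y < (0::real)"
  by (metis linorder_neqE_linordered_idom mult_eq_0_iff)

lemma lin_combo_zero:
  assumes "r * x + r' * y = (0::real)" "x \<noteq> 0" "y \<noteq> 0" shows "r = 0 \<longleftrightarrow> r' = 0"
proof
  assume "r = 0" then show "r' = 0" using assms by simp
next
  assume "r' = 0" then show "r = 0" using assms by simp
qed

context moves begin

text \<open>The point of the segment may be special, for instance lie on a line through two points
  of \<open>E\<close>. As \<open>dt a y z \<noteq> 0\<close>, the relevant determinants are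
  nonconstant linear functions of the displacement \<open>t\<close>, and a small displacement along
  the segment makes them nonzero.\<close>

lemma gp_on_segment:
  assumes g: "gp (insert a (insert a' E))" and n: "a \<noteq> a'" "a \<notin> E" "a' \<notin> E" and q: "q > 0"
  shows "eventually (\<lambda>t. gp (insert (p *\<^sub>R a + q *\<^sub>R a' + t *\<^sub>R a) E) \<and> p *\<^sub>R a + q *\<^sub>R a' + t *\<^sub>R a \<notin> E) (at_right 0)"
proof -
  let ?x = "\<lambda>t. p *\<^sub>R a + q *\<^sub>R a' + t *\<^sub>R a"
  have E: "gp E" using gp_subset[OF g] by auto
  have f: "finite (E \<union> D)" using gp_finite[OF E] fin_D by auto
  have nD: "a \<notin> D" "a' \<notin> D" using gp_disjoint[OF g] by auto
  have 1: "cross3 (?x t) y \<noteq> 0" if y: "y \<in> E \<union> D" for y t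
  proof
    assume 0: "cross3 (?x t) y = 0"
    have d: "dt a a' y \<noteq> 0" using gp_dt[OF g, of a a' y] y n nD by auto
    then have "y \<noteq> 0" by auto
    then obtain k where k: "?x t = k *\<^sub>R y" using 0 by (auto simp: cross3_eq_0_iff)
    have "dt a a' (?x t) = 0" by simp
    then have "k = 0" using d unfolding k by simp
    then have "dt a (?x t) y = 0" using k by simp
    then show False using d q by simp
  qed
  have "eventually (\<lambda>t. y \<noteq> z \<longrightarrow> dt (?x t) y z \<noteq> 0) (at_right 0)" if yz: "y \<in> E \<union> D" "z \<in> E \<union> D" for y z
  proof (cases "y = z")
    case False
    have "dt a y z \<noteq> 0" using gp_dt[OF g, of a y z] yz n nD False by auto
    from ev_linear[OF this, of "p * dt a y z + q * dt a' y z"] show ?thesis by (rule eventually_mono) (simp add: algebra_simps)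
  qed simp
  then have 2: "eventually (\<lambda>t. \<forall>y\<in>E \<union> D. \<forall>z\<in>E \<union> D. y \<noteq> z \<longrightarrow> dt (?x t) y z \<noteq> 0) (at_right 0)"
    using f by (intro eventually_ball_finite ballI) auto
  then show ?thesis
  proof eventually_elim
    case (elim t)
    show ?case using gp_insertI(1,2)[OF E 1 elim[rule_format]] by simp
  qed
qed

definition cm :: "(real^3) set \<Rightarrow> real^3 \<Rightarrow> real^3 \<Rightarrow> real^3 \<Rightarrow> real^3 \<Rightarrow> bool" where
  "cm T a a' b b' \<longleftrightarrow> mv (insert b T) a a' + mv (insert a' T) b b' = mv (insert a T) b b' + mv (insert b' T) a a'"

lemma cm_trans:
  assumes "mv (insert b T) a a1 + mv (insert b T) a1 a2 = mv (insert b T) a a2"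
    "mv (insert b' T) a a1 + mv (insert b' T) a1 a2 = mv (insert b' T) a a2"
    "cm T a a1 b b'" "cm T a1 a2 b b'"
  shows "cm T a a2 b b'"
proof -
  have "mv (insert b T) a a2 + mv (insert a2 T) b b' = mv (insert b T) a a1 + (mv (insert b T) a1 a2 + mv (insert a2 T) b b')"
    unfolding assms(1)[symmetric] by (simp only: add.assoc)
  also have "\<dots> = (mv (insert b T) a a1 + mv (insert a1 T) b b') + mv (insert b' T) a1 a2"
    using assms(4) unfolding cm_def by (simp only: add.assoc)
  also have "\<dots> = mv (insert a T) b b' + (mv (insert b' T) a a1 + mv (insert b' T) a1 a2)"
    using assms(3) unfolding cm_def by (simp only: add.assoc)
  finally show ?thesis unfolding cm_def assms(2) .
qed

end

context moves_adj begin

lemma ht_s0: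
  assumes T: "okT 2 T" and g: "gp (insert a (insert v T))" "a \<noteq> v" "a \<notin> T" "v \<notin> T"
    and c: "clr (T \<union> D) a v b" and d: "dt a v b \<noteq> 0"
  shows "ht T a v b = s0"
proof -
  have card: "card (insert a (insert v T)) = m" using T g unfolding okT_def adm_def by auto
  have e: "insert a (insert v T) - {a, v} = T" using g by auto
  have "dt a v b * dt a v b > 0" using d by (metis not_real_square_gt_zero)
  then have "Y T a v (dt a v b) = ht T a v b" by (rule Y_eq[OF T c])
  moreover have "Y T a v (dt a v b) = s0"
    using s0_facts[OF g(1) card, of a v "dt a v b"] g(2) d unfolding sw_def e by simp
  ultimately show ?thesis by simp
qed

text \<open>The loop of a token around \<open>v\<close> is the full twist \<open>s0 + s0\<close>, which vanishes.\<close>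
lemma tri_token:
  assumes T: "okT 2 T" and g: "gp (insert a (insert v T))" "a \<noteq> v" "a \<notin> T" "v \<notin> T"
    and c: "clr (T \<union> D) a b c" and d: "dt a b c \<noteq> 0"
    and v: "v = \<alpha> *\<^sub>R a + \<beta> *\<^sub>R b + \<gamma> *\<^sub>R c" and p: "0 < \<alpha>" "0 < \<beta>" "0 < \<gamma>"
  shows "mv (insert v T) a b + mv (insert v T) b c = mv (insert v T) a c"
proof -
  have dv: "dt v b c = \<alpha> * dt a b c" "dt a v c = \<beta> * dt a b c" "dt a b v = \<gamma> * dt a b c" unfolding v by simp_all
  have pos: "(k * dt a b c) * (l * dt a b c) > 0" if "k > 0" "l > 0" for k l
  proof -
    have "(k * dt a b c) * (l * dt a b c) = (k * l) * (dt a b c * dt a b c)" by simp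
    then show ?thesis using that d by (metis mult_pos_pos not_real_square_gt_zero)
  qed
  have m: "v \<in> cone3 a b c" using p by (intro cone3I[OF _ _ _ _ v]) auto
  have cl: "clr (T \<union> D) x x' x''" if "x \<in> cone3 a b c" "x' \<in> cone3 a b c" "x'' \<in> cone3 a b c" for x x' x''
    by (rule clr_mono[OF c that])
  note cl' = cl[OF cone3_vertex(1)] cl[OF cone3_vertex(2)] cl[OF cone3_vertex(3)] cl[OF m]
  have n1: "dt a v b \<noteq> 0" using dt_nz(1)[of a b v] dv d p by auto
  have n2: "dt v a c \<noteq> 0" using dt_nz(2)[of a v c] dv d p by auto
  have n3: "dt c a v \<noteq> 0" using dt_nz(4)[of a v c] dv d p by auto
  have n4: "dt v c a \<noteq> 0" using dt_nz(3)[of a v c] dv d p by auto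
  have T': "okT 1 (insert c T)" "okT 1 (insert v T)"
    by (rule okT_insert1[OF T clr_edges(6)[OF c]] okT_insert1[OF T cl[OF m m m]])+
  have g': "gp (insert v (insert a T))" using g by (simp add: insert_commute)
  have h1: "ht T a v b = s0" by (rule ht_s0[OF T g _ n1]) (simp add: cl' m)
  have h2: "ht T v a c = s0" by (rule ht_s0[OF T g' g(2)[symmetric] g(4,3) _ n2]) (simp add: cl' m)
  let ?A = "mv (insert v T) a b" and ?B = "mv (insert b T) v a" and ?C = "mv (insert a T) b v"
    and ?A' = "mv (insert a T) v c" and ?B' = "mv (insert c T) a v" and ?C' = "mv (insert v T) c a"
  \<comment> \<open>Two successive half twists of \<open>a\<close> and \<open>v\<close>, the first
    over \<open>b\<close> and the second over \<open>c\<close>. Below, the moves from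
    \<open>v\<close> to \<open>a\<close> and back cancel, and the boundary of the triangle
    \<open>a\<close>, \<open>b\<close>, \<open>c\<close> around \<open>v\<close> remains.\<close>
  have sum: "(?A + ?B + ?C) + (?A' + ?B' + ?C') = 0" using h1 h2 s0_double unfolding ht_def by simp
  have 1: "?C + ?A' = mv (insert a T) b c"
  proof (rule mv_tri2[OF T clr_edges(4)[OF c]])
    have "dt b a c * dt v a c > 0" using pos[of 1 \<beta>] p dv(2) dt_swap(1)[of b a c] dt_swap(1)[of v a c] by simp
    then show "clr {a} b v c" by (rule clr_side)
  qed (simp_all add: cl' m)
  have 2: "?B + mv (insert a T) b c = mv (insert v T) b c + mv (insert c T) v a"
  proof (rule mv_comm[OF T])
    show "dj v a b c" by (rule dj_side) (use pos[of \<alpha> 1] p dv(1) in simp)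
  qed (simp_all add: cl' m)
  have 3: "mv (insert c T) v a = - ?B'"
    by (rule mv_rev[OF T'(1), of a v v]) (use clr_dt[OF n3] cl' m in simp)
  have 4: "?C' = - mv (insert v T) a c"
    by (rule mv_rev[OF T'(2), of a c c]) (use clr_dt[of v a c] dt_nz(2)[of a v c] n2 cl' m in simp)
  have "(?A + ?B + ?C) + (?A' + ?B' + ?C') = ?A + (?B + (?C + ?A')) + ?B' + ?C'" by (simp only: add.assoc)
  also have "\<dots> = (?A + mv (insert v T) b c) + ?C'" unfolding 1 2 3 by (simp only: add.assoc minus_add_cancel)
  finally have "(?A + mv (insert v T) b c) + ?C' = 0" using sum by (rule trans[OF sym])
  then have "(?A + mv (insert v T) b c) + - mv (insert v T) a c = 0" unfolding 4 .
  then show ?thesis by (metis add.right_inverse add_right_cancel)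
qed

text \<open>Near the crossing point \<open>x\<close> the segment from \<open>a\<close> to
  \<open>a'\<close> is replaced by a detour over \<open>a1\<close>, \<open>c\<close>,
  \<open>a2\<close>, where \<open>c\<close> lies on the line of \<open>b\<close> and
  \<open>b'\<close> just beyond \<open>b\<close>; so the detour misses the other segment. If the
  other token rests at \<open>b\<close>, the detour sweeps across it, which \<open>tri_token\<close>
  permits; if it rests at \<open>b'\<close>, the triangle is empty.\<close>

lemma cross_comm:
  assumes T: "okT 2 T" and g: "gp (insert a (insert a' (insert b (insert b' T))))" and n: "distinct [a, a', b, b']"
    "a \<notin> T" "a' \<notin> T" "b \<notin> T" "b' \<notin> T"
    and o: "p *\<^sub>R a + q *\<^sub>R a' = r *\<^sub>R b + r' *\<^sub>R b'" and pos: "0 < p" "0 < q" "0 < r" "0 < r'"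
  shows "cm T a a' b b'"
proof -
  define x where "x = p *\<^sub>R a + q *\<^sub>R a'"
  have xb: "x = r *\<^sub>R b + r' *\<^sub>R b'" unfolding x_def by (rule o)
  have D: "a \<notin> D" "a' \<notin> D" "b \<notin> D" "b' \<notin> D" using gp_disjoint[OF g] by auto
  have ca: "clr (T \<union> D) a a' a'" "clr {b} a a' a'" "clr {b'} a a' a'" and cb: "clr (T \<union> D) b b' b'"
    by (rule gp_clr[OF g]; use n D in auto)+
  have d: "dt a b b' \<noteq> 0" "dt a' b b' \<noteq> 0" "dt a b a' \<noteq> 0" by (rule gp_dt[OF g]; use n in auto)+
  have xa': "x \<in> cone3 a a' a'" "x \<in> cone3 b b' b'"
    by (rule cone3_2I[of p q, OF _ _ _ x_def] cone3_2I[of r r', OF _ _ _ xb]; use pos in simp)+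
  have clx: "clr (T \<union> D) x b x" by (rule clr_mono[OF cb]) (use xa' in auto)
  have gE: "gp (insert a (insert a' (insert b T)))" by (rule gp_subset[OF g]) auto
  let ?a = "\<lambda>t. x + t *\<^sub>R a" and ?a' = "\<lambda>t. x + t *\<^sub>R a'" and ?c = "\<lambda>t. b + t *\<^sub>R (- x)"
  have E1: "eventually (\<lambda>t. clr (T \<union> D) (?a t) (?c t) (?a' t)) (at_right 0)"
    by (rule clr_eventually[OF finite_okT[OF T] clx tendsto_perturb tendsto_perturb tendsto_perturb])
  have E2: "eventually (\<lambda>t. gp (insert (?a t) (insert b T)) \<and> ?a t \<notin> insert b T) (at_right 0)"
    unfolding x_def by (rule gp_on_segment[OF gE]) (use n pos in auto)
  have "tendsto (\<lambda>t. t * r) 0 (at_right (0::real))" by (rule tendsto_eq_intros refl tendsto_ident_at | simp)+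
  then have E3: "eventually (\<lambda>t. t * r < 1) (at_right 0)" by (rule order_tendstoD) simp
  from ex_right[OF eventually_conj[OF E1 eventually_conj[OF E2 eventually_conj[OF E3 ev_pos]]]]
  obtain t where t: "clr (T \<union> D) (?a t) (?c t) (?a' t)" "gp (insert (?a t) (insert b T))" "?a t \<notin> insert b T" "t * r < 1" "0 < t"
    by blast
  define a1 a2 c where "a1 = ?a t" and "a2 = ?a' t" and "c = ?c t"
  note t = t[folded a1_def a2_def c_def]
  have m1: "a1 \<in> cone3 a a' a'" "a2 \<in> cone3 a a' a'"
    unfolding a1_def a2_def x_def by (rule cone3_2I[of "p + t" q] cone3_2I[of p "q + t"]; use pos t in \<open>simp add: algebra_simps\<close>)+
  have caa: "clr (T \<union> D) y y' y''" "clr {b} y y' y''" "clr {b'} y y' y''"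
    if "y \<in> cone3 a a' a'" "y' \<in> cone3 a a' a'" "y'' \<in> cone3 a a' a'" for y y' y''
    by (rule clr_mono[OF ca(1) that] clr_mono[OF ca(2) that] clr_mono[OF ca(3) that])+
  have dx: "dt x b b' = 0" unfolding xb by simp
  have d1: "dt a1 b b' = t * dt a b b'" "dt a2 b b' = t * dt a' b b'" "dt c b b' = 0"
    unfolding a1_def a2_def c_def by (simp_all add: dx)
  have djs: "dj y z b b'" if "dt y b b' = k * dt z b b'" "0 < k" "dt z b b' \<noteq> 0" for y z k
  proof (rule dj_side)
    have "dt y b b' * dt z b b' = k * (dt z b b' * dt z b b')" using that(1) by simp
    then show "dt y b b' * dt z b b' > 0" using that by (metis mult_pos_pos not_real_square_gt_zero)
  qed
  have cm1: "cm T a a1 b b'" unfolding cm_def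
    by (rule mv_comm[OF T _ cb]) (use caa m1 dj_sym(1) djs[OF d1(1) t(5) d(1)] in auto)
  have cm4: "cm T a2 a' b b'" unfolding cm_def
    by (rule mv_comm[OF T _ cb]) (use caa m1 djs[OF d1(2) t(5) d(2)] in auto)
  have cc: "c = (1 - t * r) *\<^sub>R b + (- (t * r')) *\<^sub>R b'" unfolding c_def xb by (simp add: algebra_simps)
  have nb: "cross3 b b' \<noteq> 0" using dt_imp_cross(2)[OF d(1)] .
  have djc: "dj z c b b'" if dz: "dt z b b' \<noteq> 0" for z
  proof (rule djI[OF nb])
    fix \<alpha> \<beta> \<gamma> \<delta> :: real
    assume *: "0 \<le> \<alpha>" "0 \<le> \<beta>" "0 < \<alpha> + \<beta>" "0 \<le> \<gamma> * \<delta>" "\<alpha> *\<^sub>R z + \<beta> *\<^sub>R c = \<gamma> *\<^sub>R b + \<delta> *\<^sub>R b'"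
    have "dt (\<alpha> *\<^sub>R z + \<beta> *\<^sub>R c) b b' = 0" unfolding *(5) by simp
    then have "\<alpha> = 0" using dz d1(3) by simp
    then have e: "0 *\<^sub>R a + (\<beta> * (1 - t * r)) *\<^sub>R b + (- (\<beta> * (t * r'))) *\<^sub>R b' = 0 *\<^sub>R a + \<gamma> *\<^sub>R b + \<delta> *\<^sub>R b'"
      using *(5) unfolding cc by (simp add: algebra_simps)
    have "\<gamma> = \<beta> * (1 - t * r)" "\<delta> = - (\<beta> * (t * r'))" using e[unfolded coord_eq[OF d(1)]] by auto
    then have "\<gamma> * \<delta> = - ((\<beta> * (1 - t * r)) * (\<beta> * (t * r')))" by simp
    moreover have "(\<beta> * (1 - t * r)) * (\<beta> * (t * r')) > 0" using * \<open>\<alpha> = 0\<close> t pos by simp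
    ultimately show False using * by simp
  qed
  have e1: "clr (T \<union> D) a1 c c" "clr (T \<union> D) c a2 a2" by (rule clr_mono[OF t(1)]; simp)+
  have cm2: "cm T a1 c b b'" unfolding cm_def
    by (rule mv_comm[OF T e1(1) cb djc]) (use d1 d t in auto)
  have cm3: "cm T c a2 b b'" unfolding cm_def
    by (rule mv_comm[OF T e1(2) cb]) (use djc[of a2] dj_sym(1) d1 d t in auto)
  have tb: "mv (insert b T) a1 c + mv (insert b T) c a2 = mv (insert b T) a1 a2"
  proof (rule tri_token[OF T t(2) _ _ _ t(1)])
    let ?k = "p + q + t"
    have k: "?k > 0" using pos t by simp
    have "p *\<^sub>R a1 + q *\<^sub>R a2 = (p + q) *\<^sub>R x + t *\<^sub>R x"
      unfolding a1_def a2_def by (simp add: algebra_simps) (simp add: x_def algebra_simps)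
    then have "x = (1 / ?k) *\<^sub>R (p *\<^sub>R a1 + q *\<^sub>R a2)" using k by (simp flip: scaleR_add_left)
    moreover have "b = c + t *\<^sub>R x" unfolding c_def by simp
    ultimately have "b = c + t *\<^sub>R ((1 / ?k) *\<^sub>R (p *\<^sub>R a1 + q *\<^sub>R a2))" by metis
    then show "b = (t * p / ?k) *\<^sub>R a1 + 1 *\<^sub>R c + (t * q / ?k) *\<^sub>R a2" by (simp add: algebra_simps)
    show "0 < t * p / ?k" "0 < (1::real)" "0 < t * q / ?k" using pos t k by simp_all
    have "dt a1 c a2 = t * (p + q + t) * dt a b a'"
      unfolding a1_def a2_def c_def x_def by (simp add: algebra_simps dt_swap(3)[of a' b a])
    then show "dt a1 c a2 \<noteq> 0" using d k t by simp
  qed (use t n in auto)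
  have tb': "mv (insert b' T) a1 c + mv (insert b' T) c a2 = mv (insert b' T) a1 a2"
  proof (rule mv_tri2[OF T _ _ t(1)])
    show "clr (T \<union> D) b' b b" by (rule clr_mono[OF cb]) simp_all
    \<comment> \<open>The linear form that vanishes at \<open>a\<close> and \<open>b'\<close> and
      equals 1 at \<open>b\<close>. It is positive at the vertices of the detour triangle.\<close>
    define N where "N = (1 / dt a b b') *\<^sub>R cross3 b' a"
    have N: "inner N a = 0" "inner N b' = 0" "inner N b = 1"
      using d dt_rot(1)[of b b' a] unfolding N_def by (simp_all add: dot_cross_self inner_commute[of "cross3 _ _"] dt_rot flip: dt_def)
    have Nx: "inner N x = r" unfolding xb by (simp add: inner_right_distrib N)
    have "inner N x = q * inner N a'" unfolding x_def by (simp add: inner_right_distrib N)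
    then have "inner N a' = r / q" using Nx pos by (simp add: field_simps)
    then show "clr {b'} a1 c a2"
      by (intro clr_fun[of _ N]) (use d pos t in \<open>auto simp: a1_def a2_def c_def inner_right_distrib inner_diff_right N Nx add_pos_pos\<close>)
  qed
  have cb': "clr (T \<union> D) b b b" "clr (T \<union> D) b' b' b'" by (rule clr_mono[OF cb]; simp)+
  have cm5: "cm T a1 a2 b b'" by (rule cm_trans[OF tb tb' cm2 cm3])
  have cm6: "cm T a a2 b b'"
    by (rule cm_trans[OF mv_tri2[OF T cb'(1)] mv_tri2[OF T cb'(2)] cm1 cm5]) (use caa m1 in auto)
  show ?thesis
    by (rule cm_trans[OF mv_tri2[OF T cb'(1)] mv_tri2[OF T cb'(2)] cm6 cm4]) (use caa m1 in auto)
qed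

lemma cm_neg: "cm T a a' (- b) (- b') \<longleftrightarrow> cm T a a' b b'"
  unfolding cm_def by (simp add: mv_neg mv_neg_ctx)

text \<open>Segments that are not disjoint cross in the projective plane. As vectors the crossing
  may take place between the first segment and the negative of the second; then \<open>b\<close> and
  \<open>b'\<close> are negated.\<close>

lemma generic_comm:
  assumes T: "okT 2 T" and g: "gp (insert a (insert a' (insert b (insert b' T))))" and n: "a \<noteq> b" "a \<noteq> b'" "a' \<noteq> b" "a' \<noteq> b'"
    "a \<notin> T" "a' \<notin> T" "b \<notin> T" "b' \<notin> T"
  shows "mv (insert b T) a a' + mv (insert a' T) b b' = mv (insert a T) b b' + mv (insert b' T) a a'"
proof -
  have D: "a \<notin> D" "a' \<notin> D" "b \<notin> D" "b' \<notin> D" using gp_disjoint[OF g] by auto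
  have r: "mv (insert y T) z z = 0" if "y \<in> {a, a', b, b'}" "z \<in> {a, a', b, b'}" "y \<noteq> z" for y z
    by (rule mv_refl[OF okT_insert1[OF T], of y y y z z z]; rule gp_clr_point[OF g]; use that n D in auto)
  consider "a = a'" | "b = b'" | "a \<noteq> a'" "b \<noteq> b'" "dj a a' b b'" | "a \<noteq> a'" "b \<noteq> b'" "\<not> dj a a' b b'" by blast
  then show ?thesis
  proof cases
    case 1 then show ?thesis using r[of b a] r[of b' a] n by simp
  next
    case 2 then show ?thesis using r[of a' b] r[of a b] n by simp
  next
    case 3
    have "clr (T \<union> D) a a' a'" "clr (T \<union> D) b b' b'" by (rule gp_clr[OF g]; use n D 3 in auto)+
    then show ?thesis using mv_comm[OF T] 3 by blast
  next
    case 4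
    have dist: "distinct [a, a', b, b']" using n 4 by auto
    have d: "dt a b b' \<noteq> 0" "dt a' b b' \<noteq> 0" "dt b a a' \<noteq> 0" "dt b' a a' \<noteq> 0" by (rule gp_dt[OF g]; use dist in auto)+
    have "\<not> dt a b b' * dt a' b b' > 0" "\<not> dt b a a' * dt b' a a' > 0"
      using 4(3) dj_side[of a b b' a'] dj_side[of b a a' b'] dj_commute[of a a' b b'] by auto
    note neg = mult_neg_if[OF d(1,2) this(1)] mult_neg_if[OF d(3,4) this(2)]
    \<comment> \<open>With these weights the combination of \<open>a\<close> and \<open>a'\<close>
      lies in the plane of \<open>b\<close> and \<open>b'\<close>: the two determinants have
      opposite signs and cancel.\<close>
    define p q where "p = \<bar>dt a' b b'\<bar>" and "q = \<bar>dt a b b'\<bar>"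
    have pq: "0 < p" "0 < q" using d unfolding p_def q_def by auto
    have d0: "dt (p *\<^sub>R a + q *\<^sub>R a') b b' = 0"
      using neg(1) unfolding p_def q_def by (auto simp: mult_less_0_iff abs_if)
    obtain ka r r' where x: "p *\<^sub>R a + q *\<^sub>R a' = ka *\<^sub>R a + r *\<^sub>R b + r' *\<^sub>R b'" using coord_ex[OF d(1)] .
    have "ka = 0" using d0 d(1) unfolding x by simp
    then have x: "p *\<^sub>R a + q *\<^sub>R a' = r *\<^sub>R b + r' *\<^sub>R b'" using x by simp
    \<comment> \<open>The crossing point also lies on the line of \<open>a\<close> and
      \<open>a'\<close>. As \<open>b\<close> and \<open>b'\<close> are on different sides of it,
      \<open>r\<close> and \<open>r'\<close> have the same sign.\<close>
    have "dt (p *\<^sub>R a + q *\<^sub>R a') a a' = 0" by simp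
    then have r0: "r * dt b a a' + r' * dt b' a a' = 0" unfolding x by simp
    have nz: "\<not> (r = 0 \<and> r' = 0)"
    proof
      assume "r = 0 \<and> r' = 0"
      then have "dt (p *\<^sub>R a + q *\<^sub>R a') a' b = 0" unfolding x by simp
      then have "p * dt a a' b = 0" by simp
      then show False using pq d(3) dt_perm_eq(1)[of b a a'] by simp
    qed
    have "r = 0 \<longleftrightarrow> r' = 0" by (rule lin_combo_zero[OF r0 d(3,4)])
    then have rr: "r \<noteq> 0" "r' \<noteq> 0" using nz by auto
    have "r * r' > 0"
    proof -
      have "r * dt b a a' = - (r' * dt b' a a')" using r0 by simp
      then have "(r * dt b a a') * (r * dt b' a a') = - ((r * r') * (dt b' a a' * dt b' a a'))" by simp
      moreover have "(r * dt b a a') * (r * dt b' a a') = (r * r) * (dt b a a' * dt b' a a')" by simp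
      moreover have "(r * r) * (dt b a a' * dt b' a a') < 0" using neg(2) rr by (metis mult_pos_neg not_real_square_gt_zero)
      ultimately have "(r * r') * (dt b' a a' * dt b' a a') > 0" by linarith
      then show ?thesis using d(4) by (metis mult_nonpos_nonneg not_le zero_le_square)
    qed
    then consider "0 < r" "0 < r'" | "0 < - r" "0 < - r'" by (auto simp: zero_less_mult_iff)
    then have "cm T a a' b b'"
    proof cases
      case 1 then show ?thesis using cross_comm[OF T g dist n(5-8) x pq] by simp
    next
      case 2
      have g1: "gp (insert b (insert a (insert a' (insert b' T))))" using g by (simp add: insert_commute)
      have g2: "gp (insert (- b) (insert a (insert a' (insert b' T))))" "- b \<notin> insert a (insert a' (insert b' T))"
        using gp_minus[OF g1] dist n by auto
      have g3: "gp (insert b' (insert (- b) (insert a (insert a' T))))" using g2 by (simp add: insert_commute)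
      have g4: "gp (insert (- b') (insert (- b) (insert a (insert a' T))))" "- b' \<notin> insert (- b) (insert a (insert a' T))"
        using gp_minus[OF g3] dist n g2 by auto
      have "cm T a a' (- b) (- b')"
        by (rule cross_comm[OF T _ _ n(5,6) _ _ _ pq 2]) (use g4 g2 dist n x in \<open>auto simp: insert_commute\<close>)
      then show ?thesis unfolding cm_neg .
    qed
    then show ?thesis unfolding cm_def .
  qed
qed

end

section \<open>Triangular loops of a single token\<close>

context moves begin

lemma gp_neg_notin: assumes "gp E" "y \<in> E" shows "- y \<notin> E" "y \<noteq> 0"
proof -
  obtain d where d: "d \<in> D" using D_nonempty by auto
  have "cross3 y d \<noteq> 0" using gp_cross[OF assms, of d] d gp_disjoint[OF assms] by auto
  then show "y \<noteq> 0" by auto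
  show "- y \<notin> E"
  proof
    assume "- y \<in> E"
    moreover have "y + y \<noteq> 0" using \<open>y \<noteq> 0\<close> by (metis scaleR_2 scaleR_eq_0_iff zero_neq_numeral)
    then have "- y \<noteq> y" by (metis add.left_inverse)
    ultimately have "cross3 y (- y) \<noteq> 0" using gp_cross[OF assms, of "- y"] by auto
    then show False by simp
  qed
qed

text \<open>Negating vectors changes cross products and determinants at most by a sign. The last
  hypothesis prevents two representatives of one point from occurring together.\<close>

lemma gp_pm:
  assumes g: "gp E" and E': "E' \<subseteq> E \<union> uminus ` E" and n: "\<And>y. y \<in> E' \<Longrightarrow> - y \<notin> E'"
  shows "gp E'"
proof -
  have "\<forall>y\<in>E'. \<exists>z\<in>E. y = z \<or> y = - z" using E' by auto
  then obtain f where f: "\<And>y. y \<in> E' \<Longrightarrow> f y \<in> E \<and> (y = f y \<or> y = - f y)" by metis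
  have inj: "f y \<noteq> f z" if "y \<in> E'" "z \<in> E'" "y \<noteq> z" for y z
    using f[OF that(1)] f[OF that(2)] that n by (metis minus_minus)
  have fin: "finite E'" using E' gp_finite[OF g] finite_subset by blast
  define h where "h y = (if y \<in> E' then f y else y)" for y
  have h: "y = h y \<or> y = - h y" for y using f unfolding h_def by auto
  have hE: "h y \<in> E \<union> D" if "y \<in> E' \<union> D" for y using f that unfolding h_def by auto
  have hE': "h y \<in> E" if "y \<in> E'" for y using f that unfolding h_def by auto
  have fD: "f y \<notin> D" if "y \<in> E'" for y using f[OF that] gp_disjoint[OF g] by auto
  have hinj: "h y \<noteq> h z" if "y \<in> E' \<union> D" "z \<in> E' \<union> D" "y \<noteq> z" for y z
    using inj fD that unfolding h_def by (cases "y \<in> E'"; cases "z \<in> E'"; metis UnE)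
  have c: "cross3 x y \<noteq> 0" if "x \<in> E'" "y \<in> E' \<union> D" "x \<noteq> y" for x y
    using gp_cross[OF g hE'[OF that(1)] hE[OF that(2)]] hinj[of x y] that h[of x] h[of y]
    by (metis UnI1 add.inverse_inverse cross_minus_left cross_minus_right neg_equal_0_iff_equal)
  have ED: "x \<notin> D" if "x \<in> E'" for x
  proof
    assume "x \<in> D"
    have "h x \<notin> D" by (rule gp_disjoint[OF g hE'[OF that]])
    then have "h x \<noteq> x" using \<open>x \<in> D\<close> by metis
    then have "cross3 (h x) x \<noteq> 0" using gp_cross[OF g hE'[OF that], of x] \<open>x \<in> D\<close> by blast
    then show False using h[of x] by (metis cross_minus_right cross_refl neg_0_equal_iff_equal)
  qed
  show ?thesis unfolding gp_def adm_def
  proof (intro conjI ballI impI fin)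
    fix x y assume "x \<in> E'" "y \<in> E' - {x} \<union> D"
    then show "cross3 x y \<noteq> 0" using c[of x y] ED by auto
  next
    fix x y z assume *: "x \<in> E'" "y \<in> E' \<union> D" "z \<in> E' \<union> D" "x \<noteq> y" "x \<noteq> z" "y \<noteq> z"
    have "dt (h x) (h y) (h z) \<noteq> 0"
      by (rule gp_dt[OF g hE' hE hE hinj hinj hinj]) (use * in auto)
    moreover have "dt x y z = dt (h x) (h y) (h z) \<or> dt x y z = - dt (h x) (h y) (h z)"
      using h[of x] h[of y] h[of z] by (metis dt_linear(10,11,12) minus_minus)
    ultimately show "dt x y z \<noteq> 0" by auto
  qed
qed

text \<open>For \<open>e = 1\<close> the token runs around the triangle \<open>p\<close>,
  \<open>x\<close>, \<open>a\<close>. For \<open>e = - 1\<close> it continues from the other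
  representative of \<open>a\<close>, so that its path in the projective plane is one-sided.\<close>

definition loop :: "(real^3) set \<Rightarrow> real^3 \<Rightarrow> real^3 \<Rightarrow> real^3 \<Rightarrow> real \<Rightarrow> 'g" where
  "loop T p x a e = mv T p x + mv T x a + mv T (e *\<^sub>R a) p"

lemma loop_H: "loop T p x a e \<in> H"
  unfolding loop_def by (intro H_add mv_H)

lemma mv_sign_ctx: "e = 1 \<or> e = - 1 \<Longrightarrow> mv (insert (e *\<^sub>R a) T) p q = mv (insert a T) p q"
  using mv_neg_ctx by auto

lemma loop_sign_ctx: "e = 1 \<or> e = - 1 \<Longrightarrow> loop (insert (e *\<^sub>R b) T) p x a e' = loop (insert b T) p x a e'"
  unfolding loop_def using mv_sign_ctx by simp

text \<open>Two loops can be compared only if all their vertices are in joint general position. When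
  \<open>x\<close> and \<open>a\<close> are displaced slightly, the corrections cancel at each
  vertex; at \<open>a\<close> this uses that moves are invariant under negation.\<close>

lemma loop_perturb:
  assumes T: "okT 1 T" and g: "gp (insert p (insert x (insert a T)))" "p \<noteq> x" "p \<noteq> a" "p \<notin> T" "x \<notin> T" "a \<notin> T"
    and E: "gp E" and e: "e = 1 \<or> e = - 1"
  shows "\<exists>x' a'. gp (insert x' (insert a' E)) \<and> x' \<notin> E \<and> a' \<notin> E \<and> x' \<noteq> a' \<and> loop T p x' a' e = loop T p x a e"
proof -
  let ?Q = "T \<union> D"
  have f: "finite ?Q" by (rule finite_okT[OF T])
  have nD: "p \<notin> D" "x \<notin> D" "a \<notin> D" using gp_disjoint[OF g(1)] by auto
  have c1: "clr ?Q p x x" by (rule gp_clr[OF g(1)]) (use g nD in auto)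
  have c2: "clr ?Q x x a"
  proof (cases "x = a")
    case True then show ?thesis using gp_clr_point[OF g(1), of x ?Q] g nD by auto
  next
    case False
    have "clr ?Q x a a" by (rule gp_clr[OF g(1)]) (use g nD False in auto)
    then show ?thesis by (rule clr_mono) auto
  qed
  have "clr ?Q p a a" by (rule gp_clr[OF g(1)]) (use g nD in auto)
  moreover have "clr ?Q (- a) p p"
  proof (rule gp_clr)
    have g': "gp (insert a (insert p T))" by (rule gp_subset[OF g(1)]) auto
    show "gp (insert (- a) (insert p T))" "- a \<noteq> p" "?Q \<subseteq> insert (- a) (insert p T) \<union> D - {- a, p}"
      using gp_minus[OF g'] g nD gp_disjoint[OF gp_minus(1)[OF g']] by auto
  qed auto
  ultimately have c3: "clr ?Q (e *\<^sub>R a) (e *\<^sub>R a) p" using e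
    by (auto simp: scaleR_minus1_left intro: clr_mono)
  have "eventually (\<lambda>x'. clr ?Q p x x') (nhds x)"
    by (rule clr_eventually[OF f c1 tendsto_const tendsto_const]) (simp add: filterlim_ident)
  moreover have "eventually (\<lambda>x'. clr ?Q x' x a) (nhds x)"
    by (rule clr_eventually[OF f c2 _ tendsto_const tendsto_const]) (simp add: filterlim_ident)
  ultimately have "eventually (\<lambda>x'. clr ?Q p x x' \<and> clr ?Q x' x a) (nhds x)" by (rule eventually_conj)
  then obtain U where U: "open U" "x \<in> U" "\<And>x'. x' \<in> U \<Longrightarrow> clr ?Q p x x' \<and> clr ?Q x' x a" unfolding eventually_nhds by blast
  have "\<exists>x'\<in>U. \<forall>E'\<in>{E}. gp (insert x' E') \<and> x' \<notin> E'"
    by (rule gp_generic) (use E U in auto)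
  then obtain x' where x': "x' \<in> U" "gp (insert x' E)" "x' \<notin> E" by auto
  note cx = U(3)[OF x'(1), THEN conjunct1] U(3)[OF x'(1), THEN conjunct2]
  have c4: "clr ?Q x' a a" by (rule clr_mono[OF cx(2)]) auto
  have "eventually (\<lambda>a'. clr ?Q x' a a') (nhds a)"
    by (rule clr_eventually[OF f c4 tendsto_const tendsto_const]) (simp add: filterlim_ident)
  moreover have "eventually (\<lambda>a'. clr ?Q (e *\<^sub>R a') (e *\<^sub>R a) p) (nhds a)"
    by (rule clr_eventually[OF f c3 _ tendsto_const tendsto_const]) (auto intro!: tendsto_scaleR tendsto_const simp: filterlim_ident)
  ultimately have "eventually (\<lambda>a'. clr ?Q x' a a' \<and> clr ?Q (e *\<^sub>R a') (e *\<^sub>R a) p) (nhds a)" by (rule eventually_conj)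
  then obtain V where V: "open V" "a \<in> V" "\<And>a'. a' \<in> V \<Longrightarrow> clr ?Q x' a a' \<and> clr ?Q (e *\<^sub>R a') (e *\<^sub>R a) p" unfolding eventually_nhds by blast
  have "\<exists>a'\<in>V. \<forall>E'\<in>{insert x' E}. gp (insert a' E') \<and> a' \<notin> E'"
    by (rule gp_generic) (use x' V in auto)
  then obtain a' where a': "a' \<in> V" "gp (insert a' (insert x' E))" "a' \<notin> insert x' E" by auto
  note ca = V(3)[OF a'(1), THEN conjunct1] V(3)[OF a'(1), THEN conjunct2]
  have 1: "mv T p x' = mv T p x + mv T x x'" by (rule mv_tri[OF T cx(1), symmetric])
  have 2: "mv T x' a' = mv T x' x + mv T x a + mv T a a'" using mv_tri[OF T cx(2)] mv_tri[OF T ca(1)] by simp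
  have 3: "mv T (e *\<^sub>R a') p = mv T (e *\<^sub>R a') (e *\<^sub>R a) + mv T (e *\<^sub>R a) p" by (rule mv_tri[OF T ca(2), symmetric])
  have 4: "mv T (e *\<^sub>R a') (e *\<^sub>R a) = mv T a' a" using e mv_neg by auto
  have 5: "mv T a' a = - mv T a a'" "mv T x' x = - mv T x x'"
    by (rule mv_rev[OF T clr_edges(2)[OF ca(1)]] mv_rev[OF T clr_edges(2)[OF cx(1)]])+
  have "loop T p x' a' e = loop T p x a e" unfolding loop_def 1 2 3 4 5
    by (simp only: add.assoc add_minus_cancel)
  then show ?thesis using a' x' by (intro exI[of _ x'] exI[of _ a']) (auto simp: insert_commute)
qed

end

context moves_adj begin

lemma loop_mv_comm:
  assumes T: "okT 2 T" and g: "gp (insert p (insert x (insert a (insert q (insert q' T)))))"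
    and n: "{p, x, a} \<inter> {q, q'} = {}" "{p, x, a, q, q'} \<inter> T = {}" "p \<noteq> a" and e: "e = 1 \<or> e = - 1"
  shows "loop (insert q T) p x a e + mv (insert p T) q q' = mv (insert p T) q q' + loop (insert q' T) p x a e"
proof -
  have 1: "mv (insert q T) p x + mv (insert x T) q q' = mv (insert p T) q q' + mv (insert q' T) p x"
    by (rule generic_comm[OF T]) (use n in \<open>auto intro: gp_subset[OF g]\<close>)
  have 2: "mv (insert q T) x a + mv (insert a T) q q' = mv (insert x T) q q' + mv (insert q' T) x a"
    by (rule generic_comm[OF T]) (use n in \<open>auto intro: gp_subset[OF g]\<close>)
  have nm: "- y \<notin> insert p (insert x (insert a (insert q (insert q' T))))" if "y \<in> insert p (insert x (insert a (insert q (insert q' T))))" for y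
    using gp_neg_notin[OF g that] by simp
  have "mv (insert q T) (e *\<^sub>R a) p + mv (insert p T) q q' = mv (insert (e *\<^sub>R a) T) q q' + mv (insert q' T) (e *\<^sub>R a) p"
  proof (rule generic_comm[OF T])
    have g': "gp (insert a (insert p (insert q (insert q' T))))" by (rule gp_subset[OF g]) auto
    show "gp (insert (e *\<^sub>R a) (insert p (insert q (insert q' T))))" using g' gp_minus(1)[OF g'] n e by auto
  qed (use e n nm[of a] in auto)
  note 3 = this[unfolded mv_sign_ctx[OF e]]
  have "loop (insert q T) p x a e + mv (insert p T) q q' = mv (insert q T) p x + mv (insert q T) x a + (mv (insert q T) (e *\<^sub>R a) p + mv (insert p T) q q')"
    unfolding loop_def by (simp only: add.assoc)
  also have "\<dots> = mv (insert q T) p x + (mv (insert q T) x a + mv (insert a T) q q') + mv (insert q' T) (e *\<^sub>R a) p"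
    unfolding 3 by (simp only: add.assoc)
  also have "\<dots> = (mv (insert q T) p x + mv (insert x T) q q') + mv (insert q' T) x a + mv (insert q' T) (e *\<^sub>R a) p"
    unfolding 2 by (simp only: add.assoc)
  finally show ?thesis unfolding 1 loop_def by (simp only: add.assoc)
qed

lemma loop_comm:
  assumes T: "okT 2 T" and g: "gp (insert p (insert x (insert a (insert q (insert y (insert b T))))))"
    and n: "{p, x, a} \<inter> {q, y, b} = {}" "{p, x, a, q, y, b} \<inter> T = {}" "p \<noteq> a" "q \<noteq> b" and e: "e = 1 \<or> e = - 1" "e' = 1 \<or> e' = - 1"
  shows "loop (insert q T) p x a e + loop (insert p T) q y b e' = loop (insert p T) q y b e' + loop (insert q T) p x a e"
proof -
  let ?L = "\<lambda>r. loop (insert r T) p x a e" and ?M = "mv (insert p T)"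
  have nm: "- z \<notin> insert p (insert x (insert a (insert q (insert y (insert b T)))))" if "z \<in> insert p (insert x (insert a (insert q (insert y (insert b T)))))" for z
    using gp_neg_notin[OF g that] by simp
  have 1: "?L q + ?M q y = ?M q y + ?L y"
    by (rule loop_mv_comm[OF T _ _ _ _ e(1)]) (use n in \<open>auto intro: gp_subset[OF g]\<close>)
  have 2: "?L y + ?M y b = ?M y b + ?L b"
    by (rule loop_mv_comm[OF T _ _ _ _ e(1)]) (use n in \<open>auto intro: gp_subset[OF g]\<close>)
  have "?L (e' *\<^sub>R b) + ?M (e' *\<^sub>R b) q = ?M (e' *\<^sub>R b) q + ?L q"
  proof (rule loop_mv_comm[OF T _ _ _ _ e(1)])
    have g': "gp (insert b (insert p (insert x (insert a (insert q T)))))" by (rule gp_subset[OF g]) auto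
    have "gp (insert (e' *\<^sub>R b) (insert p (insert x (insert a (insert q T)))))"
      using g' gp_minus(1)[OF g'] e n by auto
    then show "gp (insert p (insert x (insert a (insert (e' *\<^sub>R b) (insert q T)))))" by (simp add: insert_commute)
  qed (use n e nm[of b] in auto)
  note 3 = this[unfolded loop_sign_ctx[OF e(2)]]
  have "?L q + loop (insert p T) q y b e' = (?L q + ?M q y) + ?M y b + ?M (e' *\<^sub>R b) q" unfolding loop_def[of "insert p T"] by (simp only: add.assoc)
  also have "\<dots> = ?M q y + (?L y + ?M y b) + ?M (e' *\<^sub>R b) q" unfolding 1 by (simp only: add.assoc)
  also have "\<dots> = ?M q y + ?M y b + (?L b + ?M (e' *\<^sub>R b) q)" unfolding 2 by (simp only: add.assoc)
  also have "\<dots> = loop (insert p T) q y b e' + ?L q" unfolding 3 loop_def[of "insert p T"] by (simp only: add.assoc)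
  finally show ?thesis .
qed

text \<open>Conjugating by the central half twist \<open>s0\<close> turns a loop of the token at \<open>p\<close> into a loop of the token at \<open>q\<close>.\<close>
lemma loop_transfer:
  assumes T: "okT 2 T" and g: "gp (insert p (insert q (insert x (insert a T))))" "p \<noteq> q" "{p, q} \<inter> {x, a} = {}" "{p, q, x, a} \<inter> T = {}"
    and e: "e = 1 \<or> e = - 1"
  shows "\<exists>y. gp (insert y (insert p (insert q (insert x (insert a T))))) \<and> y \<notin> insert p (insert q (insert x (insert a T))) \<and>
    loop (insert q T) p x a e = loop (insert p T) q y x 1 + loop (insert p T) q x a e + loop (insert p T) q (e *\<^sub>R a) y 1"
proof -
  let ?E = "insert p (insert q (insert x (insert a T)))" let ?Q = "T \<union> D" and ?Qq = "insert q T \<union> D"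
  have nm: "- z \<notin> ?E" if "z \<in> ?E" for z using gp_neg_notin[OF g(1) that] by simp
  have nD: "z \<notin> D" if "z \<in> ?E" for z using gp_disjoint[OF g(1) that] .
  have g1: "gp (insert (- a) (insert p (insert q T)))"
  proof -
    have g': "gp (insert a (insert p (insert q T)))" by (rule gp_subset[OF g(1)]) auto
    show ?thesis using gp_minus(1)[OF g'] g by auto
  qed
  have na: "- a \<notin> D" "- a \<notin> ?E" using gp_disjoint[OF g1] nm[of a] by auto
  have okq: "okT 1 (insert q T)" "okT 1 (insert p T)"
    by (rule okT_insert1[OF T gp_clr_point[OF g(1)]]; use g nD in auto)+
  have f: "finite ?Qq" by (rule finite_okT[OF okq(1)])
  have fQ: "finite ?Q" by (rule finite_okT[OF T])
  have cpq: "clr ?Q q p p" by (rule gp_clr[OF g(1)]) (use g nD in auto)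
  have "clr ?Qq p x x" by (rule gp_clr[OF g(1)]) (use g nD in auto)
  then have cpx: "clr ?Qq p p x" by (rule clr_mono) auto
  have "clr ?Qq p a a" by (rule gp_clr[OF g(1)]) (use g nD in auto)
  moreover have "clr ?Qq p (- a) (- a)" by (rule gp_clr[OF g1]) (use g nD na in auto)
  ultimately have cap: "clr ?Qq (e *\<^sub>R a) p p" using e by (auto intro: clr_mono)
  \<comment> \<open>\<open>y\<close> is taken near \<open>p\<close>. There it can serve as auxiliary
    point for the half twist of \<open>q\<close> and \<open>p\<close>, and the loop at
    \<open>p\<close> can be shifted to \<open>y\<close> through clear triangles.\<close>
  have id: "tendsto (\<lambda>y. y) p (nhds p)" by (simp add: filterlim_ident)
  have "eventually (\<lambda>y. clr ?Q q p y) (nhds p)" by (rule clr_eventually[OF fQ cpq tendsto_const tendsto_const id])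
  moreover have "eventually (\<lambda>y. clr ?Qq y p x) (nhds p)" by (rule clr_eventually[OF f cpx id tendsto_const tendsto_const])
  moreover have "eventually (\<lambda>y. clr ?Qq (e *\<^sub>R a) y p) (nhds p)" by (rule clr_eventually[OF f cap tendsto_const id tendsto_const])
  ultimately have "eventually (\<lambda>y. clr ?Q q p y \<and> clr ?Qq y p x \<and> clr ?Qq (e *\<^sub>R a) y p) (nhds p)" by eventually_elim blast
  then obtain U where U: "open U" "p \<in> U" "\<And>y. y \<in> U \<Longrightarrow> clr ?Q q p y \<and> clr ?Qq y p x \<and> clr ?Qq (e *\<^sub>R a) y p" unfolding eventually_nhds by blast
  have "\<exists>y\<in>U. \<forall>E'\<in>{?E}. gp (insert y E') \<and> y \<notin> E'" by (rule gp_generic) (use g U in auto)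
  then obtain y where y: "y \<in> U" "gp (insert y ?E)" "y \<notin> ?E" by auto
  have cy: "clr ?Q q p y" "clr ?Qq y p x" "clr ?Qq (e *\<^sub>R a) y p" using U(3)[OF y(1)] by auto
  have yD: "y \<notin> D" using gp_disjoint[OF y(2)] by auto
  have gy: "gp (insert (- a) (insert y (insert p (insert q T))))"
  proof -
    have g': "gp (insert a (insert y (insert p (insert q T))))" by (rule gp_subset[OF y(2)]) auto
    show ?thesis using gp_minus(1)[OF g'] g y by auto
  qed
  have nay: "- a \<noteq> y" using gp_neg_notin[OF y(2), of a] by auto
  have "dt q p y \<noteq> 0" by (rule gp_dt[OF y(2)]) (use y g in auto)
  then have s: "ht T q p y = s0"
    by (intro ht_s0[OF T _ _ _ _ cy(1)]) (use g in \<open>auto intro: gp_subset[OF g(1)]\<close>)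
  let ?q = "mv (insert q T)" and ?p = "mv (insert p T)" and ?y = "mv (insert y T)"
  let ?L = "\<lambda>r. loop (insert r T) y x a e"
  have "?q y p + ?q p x = ?q y x" "?q (e *\<^sub>R a) y + ?q y p = ?q (e *\<^sub>R a) p"
    by (rule mv_tri[OF okq(1) cy(2)] mv_tri[OF okq(1) cy(3)])+
  then have 1: "?q y p + loop (insert q T) p x a e = ?L q + ?q y p"
    unfolding loop_def by (simp only: add.assoc[symmetric]) (simp only: add.assoc)
  have 2: "?L p + ?y p q = ?y p q + ?L q"
    by (rule loop_mv_comm[OF T _ _ _ _ e]) (use g y in \<open>auto intro: gp_subset[OF y(2)]\<close>)
  have "s0 + loop (insert q T) p x a e = ?p q y + (?y p q + ?L q) + ?q y p"
    unfolding s[symmetric] ht_def using 1 by (simp only: add.assoc)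
  also have "\<dots> = (?p q y + ?L p) + (?y p q + ?q y p)" unfolding 2[symmetric] by (simp only: add.assoc)
  also have "\<dots> = (?p q y + ?L p + - ?p q y) + s0"
    unfolding s[symmetric] ht_def by (simp only: add.assoc minus_add_cancel)
  finally have "loop (insert q T) p x a e + s0 = (?p q y + ?L p + - ?p q y) + s0"
    unfolding s0_central[OF loop_H] .
  then have m: "loop (insert q T) p x a e = ?p q y + ?L p + - ?p q y" by (rule add_right_imp_eq)
  have cp: "clr (insert p T \<union> D) q y y" "clr (insert p T \<union> D) x q q" by (rule gp_clr[OF y(2)]; use g y yD nD in auto)+
  have ca1: "clr (insert p T \<union> D) a q q" by (rule gp_clr[OF y(2)]) (use g y yD nD in auto)
  have ca2: "clr (insert p T \<union> D) (- a) q q" by (rule gp_clr[OF gy]) (use g y yD nD na in auto)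
  have ca: "clr (insert p T \<union> D) (e *\<^sub>R a) q q" using e ca1 ca2 by auto
  have r: "?p y q = - ?p q y" "?p q x = - ?p x q" "?p q (e *\<^sub>R a) = - ?p (e *\<^sub>R a) q"
    by (rule mv_rev[OF okq(2) cp(1)] mv_rev[OF okq(2) cp(2)] mv_rev[OF okq(2) ca])+
  \<comment> \<open>The conjugated loop starts at \<open>q\<close> and runs over \<open>y\<close>,
    \<open>x\<close>, \<open>a\<close>, passes to the multiple of \<open>a\<close> by
    \<open>e\<close>, and returns over \<open>y\<close>. Cutting along the segments that join
    \<open>q\<close> to \<open>x\<close> and to this multiple yields three triangular loops.\<close>
  have "loop (insert p T) q y x 1 + loop (insert p T) q x a e + loop (insert p T) q (e *\<^sub>R a) y 1 = ?p q y + ?L p + - ?p q y"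
    unfolding loop_def r scaleR_one by (simp only: add.assoc minus_add_cancel add_minus_cancel)
  then show ?thesis using m y by auto
qed

end

lemma commute_add: fixes a b c :: "'g::group_add" assumes "a + b = b + a" "c + b = b + c" shows "(a + c) + b = b + (a + c)"
  using assms by (metis add.assoc)

section \<open>Comparison with a labelled reference configuration\<close>

context moves begin

definition oth :: "(nat \<Rightarrow> real^3) \<Rightarrow> nat \<Rightarrow> (real^3) set" where
  "oth w j = w ` ({..<m} - {j})"

definition others :: "(nat \<Rightarrow> real^3) \<Rightarrow> nat \<Rightarrow> nat \<Rightarrow> (real^3) set" where
  "others w i j = w ` ({..<m} - {i, j})"

lemma oth_others: "i < m \<Longrightarrow> j < m \<Longrightarrow> i \<noteq> j \<Longrightarrow> oth w i = insert (w j) (others w i j)"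
  unfolding oth_def others_def by auto

lemma oth_others2: "i < m \<Longrightarrow> j < m \<Longrightarrow> i \<noteq> j \<Longrightarrow> oth w j = insert (w i) (others w i j)"
  unfolding oth_def others_def by auto

lemma card_others: assumes "inj_on w {..<m}" "i < m" "j < m" "i \<noteq> j" shows "card (others w i j) + 2 = m"
proof -
  have "card (others w i j) = card ({..<m} - {i, j})"
    unfolding others_def by (rule card_image) (rule inj_on_subset[OF assms(1)], auto)
  moreover have "card ({..<m} - {i, j}) = m - 2" using assms by (subst card_Diff_subset) auto
  moreover have "2 \<le> m" using assms by linarith
  ultimately show ?thesis by linarith
qed

lemma card_oth: assumes "inj_on w {..<m}" "j < m" shows "card (oth w j) + 1 = m"
proof -
  have "card (oth w j) = card ({..<m} - {j})"
    unfolding oth_def by (rule card_image) (rule inj_on_subset[OF assms(1)], auto)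
  then show ?thesis using assms(2) by simp
qed

text \<open>The tokens are moved from \<open>w\<close> to \<open>v\<close> in the order of their
  labels. During the move with label \<open>n\<close> the resting tokens are at \<open>v\<close> for
  smaller labels and at \<open>w\<close> for larger ones.\<close>

fun Pm :: "(nat \<Rightarrow> real^3) \<Rightarrow> (nat \<Rightarrow> real^3) \<Rightarrow> nat \<Rightarrow> 'g" where
  "Pm w v 0 = 0"
| "Pm w v (Suc n) = Pm w v n + mv (oth (\<lambda>i. if i < n then v i else w i) n) (w n) (v n)"

abbreviation mx :: "(nat \<Rightarrow> real^3) \<Rightarrow> (nat \<Rightarrow> real^3) \<Rightarrow> nat \<Rightarrow> nat \<Rightarrow> real^3" where
  "mx w v n \<equiv> (\<lambda>i. if i < n then v i else w i)"

lemma Pm_H: "Pm w v n \<in> H"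
  by (induction n) (auto intro: H_zero H_add mv_H)

lemma Pm_cong: "(\<And>i. i < n \<Longrightarrow> v i = v' i) \<Longrightarrow> Pm w v n = Pm w v' n"
proof (induction n)
  case (Suc n)
  have "mx w v n = mx w v' n" using Suc.prems by auto
  then show ?case using Suc by simp
qed simp

definition JG :: "(nat \<Rightarrow> real^3) \<Rightarrow> (nat \<Rightarrow> real^3) \<Rightarrow> bool" where
  "JG w v \<longleftrightarrow> inj_on w {..<m} \<and> inj_on v {..<m} \<and> w ` {..<m} \<inter> v ` {..<m} = {} \<and> gp (w ` {..<m} \<union> v ` {..<m})"

lemma JG_eqs:
  assumes "JG w v" "i < m" "j < m"
  shows "w i = w j \<longleftrightarrow> i = j" "v i = v j \<longleftrightarrow> i = j" "w i \<noteq> v j" "v j \<noteq> w i"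
  using assms unfolding JG_def inj_on_def by auto

lemma mx_inj: "JG w v \<Longrightarrow> inj_on (mx w v n) {..<m}"
  using JG_eqs by (auto simp: inj_on_def)

lemma mx_notin:
  assumes J: "JG w v" and ij: "i < m" "j < m" "i \<noteq> j" 
  shows "mx w v n i \<notin> others (mx w v k) i j" "w i \<notin> others (mx w v k) i j" "v i \<notin> others (mx w v k) i j"
    "w j \<notin> others (mx w v k) i j" "v j \<notin> others (mx w v k) i j"
    "others (mx w v k) i j \<subseteq> w ` {..<m} \<union> v ` ({..<m} - {j})"
  using JG_eqs[OF J] ij unfolding others_def by auto

lemma others_okT:
  assumes J: "JG w v" and ij: "i < m" "j < m" "i \<noteq> j" shows "okT 2 (others (mx w v n) i j)"
proof (rule gp_okT)
  show "gp (w ` {..<m} \<union> v ` {..<m})" using J unfolding JG_def by simp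
  show "others (mx w v n) i j \<subseteq> w ` {..<m} \<union> v ` {..<m}" unfolding others_def by auto
  show "card (others (mx w v n) i j) + 2 = m" by (rule card_others[OF mx_inj[OF J] ij])
qed

end

context moves_adj begin

text \<open>\<open>s0\<close> is among the generators because exchanging two labels in
  \<open>Pm_swap\<close> costs one half twist.\<close>

inductive_set loops :: "(nat \<Rightarrow> real^3) \<Rightarrow> 'g set" for w where
  loops_zero: "0 \<in> loops w"
| loops_s0: "s0 \<in> loops w"
| loops_add: "g \<in> loops w \<Longrightarrow> h \<in> loops w \<Longrightarrow> g + h \<in> loops w"
| loops_loop: "j < m \<Longrightarrow> gp (insert x (insert a (w ` {..<m}))) \<Longrightarrow> x \<notin> w ` {..<m} \<Longrightarrow> a \<notin> w ` {..<m} \<Longrightarrow> e = 1 \<or> e = - 1 \<Longrightarrow>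
    loop (oth w j) (w j) x a e \<in> loops w"

lemma loops_H: "g \<in> loops w \<Longrightarrow> g \<in> H"
  by (induction rule: loops.induct) (auto intro: H_zero s0_H H_add loop_H)

text \<open>Each loop is generic with respect to \<open>w\<close>, but the two need not be so with
  respect to each other. The second one is therefore perturbed before \<open>loop_comm\<close> is
  applied.\<close>

lemma loops_comm_distinct:
  assumes w: "inj_on w {..<m}" and ij: "i < m" "j < m" "i \<noteq> j"
    and 1: "gp (insert x (insert a (w ` {..<m})))" "x \<notin> w ` {..<m}" "a \<notin> w ` {..<m}" "e = 1 \<or> e = - 1"
    and 2: "gp (insert x' (insert a' (w ` {..<m})))" "x' \<notin> w ` {..<m}" "a' \<notin> w ` {..<m}" "e' = 1 \<or> e' = - 1"
  shows "loop (oth w i) (w i) x a e + loop (oth w j) (w j) x' a' e' = loop (oth w j) (w j) x' a' e' + loop (oth w i) (w i) x a e"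
proof -
  let ?T = "others w i j"
  have wW: "w i \<in> w ` {..<m}" "w j \<in> w ` {..<m}" "?T \<subseteq> w ` {..<m}" "oth w j \<subseteq> w ` {..<m}" using ij unfolding others_def oth_def by auto
  have wn: "w i \<noteq> w j" "w i \<notin> ?T" "w j \<notin> ?T" "w j \<notin> oth w j" using w ij unfolding others_def oth_def inj_on_def by auto
  have T: "okT 2 ?T" by (rule gp_okT[OF 1(1)]) (use wW card_others[OF w ij] in auto)
  have Tj: "okT 1 (oth w j)" by (rule gp_okT[OF 1(1)]) (use wW card_oth[OF w ij(2)] in auto)
  have "\<exists>x'' a''. gp (insert x'' (insert a'' (insert x (insert a (w ` {..<m}))))) \<and> x'' \<notin> insert x (insert a (w ` {..<m})) \<and>
     a'' \<notin> insert x (insert a (w ` {..<m})) \<and> x'' \<noteq> a'' \<and> loop (oth w j) (w j) x'' a'' e' = loop (oth w j) (w j) x' a' e'"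
  proof (rule loop_perturb[OF Tj _ _ _ _ _ _ 1(1) 2(4)])
    show "gp (insert (w j) (insert x' (insert a' (oth w j))))" by (rule gp_subset[OF 2(1)]) (use wW in auto)
  qed (use 2 wW wn in auto)
  then obtain x'' a'' where x'': "gp (insert x'' (insert a'' (insert x (insert a (w ` {..<m})))))" "x'' \<notin> insert x (insert a (w ` {..<m}))"
     "a'' \<notin> insert x (insert a (w ` {..<m}))" "x'' \<noteq> a''" "loop (oth w j) (w j) x'' a'' e' = loop (oth w j) (w j) x' a' e'" by blast
  have "loop (insert (w j) ?T) (w i) x a e + loop (insert (w i) ?T) (w j) x'' a'' e' = loop (insert (w i) ?T) (w j) x'' a'' e' + loop (insert (w j) ?T) (w i) x a e"
  proof (rule loop_comm[OF T _ _ _ _ _ 1(4) 2(4)])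
    show "gp (insert (w i) (insert x (insert a (insert (w j) (insert x'' (insert a'' ?T))))))"
      by (rule gp_subset[OF x''(1)]) (use wW in auto)
    show "{w i, x, a} \<inter> {w j, x'', a''} = {}" using wn wW x'' 1 by auto
    show "{w i, x, a, w j, x'', a''} \<inter> ?T = {}" using wn wW x'' 1 by auto
  qed (use wW x'' 1 in auto)
  from this[folded oth_others[OF ij] oth_others2[OF ij], unfolded x''(5)] show ?thesis .
qed

text \<open>If both loops belong to the same token, the first is rewritten by
  \<open>loop_transfer\<close> as a product of loops of another token \<open>k\<close>, each of
  which commutes with the second loop.\<close>

lemma loops_comm_gen:
  assumes w: "inj_on w {..<m}" and ij: "i < m" "j < m"
    and 1: "gp (insert x (insert a (w ` {..<m})))" "x \<notin> w ` {..<m}" "a \<notin> w ` {..<m}" "e = 1 \<or> e = - 1"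
    and 2: "gp (insert x' (insert a' (w ` {..<m})))" "x' \<notin> w ` {..<m}" "a' \<notin> w ` {..<m}" "e' = 1 \<or> e' = - 1"
  shows "loop (oth w i) (w i) x a e + loop (oth w j) (w j) x' a' e' = loop (oth w j) (w j) x' a' e' + loop (oth w i) (w i) x a e"
proof (cases "i = j")
  case False
  show ?thesis by (rule loops_comm_distinct[OF w ij False 1 2])
next
  case True
  have "\<exists>k. k < m \<and> k \<noteq> i" using m3 by (intro exI[of _ "if i = 0 then 1 else 0"]) auto
  then obtain k where k: "k < m" "k \<noteq> i" by auto
  let ?T = "others w i k"
  have wW: "w i \<in> w ` {..<m}" "w k \<in> w ` {..<m}" "?T \<subseteq> w ` {..<m}" using ij k unfolding others_def by auto
  have wn: "w i \<noteq> w k" "w i \<notin> ?T" "w k \<notin> ?T" using w ij k unfolding others_def inj_on_def by auto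
  have W: "w ` {..<m} = insert (w i) (insert (w k) ?T)" using ij k unfolding others_def by auto
  have T: "okT 2 ?T" by (rule gp_okT[OF 1(1)]) (use wW card_others[OF w ij(1) k(1) k(2)[symmetric]] in auto)
  have "\<exists>y. gp (insert y (insert (w i) (insert (w k) (insert x (insert a ?T))))) \<and> y \<notin> insert (w i) (insert (w k) (insert x (insert a ?T))) \<and>
    loop (insert (w k) ?T) (w i) x a e = loop (insert (w i) ?T) (w k) y x 1 + loop (insert (w i) ?T) (w k) x a e + loop (insert (w i) ?T) (w k) (e *\<^sub>R a) y 1"
  proof (rule loop_transfer[OF T])
    show "gp (insert (w i) (insert (w k) (insert x (insert a ?T))))" by (rule gp_subset[OF 1(1)]) (use wW in auto)
    show "{w i, w k} \<inter> {x, a} = {}" "{w i, w k, x, a} \<inter> ?T = {}" using 1 wW wn by auto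
  qed (use wn 1 in auto)
  then obtain y where y: "gp (insert y (insert (w i) (insert (w k) (insert x (insert a ?T)))))" "y \<notin> insert (w i) (insert (w k) (insert x (insert a ?T)))"
    "loop (insert (w k) ?T) (w i) x a e = loop (insert (w i) ?T) (w k) y x 1 + loop (insert (w i) ?T) (w k) x a e + loop (insert (w i) ?T) (w k) (e *\<^sub>R a) y 1" by blast
  let ?B = "loop (oth w j) (w j) x' a' e'"
  have c: "loop (oth w k) (w k) p b f + ?B = ?B + loop (oth w k) (w k) p b f"
    if "gp (insert p (insert b (w ` {..<m})))" "p \<notin> w ` {..<m}" "b \<notin> w ` {..<m}" "f = 1 \<or> f = - 1" for p b f
    by (rule loops_comm_distinct[OF w k(1) ij(2) _ that 2]) (use k True in auto)
  have yW: "y \<notin> w ` {..<m}" using y(2) unfolding W by auto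
  have c1: "loop (oth w k) (w k) y x 1 + ?B = ?B + loop (oth w k) (w k) y x 1"
    by (rule c) (use 1 yW in \<open>auto intro: gp_subset[OF y(1)] simp: W\<close>)
  have c2: "loop (oth w k) (w k) x a e + ?B = ?B + loop (oth w k) (w k) x a e"
    by (rule c[OF 1])
  have c3: "loop (oth w k) (w k) (e *\<^sub>R a) y 1 + ?B = ?B + loop (oth w k) (w k) (e *\<^sub>R a) y 1"
  proof (rule c)
    have g': "gp (insert a (insert y (w ` {..<m})))" unfolding W by (rule gp_subset[OF y(1)]) auto
    have an: "a \<notin> insert y (w ` {..<m})" using 1 y(2) by auto
    show "gp (insert (e *\<^sub>R a) (insert y (w ` {..<m})))" using 1(4) g' gp_minus(1)[OF g' an] by auto
    show "e *\<^sub>R a \<notin> w ` {..<m}" using 1(3,4) gp_minus(2)[OF g' an] by auto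
  qed (use yW in auto)
  have o: "oth w k = insert (w i) ?T" "oth w i = insert (w k) ?T"
    using oth_others[OF ij(1) k(1) k(2)[symmetric]] oth_others2[OF ij(1) k(1) k(2)[symmetric]] by auto
  note c' = commute_add[OF commute_add[OF c1 c2] c3]
  show ?thesis using c' unfolding o y(3) .
qed

lemma loops_commute:
  assumes w: "inj_on w {..<m}" and g: "g \<in> loops w" and h: "h \<in> loops w" shows "g + h = h + g"
  using g
proof (induction rule: loops.induct)
  case (loops_loop j x a e)
  let ?g = "loop (oth w j) (w j) x a e"
  have "h + ?g = ?g + h" using h
  proof (induction rule: loops.induct)
    case (loops_loop j' x' a' e')
    then show ?case using loops_comm_gen[OF w loops_loop(1) \<open>j < m\<close>] \<open>gp (insert x (insert a (w ` {..<m})))\<close> \<open>x \<notin> w ` {..<m}\<close> \<open>a \<notin> w ` {..<m}\<close> \<open>e = 1 \<or> e = - 1\<close> by blast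
  next
    case (loops_add g h)
    then show ?case using commute_add by blast
  qed (use s0_central[OF loop_H] in auto)
  then show ?case ..
next
  case (loops_add g g')
  then show ?case using commute_add by blast
next
  case loops_s0
  then show ?case by (rule s0_central[OF loops_H[OF h]])
qed simp

text \<open>Since \<open>k \<le> j\<close>, the loop passes only moves of tokens other than
  \<open>j\<close>.\<close>

lemma Pm_loop:
  assumes J: "JG w v" and j: "j < m" and g: "gp (insert x (insert a (w ` {..<m} \<union> v ` ({..<m} - {j}))))"
    and n: "x \<notin> w ` {..<m} \<union> v ` ({..<m} - {j})" "a \<notin> w ` {..<m} \<union> v ` ({..<m} - {j})" and e: "e = 1 \<or> e = - 1"
  shows "k \<le> j \<Longrightarrow> Pm w v k + loop (oth (mx w v k) j) (w j) x a e = loop (oth w j) (w j) x a e + Pm w v k"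
proof (induction k)
  case 0
  then show ?case by simp
next
  case (Suc k)
  have k: "k < m" "k \<noteq> j" "k < j" using Suc.prems j by auto
  let ?T = "others (mx w v k) k j"
  have m: "w j \<in> w ` {..<m}" "w k \<in> w ` {..<m}" "v k \<in> v ` ({..<m} - {j})" using j k by auto
  note mn = mx_notin[OF J k(1) j k(2), of k]
  have o: "oth (mx w v k) k = insert (w j) ?T" "oth (mx w v k) j = insert (w k) ?T"
    using oth_others[OF k(1) j k(2), of "mx w v k"] oth_others2[OF k(1) j k(2), of "mx w v k"] k by auto
  have o': "oth (mx w v (Suc k)) j = insert (v k) ?T"
    using oth_others2[OF k(1) j k(2), of "mx w v (Suc k)"] k unfolding others_def by (auto simp: less_Suc_eq)
  have "loop (insert (w k) ?T) (w j) x a e + mv (insert (w j) ?T) (w k) (v k) = mv (insert (w j) ?T) (w k) (v k) + loop (insert (v k) ?T) (w j) x a e"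
  proof (rule loop_mv_comm[OF others_okT[OF J k(1) j k(2)] _ _ _ _ e])
    show "gp (insert (w j) (insert x (insert a (insert (w k) (insert (v k) ?T)))))"
      by (rule gp_subset[OF g]) (use m mn in auto)
    show "{w j, x, a} \<inter> {w k, v k} = {}" using n m JG_eqs[OF J j k(1)] k by auto
    show "{w j, x, a, w k, v k} \<inter> ?T = {}" using n m mn by blast
    show "w j \<noteq> a" using n m by auto
  qed
  note c = this
  have "Pm w v (Suc k) + loop (oth (mx w v (Suc k)) j) (w j) x a e = Pm w v k + (mv (insert (w j) ?T) (w k) (v k) + loop (insert (v k) ?T) (w j) x a e)"
    unfolding o' Pm.simps o by (simp only: add.assoc)
  also have "\<dots> = (Pm w v k + loop (oth (mx w v k) j) (w j) x a e) + mv (insert (w j) ?T) (w k) (v k)"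
    unfolding c[symmetric] o by (simp only: add.assoc)
  also have "\<dots> = loop (oth w j) (w j) x a e + Pm w v (Suc k)"
    using Suc.IH k unfolding Pm.simps o by (simp add: add.assoc)
  finally show ?case .
qed

text \<open>An additional move of token \<open>j\<close> is pulled back past the moves of later
  tokens to the place where \<open>j\<close> itself was moved. There the broken path over
  \<open>v j\<close> is a loop at \<open>w j\<close> followed by a direct move, and the loop is
  carried to the front by \<open>Pm_loop\<close>.\<close>

lemma Pm_mv:
  assumes J: "JG w v" and j: "j < m" and g: "gp (insert a (w ` {..<m} \<union> v ` {..<m}))"
    and n: "a \<notin> w ` {..<m} \<union> v ` ({..<m} - {j})" and e: "e = 1 \<or> e = - 1"
  shows "Suc j \<le> k \<Longrightarrow> k \<le> m \<Longrightarrow> Pm w v k + mv (oth (mx w v k) j) (v j) a = loop (oth w j) (w j) (v j) a e + Pm w (v(j := e *\<^sub>R a)) k"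
proof (induction k rule: dec_induct)
  case base
  let ?T = "oth (mx w v j) j"
  have m: "w j \<in> w ` {..<m}" "v j \<in> v ` {..<m}" using j by auto
  have vj: "v j \<notin> w ` {..<m} \<union> v ` ({..<m} - {j})" using JG_eqs[OF J _ j] j by fastforce
  have Tsub: "?T \<subseteq> w ` {..<m} \<union> v ` ({..<m} - {j})" unfolding oth_def by auto
  have wjT: "w j \<notin> ?T" using JG_eqs[OF J j] unfolding oth_def by auto
  have T: "okT 1 ?T" by (rule gp_okT[OF g]) (use Tsub card_oth[OF mx_inj[OF J] j] in auto)
  have nD: "z \<notin> D" if "z \<in> insert a (w ` {..<m} \<union> v ` {..<m})" for z using gp_disjoint[OF g that] .
  have g': "gp (insert a (w ` {..<m} \<union> v ` ({..<m} - {j})))" by (rule gp_subset[OF g]) auto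
  have c1: "clr (?T \<union> D) a (w j) (w j)" by (rule gp_clr[OF g]) (use Tsub n m wjT nD in auto)
  have c2: "clr (?T \<union> D) (- a) (w j) (w j)"
    by (rule gp_clr[OF gp_minus(1)[OF g' n]])
      (use Tsub m wjT nD gp_minus(2)[OF g' n] gp_disjoint[OF gp_minus(1)[OF g' n]] in auto)
  have c: "clr (?T \<union> D) (e *\<^sub>R a) (w j) (w j)" using e c1 c2 by auto
  have r: "mv ?T (w j) (e *\<^sub>R a) = - mv ?T (e *\<^sub>R a) (w j)" by (rule mv_rev[OF T c])
  have p: "Pm w (v(j := e *\<^sub>R a)) j = Pm w v j" by (rule Pm_cong) auto
  have o: "oth (mx w v (Suc j)) j = ?T" "oth (mx w (v(j := e *\<^sub>R a)) j) j = ?T" unfolding oth_def by (auto simp: less_Suc_eq)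
  have l: "Pm w v j + loop ?T (w j) (v j) a e = loop (oth w j) (w j) (v j) a e + Pm w v j"
  proof (rule Pm_loop[OF J j _ vj n e])
    show "gp (insert (v j) (insert a (w ` {..<m} \<union> v ` ({..<m} - {j}))))" by (rule gp_subset[OF g]) (use j in auto)
  qed simp
  \<comment> \<open>The loop closes up by returning to \<open>w j\<close>; the direct move after it
    undoes this return.\<close>
  have "Pm w v (Suc j) + mv ?T (v j) a = (Pm w v j + loop ?T (w j) (v j) a e) + mv ?T (w j) (e *\<^sub>R a)"
    unfolding Pm.simps loop_def r by (simp only: add.assoc right_minus add_0_right)
  then show ?case unfolding l o unfolding Pm.simps p o by (simp add: add.assoc)
next
  case (step k)
  have k: "k < m" "k \<noteq> j" "j < k" using step by auto
  let ?T = "others (mx w v k) k j"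
  have m: "w j \<in> w ` {..<m}" "w k \<in> w ` {..<m}" "v k \<in> v ` ({..<m} - {j})" using j k by auto
  note mn = mx_notin[OF J k(1) j k(2), of k]
  have o: "oth (mx w v k) k = insert (v j) ?T" "oth (mx w v k) j = insert (w k) ?T"
    using oth_others[OF k(1) j k(2), of "mx w v k"] oth_others2[OF k(1) j k(2), of "mx w v k"] k by auto
  have o': "oth (mx w v (Suc k)) j = insert (v k) ?T"
    using oth_others2[OF k(1) j k(2), of "mx w v (Suc k)"] k unfolding others_def by (auto simp: less_Suc_eq)
  have o'': "oth (mx w (v(j := e *\<^sub>R a)) k) k = insert (e *\<^sub>R a) ?T"
    using oth_others[OF k(1) j k(2), of "mx w (v(j := e *\<^sub>R a)) k"] k unfolding others_def by auto
  \<comment> \<open>Tokens \<open>k\<close> and \<open>j\<close> are different, so their moves may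
    be interchanged whether or not their segments cross.\<close>
  have "mv (insert (v j) ?T) (w k) (v k) + mv (insert (v k) ?T) (v j) a = mv (insert (w k) ?T) (v j) a + mv (insert a ?T) (w k) (v k)"
  proof (rule generic_comm[OF others_okT[OF J k(1) j k(2)]])
    show "gp (insert (w k) (insert (v k) (insert (v j) (insert a ?T))))"
      by (rule gp_subset[OF g]) (use m mn j in auto)
    show "w k \<noteq> v j" "v k \<noteq> v j" using JG_eqs[OF J k(1) j] k by auto
    show "w k \<noteq> a" "v k \<noteq> a" "a \<notin> ?T" using n m mn by auto
  qed (use mn in auto)
  note c = this
  have IH: "Pm w v k + mv (oth (mx w v k) j) (v j) a = loop (oth w j) (w j) (v j) a e + Pm w (v(j := e *\<^sub>R a)) k"
    by (rule step.IH) (use k in simp)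
  have "Pm w v (Suc k) + mv (oth (mx w v (Suc k)) j) (v j) a = Pm w v k + (mv (insert (v j) ?T) (w k) (v k) + mv (insert (v k) ?T) (v j) a)"
    unfolding o' Pm.simps o by (simp only: add.assoc)
  also have "\<dots> = (Pm w v k + mv (oth (mx w v k) j) (v j) a) + mv (insert a ?T) (w k) (v k)"
    unfolding c o by (simp only: add.assoc)
  also have "\<dots> = loop (oth w j) (w j) (v j) a e + (Pm w (v(j := e *\<^sub>R a)) k + mv (insert (e *\<^sub>R a) ?T) (w k) (v k))"
    unfolding mv_sign_ctx[OF e] IH by (simp only: add.assoc)
  also have "\<dots> = loop (oth w j) (w j) (v j) a e + Pm w (v(j := e *\<^sub>R a)) (Suc k)"
    unfolding Pm.simps o'' using k by simp
  finally show ?case .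
qed

lemma Pm_move:
  assumes J: "JG w v" and j: "j < m" and g: "gp (insert a (w ` {..<m} \<union> v ` {..<m}))"
    and n: "a \<notin> w ` {..<m} \<union> v ` ({..<m} - {j})" and e: "e = 1 \<or> e = - 1"
  shows "\<exists>l\<in>loops w. Pm w v m + mv (oth v j) (v j) a = l + Pm w (v(j := e *\<^sub>R a)) m"
proof (rule bexI)
  have "oth (mx w v m) j = oth v j" unfolding oth_def by (auto simp: image_iff)
  then show "Pm w v m + mv (oth v j) (v j) a = loop (oth w j) (w j) (v j) a e + Pm w (v(j := e *\<^sub>R a)) m"
    using Pm_mv[OF J j g n e, of m] j by simp
  have "v j \<notin> w ` {..<m}" using JG_eqs[OF J _ j] by auto
  then show "loop (oth w j) (w j) (v j) a e \<in> loops w"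
    using n j by (intro loops_loop j e gp_subset[OF g]) auto
qed

text \<open>A half twist exchanging \<open>v i\<close> and \<open>v j\<close> consists of three
  moves, each of which is absorbed by \<open>Pm_move\<close>. Its value \<open>s0\<close> is central
  and cancels against a second copy of itself.\<close>

lemma Pm_swap:
  assumes J: "JG w v" and ij: "i < m" "j < m" "i \<noteq> j"
  shows "\<exists>l\<in>loops w. Pm w v m = l + Pm w (v(i := v j, j := v i)) m"
proof -
  let ?E = "w ` {..<m} \<union> v ` {..<m}" and ?T = "others v i j"
  have g: "gp ?E" using J unfolding JG_def by auto
  have nD: "z \<notin> D" if "z \<in> ?E" for z using gp_disjoint[OF g that] .
  have m: "v i \<in> v ` {..<m}" "v j \<in> v ` {..<m}" "?T \<subseteq> v ` {..<m}" using ij unfolding others_def by auto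
  have vn: "v i \<noteq> v j" "v i \<notin> ?T" "v j \<notin> ?T" using JG_eqs(2)[OF J] ij unfolding others_def by auto
  have cT: "card ?T + 2 = m" using J ij by (intro card_others) (auto simp: JG_def)
  have T: "okT 2 ?T" by (rule gp_okT[OF g]) (use m cT in auto)
  have cl: "clr (?T \<union> D) (v i) (v j) (v j)" by (rule gp_clr[OF g]) (use m vn nD in auto)
  have "clr (?T \<union> D) (v i) (v j) (v i)" by (rule clr_mono[OF cl]) auto
  then have "eventually (\<lambda>z. clr (?T \<union> D) (v i) (v j) z) (nhds (v i))"
    by (rule clr_eventually[OF finite_okT[OF T] _ tendsto_const tendsto_const]) (simp add: filterlim_ident)
  then obtain U where U: "open U" "v i \<in> U" "\<And>z. z \<in> U \<Longrightarrow> clr (?T \<union> D) (v i) (v j) z" unfolding eventually_nhds by blast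
  have "\<exists>z\<in>U. \<forall>E'\<in>{?E}. gp (insert z E') \<and> z \<notin> E'" by (rule gp_generic) (use g U in auto)
  then obtain z where z: "z \<in> U" "gp (insert z ?E)" "z \<notin> ?E" by auto
  have "dt (v i) (v j) z \<noteq> 0" by (rule gp_dt[OF z(2)]) (use m vn z in auto)
  then have s: "ht ?T (v i) (v j) z = s0"
    by (intro ht_s0[OF T _ vn U(3)[OF z(1)]]) (use m in \<open>auto intro!: gp_subset[OF g]\<close>)
  define v1 v2 where "v1 = v(i := z)" and "v2 = v1(j := v i)"
  have v3: "v2(i := v j) = v(i := v j, j := v i)" unfolding v2_def v1_def using ij by auto
  have im: "v1 ` {..<m} = insert z (insert (v j) ?T)" "v2 ` {..<m} = insert z (insert (v i) ?T)" "v ` {..<m} = insert (v i) (insert (v j) ?T)"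
    unfolding v2_def v1_def others_def using ij by auto
  have zn: "z \<notin> w ` {..<m}" "z \<noteq> v i" "z \<noteq> v j" "z \<notin> ?T" using z(3) im(3) by auto
  have wn: "v i \<notin> w ` {..<m}" "v j \<notin> w ` {..<m}" "?T \<inter> w ` {..<m} = {}" using J m unfolding JG_def by auto
  have inj: "inj_on v {..<m}" using J unfolding JG_def by auto
  have inj1: "inj_on v1 {..<m}" "inj_on v2 {..<m}"
    by (rule eq_card_imp_inj_on; use im zn vn cT in \<open>simp add: others_def\<close>)+
  have J1: "JG w v1" "JG w v2"
    unfolding JG_def by (intro conjI inj1 gp_subset[OF z(2)]; use J im zn wn in \<open>auto simp: JG_def\<close>)+
  have o: "oth v i = insert (v j) ?T" "oth v1 j = insert z ?T" "oth v2 i = insert (v i) ?T"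
    unfolding oth_def others_def v1_def v2_def using ij by auto
  have val: "v1 j = v j" "v2 i = z" using ij unfolding v1_def v2_def by auto
  have sub: "v1 ` ({..<m} - {j}) \<subseteq> insert z ?T" "v2 ` ({..<m} - {i}) \<subseteq> insert (v i) ?T" unfolding v1_def v2_def others_def by auto
  have n1: "v i \<notin> v1 ` ({..<m} - {j})" using sub(1) zn(2) vn(2) by blast
  have n2: "v j \<notin> v2 ` ({..<m} - {i})" using subsetD[OF sub(2), of "v j"] vn(1,3) by (metis insertE)
  obtain l1 where l1: "l1 \<in> loops w" "Pm w v m + mv (oth v i) (v i) z = l1 + Pm w v1 m"
    using Pm_move[OF J ij(1) z(2), of 1] z(3) unfolding v1_def by auto
  obtain l2 where l2: "l2 \<in> loops w" "Pm w v1 m + mv (oth v1 j) (v1 j) (v i) = l2 + Pm w v2 m"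
  proof -
    have "gp (insert (v i) (w ` {..<m} \<union> v1 ` {..<m}))" by (rule gp_subset[OF z(2)]) (use im in auto)
    from Pm_move[OF J1(1) ij(2) this, of 1] show ?thesis using that wn n1 unfolding v2_def by auto
  qed
  obtain l3 where l3: "l3 \<in> loops w" "Pm w v2 m + mv (oth v2 i) (v2 i) (v j) = l3 + Pm w (v(i := v j, j := v i)) m"
  proof -
    have "gp (insert (v j) (w ` {..<m} \<union> v2 ` {..<m}))" by (rule gp_subset[OF z(2)]) (use im in auto)
    from Pm_move[OF J1(2) ij(1) this, of 1] show ?thesis using that wn n2 unfolding v3[symmetric] by auto
  qed
  let ?P = "Pm w (v(i := v j, j := v i)) m"
  have "Pm w v m + s0 = (Pm w v m + mv (oth v i) (v i) z) + mv (oth v1 j) (v1 j) (v i) + mv (oth v2 i) (v2 i) (v j)"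
    unfolding s[symmetric] ht_def o val by (simp only: add.assoc)
  also have "\<dots> = l1 + (Pm w v1 m + mv (oth v1 j) (v1 j) (v i)) + mv (oth v2 i) (v2 i) (v j)"
    unfolding l1 by (simp only: add.assoc)
  also have "\<dots> = l1 + l2 + (Pm w v2 m + mv (oth v2 i) (v2 i) (v j))"
    unfolding l2 by (simp only: add.assoc)
  also have "\<dots> = (l1 + l2 + l3) + ?P" unfolding l3 by (simp only: add.assoc)
  finally have "s0 + Pm w v m = (l1 + l2 + l3) + ?P" using s0_central[OF Pm_H] by metis
  then have "s0 + (s0 + Pm w v m) = (s0 + (l1 + l2 + l3)) + ?P" by (simp only: add.assoc)
  then have "Pm w v m = (s0 + (l1 + l2 + l3)) + ?P" by (simp only: add.assoc[symmetric] s0_double add_0_left)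
  moreover have "s0 + (l1 + l2 + l3) \<in> loops w" using l1 l2 l3 by (intro loops_add loops_s0)
  ultimately show ?thesis by blast
qed

text \<open>The labels are sorted by transpositions. \<open>v\<close> and \<open>v'\<close> agree
  from \<open>k\<close> on, and one exchange makes them agree from \<open>k - 1\<close> on.\<close>

lemma Pm_relabel:
  assumes v': "inj_on v' {..<m}"
  shows "k \<le> m \<Longrightarrow> JG w v \<Longrightarrow> v ` {..<m} = v' ` {..<m} \<Longrightarrow> (\<And>i. k \<le> i \<Longrightarrow> i < m \<Longrightarrow> v i = v' i) \<Longrightarrow>
    \<exists>l\<in>loops w. Pm w v m = l + Pm w v' m"
proof (induction k arbitrary: v)
  case 0
  then have "Pm w v m = Pm w v' m" by (intro Pm_cong) auto
  then show ?case using loops_zero by (metis add_0_left)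
next
  case (Suc k)
  have k: "k < m" using Suc by auto
  then have "v' k \<in> v ` {..<m}" using Suc.prems(3) by auto
  then obtain i where i: "i < m" "v i = v' k" by auto
  have "i \<le> k"
  proof (rule ccontr)
    assume "\<not> i \<le> k"
    then have "v i = v' i" using Suc.prems(4)[of i] i by auto
    then show False using v' i k \<open>\<not> i \<le> k\<close> unfolding inj_on_def by (metis lessThan_iff order_refl)
  qed
  show ?case
  proof (cases "i = k")
    case True
    have "v l = v' l" if "k \<le> l" "l < m" for l using Suc.prems(4)[of l] that i True by (cases "l = k") auto
    then show ?thesis using Suc.IH[of v] Suc.prems k by auto
  next
    case False
    define u where "u = v(k := v i, i := v k)"
    have "bij_betw (id(k := i, i := k)) {..<m} {..<m}"
      using i k by (intro bij_betwI[of _ _ _ "id(k := i, i := k)"]) auto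
    then have b: "inj_on (id(k := i, i := k)) {..<m}" "(id(k := i, i := k)) ` {..<m} = {..<m}" by (auto simp: bij_betw_def)
    have u: "u = v \<circ> (id(k := i, i := k))" unfolding u_def using False by auto
    have im: "u ` {..<m} = v ` {..<m}" unfolding u image_comp[symmetric] b ..
    have "inj_on u {..<m}" unfolding u using Suc.prems(2) b by (intro comp_inj_on) (auto simp: JG_def)
    then have J: "JG w u" using Suc.prems(2) unfolding JG_def im by auto
    have "u l = v' l" if "k \<le> l" "l < m" for l
      using Suc.prems(4)[of l] that i \<open>i \<le> k\<close> False unfolding u_def by (cases "l = k") auto
    then obtain l where l: "l \<in> loops w" "Pm w u m = l + Pm w v' m" using Suc.IH[of u] J im Suc.prems k by auto
    obtain l' where "l' \<in> loops w" "Pm w v m = l' + Pm w u m" using Pm_swap[OF Suc.prems(2) k i(1)] False unfolding u_def by auto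
    then have "Pm w v m = (l' + l) + Pm w v' m" "l' + l \<in> loops w" using l loops_add by (auto simp: add.assoc)
    then show ?thesis by blast
  qed
qed

text \<open>\<open>F\<close> collects the configurations along the chain, together with those in
  which the old and the new place of a token are both present. Being independent of
  \<open>w\<close>, it allows \<open>w\<close> to be chosen generic for several chains at
  once.\<close>

lemma chain_Pm:
  assumes "chain b g S" "inj_on v0 {..<m}" "v0 ` {..<m} = b"
  shows "\<exists>F. finite F \<and> S \<in> F \<and> (\<forall>E\<in>F. gp E) \<and> (\<forall>w. inj_on w {..<m} \<longrightarrow> (\<forall>E\<in>F. gp (w ` {..<m} \<union> E) \<and> w ` {..<m} \<inter> E = {}) \<longrightarrow>
    (\<exists>v. inj_on v {..<m} \<and> v ` {..<m} = S \<and> (\<exists>l\<in>loops w. Pm w v0 m + g = l + Pm w v m)))"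
  using assms
proof (induction rule: chain.induct)
  case chain_refl
  show ?case
    by (rule exI[of _ "{b}"]) (use chain_refl loops_zero in \<open>auto intro!: exI[of _ v0] bexI[of _ 0]\<close>)
next
  case (chain_move g S x x')
  then obtain F where F: "finite F" "S \<in> F" "\<forall>E\<in>F. gp E" "\<And>w. inj_on w {..<m} \<Longrightarrow> (\<forall>E\<in>F. gp (w ` {..<m} \<union> E) \<and> w ` {..<m} \<inter> E = {}) \<Longrightarrow>
    (\<exists>v. inj_on v {..<m} \<and> v ` {..<m} = S \<and> (\<exists>l\<in>loops w. Pm w v0 m + g = l + Pm w v m))" by blast
  let ?S = "insert x' (S - {x})"
  have gS: "gp ?S" using chain_props[OF chain.chain_move[OF chain_move(1-4)]] by auto
  show ?case
  proof (intro exI[of _ "{?S, insert x' S} \<union> F"] conjI allI impI)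
    fix w assume w: "inj_on w {..<m}" "\<forall>E\<in>{?S, insert x' S} \<union> F. gp (w ` {..<m} \<union> E) \<and> w ` {..<m} \<inter> E = {}"
    then obtain v l where v: "inj_on v {..<m}" "v ` {..<m} = S" "l \<in> loops w" "Pm w v0 m + g = l + Pm w v m" using F(4)[of w] by blast
    have J: "JG w v" unfolding JG_def using w v F(2) by auto
    obtain j where j: "j < m" "v j = x" using v(2) chain_move(2) by auto
    have vj: "v ` ({..<m} - {j}) = S - {x}" using inj_on_image_set_diff[OF v(1), of "{..<m}" "{j}"] v(2) j by auto
    have "\<exists>l\<in>loops w. Pm w v m + mv (oth v j) (v j) x' = l + Pm w (v(j := 1 *\<^sub>R x')) m"
    proof (rule Pm_move[OF J j(1)])
      show "gp (insert x' (w ` {..<m} \<union> v ` {..<m}))" using w(2) v(2) by simp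
      show "x' \<notin> w ` {..<m} \<union> v ` ({..<m} - {j})" using w(2) vj chain_move(3) by auto
    qed simp
    then obtain l' where l': "l' \<in> loops w" "Pm w v m + mv (S - {x}) x x' = l' + Pm w (v(j := x')) m"
      unfolding oth_def vj j(2) by auto
    show "\<exists>v. inj_on v {..<m} \<and> v ` {..<m} = ?S \<and> (\<exists>l\<in>loops w. Pm w v0 m + (g + mv (S - {x}) x x') = l + Pm w v m)"
    proof (intro exI[of _ "v(j := x')"] conjI bexI[of _ "l + l'"])
      show "inj_on (v(j := x')) {..<m}" using v(1,2) chain_move(3) by (auto intro: inj_on_fun_updI)
      show "v(j := x') ` {..<m} = ?S" unfolding vj[symmetric] using j by auto
      show "l + l' \<in> loops w" using v l' loops_add by auto
      have "Pm w v0 m + (g + mv (S - {x}) x x') = l + (Pm w v m + mv (S - {x}) x x')" using v(4) by (simp only: add.assoc[symmetric])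
      then show "Pm w v0 m + (g + mv (S - {x}) x x') = l + l' + Pm w (v(j := x')) m" unfolding l' by (simp only: add.assoc)
    qed
  qed (use F gS chain_move in auto)
next
  case (chain_flip g S x)
  then obtain F where F: "finite F" "S \<in> F" "\<forall>E\<in>F. gp E" "\<And>w. inj_on w {..<m} \<Longrightarrow> (\<forall>E\<in>F. gp (w ` {..<m} \<union> E) \<and> w ` {..<m} \<inter> E = {}) \<Longrightarrow>
    (\<exists>v. inj_on v {..<m} \<and> v ` {..<m} = S \<and> (\<exists>l\<in>loops w. Pm w v0 m + g = l + Pm w v m))" by blast
  let ?S = "insert (- x) (S - {x})"
  have gS: "gp ?S" "card S = m" "gp S" using chain_props[OF chain.chain_flip[OF chain_flip(1,2)]] chain_props[OF chain_flip(1)] by auto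
  show ?case
  proof (intro exI[of _ "insert ?S F"] conjI allI impI)
    fix w assume w: "inj_on w {..<m}" "\<forall>E\<in>insert ?S F. gp (w ` {..<m} \<union> E) \<and> w ` {..<m} \<inter> E = {}"
    then obtain v l where v: "inj_on v {..<m}" "v ` {..<m} = S" "l \<in> loops w" "Pm w v0 m + g = l + Pm w v m" using F(4)[of w] by blast
    have J: "JG w v" unfolding JG_def using w v F(2) by auto
    obtain j where j: "j < m" "v j = x" using v(2) chain_flip(2) by auto
    have vj: "v ` ({..<m} - {j}) = S - {x}" using inj_on_image_set_diff[OF v(1), of "{..<m}" "{j}"] v(2) j by auto
    have "w ` {..<m} \<inter> S = {}" using w(2) F(2) by blast
    then have xw: "x \<notin> w ` {..<m}" using chain_flip(2) by blast
    have mx: "- x \<notin> S" using gp_neg_notin[OF gS(3) chain_flip(2)] by auto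
    have T: "okT 1 (S - {x})" by (rule gp_okT[OF gS(3)]) (use gS chain_flip(2) gp_finite[OF gS(3)] m3 in auto)
    have "clr (S - {x} \<union> D) x x x" by (rule gp_clr_point[OF gS(3)]) (use chain_flip(2) gp_disjoint[OF gS(3)] in auto)
    then have r: "mv (S - {x}) x x = 0" by (rule mv_refl[OF T])
    \<comment> \<open>A change of sign is treated as the trivial move from \<open>x\<close> to
      itself, absorbed with \<open>e = - 1\<close>; the resulting loop is one-sided.\<close>
    have "\<exists>l\<in>loops w. Pm w v m + mv (oth v j) (v j) x = l + Pm w (v(j := (- 1) *\<^sub>R x)) m"
    proof (rule Pm_move[OF J j(1)])
      show "gp (insert x (w ` {..<m} \<union> v ` {..<m}))" using w(2) v(2) F(2) chain_flip(2) by (simp add: insert_absorb)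
      show "x \<notin> w ` {..<m} \<union> v ` ({..<m} - {j})" using xw vj by auto
    qed simp
    then obtain l' where l': "l' \<in> loops w" "Pm w v m = l' + Pm w (v(j := - x)) m"
      unfolding oth_def vj j(2) r by auto
    show "\<exists>v. inj_on v {..<m} \<and> v ` {..<m} = ?S \<and> (\<exists>l\<in>loops w. Pm w v0 m + g = l + Pm w v m)"
    proof (intro exI[of _ "v(j := - x)"] conjI bexI[of _ "l + l'"])
      show "inj_on (v(j := - x)) {..<m}" using v(1,2) mx by (auto intro: inj_on_fun_updI)
      show "v(j := - x) ` {..<m} = ?S" unfolding vj[symmetric] using j by auto
      show "l + l' \<in> loops w" using v l' loops_add by auto
      show "Pm w v0 m + g = l + l' + Pm w (v(j := - x)) m" using v(4) l'(2) by (simp add: add.assoc)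
    qed
  qed (use F gS in auto)
qed

lemma ex_generic_labelling:
  fixes k :: nat
  assumes "finite F" "\<And>E. E \<in> F \<Longrightarrow> gp E" "b \<in> F"
  shows "\<exists>w. inj_on w {..<k} \<and> (\<forall>E\<in>F. gp (w ` {..<k} \<union> E) \<and> w ` {..<k} \<inter> E = {})"
proof (induction k)
  case 0 then show ?case using assms by auto
next
  case (Suc k)
  then obtain w where w: "inj_on w {..<k}" "\<forall>E\<in>F. gp (w ` {..<k} \<union> E) \<and> w ` {..<k} \<inter> E = {}" by blast
  have "\<exists>x\<in>UNIV. \<forall>E'\<in>(\<lambda>E. w ` {..<k} \<union> E) ` F. gp (insert x E') \<and> x \<notin> E'"
    by (rule gp_generic) (use assms w in auto)
  then obtain x where x: "\<And>E. E \<in> F \<Longrightarrow> gp (insert x (w ` {..<k} \<union> E)) \<and> x \<notin> w ` {..<k} \<union> E" by auto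
  define w' where "w' = w(k := x)"
  have im: "w' ` {..<Suc k} = insert x (w ` {..<k})" unfolding w'_def by (auto simp: lessThan_Suc)
  have inj: "inj_on w' {..<Suc k}" unfolding w'_def
    using w(1) x[OF assms(3)] by (auto simp: inj_on_def less_Suc_eq)
  have "gp (w' ` {..<Suc k} \<union> E) \<and> w' ` {..<Suc k} \<inter> E = {}" if "E \<in> F" for E
    unfolding im using w(2) x[OF that] that by auto
  then show ?case using inj by blast
qed

text \<open>A loop changes \<open>Pm w b\<close> by an element of the commutative monoid \<open>loops w\<close>, where the auxiliary
  labelling \<open>w\<close> can be chosen for any two loops simultaneously.\<close>
theorem H_commute:
  assumes "g \<in> H" "h \<in> H" shows "g + h = h + g"
proof -
  obtain b where b: "\<forall>g\<in>H. chain b g b" using H_chain by blast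
  have gb: "gp b" "card b = m" using b H_zero chain_props by auto
  obtain v0 where v0: "bij_betw v0 {..<m} b" using ex_bij_betw_nat_finite[OF gp_finite[OF gb(1)]] gb(2) by (auto simp: lessThan_atLeast0)
  then have v0: "inj_on v0 {..<m}" "v0 ` {..<m} = b" by (auto simp: bij_betw_def)
  have ch: "chain b g b" "chain b h b" using b assms by auto
  obtain F where F: "finite F" "b \<in> F" "\<forall>E\<in>F. gp E" "\<And>w. inj_on w {..<m} \<Longrightarrow> (\<forall>E\<in>F. gp (w ` {..<m} \<union> E) \<and> w ` {..<m} \<inter> E = {}) \<Longrightarrow>
    (\<exists>v. inj_on v {..<m} \<and> v ` {..<m} = b \<and> (\<exists>l\<in>loops w. Pm w v0 m + g = l + Pm w v m))" using chain_Pm[OF ch(1) v0] by blast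
  obtain F' where F': "finite F'" "b \<in> F'" "\<forall>E\<in>F'. gp E" "\<And>w. inj_on w {..<m} \<Longrightarrow> (\<forall>E\<in>F'. gp (w ` {..<m} \<union> E) \<and> w ` {..<m} \<inter> E = {}) \<Longrightarrow>
    (\<exists>v. inj_on v {..<m} \<and> v ` {..<m} = b \<and> (\<exists>l\<in>loops w. Pm w v0 m + h = l + Pm w v m))" using chain_Pm[OF ch(2) v0] by blast
  have gF: "\<And>E. E \<in> F \<union> F' \<Longrightarrow> gp E" using F(3) F'(3) by blast
  obtain w where w: "inj_on w {..<m}" "\<forall>E\<in>F \<union> F'. gp (w ` {..<m} \<union> E) \<and> w ` {..<m} \<inter> E = {}"
    using ex_generic_labelling[of "F \<union> F'" b m, OF _ gF] F(1,2) F'(1) by blast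
  obtain v l where v: "inj_on v {..<m}" "v ` {..<m} = b" "l \<in> loops w" "Pm w v0 m + g = l + Pm w v m" using F(4)[of w] w by blast
  obtain v' l' where v': "inj_on v' {..<m}" "v' ` {..<m} = b" "l' \<in> loops w" "Pm w v0 m + h = l' + Pm w v' m" using F'(4)[of w] w by blast
  have J: "JG w v" "JG w v'" unfolding JG_def using w v v' F by auto
  obtain k where k: "k \<in> loops w" "Pm w v m = k + Pm w v0 m" using Pm_relabel[OF v0(1) order_refl J(1)] v v0 by auto
  obtain k' where k': "k' \<in> loops w" "Pm w v' m = k' + Pm w v0 m" using Pm_relabel[OF v0(1) order_refl J(2)] v' v0 by auto
  let ?P = "Pm w v0 m"
  have g: "?P + g = (l + k) + ?P" using v(4) k(2) by (simp add: add.assoc)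
  have h: "?P + h = (l' + k') + ?P" using v'(4) k'(2) by (simp add: add.assoc)
  have c: "(l + k) + (l' + k') = (l' + k') + (l + k)" by (rule loops_commute[OF w(1)]) (use v v' k k' loops_add in auto)
  have "?P + (g + h) = (l + k) + (?P + h)" using g by (simp only: add.assoc[symmetric])
  also have "\<dots> = ((l + k) + (l' + k')) + ?P" unfolding h by (simp only: add.assoc)
  also have "\<dots> = (l' + k') + ((l + k) + ?P)" unfolding c by (simp only: add.assoc)
  also have "\<dots> = (l' + k') + ?P + g" unfolding g[symmetric] by (simp only: add.assoc)
  also have "\<dots> = ?P + (h + g)" unfolding h[symmetric] by (simp only: add.assoc)
  finally show ?thesis by simp
qed

end

subsection \<open>Paths up to homotopy\<close>

definition path_rev :: "(real \<Rightarrow> 'a) \<Rightarrow> real \<Rightarrow> 'a" where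
  "path_rev p = (\<lambda>t. p (1 - t))"

lemma path_join_ends [simp]: "path_join p q 0 = p 0" "path_join p q 1 = q 1"
  by (simp_all add: path_join_def)

lemma path_rev_ends [simp]: "path_rev p 0 = p 1" "path_rev p 1 = p 0"
  by (simp_all add: path_rev_def)

lemma continuous_map_comp_on:
  assumes "continuous_map (top_of_set S) T f" "continuous_on R \<phi>" "\<phi> ` R \<subseteq> S"
  shows "continuous_map (top_of_set R) T (\<lambda>z. f (\<phi> z))"
proof -
  have "continuous_map (top_of_set R) (top_of_set S) \<phi>" using assms(2,3) by (auto simp: continuous_map_in_subtopology)
  from continuous_map_compose[OF this assms(1)] show ?thesis by (simp add: o_def)
qed

lemma continuous_map_glue:
  fixes g :: "'a::topological_space \<Rightarrow> real"
  assumes g: "continuous_on S g" and f1: "continuous_map (top_of_set {z\<in>S. g z \<le> c}) T f1"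
    and f2: "continuous_map (top_of_set {z\<in>S. c \<le> g z}) T f2" and eq: "\<And>z. z \<in> S \<Longrightarrow> g z = c \<Longrightarrow> f1 z = f2 z"
  shows "continuous_map (top_of_set S) T (\<lambda>z. if g z \<le> c then f1 z else f2 z)"
proof (rule continuous_map_cases_le)
  show "continuous_map (top_of_set S) euclideanreal g" using g by simp
  have e: "{z. z \<in> topspace (top_of_set S) \<and> P z} = {z\<in>S. P z}" "S \<inter> {z\<in>S. P z} = {z\<in>S. P z}" for P by auto
  show "continuous_map (subtopology (top_of_set S) {x. x \<in> topspace (top_of_set S) \<and> g x \<le> c}) T f1"
    "continuous_map (subtopology (top_of_set S) {x. x \<in> topspace (top_of_set S) \<and> c \<le> g x}) T f2"
    unfolding e subtopology_subtopology by (rule f1 f2)+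
qed (use eq in auto)

lemma path_homotopic_iff:
  fixes T :: "'a topology"
  shows "path_homotopic T p q \<longleftrightarrow> (\<exists>h::real \<times> real \<Rightarrow> 'a. continuous_map (top_of_set ({0..1} \<times> {0..1})) T h \<and> (\<forall>t\<in>{0..1}. h (0, t) = p t) \<and> (\<forall>t\<in>{0..1}. h (1, t) = q t)
     \<and> (\<forall>s\<in>{0..1}. h (s, 0) = p 0 \<and> h (s, 1) = p 1))"
proof -
  have "homotopic_with (\<lambda>r. r 0 = p 0 \<and> r 1 = p 1) (top_of_set {0..1}) T p q \<longleftrightarrow>
    (\<exists>h::real \<times> real \<Rightarrow> 'a. continuous_map (prod_topology (subtopology euclideanreal {0..1}) (top_of_set {0..1})) T h
        \<and> (\<forall>x \<in> topspace (top_of_set {0..1}). h (0, x) = p x)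
        \<and> (\<forall>x \<in> topspace (top_of_set {0..1}). h (1, x) = q x)
        \<and> (\<forall>t \<in> {0..1}. (\<lambda>x. h (t, x)) 0 = p 0 \<and> (\<lambda>x. h (t, x)) 1 = p 1))"
    by (rule homotopic_with) auto
  then show ?thesis unfolding path_homotopic_def by (simp add: prod_topology_subtopology_eu)
qed

lemma path_homotopic_pathin: assumes "path_homotopic T p q" shows "pathin T p" "pathin T q"
  using homotopic_with_imp_continuous_maps assms unfolding path_homotopic_def pathin_def by blast+

lemma path_homotopic_ends: assumes "path_homotopic T p q" shows "q 0 = p 0" "q 1 = p 1"
  using homotopic_with_imp_property assms unfolding path_homotopic_def by blast+

lemma path_homotopic_sym: "path_homotopic T p q \<Longrightarrow> path_homotopic T q p"
  using path_homotopic_ends[of T p q] unfolding path_homotopic_def by (simp add: homotopic_with_sym[of _ _ _ p q])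

lemma path_homotopic_trans [trans]: "path_homotopic T p q \<Longrightarrow> path_homotopic T q r \<Longrightarrow> path_homotopic T p r"
  using path_homotopic_ends[of T p q] unfolding path_homotopic_def by (auto intro: homotopic_with_trans)

lemma path_homotopic_eq: "pathin T p \<Longrightarrow> (\<And>t. 0 \<le> t \<Longrightarrow> t \<le> 1 \<Longrightarrow> p t = q t) \<Longrightarrow> path_homotopic T p q"
  unfolding path_homotopic_def pathin_def by (rule homotopic_with_equal) auto

lemma path_homotopic_refl: "pathin T p \<Longrightarrow> path_homotopic T p p"
  by (rule path_homotopic_eq) auto

text \<open>Two parameter changes with the same ends are joined by convex combination. The groupoid
  laws below reduce to this.\<close>

lemma path_homotopic_reparam:
  assumes p: "pathin T p" and f: "continuous_on {0..1} \<phi>" "\<phi> ` {0..1} \<subseteq> {0..1}" and g: "continuous_on {0..1} \<psi>" "\<psi> ` {0..1} \<subseteq> {0..1}"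
    and e: "\<phi> 0 = \<psi> 0" "\<phi> 1 = \<psi> 1"
  shows "path_homotopic T (\<lambda>t. p (\<phi> t)) (\<lambda>t. p (\<psi> t))"
  unfolding path_homotopic_iff
proof (intro exI[of _ "\<lambda>(s, t). p ((1 - s) * \<phi> t + s * \<psi> t)"] conjI)
  have c: "continuous_on ({0..1} \<times> {0..1}) (\<lambda>z. (1 - fst z) * \<phi> (snd z) + fst z * \<psi> (snd z))"
    by (intro continuous_intros continuous_on_compose2[OF f(1)] continuous_on_compose2[OF g(1)]) auto
  have "(\<lambda>z. (1 - fst z) * \<phi> (snd z) + fst z * \<psi> (snd z)) ` ({0..1} \<times> {0..1}) \<subseteq> {0..1}"
  proof (clarsimp)
    fix s t :: real assume st: "0 \<le> s" "s \<le> 1" "0 \<le> t" "t \<le> 1"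
    then have "\<phi> t \<in> {0..1}" "\<psi> t \<in> {0..1}" using f(2) g(2) by (simp_all add: image_subset_iff)
    then have "0 \<le> \<phi> t" "\<phi> t \<le> 1" "0 \<le> \<psi> t" "\<psi> t \<le> 1" by auto
    then show "0 \<le> (1 - s) * \<phi> t + s * \<psi> t \<and> (1 - s) * \<phi> t + s * \<psi> t \<le> 1"
      using st by (auto intro: convex_bound_le[of _ 1 _ "1 - s" s])
  qed
  from continuous_map_comp_on[OF p[unfolded pathin_def] c this]
  show "continuous_map (top_of_set ({0..1} \<times> {0..1})) T (\<lambda>(s, t). p ((1 - s) * \<phi> t + s * \<psi> t))" by (simp add: case_prod_unfold)
qed (use e in \<open>auto simp: algebra_simps\<close>)

lemma pathin_join: assumes "pathin T p" "pathin T q" "p 1 = q 0" shows "pathin T (path_join p q)"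
  unfolding pathin_def path_join_def
proof (rule continuous_map_glue)
  show "continuous_map (top_of_set {t \<in> {0..1}. t \<le> 1/2}) T (\<lambda>t. p (2 * t))"
    by (rule continuous_map_comp_on[OF assms(1)[unfolded pathin_def]]) (auto intro!: continuous_intros)
  show "continuous_map (top_of_set {t \<in> {0..1}. 1/2 \<le> t}) T (\<lambda>t. q (2 * t - 1))"
    by (rule continuous_map_comp_on[OF assms(2)[unfolded pathin_def]]) (auto intro!: continuous_intros)
  show "p (2 * t) = q (2 * t - 1)" if "t = 1/2" for t using assms(3) unfolding that by simp
qed (auto intro!: continuous_intros)

lemma pathin_rev: "pathin T p \<Longrightarrow> pathin T (path_rev p)"
  unfolding pathin_def path_rev_def by (rule continuous_map_comp_on) (auto intro!: continuous_intros)

lemma pathin_const_iff: "pathin T (\<lambda>t. x) \<longleftrightarrow> x \<in> topspace T"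
proof -
  have "topspace (top_of_set {0..1::real}) \<noteq> {}" by simp
  then have "top_of_set {0..1::real} \<noteq> trivial_topology" by (metis null_topspace_iff_trivial)
  then show ?thesis unfolding pathin_def by simp
qed

lemma pathin_ends: "pathin T p \<Longrightarrow> p 0 \<in> topspace T \<and> p 1 \<in> topspace T"
  unfolding pathin_def using continuous_map_image_subset_topspace by fastforce

lemma path_homotopic_join:
  fixes T :: "'a topology"
  assumes "path_homotopic T p p'" "path_homotopic T q q'" "p 1 = q 0"
  shows "path_homotopic T (path_join p q) (path_join p' q')"
proof -
  obtain h :: "real \<times> real \<Rightarrow> 'a" where h: "continuous_map (top_of_set ({0..1} \<times> {0..1})) T h" "\<forall>t\<in>{0..1}. h (0, t) = p t" "\<forall>t\<in>{0..1}. h (1, t) = p' t"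
     "\<forall>s\<in>{0..1}. h (s, 0) = p 0 \<and> h (s, 1) = p 1" using assms(1) unfolding path_homotopic_iff by blast
  obtain k :: "real \<times> real \<Rightarrow> 'a" where k: "continuous_map (top_of_set ({0..1} \<times> {0..1})) T k" "\<forall>t\<in>{0..1}. k (0, t) = q t" "\<forall>t\<in>{0..1}. k (1, t) = q' t"
     "\<forall>s\<in>{0..1}. k (s, 0) = q 0 \<and> k (s, 1) = q 1" using assms(2) unfolding path_homotopic_iff by blast
  show ?thesis unfolding path_homotopic_iff
  proof (intro exI[of _ "\<lambda>z. if snd z \<le> 1/2 then h (fst z, 2 * snd z) else k (fst z, 2 * snd z - 1)"] conjI)
    show "continuous_map (top_of_set ({0..1} \<times> {0..1})) T (\<lambda>z. if snd z \<le> 1/2 then h (fst z, 2 * snd z) else k (fst z, 2 * snd z - 1))"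
    proof (rule continuous_map_glue)
      show "continuous_map (top_of_set {z \<in> {0..1} \<times> {0..1}. snd z \<le> 1/2}) T (\<lambda>z. h (fst z, 2 * snd z))"
        by (rule continuous_map_comp_on[OF h(1)]) (auto intro!: continuous_intros)
      show "continuous_map (top_of_set {z \<in> {0..1} \<times> {0..1}. 1/2 \<le> snd z}) T (\<lambda>z. k (fst z, 2 * snd z - 1))"
        by (rule continuous_map_comp_on[OF k(1)]) (auto intro!: continuous_intros)
      show "h (fst z, 2 * snd z) = k (fst z, 2 * snd z - 1)" if "z \<in> {0..1} \<times> {0..1}" "snd z = 1/2" for z
        using that(1) h(4) k(4) assms(3) unfolding that(2) by auto
    qed (auto intro!: continuous_intros)
  qed (use h k in \<open>auto simp: path_join_def\<close>)
qed

lemma path_homotopic_assoc: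
  assumes "pathin T p" "pathin T q" "pathin T r" "p 1 = q 0" "q 1 = r 0"
  shows "path_homotopic T (path_join (path_join p q) r) (path_join p (path_join q r))"
proof -
  \<comment> \<open>The change of parameter has slopes 1/2, 1 and 2. It is convex, hence the maximum
    of three linear functions.\<close>
  let ?f = "path_join (path_join p q) r" and ?\<phi> = "\<lambda>t::real. max (t / 2) (max (t - 1/4) (2 * t - 1))"
  have f: "pathin T ?f" using assms by (intro pathin_join) auto
  have 1: "path_homotopic T (\<lambda>t. ?f t) (\<lambda>t. ?f (?\<phi> t))"
    by (rule path_homotopic_reparam[OF f]) (auto intro!: continuous_intros simp: le_max_iff_disj)
  have "path_homotopic T (\<lambda>t. ?f (?\<phi> t)) (path_join p (path_join q r))"
  proof (rule path_homotopic_eq)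
    fix t :: real assume t: "0 \<le> t" "t \<le> 1"
    consider "t \<le> 1/2" | "1/2 < t" "t \<le> 3/4" | "3/4 < t" by linarith
    then show "?f (?\<phi> t) = path_join p (path_join q r) t"
    proof cases
      case 1
      then have "?\<phi> t = t / 2" by auto
      then show ?thesis using 1 t by (simp add: path_join_def)
    next
      case 2
      then have e: "?\<phi> t = t - 1/4" by auto
      show ?thesis using 2 unfolding e by (auto simp: path_join_def algebra_simps)
    next
      case 3
      then have e: "?\<phi> t = 2 * t - 1" by auto
      have "\<not> 2 * t - 1 \<le> 1/2" "\<not> t \<le> 1/2" using 3 by linarith+
      then show ?thesis unfolding e path_join_def by (simp only: if_False)
    qed
  qed (use path_homotopic_pathin(2)[OF 1] in simp)
  from path_homotopic_trans[OF 1 this] show ?thesis .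
qed

lemma path_homotopic_lid: assumes "pathin T p" shows "path_homotopic T (path_join (\<lambda>t. p 0) p) p"
proof -
  have 1: "path_homotopic T (\<lambda>t. p (max 0 (2 * t - 1))) (\<lambda>t. p t)"
    by (rule path_homotopic_reparam[OF assms]) (auto intro!: continuous_intros)
  have "path_homotopic T (\<lambda>t. p (max 0 (2 * t - 1))) (path_join (\<lambda>t. p 0) p)"
    by (rule path_homotopic_eq[OF path_homotopic_pathin(1)[OF 1]]) (simp_all add: path_join_def max_absorb1 max_absorb2)
  then show ?thesis using 1 path_homotopic_sym path_homotopic_trans by fastforce
qed

lemma path_homotopic_rid: assumes "pathin T p" shows "path_homotopic T (path_join p (\<lambda>t. p 1)) p"
proof -
  have 1: "path_homotopic T (\<lambda>t. p (min 1 (2 * t))) (\<lambda>t. p t)"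
    by (rule path_homotopic_reparam[OF assms]) (auto intro!: continuous_intros)
  have "path_homotopic T (\<lambda>t. p (min 1 (2 * t))) (path_join p (\<lambda>t. p 1))"
    by (rule path_homotopic_eq[OF path_homotopic_pathin(1)[OF 1]]) (simp_all add: path_join_def min_absorb1 min_absorb2)
  then show ?thesis using 1 path_homotopic_sym path_homotopic_trans by fastforce
qed

lemma path_homotopic_rinv: assumes "pathin T p" shows "path_homotopic T (path_join p (path_rev p)) (\<lambda>t. p 0)"
proof -
  have 1: "path_homotopic T (\<lambda>t. p (min (2 * t) (2 - 2 * t))) (\<lambda>t. p 0)"
    by (rule path_homotopic_reparam[OF assms, of _ "\<lambda>t. 0"]) (auto intro!: continuous_intros)
  have "path_homotopic T (\<lambda>t. p (min (2 * t) (2 - 2 * t))) (path_join p (path_rev p))"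
    by (rule path_homotopic_eq[OF path_homotopic_pathin(1)[OF 1]]) (auto simp: path_join_def path_rev_def min_def)
  then show ?thesis using 1 path_homotopic_sym path_homotopic_trans by blast
qed

lemma path_homotopic_linv: assumes "pathin T p" shows "path_homotopic T (path_join (path_rev p) p) (\<lambda>t. p 1)"
  using path_homotopic_rinv[OF pathin_rev[OF assms]] by (simp add: path_rev_def)

lemma loop_class_eq:
  assumes "loop_at T b g" "loop_at T b h"
  shows "loop_class T b g = loop_class T b h \<longleftrightarrow> path_homotopic T g h"
proof
  assume "loop_class T b g = loop_class T b h"
  moreover have "h \<in> loop_class T b h" using assms(2) by (auto simp: loop_class_def loop_at_def intro: path_homotopic_refl)
  ultimately show "path_homotopic T g h" unfolding loop_class_def by blast
next
  assume "path_homotopic T g h"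
  then show "loop_class T b g = loop_class T b h"
    unfolding loop_class_def using path_homotopic_sym path_homotopic_trans by blast
qed

lemma loop_class_some:
  assumes "loop_at T b g"
  shows "loop_at T b (SOME a. a \<in> loop_class T b g)" "path_homotopic T g (SOME a. a \<in> loop_class T b g)"
proof -
  have "g \<in> loop_class T b g" using assms by (auto simp: loop_class_def loop_at_def intro: path_homotopic_refl)
  then have "(SOME a. a \<in> loop_class T b g) \<in> loop_class T b g" by (rule someI[of "\<lambda>a. a \<in> loop_class T b g"])
  then show "loop_at T b (SOME a. a \<in> loop_class T b g)" "path_homotopic T g (SOME a. a \<in> loop_class T b g)"
    by (simp_all add: loop_class_def)
qed

lemma loop_at_join: "loop_at T b g \<Longrightarrow> loop_at T b h \<Longrightarrow> loop_at T b (path_join g h)"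
  unfolding loop_at_def by (auto intro: pathin_join)

lemma loop_at_rev: "loop_at T b g \<Longrightarrow> loop_at T b (path_rev g)"
  unfolding loop_at_def by (auto intro: pathin_rev)

lemma fundamental_group_mult:
  assumes "loop_at T b g" "loop_at T b h"
  shows "loop_class T b g \<otimes>\<^bsub>fundamental_group T b\<^esub> loop_class T b h = loop_class T b (path_join g h)"
proof -
  let ?g = "SOME a. a \<in> loop_class T b g" and ?h = "SOME a. a \<in> loop_class T b h"
  note s = loop_class_some[OF assms(1)] loop_class_some[OF assms(2)]
  have "path_homotopic T (path_join g h) (path_join ?g ?h)"
    by (rule path_homotopic_join[OF s(2,4)]) (use assms in \<open>auto simp: loop_at_def\<close>)
  then have "loop_class T b (path_join g h) = loop_class T b (path_join ?g ?h)"
    using loop_class_eq[OF loop_at_join[OF assms] loop_at_join[OF s(1,3)]] by simp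
  then show ?thesis by (simp add: fundamental_group_def)
qed

lemma fundamental_group_carrier: "x \<in> carrier (fundamental_group T b) \<longleftrightarrow> (\<exists>g. loop_at T b g \<and> x = loop_class T b g)"
  by (auto simp: fundamental_group_def)

lemma fundamental_group_one: "\<one>\<^bsub>fundamental_group T b\<^esub> = loop_class T b (\<lambda>t. b)"
  by (simp add: fundamental_group_def)

theorem group_fundamental_group:
  assumes b: "b \<in> topspace T" shows "group (fundamental_group T b)"
proof (rule groupI)
  let ?G = "fundamental_group T b"
  have l1: "loop_at T b (\<lambda>t. b)" using b by (simp add: loop_at_def pathin_const_iff)
  show "\<one>\<^bsub>?G\<^esub> \<in> carrier ?G" unfolding fundamental_group_carrier fundamental_group_one using l1 by blast
  fix x assume "x \<in> carrier ?G"
  then obtain g where g: "loop_at T b g" "x = loop_class T b g" unfolding fundamental_group_carrier by blast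
  show "\<one>\<^bsub>?G\<^esub> \<otimes>\<^bsub>?G\<^esub> x = x"
    unfolding fundamental_group_one g(2) fundamental_group_mult[OF l1 g(1)] loop_class_eq[OF loop_at_join[OF l1 g(1)] g(1)]
    using path_homotopic_lid[of T g] g(1) by (simp add: loop_at_def)
  show "\<exists>y\<in>carrier ?G. y \<otimes>\<^bsub>?G\<^esub> x = \<one>\<^bsub>?G\<^esub>"
  proof (rule bexI[of _ "loop_class T b (path_rev g)"])
    show "loop_class T b (path_rev g) \<otimes>\<^bsub>?G\<^esub> x = \<one>\<^bsub>?G\<^esub>"
      unfolding fundamental_group_one g(2) fundamental_group_mult[OF loop_at_rev[OF g(1)] g(1)] loop_class_eq[OF loop_at_join[OF loop_at_rev[OF g(1)] g(1)] l1]
      using path_homotopic_linv[of T g] g(1) by (simp add: loop_at_def)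
  qed (use loop_at_rev[OF g(1)] in \<open>auto simp: fundamental_group_carrier\<close>)
  fix y assume "y \<in> carrier ?G"
  then obtain h where h: "loop_at T b h" "y = loop_class T b h" unfolding fundamental_group_carrier by blast
  show "x \<otimes>\<^bsub>?G\<^esub> y \<in> carrier ?G"
    unfolding g(2) h(2) fundamental_group_mult[OF g(1) h(1)] fundamental_group_carrier using loop_at_join[OF g(1) h(1)] by blast
  fix z assume "z \<in> carrier ?G"
  then obtain k where k: "loop_at T b k" "z = loop_class T b k" unfolding fundamental_group_carrier by blast
  show "x \<otimes>\<^bsub>?G\<^esub> y \<otimes>\<^bsub>?G\<^esub> z = x \<otimes>\<^bsub>?G\<^esub> (y \<otimes>\<^bsub>?G\<^esub> z)"
    unfolding g(2) h(2) k(2) fundamental_group_mult[OF g(1) h(1)] fundamental_group_mult[OF h(1) k(1)]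
      fundamental_group_mult[OF loop_at_join[OF g(1) h(1)] k(1)] fundamental_group_mult[OF g(1) loop_at_join[OF h(1) k(1)]]
      loop_class_eq[OF loop_at_join[OF loop_at_join[OF g(1) h(1)] k(1)] loop_at_join[OF g(1) loop_at_join[OF h(1) k(1)]]]
    using g h k by (intro path_homotopic_assoc) (auto simp: loop_at_def)
qed

text \<open>A homomorphism \<open>\<psi>\<close> on the fundamental group extends to a functor \<open>Fp\<close> on all paths, after a choice of paths from the
  base point; \<open>Fp\<close> vanishes on paths outside of the component of the base point.\<close>
locale path_functor =
  fixes T :: "'a topology" and c :: 'a and \<psi> :: "(real \<Rightarrow> 'a) set \<Rightarrow> 'g::group_add"
  assumes c: "c \<in> topspace T"
    and hom: "\<And>g h. loop_at T c g \<Longrightarrow> loop_at T c h \<Longrightarrow> \<psi> (loop_class T c (path_join g h)) = \<psi> (loop_class T c g) + \<psi> (loop_class T c h)"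
begin

text \<open>The path chosen for \<open>c\<close> itself is constant, so that \<open>Fp\<close>
  agrees with \<open>\<psi>\<close> on loops at \<open>c\<close>.\<close>

definition from_c :: "'a \<Rightarrow> (real \<Rightarrow> 'a) \<Rightarrow> bool" where
  "from_c x r \<longleftrightarrow> pathin T r \<and> r 0 = c \<and> r 1 = x \<and> (x = c \<longrightarrow> r = (\<lambda>t. c))"

definition conn :: "'a \<Rightarrow> bool" where
  "conn x \<longleftrightarrow> (\<exists>r. from_c x r)"

definition rp :: "'a \<Rightarrow> real \<Rightarrow> 'a" where
  "rp x = (SOME r. from_c x r)"

definition Fp :: "(real \<Rightarrow> 'a) \<Rightarrow> 'g" where
  "Fp p = (if conn (p 0) then \<psi> (loop_class T c (path_join (path_join (rp (p 0)) p) (path_rev (rp (p 1))))) else 0)"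

lemma connI: "pathin T r \<Longrightarrow> r 0 = c \<Longrightarrow> conn (r 1)"
  unfolding conn_def from_c_def using c by (cases "r 1 = c") (auto simp: pathin_const_iff)

lemma rp: "conn x \<Longrightarrow> from_c x (rp x)"
  unfolding rp_def conn_def by (rule someI_ex[of "from_c x"])

lemma conn_end: assumes "pathin T p" "conn (p 0)" shows "conn (p 1)"
  using connI[of "path_join (rp (p 0)) p"] rp[OF assms(2)] assms(1) by (auto simp: from_c_def intro: pathin_join)

lemma conn_start: assumes "pathin T p" "conn (p 1)" shows "conn (p 0)"
  using conn_end[OF pathin_rev[OF assms(1)]] assms by simp

lemma Fp_loop_at:
  assumes "pathin T p" "conn (p 0)"
  shows "loop_at T c (path_join (path_join (rp (p 0)) p) (path_rev (rp (p 1))))"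
proof -
  have "from_c (p 0) (rp (p 0))" "from_c (p 1) (rp (p 1))" using rp assms conn_end by blast+
  then show ?thesis using assms unfolding from_c_def loop_at_def by (auto intro!: pathin_join pathin_rev)
qed

lemma Fp_homotopic: assumes "path_homotopic T p q" shows "Fp p = Fp q"
proof -
  note e = path_homotopic_ends[OF assms] and pq = path_homotopic_pathin[OF assms]
  show ?thesis
  proof (cases "conn (p 0)")
    case True
    then have r: "from_c (p 0) (rp (p 0))" "from_c (p 1) (rp (p 1))" using rp pq conn_end by blast+
    have "path_homotopic T (path_join (path_join (rp (p 0)) p) (path_rev (rp (p 1)))) (path_join (path_join (rp (p 0)) q) (path_rev (rp (p 1))))"
      by (intro path_homotopic_join path_homotopic_refl assms) (use r in \<open>auto simp: from_c_def intro: pathin_rev\<close>)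
    then show ?thesis using loop_class_eq[OF Fp_loop_at[OF pq(1) True], of "path_join (path_join (rp (p 0)) q) (path_rev (rp (p 1)))"]
        Fp_loop_at[OF pq(2)] True e unfolding Fp_def by simp
  next
    case False
    then show ?thesis using e unfolding Fp_def by simp
  qed
qed

lemma Fp_join:
  assumes p: "pathin T p" and q: "pathin T q" and e: "p 1 = q 0" shows "Fp (path_join p q) = Fp p + Fp q"
proof (cases "conn (p 0)")
  case True
  have t1: "conn (q 0)" using conn_end[OF p] True e by auto
  then have r: "from_c (p 0) (rp (p 0))" "from_c (q 0) (rp (q 0))" "from_c (q 1) (rp (q 1))" using rp True conn_end[OF q] by blast+
  let ?a = "rp (p 0)" and ?b = "rp (q 0)" and ?d = "path_rev (rp (q 1))"
  have pa: "pathin T ?a" "pathin T ?b" "pathin T ?d" "?a 1 = p 0" "?b 1 = q 0" "?d 0 = q 1" "?a 0 = c" "?b 0 = c" "?d 1 = c"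
    using r by (auto simp: from_c_def intro: pathin_rev)
  note [intro] = pathin_join pathin_rev
  have "path_homotopic T (path_join (path_join (path_join ?a p) (path_rev ?b)) (path_join (path_join ?b q) ?d))
      (path_join (path_join ?a p) (path_join (path_rev ?b) (path_join (path_join ?b q) ?d)))"
    by (rule path_homotopic_assoc) (use pa p q e in auto)
  also have "path_homotopic T (path_join (path_join ?a p) (path_join (path_rev ?b) (path_join (path_join ?b q) ?d)))
      (path_join (path_join ?a p) (path_join q ?d))"
  proof (rule path_homotopic_join[OF path_homotopic_refl])
    have "path_homotopic T (path_join (path_rev ?b) (path_join (path_join ?b q) ?d)) (path_join (path_join (path_rev ?b) (path_join ?b q)) ?d)"
      by (intro path_homotopic_sym[OF path_homotopic_assoc]) (use pa p q e in auto)
    also have "path_homotopic T (path_join (path_join (path_rev ?b) (path_join ?b q)) ?d) (path_join q ?d)"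
    proof (rule path_homotopic_join[OF _ path_homotopic_refl])
      have "path_homotopic T (path_join (path_rev ?b) (path_join ?b q)) (path_join (path_join (path_rev ?b) ?b) q)"
        by (intro path_homotopic_sym[OF path_homotopic_assoc]) (use pa p q e in auto)
      also have "path_homotopic T (path_join (path_join (path_rev ?b) ?b) q) (path_join (\<lambda>t. ?b 1) q)"
        by (intro path_homotopic_join path_homotopic_refl path_homotopic_linv) (use pa q in auto)
      also have "path_homotopic T (path_join (\<lambda>t. ?b 1) q) q" using path_homotopic_lid[OF q] pa by simp
      finally show "path_homotopic T (path_join (path_rev ?b) (path_join ?b q)) q" .
    qed (use pa q in auto)
    finally show "path_homotopic T (path_join (path_rev ?b) (path_join (path_join ?b q) ?d)) (path_join q ?d)" .
  qed (use pa p e in auto)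
  also have "path_homotopic T (path_join (path_join ?a p) (path_join q ?d)) (path_join (path_join (path_join ?a p) q) ?d)"
    by (intro path_homotopic_sym[OF path_homotopic_assoc]) (use pa p q e in auto)
  also have "path_homotopic T (path_join (path_join (path_join ?a p) q) ?d) (path_join (path_join ?a (path_join p q)) ?d)"
    by (rule path_homotopic_join[OF path_homotopic_assoc path_homotopic_refl]) (use pa p q e in auto)
  finally have h: "path_homotopic T (path_join (path_join (path_join ?a p) (path_rev ?b)) (path_join (path_join ?b q) ?d)) (path_join (path_join ?a (path_join p q)) ?d)" .
  have l: "loop_at T c (path_join (path_join ?a p) (path_rev ?b))" "loop_at T c (path_join (path_join ?b q) ?d)"
    "loop_at T c (path_join (path_join ?a (path_join p q)) ?d)"
    using Fp_loop_at[OF p True] Fp_loop_at[OF q t1] Fp_loop_at[OF pathin_join[OF p q e]] True e by auto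
  show ?thesis
    using h[folded loop_class_eq[OF loop_at_join[OF l(1,2)] l(3)]] hom[OF l(1,2)] True t1 e unfolding Fp_def by simp
next
  case False
  then have "\<not> conn (q 0)" using conn_start[OF p] e by auto
  then show ?thesis using False unfolding Fp_def by simp
qed

lemma Fp_const: assumes "x \<in> topspace T" shows "Fp (\<lambda>t. x) = 0"
proof -
  have p: "pathin T (\<lambda>t. x)" using assms by (simp add: pathin_const_iff)
  have "Fp (path_join (\<lambda>t. x) (\<lambda>t. x)) = Fp (\<lambda>t. x) + Fp (\<lambda>t. x)" by (rule Fp_join[OF p p]) simp
  moreover have "path_join (\<lambda>t. x) (\<lambda>t. x) = (\<lambda>t. x)" by (auto simp: path_join_def)
  ultimately show ?thesis by (metis add_0_right add_left_cancel)
qed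

lemma Fp_loop: assumes g: "loop_at T c g" shows "Fp g = \<psi> (loop_class T c g)"
proof -
  have e: "pathin T g" "g 0 = c" "g 1 = c" using g by (auto simp: loop_at_def)
  have "from_c c (\<lambda>t. c)" using c by (simp add: from_c_def pathin_const_iff)
  then have ex: "conn (g 0)" using e by (auto simp: conn_def)
  then have r: "rp c = (\<lambda>t. c)" using rp[of c] e ex unfolding from_c_def by auto
  have "path_homotopic T (path_join (path_join (\<lambda>t. g 0) g) (\<lambda>t. g 1)) (path_join g (\<lambda>t. g 1))"
    by (intro path_homotopic_join path_homotopic_lid path_homotopic_refl) (use e c in \<open>auto simp: pathin_const_iff\<close>)
  also have "path_homotopic T (path_join g (\<lambda>t. g 1)) g" by (rule path_homotopic_rid[OF e(1)])
  finally have "path_homotopic T (path_join (path_join (\<lambda>t. c) g) (\<lambda>t. c)) g" unfolding e .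
  moreover have "path_rev (\<lambda>t. c) = (\<lambda>t. c)" by (simp add: path_rev_def)
  ultimately show ?thesis using loop_class_eq[OF Fp_loop_at[OF e(1) ex] g] ex unfolding Fp_def e r by simp
qed

lemma Fp_range: "pathin T p \<Longrightarrow> \<exists>g. loop_at T c g \<and> Fp p = \<psi> (loop_class T c g)"
proof (cases "conn (p 0)")
  case True
  assume "pathin T p"
  then show ?thesis using Fp_loop_at[of p] True unfolding Fp_def by auto
next
  case False
  have "loop_at T c (\<lambda>t. c)" using c by (simp add: loop_at_def pathin_const_iff)
  moreover have "Fp p = 0" using False by (simp add: Fp_def)
  ultimately show ?thesis using Fp_loop[of "\<lambda>t. c"] Fp_const[OF c] by metis
qed

lemma Fp_rev: assumes "pathin T p" shows "Fp (path_rev p) = - Fp p"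
proof -
  have "Fp (path_join p (path_rev p)) = Fp (\<lambda>t. p 0)" by (rule Fp_homotopic[OF path_homotopic_rinv[OF assms]])
  then have "Fp p + Fp (path_rev p) = 0" using Fp_join[OF assms pathin_rev[OF assms]] Fp_const[of "p 0"] pathin_ends[OF assms] by simp
  then show ?thesis by (metis minus_unique)
qed

end

subsection \<open>Configurations of points\<close>

lemma istopology_quotient: "istopology (\<lambda>U. U \<subseteq> q ` topspace T \<and> openin T {x \<in> topspace T. q x \<in> U})"
  unfolding istopology_def
proof (intro conjI allI impI)
  fix S U assume *: "S \<subseteq> q ` topspace T \<and> openin T {x \<in> topspace T. q x \<in> S}" "U \<subseteq> q ` topspace T \<and> openin T {x \<in> topspace T. q x \<in> U}"
  have "{x \<in> topspace T. q x \<in> S \<inter> U} = {x \<in> topspace T. q x \<in> S} \<inter> {x \<in> topspace T. q x \<in> U}" by auto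
  then show "openin T {x \<in> topspace T. q x \<in> S \<inter> U}" using * by auto
  show "S \<inter> U \<subseteq> q ` topspace T" using * by auto
next
  fix K assume *: "\<forall>S\<in>K. S \<subseteq> q ` topspace T \<and> openin T {x \<in> topspace T. q x \<in> S}"
  have "{x \<in> topspace T. q x \<in> \<Union> K} = (\<Union>S\<in>K. {x \<in> topspace T. q x \<in> S})" by auto
  then show "openin T {x \<in> topspace T. q x \<in> \<Union> K}" using * by auto
  show "\<Union> K \<subseteq> q ` topspace T" using * by auto
qed

lemma openin_quotient: "openin (quotient_topology T q) U \<longleftrightarrow> U \<subseteq> q ` topspace T \<and> openin T {x \<in> topspace T. q x \<in> U}"
  unfolding quotient_topology_def by (subst topology_inverse') (rule istopology_quotient, simp)

lemma topspace_quotient [simp]: "topspace (quotient_topology T q) = q ` topspace T"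
proof
  show "topspace (quotient_topology T q) \<subseteq> q ` topspace T" using openin_quotient[of T q] openin_topspace by blast
  have "{x \<in> topspace T. q x \<in> q ` topspace T} = topspace T" by auto
  then have "openin (quotient_topology T q) (q ` topspace T)" unfolding openin_quotient by simp
  then show "q ` topspace T \<subseteq> topspace (quotient_topology T q)" by (rule openin_subset)
qed

lemma continuous_map_quotient: "continuous_map T (quotient_topology T q) q"
  unfolding continuous_map by (auto simp: openin_quotient)

text \<open>Normalisation by \<open>sgn\<close> extends the quotient map of the sphere to all
  nonzero vectors, so representatives may be rescaled and moved along straight lines.\<close>

definition pr :: "real^3 \<Rightarrow> (real^3) set" where
  "pr v = {sgn v, - sgn v}"

lemma pr_minus [simp]: "pr (- v) = pr v"
  by (auto simp: pr_def sgn_minus)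

lemma pr_scale: "k > 0 \<Longrightarrow> pr (k *\<^sub>R v) = pr v"
  by (simp add: pr_def sgn_scaleR)

lemma pr_sgn [simp]: "pr (sgn v) = pr v"
proof -
  have "sgn (sgn v) = sgn v" by (cases "v = 0") (auto simp: sgn_div_norm)
  then show ?thesis by (simp add: pr_def)
qed

lemma pr_unit: "norm v = 1 \<Longrightarrow> pr v = {v, - v}"
  by (simp add: pr_def sgn_div_norm)

lemma pr_eq_unit: assumes "norm v = 1" "norm w = 1" shows "pr v = pr w \<longleftrightarrow> w = v \<or> w = - v"
  unfolding pr_unit[OF assms(1)] pr_unit[OF assms(2)] by (auto simp: doubleton_eq_iff)

lemma pr_eq_iff: assumes "v \<noteq> 0" "w \<noteq> 0" shows "pr v = pr w \<longleftrightarrow> cross3 v w = 0"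
proof
  assume "pr v = pr w"
  then have "sgn v = sgn w \<or> sgn v = - sgn w" by (auto simp: pr_def doubleton_eq_iff)
  then have "cross3 (sgn v) (sgn w) = 0" by auto
  then have "inverse (norm w) *\<^sub>R inverse (norm v) *\<^sub>R cross3 v w = 0"
    unfolding sgn_div_norm cross_mult_left cross_mult_right .
  then show "cross3 v w = 0" using assms by simp
next
  assume "cross3 v w = 0"
  then obtain k where k: "v = k *\<^sub>R w" using assms by (auto simp: cross3_eq_0_iff)
  then have "k \<noteq> 0" using assms by auto
  then consider "k > 0" | "- k > 0" by linarith
  then show "pr v = pr w"
  proof cases
    case 1 then show ?thesis unfolding k by (rule pr_scale)
  next
    case 2
    have "v = - ((- k) *\<^sub>R w)" using k by simp
    then show ?thesis using pr_scale[OF 2, of w] by (metis pr_minus)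
  qed
qed

lemma topspace_RP2: "topspace RP2 = pr ` {v. norm v = 1}"
  unfolding RP2_def by (auto simp: pr_unit image_iff)

lemma continuous_map_pr:
  assumes "continuous_map Z euclidean f" "\<And>z. z \<in> topspace Z \<Longrightarrow> f z \<noteq> 0"
  shows "continuous_map Z RP2 (\<lambda>z. pr (f z))"
proof -
  have "continuous_on (- {0}) (sgn :: real^3 \<Rightarrow> real^3)"
    unfolding sgn_div_norm by (intro continuous_intros) auto
  then have s: "continuous_map (top_of_set (- {0})) (top_of_set (sphere (0::real^3) 1)) sgn"
    by (auto simp: continuous_map_in_subtopology norm_sgn)
  have "continuous_map Z (top_of_set (- {0})) f"
    using assms by (auto simp: continuous_map_in_subtopology)
  from continuous_map_compose[OF continuous_map_compose[OF this s] continuous_map_quotient]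
  show ?thesis by (simp add: RP2_def o_def pr_def)
qed

text \<open>\<open>D\<close> selects one unit vector for each puncture in \<open>P\<close>.\<close>

locale conf =
  fixes m :: nat and D :: "(real^3) set" and P :: "(real^3) set set"
  assumes fin_D: "finite D" and D_ne: "D \<noteq> {}" and D_unit: "d \<in> D \<Longrightarrow> norm d = 1"
    and D_cross: "d \<in> D \<Longrightarrow> e \<in> D \<Longrightarrow> d \<noteq> e \<Longrightarrow> cross3 d e \<noteq> 0" and P_eq: "P = pr ` D"
begin

abbreviation "C \<equiv> unordered_conf (punctured_RP2 P) m"

definition cfg :: "(nat \<Rightarrow> real^3) \<Rightarrow> (real^3) set set" where
  "cfg w = pr ` w ` {..<m}"

definition adml :: "(nat \<Rightarrow> real^3) \<Rightarrow> bool" where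
  "adml w \<longleftrightarrow> (\<forall>i<m. \<forall>j<m. i \<noteq> j \<longrightarrow> cross3 (w i) (w j) \<noteq> 0) \<and> (\<forall>i<m. \<forall>d\<in>D. cross3 (w i) d \<noteq> 0)"

lemma adml_nz: "adml w \<Longrightarrow> i < m \<Longrightarrow> w i \<noteq> 0"
proof
  assume *: "adml w" "i < m" "w i = 0"
  obtain d where "d \<in> D" using D_ne by auto
  then have "cross3 (w i) d \<noteq> 0" using * unfolding adml_def by blast
  then show False using *(3) by simp
qed

lemma D_nz: "d \<in> D \<Longrightarrow> d \<noteq> 0"
  using D_unit by fastforce

lemma adml_pr: assumes "adml w" shows "i < m \<Longrightarrow> pr (w i) \<notin> P" "i < m \<Longrightarrow> j < m \<Longrightarrow> pr (w i) = pr (w j) \<longleftrightarrow> i = j"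
proof -
  show "pr (w i) \<notin> P" if "i < m"
  proof
    assume "pr (w i) \<in> P"
    then obtain d where d: "d \<in> D" "pr (w i) = pr d" using P_eq by auto
    then have "cross3 (w i) d = 0" using pr_eq_iff[OF adml_nz[OF assms that] D_nz[OF d(1)]] by simp
    then show False using assms that d unfolding adml_def by blast
  qed
  show "i < m \<Longrightarrow> j < m \<Longrightarrow> pr (w i) = pr (w j) \<longleftrightarrow> i = j"
    using pr_eq_iff[OF adml_nz[OF assms] adml_nz[OF assms], of i j] assms unfolding adml_def by auto
qed

lemma topspace_X: "topspace (punctured_RP2 P) = pr ` {v. norm v = 1} - P"
  unfolding punctured_RP2_def by (auto simp: topspace_RP2)

lemma topspace_ordered: "topspace (ordered_conf (punctured_RP2 P) m) = {g \<in> {..<m} \<rightarrow>\<^sub>E topspace (punctured_RP2 P). inj_on g {..<m}}"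
  unfolding ordered_conf_def by (auto simp: topspace_subtopology topspace_product_topology)

lemma continuous_map_cfg:
  assumes c: "\<And>i. i < m \<Longrightarrow> continuous_map Z euclidean (\<lambda>z. w z i)" and a: "\<And>z. z \<in> topspace Z \<Longrightarrow> adml (w z)"
  shows "continuous_map Z C (\<lambda>z. cfg (w z))"
proof -
  have 1: "continuous_map Z (punctured_RP2 P) (\<lambda>z. pr (w z i))" if i: "i < m" for i
  proof -
    have "continuous_map Z RP2 (\<lambda>z. pr (w z i))" by (rule continuous_map_pr[OF c[OF i]]) (use a adml_nz i in blast)
    moreover from this have "pr (w z i) \<in> topspace RP2" if "z \<in> topspace Z" for z
      using continuous_map_image_subset_topspace that by fastforce
    ultimately show ?thesis unfolding punctured_RP2_def
      using adml_pr(1)[OF a i] by (auto simp: continuous_map_in_subtopology)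
  qed
  let ?g = "\<lambda>z. \<lambda>i\<in>{..<m}. pr (w z i)"
  have "continuous_map Z (product_topology (\<lambda>i. punctured_RP2 P) {..<m}) ?g"
    unfolding continuous_map_componentwise using 1 by (auto intro: continuous_map_eq)
  moreover have "inj_on (?g z) {..<m}" if "z \<in> topspace Z" for z
    using adml_pr(2)[OF a[OF that]] by (auto simp: inj_on_def)
  ultimately have "continuous_map Z (ordered_conf (punctured_RP2 P) m) ?g"
    unfolding ordered_conf_def by (auto simp: continuous_map_in_subtopology)
  from continuous_map_compose[OF this continuous_map_quotient[of _ "\<lambda>g. g ` {..<m}"]]
  have "continuous_map Z C ((\<lambda>g. g ` {..<m}) \<circ> ?g)" unfolding unordered_conf_def .
  moreover have "(\<lambda>g. g ` {..<m}) \<circ> ?g = (\<lambda>z. cfg (w z))" by (auto simp: cfg_def image_image fun_eq_iff)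
  ultimately show ?thesis by simp
qed

definition lab :: "(real^3) set set \<Rightarrow> (nat \<Rightarrow> real^3) \<Rightarrow> bool" where
  "lab c w \<longleftrightarrow> adml w \<and> (\<forall>i<m. norm (w i) = 1) \<and> c = cfg w"

lemma ex_lab: assumes "c \<in> topspace C" shows "\<exists>w. lab c w"
proof -
  obtain g where g: "g \<in> topspace (ordered_conf (punctured_RP2 P) m)" "c = g ` {..<m}"
    using assms unfolding unordered_conf_def by auto
  have gi: "g i \<in> pr ` {v. norm v = 1} - P" if "i < m" for i
    using g(1) that unfolding topspace_ordered topspace_X[symmetric] by auto
  then have "\<forall>i. \<exists>v. i < m \<longrightarrow> norm v = 1 \<and> g i = pr v" by fastforce
  then obtain w where w: "\<And>i. i < m \<Longrightarrow> norm (w i) = 1 \<and> g i = pr (w i)" by metis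
  have nz: "w i \<noteq> 0" if "i < m" for i using w[OF that] by fastforce
  have "adml w" unfolding adml_def
  proof (intro conjI allI impI ballI)
    fix i j assume ij: "i < m" "j < m" "i \<noteq> j"
    then have "g i \<noteq> g j" using g(1) unfolding topspace_ordered inj_on_def by auto
    then show "cross3 (w i) (w j) \<noteq> 0" using w ij pr_eq_iff[OF nz nz] by metis
  next
    fix i d assume i: "i < m" "d \<in> D"
    then have "pr (w i) \<noteq> pr d" using gi[OF i(1)] w[OF i(1)] P_eq by auto
    then show "cross3 (w i) d \<noteq> 0" using pr_eq_iff[OF nz D_nz] i by metis
  qed
  moreover have "c = cfg w" unfolding g(2) cfg_def image_image using w by auto
  ultimately show ?thesis using w unfolding lab_def by blast
qed

lemma cfg_topspace: assumes "adml w" shows "cfg w \<in> topspace C"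
proof -
  have "continuous_map (top_of_set {0::real}) C (\<lambda>z. cfg w)"
    using assms by (intro continuous_map_cfg) auto
  from continuous_map_image_subset_topspace[OF this] show ?thesis by simp
qed

lemma card_cfg: "adml w \<Longrightarrow> card (cfg w) = m"
  unfolding cfg_def image_image using adml_pr(2) by (subst card_image) (auto simp: inj_on_def)

text \<open>On ordered configurations the condition becomes a union over the index of the point that
  is represented in \<open>B\<close>.\<close>

lemma openin_meets:
  assumes B: "open B"
  shows "openin C {c \<in> topspace C. \<exists>x\<in>B. norm x = 1 \<and> pr x \<in> c}"
proof -
  let ?X = "punctured_RP2 P" and ?O = "ordered_conf (punctured_RP2 P) m"
  let ?U = "pr ` {x \<in> B. norm x = 1}"
  have "{x \<in> sphere 0 1. {x, - x} \<in> ?U} = sphere 0 1 \<inter> (B \<union> uminus ` B)"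
  proof (rule Set.set_eqI)
    fix x :: "real^3"
    have "{x, - x} \<in> ?U \<longleftrightarrow> x \<in> B \<or> - x \<in> B" if n: "norm x = 1"
    proof
      assume "{x, - x} \<in> ?U"
      then obtain v where v: "v \<in> B" "norm v = 1" "pr x = pr v" using pr_unit[OF n] by auto
      then have "v = x \<or> v = - x" using pr_eq_unit[OF n v(2)] by blast
      then show "x \<in> B \<or> - x \<in> B" using v by auto
    next
      assume "x \<in> B \<or> - x \<in> B"
      then have "pr x \<in> ?U"
      proof
        assume "- x \<in> B"
        then have "pr (- x) \<in> ?U" using n by (intro imageI) simp
        then show ?thesis by simp
      qed (use n in \<open>auto intro: imageI\<close>)
      then show "{x, - x} \<in> ?U" using pr_unit[OF n] by simp
    qed
    moreover have "x \<in> uminus ` B \<longleftrightarrow> - x \<in> B" by force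
    ultimately show "x \<in> {x \<in> sphere 0 1. {x, - x} \<in> ?U} \<longleftrightarrow> x \<in> sphere 0 1 \<inter> (B \<union> uminus ` B)" by auto
  qed
  moreover have "open (B \<union> uminus ` B)" using B by (intro open_Un open_negations)
  ultimately have "openin (top_of_set (sphere 0 1)) {x \<in> sphere 0 1. {x, - x} \<in> ?U}" by (simp only: openin_open_Int)
  moreover have "?U \<subseteq> topspace RP2" unfolding topspace_RP2 by auto
  ultimately have "openin RP2 ?U" unfolding RP2_def openin_quotient by simp
  then have "openin ?X (?U \<inter> (topspace RP2 - P))" unfolding punctured_RP2_def by (rule openin_subtopology_Int)
  moreover have "?U \<inter> (topspace RP2 - P) = topspace ?X \<inter> ?U" unfolding punctured_RP2_def by auto
  ultimately have UX: "openin ?X (topspace ?X \<inter> ?U)" by simp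
  have pi: "openin ?O {g \<in> topspace ?O. g i \<in> topspace ?X \<inter> ?U}" if "i < m" for i
  proof (rule openin_continuous_map_preimage[OF _ UX])
    show "continuous_map ?O ?X (\<lambda>g. g i)" unfolding ordered_conf_def
      by (intro continuous_map_from_subtopology continuous_map_product_projection) (use that in simp)
  qed
  have "{g \<in> topspace ?O. g ` {..<m} \<in> {c \<in> topspace C. \<exists>x\<in>B. norm x = 1 \<and> pr x \<in> c}} = (\<Union>i<m. {g \<in> topspace ?O. g i \<in> topspace ?X \<inter> ?U})"
  proof -
    have "g ` {..<m} \<in> topspace C" if "g \<in> topspace ?O" for g using that unfolding unordered_conf_def by auto
    moreover have "g i \<in> topspace ?X" if "g \<in> topspace ?O" "i < m" for g i using that unfolding topspace_ordered by auto
    ultimately show ?thesis by (auto simp: image_iff) (metis lessThan_iff)+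
  qed
  moreover have "openin ?O (\<Union>i<m. {g \<in> topspace ?O. g i \<in> topspace ?X \<inter> ?U})" using pi by auto
  ultimately show ?thesis unfolding unordered_conf_def openin_quotient by auto
qed

text \<open>The balls \<open>ball (q i) r\<close> represent disjoint sets of points of the punctured projective plane.\<close>
definition isbox :: "(nat \<Rightarrow> real^3) \<Rightarrow> real \<Rightarrow> bool" where
  "isbox q r \<longleftrightarrow> 0 < r \<and> r \<le> 1 \<and> (\<forall>u. (\<forall>i<m. u i \<in> ball (q i) r) \<longrightarrow> adml u)"

definition inbox :: "(nat \<Rightarrow> real^3) \<Rightarrow> real \<Rightarrow> (nat \<Rightarrow> real^3) \<Rightarrow> bool" where
  "inbox q r u \<longleftrightarrow> (\<forall>i<m. u i \<in> ball (q i) r)"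

lemma isbox_adml: "isbox q r \<Longrightarrow> inbox q r u \<Longrightarrow> adml u"
  unfolding isbox_def inbox_def by blast

lemma isbox_cross:
  assumes "isbox q r" "i < m" "j < m" "i \<noteq> j" "x \<in> ball (q i) r" "y \<in> ball (q j) r" shows "cross3 x y \<noteq> 0"
proof -
  have "inbox q r (q(i := x, j := y))" using assms unfolding inbox_def isbox_def by auto
  from isbox_adml[OF assms(1) this] show ?thesis using assms unfolding adml_def by (metis fun_upd_apply)
qed

text \<open>Being non-parallel is an open condition on a pair of vectors, and only finitely many
  pairs of tokens or of a token and a puncture are involved.\<close>

lemma ex_isbox: assumes a: "adml q" shows "\<exists>r. isbox q r"
proof -
  have 1: "\<exists>r>0. \<forall>x\<in>ball a r. \<forall>y\<in>ball b r. cross3 x y \<noteq> 0" if "cross3 a b \<noteq> 0" for a b :: "real^3"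
  proof -
    have "open {p :: (real^3) \<times> (real^3). cross3 (fst p) (snd p) \<noteq> 0}"
      by (intro open_Collect_neq continuous_on_cross continuous_intros)
    moreover have "(a, b) \<in> {p. cross3 (fst p) (snd p) \<noteq> 0}" using that by simp
    ultimately obtain A B where "open A" "open B" "(a, b) \<in> A \<times> B" "A \<times> B \<subseteq> {p. cross3 (fst p) (snd p) \<noteq> 0}"
      by (rule open_prod_elim)
    then have AB: "open A" "open B" "a \<in> A" "b \<in> B" "A \<times> B \<subseteq> {p. cross3 (fst p) (snd p) \<noteq> 0}" by auto
    obtain r s where "r > 0" "ball a r \<subseteq> A" "s > 0" "ball b s \<subseteq> B" using AB openE by metis
    then have "cross3 x y \<noteq> 0" if "x \<in> ball a (min r s)" "y \<in> ball b (min r s)" for x y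
      using AB(5) that by (auto dest!: subsetD[of _ _ "(x, y)"])
    then show ?thesis using \<open>r > 0\<close> \<open>s > 0\<close> by (intro exI[of _ "min r s"]) auto
  qed
  define Q where "Q = {(q i, q j) | i j. i < m \<and> j < m \<and> i \<noteq> j} \<union> {(q i, d) | i d. i < m \<and> d \<in> D}"
  have fQ: "finite Q"
  proof -
    have "Q \<subseteq> (q ` {..<m} \<times> q ` {..<m}) \<union> (q ` {..<m} \<times> D)" unfolding Q_def by auto
    then show ?thesis using fin_D by (meson finite_Un finite_SigmaI finite_imageI finite_lessThan finite_subset)
  qed
  have "\<forall>p\<in>Q. \<exists>r>0. \<forall>x\<in>ball (fst p) r. \<forall>y\<in>ball (snd p) r. cross3 x y \<noteq> 0"
    using a 1 unfolding Q_def adml_def by auto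
  then obtain R where R: "\<And>p. p \<in> Q \<Longrightarrow> R p > 0 \<and> (\<forall>x\<in>ball (fst p) (R p). \<forall>y\<in>ball (snd p) (R p). cross3 x y \<noteq> 0)" by metis
  \<comment> \<open>The bound 1 ensures that no ball contains two antipodal unit vectors, which
    \<open>unit_ball_pm\<close> needs.\<close>
  let ?r = "Min (insert 1 (R ` Q))"
  have r: "?r > 0" "?r \<le> 1" "\<And>p. p \<in> Q \<Longrightarrow> ?r \<le> R p" using fQ R by auto
  have "adml u" if u: "\<forall>i<m. u i \<in> ball (q i) ?r" for u
    unfolding adml_def
  proof (intro conjI allI impI ballI)
    fix i j assume ij: "i < m" "j < m" "i \<noteq> j"
    then have p: "(q i, q j) \<in> Q" unfolding Q_def by auto
    have "u i \<in> ball (q i) (R (q i, q j))" "u j \<in> ball (q j) (R (q i, q j))" using u ij r(3)[OF p] by (force simp: dist_commute)+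
    then show "cross3 (u i) (u j) \<noteq> 0" using R[OF p] by simp
  next
    fix i d assume ij: "i < m" "d \<in> D"
    then have p: "(q i, d) \<in> Q" unfolding Q_def by auto
    have "u i \<in> ball (q i) (R (q i, d))" "d \<in> ball d (R (q i, d))" using u ij r(3)[OF p] R[OF p] by (force simp: dist_commute)+
    then show "cross3 (u i) d \<noteq> 0" using R[OF p] by simp
  qed
  then show ?thesis unfolding isbox_def using r by blast
qed

lemma isbox_mono: assumes "isbox q r" "inbox q r q'" "0 < s" "\<And>i. i < m \<Longrightarrow> dist (q i) (q' i) + s \<le> r" "s \<le> r" shows "isbox q' s"
proof -
  have "inbox q r u" if "\<forall>i<m. u i \<in> ball (q' i) s" for u unfolding inbox_def
  proof (intro allI impI)
    fix i assume i: "i < m"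
    have "dist (q i) (u i) \<le> dist (q i) (q' i) + dist (q' i) (u i)" by (rule dist_triangle)
    then show "u i \<in> ball (q i) r" using assms(4)[OF i] that i by force
  qed
  then show ?thesis using assms isbox_adml[OF assms(1)] unfolding isbox_def by auto
qed

text \<open>An open set over which labels can be chosen canonically: by \<open>nbox_lab\<close> and
  \<open>lab_unique\<close> each of its configurations has, up to indices outside \<open>I\<close>,
  exactly one unit labelling in the box.\<close>

definition nbox :: "(nat \<Rightarrow> real^3) \<Rightarrow> real \<Rightarrow> (real^3) set set set" where
  "nbox q r = {c \<in> topspace C. \<forall>i<m. \<exists>x\<in>ball (q i) r. norm x = 1 \<and> pr x \<in> c}"

lemma openin_nbox: "openin C (nbox q r)"
proof -
  have *: "nbox q r = topspace C \<inter> (\<Inter>i\<in>{..<m}. {c \<in> topspace C. \<exists>x\<in>ball (q i) r. norm x = 1 \<and> pr x \<in> c})"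
    unfolding nbox_def by auto
  show ?thesis unfolding * by (intro openin_Int_Inter openin_topspace) (auto intro: openin_meets)
qed

lemma nbox_center: "lab c q \<Longrightarrow> 0 < r \<Longrightarrow> c \<in> nbox q r"
  unfolding nbox_def lab_def using cfg_topspace by (auto simp: cfg_def intro!: bexI[of _ "q _"])

lemma nbox_lab:
  assumes b: "isbox q r" and c: "c \<in> nbox q r"
  shows "\<exists>u. lab c u \<and> inbox q r u"
proof -
  have "\<forall>i. \<exists>x. i < m \<longrightarrow> x \<in> ball (q i) r \<and> norm x = 1 \<and> pr x \<in> c" using c unfolding nbox_def by blast
  then obtain u where u: "\<And>i. i < m \<Longrightarrow> u i \<in> ball (q i) r \<and> norm (u i) = 1 \<and> pr (u i) \<in> c" by metis
  then have i: "inbox q r u" unfolding inbox_def by blast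
  have a: "adml u" by (rule isbox_adml[OF b i])
  have "c \<in> topspace C" using c unfolding nbox_def by blast
  then obtain w where w: "lab c w" using ex_lab by blast
  have "cfg u \<subseteq> c" unfolding cfg_def using u by auto
  moreover have "card (cfg u) = card c" "finite c" using card_cfg[OF a] card_cfg[of w] w unfolding lab_def by (auto simp: cfg_def)
  ultimately have "cfg u = c" by (metis card_subset_eq)
  then show ?thesis using u i a unfolding lab_def by blast
qed

lemma unit_ball_pm:
  assumes "norm (x::real^3) = 1" "x \<in> ball a r" "y \<in> ball a r" "r \<le> 1" "y = x \<or> y = - x"
  shows "y = x"
proof (rule ccontr)
  assume "y \<noteq> x"
  then have e: "y = - x" using assms by auto
  have "dist x y \<le> dist a x + dist a y" by (metis dist_commute dist_triangle)
  also have "\<dots> < r + r" using assms by (intro add_strict_mono) auto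
  also have "\<dots> \<le> 2" using assms by simp
  also have "dist x y = norm (2 *\<^sub>R x)" unfolding e dist_norm by (simp add: scaleR_2)
  finally show False using assms by simp
qed

lemma lab_unique:
  assumes b: "isbox q r" and u: "lab c u" "inbox q r u" and v: "lab c v" "inbox q r v" and i: "i < m"
  shows "u i = v i"
proof -
  have "pr (u i) \<in> cfg v" using u(1) v(1) i unfolding lab_def by (auto simp: cfg_def)
  then obtain j where j: "j < m" "pr (u i) = pr (v j)" unfolding cfg_def by auto
  have nz: "u i \<noteq> 0" "v j \<noteq> 0" using adml_nz isbox_adml[OF b] u v i j by blast+
  have "cross3 (u i) (v j) = 0" using j(2) pr_eq_iff[OF nz] by simp
  then have ji: "j = i" using isbox_cross[OF b i j(1)] u(2) v(2) i j(1) unfolding inbox_def by metis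
  have n: "norm (u i) = 1" "norm (v i) = 1" using u v i unfolding lab_def by auto
  then have "v i = u i \<or> v i = - u i" using j(2) pr_eq_unit unfolding ji by blast
  moreover have "u i \<in> ball (q i) r" "v i \<in> ball (q i) r" "r \<le> 1" using u(2) v(2) i b unfolding inbox_def isbox_def by blast+
  ultimately have "v i = u i" using unit_ball_pm[OF n(1)] by blast
  then show ?thesis by simp
qed

text \<open>Continuity follows from uniqueness: configurations near \<open>g z\<close> have a
  labelling in a small box around \<open>u z\<close>, and this must be the one already
  chosen.\<close>

lemma box_section:
  fixes S :: "'a::topological_space set"
  assumes b: "isbox q r" and g: "continuous_map (top_of_set S) C g" and sub: "g ` S \<subseteq> nbox q r"
  shows "\<exists>u. (\<forall>z\<in>S. lab (g z) (u z) \<and> inbox q r (u z)) \<and> (\<forall>i<m. continuous_on S (\<lambda>z. u z i))"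
proof -
  have "\<forall>z. \<exists>u. z \<in> S \<longrightarrow> lab (g z) u \<and> inbox q r u" using nbox_lab[OF b] sub by blast
  then obtain u where u: "\<And>z. z \<in> S \<Longrightarrow> lab (g z) (u z) \<and> inbox q r (u z)" by metis
  have "continuous_on S (\<lambda>z. u z i)" if i: "i < m" for i
    unfolding continuous_on_topological
  proof (intro ballI allI impI)
    fix z B assume z: "z \<in> S" and B: "open B" "u z i \<in> B"
    obtain e where e: "e > 0" "ball (u z i) e \<subseteq> B" using B openE by blast
    \<comment> \<open>Small enough for the box around \<open>u z\<close> to stay inside the given
      box and within distance \<open>e\<close>.\<close>
    define s where "s = Min (insert e ((\<lambda>i. r - dist (q i) (u z i)) ` {..<m}))"
    have pos: "r - dist (q i) (u z i) > 0" if "i < m" for i using u[OF z] that unfolding inbox_def by auto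
    have s: "s > 0" "s \<le> e" "\<And>i. i < m \<Longrightarrow> s \<le> r - dist (q i) (u z i)" unfolding s_def using pos e by auto
    have "s \<le> r" using s(3)[OF i] by (smt (verit) zero_le_dist)
    have sb: "isbox (u z) s" by (rule isbox_mono[OF b]) (use u[OF z] s \<open>s \<le> r\<close> in \<open>auto simp: algebra_simps\<close>)
    have "openin (top_of_set S) {y \<in> topspace (top_of_set S). g y \<in> nbox (u z) s}"
      by (rule openin_continuous_map_preimage[OF g openin_nbox])
    then obtain A where A: "open A" "{y \<in> S. g y \<in> nbox (u z) s} = S \<inter> A" by (auto simp: openin_open)
    show "\<exists>A. open A \<and> z \<in> A \<and> (\<forall>y\<in>S. y \<in> A \<longrightarrow> u y i \<in> B)"
    proof (intro exI[of _ A] conjI ballI impI)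
      have "g z \<in> nbox (u z) s" using nbox_center s u[OF z] by blast
      then show "z \<in> A" using A z by auto
      fix y assume y: "y \<in> S" "y \<in> A"
      then have "g y \<in> nbox (u z) s" using A by blast
      then obtain v where v: "lab (g y) v" "inbox (u z) s v" using nbox_lab[OF sb] by blast
      have "inbox q r v" unfolding inbox_def
      proof (intro allI impI)
        fix j assume j: "j < m"
        have "dist (q j) (v j) \<le> dist (q j) (u z j) + dist (u z j) (v j)" by (rule dist_triangle)
        then show "v j \<in> ball (q j) r" using s(3)[OF j] v(2) j unfolding inbox_def by force
      qed
      then have "u y i = v i" using lab_unique[OF b _ _ v(1) _ i] u[OF y(1)] by blast
      then have "u y i \<in> ball (u z i) e" using v(2) i s(2) unfolding inbox_def by force
      then show "u y i \<in> B" using e by blast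
    qed (rule A)
  qed
  then show ?thesis using u by blast
qed

lemma straight_homotopy:
  assumes c: "\<And>i. i < m \<Longrightarrow> continuous_on {0..1} (\<lambda>t. w t i)" "\<And>i. i < m \<Longrightarrow> continuous_on {0..1} (\<lambda>t. v t i)"
    and e: "\<And>i. i < m \<Longrightarrow> w 0 i = v 0 i" "\<And>i. i < m \<Longrightarrow> w 1 i = v 1 i"
    and a: "\<And>s t. 0 \<le> s \<Longrightarrow> s \<le> 1 \<Longrightarrow> 0 \<le> t \<Longrightarrow> t \<le> 1 \<Longrightarrow> adml (\<lambda>i. (1 - s) *\<^sub>R w t i + s *\<^sub>R v t i)"
  shows "path_homotopic C (\<lambda>t. cfg (w t)) (\<lambda>t. cfg (v t))"
  unfolding path_homotopic_iff
proof (intro exI[of _ "\<lambda>z. cfg (\<lambda>i. (1 - fst z) *\<^sub>R w (snd z) i + fst z *\<^sub>R v (snd z) i)"] conjI ballI)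
  show "continuous_map (top_of_set ({0..1} \<times> {0..1})) C (\<lambda>z. cfg (\<lambda>i. (1 - fst z) *\<^sub>R w (snd z) i + fst z *\<^sub>R v (snd z) i))"
  proof (rule continuous_map_cfg)
    fix i assume i: "i < m"
    have "continuous_on ({0..1} \<times> {0..1}) (\<lambda>z::real \<times> real. (1 - fst z) *\<^sub>R w (snd z) i + fst z *\<^sub>R v (snd z) i)"
      by (intro continuous_intros continuous_on_compose2[OF c(1)[OF i]] continuous_on_compose2[OF c(2)[OF i]]) auto
    then show "continuous_map (top_of_set ({0..1} \<times> {0..1})) euclidean (\<lambda>z::real \<times> real. (1 - fst z) *\<^sub>R w (snd z) i + fst z *\<^sub>R v (snd z) i)" by simp
  qed (use a in auto)
  have e': "cfg (\<lambda>i. (1 - s) *\<^sub>R w t i + s *\<^sub>R v t i) = cfg (w t)" if "\<And>i. i < m \<Longrightarrow> w t i = v t i" for s t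
  proof -
    have "(1 - s) *\<^sub>R w t i + s *\<^sub>R v t i = w t i" if "i < m" for i
      unfolding \<open>\<And>i. i < m \<Longrightarrow> w t i = v t i\<close>[OF that, symmetric] by (simp flip: scaleR_add_left)
    then have "(\<lambda>i. (1 - s) *\<^sub>R w t i + s *\<^sub>R v t i) ` {..<m} = w t ` {..<m}" by (intro image_cong) auto
    then show ?thesis unfolding cfg_def by simp
  qed
  fix s :: real
  show "cfg (\<lambda>i. (1 - fst (s, 0)) *\<^sub>R w (snd (s, 0)) i + fst (s, 0) *\<^sub>R v (snd (s, 0)) i) = cfg (w 0)"
     "cfg (\<lambda>i. (1 - fst (s, 1)) *\<^sub>R w (snd (s, 1)) i + fst (s, 1) *\<^sub>R v (snd (s, 1)) i) = cfg (w 1)"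
    using e'[of 0 s] e'[of 1 s] e by simp_all
qed simp_all

end

context conf
begin

abbreviation "I \<equiv> {..<m}"

lemma adml_iff: "adml w \<longleftrightarrow> inj_on w I \<and> adm D (w ` I)"
proof
  assume a: "adml w"
  have "inj_on w I"
  proof (rule inj_onI, rule ccontr)
    fix i j assume *: "i \<in> I" "j \<in> I" "w i = w j" "i \<noteq> j"
    then have "cross3 (w i) (w j) \<noteq> 0" using a unfolding adml_def by blast
    then show False using * by simp
  qed
  then show "inj_on w I \<and> adm D (w ` I)" using a unfolding adml_def adm_def by (auto simp: inj_on_def)
next
  assume *: "inj_on w I \<and> adm D (w ` I)"
  show "adml w" unfolding adml_def
  proof (intro conjI allI impI ballI)
    fix i j assume "i < m" "j < m" "i \<noteq> j"
    then have "w i \<in> w ` I" "w j \<in> w ` I - {w i}" using * by (auto simp: inj_on_def)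
    then show "cross3 (w i) (w j) \<noteq> 0" using * unfolding adm_def by blast
  next
    fix i d assume "i < m" "d \<in> D"
    then show "cross3 (w i) d \<noteq> 0" using * unfolding adm_def by blast
  qed
qed

lemma adml_upd:
  assumes "k < m" "inj_on w (I - {k})" "adm D (w ` (I - {k}))" "clr (w ` (I - {k}) \<union> D) x a b"
  shows "adml (w(k := x))"
proof -
  have i: "w(k := x) ` I = insert x (w ` (I - {k}))" using assms(1) by auto
  have "inj_on (w(k := x)) I" using adm_insert(1)[OF assms(3,4)] assms(2) by (auto simp: inj_on_def)
  then show ?thesis unfolding adml_iff i using adm_insert(2)[OF assms(3,4)] by simp
qed

definition lin :: "(nat \<Rightarrow> real^3) \<Rightarrow> (nat \<Rightarrow> real^3) \<Rightarrow> real \<Rightarrow> nat \<Rightarrow> real^3" where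
  "lin u v t = (\<lambda>i. (1 - t) *\<^sub>R u i + t *\<^sub>R v i)"

lemma lin_upd: "lin (w(k := a)) (w(k := b)) t = w(k := (1 - t) *\<^sub>R a + t *\<^sub>R b)"
  by (auto simp: lin_def fun_eq_iff simp flip: scaleR_left_distrib)

lemma cfg_upd: "k < m \<Longrightarrow> cfg (w(k := x)) = pr ` insert x (w ` (I - {k}))"
  unfolding cfg_def by (rule arg_cong[where f = "image pr"]) auto

lemma lab_relabel:
  assumes q: "lab c q" and v: "lab c v"
  shows "\<exists>\<pi> e. bij_betw \<pi> I I \<and> (\<forall>i. e i = 1 \<or> e i = - 1) \<and> (\<forall>i<m. v i = e i *\<^sub>R q (\<pi> i))"
proof -
  have "\<exists>j s. i < m \<longrightarrow> j < m \<and> pr (v i) = pr (q j) \<and> (s = 1 \<or> s = - 1) \<and> v i = s *\<^sub>R q j" for i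
  proof (cases "i < m")
    case True
    then have "pr (v i) \<in> cfg v" by (auto simp: cfg_def)
    moreover have "cfg v = cfg q" using q v unfolding lab_def by simp
    ultimately have "pr (v i) \<in> cfg q" by simp
    then obtain j where j: "j < m" "pr (v i) = pr (q j)" unfolding cfg_def by auto
    have "norm (v i) = 1" "norm (q j) = 1" using q v j True unfolding lab_def by auto
    from pr_eq_unit[OF this] j(2) have "v i = 1 *\<^sub>R q j \<or> v i = (- 1) *\<^sub>R q j" by auto
    then show ?thesis using j by blast
  qed simp
  then obtain \<pi> where "\<forall>i. \<exists>s. i < m \<longrightarrow> \<pi> i < m \<and> pr (v i) = pr (q (\<pi> i)) \<and> (s = 1 \<or> s = - 1) \<and> v i = s *\<^sub>R q (\<pi> i)" by metis
  then obtain e where pe: "\<And>i. i < m \<Longrightarrow> \<pi> i < m \<and> pr (v i) = pr (q (\<pi> i)) \<and> (e i = 1 \<or> e i = - 1) \<and> v i = e i *\<^sub>R q (\<pi> i)" by metis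
  have "inj_on \<pi> I"
  proof (rule inj_onI)
    fix i j assume ij: "i \<in> I" "j \<in> I" "\<pi> i = \<pi> j"
    then have "pr (v i) = pr (q (\<pi> i))" "pr (v j) = pr (q (\<pi> j))" using pe by blast+
    then have "pr (v i) = pr (v j)" using ij by simp
    then show "i = j" using adml_pr(2)[of v i j] ij v unfolding lab_def by auto
  qed
  moreover have "\<pi> ` I \<subseteq> I" using pe by auto
  ultimately have "bij_betw \<pi> I I" using endo_inj_surj[of I \<pi>] by (simp add: bij_betw_def)
  moreover have "\<exists>e'. (\<forall>i. e' i = 1 \<or> e' i = - 1) \<and> (\<forall>i<m. e' i = e i)"
    using pe by (intro exI[of _ "\<lambda>i. if i < m then e i else 1"]) auto
  ultimately show ?thesis using pe by metis
qed

lemma cfg_relabel: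
  assumes "bij_betw \<pi> I I" "\<And>i. e i = 1 \<or> e i = - 1"
  shows "cfg (\<lambda>i. e i *\<^sub>R w (\<pi> i)) = cfg w"
proof -
  have "pr (e i *\<^sub>R w (\<pi> i)) = pr (w (\<pi> i))" for i using assms(2)[of i] by auto
  then have "cfg (\<lambda>i. e i *\<^sub>R w (\<pi> i)) = pr ` w ` (\<pi> ` I)" unfolding cfg_def image_image by simp
  then show ?thesis using assms(1) unfolding cfg_def bij_betw_def by simp
qed

lemma inbox_conv:
  assumes "inbox q r u" "inbox q r v" "inbox q r w" "0 \<le> \<alpha>" "0 \<le> \<beta>" "0 \<le> \<gamma>" "\<alpha> + \<beta> + \<gamma> = (1::real)"
  shows "inbox q r (\<lambda>i. \<alpha> *\<^sub>R u i + \<beta> *\<^sub>R v i + \<gamma> *\<^sub>R w i)"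
  unfolding inbox_def
proof (intro allI impI)
  fix i assume i: "i < m"
  let ?a = "\<lambda>n::nat. if n = 0 then \<alpha> else if n = 1 then \<beta> else \<gamma>" and ?y = "\<lambda>n::nat. if n = 0 then u i else if n = 1 then v i else w i"
  have "(\<Sum>n\<in>{0, 1, 2}. ?a n *\<^sub>R ?y n) \<in> ball (q i) r"
    by (rule convex_sum) (use assms i in \<open>auto simp: inbox_def simp del: mem_ball\<close>)
  then show "\<alpha> *\<^sub>R u i + \<beta> *\<^sub>R v i + \<gamma> *\<^sub>R w i \<in> ball (q i) r" by (simp add: add.assoc)
qed

end

section \<open>Straight moves as images of path classes\<close>

locale conf_hom = conf m D P + path_functor "unordered_conf (punctured_RP2 P) m" c0 \<psi>
  for m D P c0 and \<psi> :: "(real \<Rightarrow> (real^3) set set) set \<Rightarrow> 'g::group_add"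
begin

definition seg :: "(nat \<Rightarrow> real^3) \<Rightarrow> (nat \<Rightarrow> real^3) \<Rightarrow> bool" where
  "seg u v \<longleftrightarrow> (\<forall>t\<in>{0..1}. adml (lin u v t))"

definition Fl :: "(nat \<Rightarrow> real^3) \<Rightarrow> (nat \<Rightarrow> real^3) \<Rightarrow> 'g" where
  "Fl u v = Fp (\<lambda>t. cfg (lin u v t))"

lemma pathin_cfg:
  assumes "\<And>i. i < m \<Longrightarrow> continuous_on {0..1} (\<lambda>t. w t i)" "\<And>t. 0 \<le> t \<Longrightarrow> t \<le> 1 \<Longrightarrow> adml (w t)"
  shows "pathin C (\<lambda>t. cfg (w t))"
  unfolding pathin_def using assms by (intro continuous_map_cfg) auto

lemma seg_pathin: "seg u v \<Longrightarrow> pathin C (\<lambda>t. cfg (lin u v t))"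
  by (rule pathin_cfg) (auto simp: seg_def lin_def intro!: continuous_intros)

text \<open>If the whole simplex of labellings spanned by \<open>u\<close>, \<open>v\<close> and
  \<open>w\<close> is admissible, the broken path is deformed into the direct one inside this
  simplex.\<close>

lemma Fl_tri:
  assumes a: "\<And>\<alpha> \<beta> \<gamma>. 0 \<le> \<alpha> \<Longrightarrow> 0 \<le> \<beta> \<Longrightarrow> 0 \<le> \<gamma> \<Longrightarrow> \<alpha> + \<beta> + \<gamma> = 1 \<Longrightarrow> adml (\<lambda>i. \<alpha> *\<^sub>R u i + \<beta> *\<^sub>R v i + \<gamma> *\<^sub>R w i)"
  shows "Fl u v + Fl v w = Fl u w" "seg u v" "seg v w" "seg u w"
proof -
  have s: "seg u v" "seg v w" "seg u w" unfolding seg_def lin_def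
    using a[of "1 - t" t 0 for t] a[of 0 "1 - t" t for t] a[of "1 - t" 0 t for t] by auto
  \<comment> \<open>The broken path in barycentric coordinates of the simplex; the coefficients are
    nonnegative and add up to 1.\<close>
  define W where "W t i = max 0 (1 - 2 * t) *\<^sub>R u i + min (2 * t) (2 - 2 * t) *\<^sub>R v i + max 0 (2 * t - 1) *\<^sub>R w i" for t i
  have j: "path_join (\<lambda>t. cfg (lin u v t)) (\<lambda>t. cfg (lin v w t)) = (\<lambda>t. cfg (W t))"
  proof
    fix t :: real
    show "path_join (\<lambda>t. cfg (lin u v t)) (\<lambda>t. cfg (lin v w t)) t = cfg (W t)"
    proof (cases "t \<le> 1/2")
      case True
      then have "W t = lin u v (2 * t)" by (auto simp: W_def lin_def fun_eq_iff max_def min_def)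
      then show ?thesis using True by (simp add: path_join_def)
    next
      case False
      then have "W t = lin v w (2 * t - 1)" by (auto simp: W_def lin_def fun_eq_iff max_def min_def)
      then show ?thesis using False by (simp add: path_join_def)
    qed
  qed
  have "path_homotopic C (\<lambda>t. cfg (W t)) (\<lambda>t. cfg (lin u w t))"
  proof (rule straight_homotopy)
    fix x t :: real assume t: "0 \<le> x" "x \<le> 1" "0 \<le> t" "t \<le> 1"
    let ?\<alpha> = "(1 - x) * max 0 (1 - 2 * t) + x * (1 - t)" and ?\<beta> = "(1 - x) * min (2 * t) (2 - 2 * t)" and ?\<gamma> = "(1 - x) * max 0 (2 * t - 1) + x * t"
    have e: "(\<lambda>i. (1 - x) *\<^sub>R W t i + x *\<^sub>R lin u w t i) = (\<lambda>i. ?\<alpha> *\<^sub>R u i + ?\<beta> *\<^sub>R v i + ?\<gamma> *\<^sub>R w i)"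
      by (simp add: W_def lin_def scaleR_add_right scaleR_add_left algebra_simps del: max_def min_def)
    have n: "max 0 (1 - 2 * t) + min (2 * t) (2 - 2 * t) + max 0 (2 * t - 1) = 1" by (auto simp: max_def min_def)
    have "?\<alpha> + ?\<beta> + ?\<gamma> = (1 - x) * (max 0 (1 - 2 * t) + min (2 * t) (2 - 2 * t) + max 0 (2 * t - 1)) + x" by argo
    then have "?\<alpha> + ?\<beta> + ?\<gamma> = 1" unfolding n by simp
    then show "adml (\<lambda>i. (1 - x) *\<^sub>R W t i + x *\<^sub>R lin u w t i)" unfolding e using t by (intro a) auto
  qed (auto simp: W_def lin_def intro!: continuous_intros)
  from Fp_homotopic[OF this] have "Fp (path_join (\<lambda>t. cfg (lin u v t)) (\<lambda>t. cfg (lin v w t))) = Fl u w" unfolding j Fl_def .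
  moreover have "Fp (path_join (\<lambda>t. cfg (lin u v t)) (\<lambda>t. cfg (lin v w t))) = Fl u v + Fl v w"
    unfolding Fl_def by (rule Fp_join[OF seg_pathin seg_pathin]) (use s in \<open>auto simp: lin_def\<close>)
  ultimately show "Fl u v + Fl v w = Fl u w" by simp
  show "seg u v" "seg v w" "seg u w" by (rule s)+
qed

text \<open>The default value 0 for motions that are not paths of configurations keeps all values in
  \<open>H\<close>.\<close>

definition mv :: "(real^3) set \<Rightarrow> real^3 \<Rightarrow> real^3 \<Rightarrow> 'g" where
  "mv T a b = (let p = \<lambda>t. pr ` insert ((1 - t) *\<^sub>R a + t *\<^sub>R b) T in if pathin C p then Fp p else 0)"

definition H :: "'g set" where
  "H = {\<psi> (loop_class C c0 g) | g. loop_at C c0 g}"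

lemma mv_Fl: assumes k: "k < m" and s: "seg (w(k := a)) (w(k := b))" and T: "T = w ` (I - {k})"
  shows "mv T a b = Fl (w(k := a)) (w(k := b))"
proof -
  have "(\<lambda>t. pr ` insert ((1 - t) *\<^sub>R a + t *\<^sub>R b) T) = (\<lambda>t. cfg (lin (w(k := a)) (w(k := b)) t))"
    unfolding lin_upd cfg_upd[OF k] T ..
  then show ?thesis using seg_pathin[OF s] unfolding mv_def Fl_def by simp
qed

lemma Fp_H: "pathin C p \<Longrightarrow> Fp p \<in> H"
  using Fp_range unfolding H_def by blast

lemma zero_H: "0 \<in> H"
  using Fp_H[of "\<lambda>t. c0"] Fp_const[OF c] c by (simp add: pathin_const_iff)

lemma mv_in_H: "mv T a b \<in> H"
  unfolding mv_def Let_def using Fp_H zero_H by simp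

lemma H_loop: assumes "g \<in> H" shows "\<exists>p. loop_at C c0 p \<and> Fp p = g"
  using assms Fp_loop unfolding H_def by blast

lemma add_H: assumes "g \<in> H" "h \<in> H" shows "g + h \<in> H"
proof -
  obtain p q where p: "loop_at C c0 p" "Fp p = g" and q: "loop_at C c0 q" "Fp q = h" using H_loop assms by blast
  have "Fp (path_join p q) = g + h" using Fp_join[of p q] p q by (simp add: loop_at_def)
  then show ?thesis using Fp_H[of "path_join p q"] loop_at_join[OF p(1) q(1)] by (simp add: loop_at_def)
qed

lemma minus_H: assumes "g \<in> H" shows "- g \<in> H"
proof -
  obtain p where p: "loop_at C c0 p" "Fp p = g" using H_loop assms by blast
  then show ?thesis using Fp_H[OF pathin_rev[of C p]] Fp_rev[of p] by (simp add: loop_at_def)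
qed

lemma mv_triangle:
  assumes T: "adm D T" "card T + 1 = m" and c: "clr (T \<union> D) a b c"
  shows "mv T a b + mv T b c = mv T a c"
proof -
  define k where "k = m - 1"
  have k: "k < m" "I - {k} = {..<k}" "card T = k" using T(2) unfolding k_def by auto
  have "finite T" using T by (simp add: adm_def)
  then obtain e where e: "bij_betw e {..<k} T" using ex_bij_betw_nat_finite[of T] k by (auto simp: lessThan_atLeast0)
  have eT: "T = e ` (I - {k})" and inj: "inj_on e (I - {k})" using e k by (auto simp: bij_betw_def)
  have ad: "adml (e(k := x))" if "x \<in> cone3 a b c" for x
    by (rule adml_upd[OF k(1) inj, of x x x]) (use T clr_mono[OF c that that that] eT in auto)
  have t': "adml (\<lambda>i. \<alpha> *\<^sub>R (e(k := a)) i + \<beta> *\<^sub>R (e(k := b)) i + \<gamma> *\<^sub>R (e(k := c)) i)" if p: "0 \<le> \<alpha>" "0 \<le> \<beta>" "0 \<le> \<gamma>" "\<alpha> + \<beta> + \<gamma> = 1" for \<alpha> \<beta> \<gamma> :: real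
  proof -
    have "(\<lambda>i. \<alpha> *\<^sub>R (e(k := a)) i + \<beta> *\<^sub>R (e(k := b)) i + \<gamma> *\<^sub>R (e(k := c)) i) = e(k := \<alpha> *\<^sub>R a + \<beta> *\<^sub>R b + \<gamma> *\<^sub>R c)"
      using p(4) by (auto simp: fun_eq_iff simp flip: scaleR_left_distrib)
    then show ?thesis
      using ad[of "\<alpha> *\<^sub>R a + \<beta> *\<^sub>R b + \<gamma> *\<^sub>R c"] p cone3I[of \<alpha> \<beta> \<gamma> _ a b c] by simp
  qed
  have t: "Fl (e(k := a)) (e(k := b)) + Fl (e(k := b)) (e(k := c)) = Fl (e(k := a)) (e(k := c))" "seg (e(k := a)) (e(k := b))" "seg (e(k := b)) (e(k := c))" "seg (e(k := a)) (e(k := c))"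
    by (rule Fl_tri[of "e(k := a)" "e(k := b)" "e(k := c)"]; rule t'; assumption)+
  show ?thesis unfolding mv_Fl[OF k(1) t(2) eT] mv_Fl[OF k(1) t(3) eT] mv_Fl[OF k(1) t(4) eT] by (rule t(1))
qed

text \<open>The places of the two tokens range over a square of admissible labellings. Its diagonal
  cuts it into two simplices, and \<open>Fl_tri\<close> applies to both.\<close>

lemma mv_commute:
  assumes T: "adm D T" "card T + 2 = m" and ca: "clr (T \<union> D) a a' a'" and cb: "clr (T \<union> D) b b' b'" and d: "dj a a' b b'"
  shows "mv (insert b T) a a' + mv (insert a' T) b b' = mv (insert a T) b b' + mv (insert b' T) a a'"
proof -
  define l where "l = m - 2"
  define k where "k = m - 1"
  have k: "k < m" "l < m" "k \<noteq> l" "card T = l" and ml: "m = Suc (Suc l)" "k = Suc l" using T(2) unfolding k_def l_def by linarith+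
  have Ik: "I - {k} = insert l {..<l}" "I - {l} = insert k {..<l}" "k \<notin> {..<l}" unfolding ml lessThan_Suc by auto
  have "finite T" using T by (simp add: adm_def)
  then obtain e where e: "bij_betw e {..<l} T" using ex_bij_betw_nat_finite[of T] k by (auto simp: lessThan_atLeast0)
  define E where "E x y = e(l := y, k := x)" for x y
  have E: "E x y = (E x' y)(k := x)" "E x y = (E x y')(l := y)" for x y x' y'
    using k(3) by (auto simp: E_def fun_eq_iff)
  have im: "E x y ` (I - {k}) = insert y T" "E x y ` (I - {l}) = insert x T" for x y
  proof -
    have "e ` {..<l} = T" using e by (simp add: bij_betw_def)
    moreover have "E x y ` {..<l} = e ` {..<l}" by (rule image_cong) (use ml in \<open>auto simp: E_def\<close>)
    ultimately show "E x y ` (I - {k}) = insert y T" "E x y ` (I - {l}) = insert x T" using k(3) unfolding Ik by (auto simp: E_def)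
  qed
  have ad: "adml (E x y)" if x: "x \<in> cone3 a a' a'" and y: "y \<in> cone3 b b' b'" for x y
  proof -
    have cy: "clr (T \<union> D) y y y" and cx: "clr (T \<union> D) x x x" using clr_mono[OF cb y y y] clr_mono[OF ca x x x] by auto
    have "clr {y} x x x" using clr_mono[of "{y}" a a' a' x x x] d x y unfolding dj_def sep_def clr_def by blast
    then have c2: "clr (insert y T \<union> D) x x x" using cx clr_insert[of y "T \<union> D" x x x] by simp
    have "adm D (insert y T)" using adm_insert[OF T(1) cy] by simp
    moreover have "inj_on (E x y) (I - {k})"
    proof -
      have "inj_on e {..<l}" "e ` {..<l} = T" using e by (simp_all add: bij_betw_def)
      then show ?thesis using adm_insert(1)[OF T(1) cy] k(3) Ik(3) unfolding Ik E_def by (auto simp: inj_on_def)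
    qed
    ultimately have "adml ((E x y)(k := x))" using c2 im by (intro adml_upd[OF k(1), of _ x x x]) auto
    then show ?thesis using E(1)[of x y x] by simp
  qed
  have t1': "adml (\<lambda>i. \<alpha> *\<^sub>R E a b i + \<beta> *\<^sub>R E a' b i + \<gamma> *\<^sub>R E a' b' i)" if p: "0 \<le> \<alpha>" "0 \<le> \<beta>" "0 \<le> \<gamma>" "\<alpha> + \<beta> + \<gamma> = 1" for \<alpha> \<beta> \<gamma> :: real
  proof -
    have "(\<lambda>i. \<alpha> *\<^sub>R E a b i + \<beta> *\<^sub>R E a' b i + \<gamma> *\<^sub>R E a' b' i) = E (\<alpha> *\<^sub>R a + (\<beta> + \<gamma>) *\<^sub>R a' + 0 *\<^sub>R a') ((\<alpha> + \<beta>) *\<^sub>R b + \<gamma> *\<^sub>R b' + 0 *\<^sub>R b')"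
      using p(4) k(3) by (auto simp: E_def fun_eq_iff scaleR_left_distrib simp flip: scaleR_left_distrib)
    then show ?thesis
      using ad[OF cone3I cone3I, of \<alpha> "\<beta> + \<gamma>" 0 _ "\<alpha> + \<beta>" \<gamma> 0] p by simp
  qed
  have t1: "Fl (E a b) (E a' b) + Fl (E a' b) (E a' b') = Fl (E a b) (E a' b')" "seg (E a b) (E a' b)" "seg (E a' b) (E a' b')" "seg (E a b) (E a' b')"
    by (rule Fl_tri[of "E a b" "E a' b" "E a' b'"]; rule t1'; assumption)+
  have t2': "adml (\<lambda>i. \<alpha> *\<^sub>R E a b i + \<beta> *\<^sub>R E a b' i + \<gamma> *\<^sub>R E a' b' i)" if p: "0 \<le> \<alpha>" "0 \<le> \<beta>" "0 \<le> \<gamma>" "\<alpha> + \<beta> + \<gamma> = 1" for \<alpha> \<beta> \<gamma> :: real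
  proof -
    have "(\<lambda>i. \<alpha> *\<^sub>R E a b i + \<beta> *\<^sub>R E a b' i + \<gamma> *\<^sub>R E a' b' i) = E ((\<alpha> + \<beta>) *\<^sub>R a + \<gamma> *\<^sub>R a' + 0 *\<^sub>R a') (\<alpha> *\<^sub>R b + (\<beta> + \<gamma>) *\<^sub>R b' + 0 *\<^sub>R b')"
      using p(4) k(3) by (auto simp: E_def fun_eq_iff scaleR_left_distrib simp flip: scaleR_left_distrib)
    then show ?thesis
      using ad[OF cone3I cone3I, of "\<alpha> + \<beta>" \<gamma> 0 _ \<alpha> "\<beta> + \<gamma>" 0] p by simp
  qed
  have t2: "Fl (E a b) (E a b') + Fl (E a b') (E a' b') = Fl (E a b) (E a' b')" "seg (E a b) (E a b')" "seg (E a b') (E a' b')" "seg (E a b) (E a' b')"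
    by (rule Fl_tri[of "E a b" "E a b'" "E a' b'"]; rule t2'; assumption)+
  have mk: "mv (insert y T) x x' = Fl (E x y) (E x' y)" if "seg (E x y) (E x' y)" for x x' y
  proof -
    have e: "(E x y)(k := x) = E x y" "(E x y)(k := x') = E x' y" by (simp_all add: E_def)
    show ?thesis using mv_Fl[OF k(1) _ im(1)[symmetric], of x y x x'] that unfolding e by blast
  qed
  have ml': "mv (insert x T) y y' = Fl (E x y) (E x y')" if "seg (E x y) (E x y')" for x y y'
  proof -
    have e: "(E x y)(l := y) = E x y" "(E x y)(l := y') = E x y'" using k(3) by (auto simp: E_def fun_eq_iff)
    show ?thesis using mv_Fl[OF k(2) _ im(2)[symmetric], of x y y y'] that unfolding e by blast
  qed
  show ?thesis unfolding mk[OF t1(2)] ml'[OF t1(3)] ml'[OF t2(2)] mk[OF t2(3)] t1(1) t2(1) ..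
qed

sublocale mo: moves D m mv H
proof
  show "finite D" "D \<noteq> {}" by (rule fin_D D_ne)+
  show "0 \<notin> D" using D_nz by blast
  show "cross3 d e \<noteq> 0" if "d \<in> D" "e \<in> D" "d \<noteq> e" for d e using D_cross that .
  show "0 \<in> H" by (rule zero_H)
  show "g + h \<in> H" if "g \<in> H" "h \<in> H" for g h using add_H that .
  show "- g \<in> H" if "g \<in> H" for g using minus_H that .
  show "mv T a b \<in> H" for T a b by (rule mv_in_H)
  show "mv T a b + mv T b c = mv T a c" if "adm D T" "card T + 1 = m" "clr (T \<union> D) a b c" for T a b c using mv_triangle that .
  show "mv (insert b T) a a' + mv (insert a' T) b b' = mv (insert a T) b b' + mv (insert b' T) a a'"
    if "adm D T" "card T + 2 = m" "clr (T \<union> D) a a' a'" "clr (T \<union> D) b b' b'" "dj a a' b b'" for T a a' b b' using mv_commute that .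
  show "mv T (- a) (- b) = mv T a b" for T a b
  proof -
    have "pr ((1 - t) *\<^sub>R (- a) + t *\<^sub>R (- b)) = pr ((1 - t) *\<^sub>R a + t *\<^sub>R b)" for t
      using pr_minus[of "(1 - t) *\<^sub>R a + t *\<^sub>R b"] by simp
    then show ?thesis unfolding mv_def by simp
  qed
  show "mv (insert (- t) T) a b = mv (insert t T) a b" for t T a b unfolding mv_def by simp
qed

section \<open>Decomposition of loops into chains of moves\<close>

lemma box_tri:
  assumes "isbox q r" "inbox q r u" "inbox q r v" "inbox q r w"
  shows "Fl u v + Fl v w = Fl u w" "seg u v"
  by (rule Fl_tri[of u v w]; rule isbox_adml[OF assms(1)], rule inbox_conv; use assms in simp)+

lemma box_refl: "isbox q r \<Longrightarrow> inbox q r u \<Longrightarrow> Fl u u = 0"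
  using box_tri(1)[of q r u u u] by (metis add_0_right add_left_cancel)

text \<open>All labellings in a box are admissible and the box is convex, so moving all tokens at
  once along straight lines is the same as moving them one after the other.\<close>

lemma box_chain_disjoint:
  assumes b: "isbox q r" "inbox q r u" "inbox q r v" and g: "mo.gp (u ` I \<union> v ` I)" and n: "u ` I \<inter> v ` I = {}"
  shows "mo.chain (u ` I) (Fl u v) (v ` I)"
proof -
  define w where "w k i = (if i < k then v i else u i)" for k i
  have wb: "inbox q r (w k)" for k using b unfolding inbox_def w_def by auto
  have wi: "inj_on (w k) I" for k using isbox_adml[OF b(1) wb] adml_iff by blast
  have "mo.chain (u ` I) (Fl u (w k)) (w k ` I)" if "k \<le> m" for k
    using that
  proof (induction k)
    case 0
    have u: "w 0 = u" by (auto simp: w_def fun_eq_iff)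
    have "mo.gp (u ` I)" by (rule mo.gp_subset[OF g]) auto
    moreover have "card (u ` I) = m" using wi[of 0] unfolding u by (simp add: card_image)
    ultimately show ?case unfolding u box_refl[OF b(1,2)] by (rule mo.chain_refl)
  next
    case (Suc k)
    then have k: "k < m" by simp
    have e: "w (Suc k) = (w k)(k := v k)" "w k k = u k" by (auto simp: w_def fun_eq_iff)
    have i: "w k ` I - {u k} = w k ` (I - {k})" using wi[of k] k e(2) by (auto simp: inj_on_def)
    have "mo.chain (u ` I) (Fl u (w k) + mv (w k ` I - {u k}) (u k) (v k)) (insert (v k) (w k ` I - {u k}))"
    proof (rule mo.chain_move)
      show "mo.chain (u ` I) (Fl u (w k)) (w k ` I)" using Suc by simp
      show "u k \<in> w k ` I" using e(2) k by (metis imageI lessThan_iff)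
      show "v k \<notin> w k ` I"
      proof
        assume "v k \<in> w k ` I"
        then obtain i where i: "i < m" "v k = w k i" by auto
        show False
        proof (cases "i < k")
          case True
          then have "v k = v i" using i by (simp add: w_def)
          moreover have "inj_on v I" using isbox_adml[OF b(1,3)] adml_iff by blast
          ultimately have "k = i" using True k by (intro inj_onD[of v I k i]) auto
          then show False using True by simp
        next
          case False
          then have "v k = u i" using i by (simp add: w_def)
          then show False using n i k by auto
        qed
      qed
      show "mo.gp (insert (v k) (w k ` I))" by (rule mo.gp_subset[OF g]) (use k in \<open>auto simp: w_def\<close>)
    qed
    moreover have "insert (v k) (w k ` I - {u k}) = w (Suc k) ` I" unfolding i e(1) using k by auto
    moreover have "mv (w k ` I - {u k}) (u k) (v k) = Fl (w k) (w (Suc k))"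
    proof -
      have "(w k)(k := u k) = w k" using e(2) by auto
      then show ?thesis unfolding i using mv_Fl[OF k, of "w k" "u k" "v k"] box_tri(2)[OF b(1) wb[of k] wb[of "Suc k"] wb[of k]] e(1) by simp
    qed
    moreover have "Fl u (w k) + Fl (w k) (w (Suc k)) = Fl u (w (Suc k))" by (rule box_tri(1)[OF b(1,2) wb wb])
    ultimately show ?case by simp
  qed
  from this[of m] have "mo.chain (u ` I) (Fl u (w m)) (w m ` I)" by simp
  moreover have "w m ` I = v ` I" by (auto simp: w_def)
  moreover have "Fl u (w m) = Fl u v"
  proof -
    have "cfg (lin u (w m) t) = cfg (lin u v t)" for t
      unfolding cfg_def lin_def w_def by (intro arg_cong[where f = "image pr"] image_cong) auto
    then show ?thesis unfolding Fl_def by simp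
  qed
  ultimately show ?thesis by simp
qed

lemma box_generic:
  assumes F: "finite F" "\<And>E. E \<in> F \<Longrightarrow> mo.gp E" and r: "0 < r"
  shows "\<exists>v. inbox q r v \<and> (\<forall>E\<in>F. mo.gp (E \<union> v ` I) \<and> E \<inter> v ` I = {})"
proof -
  have "\<exists>v. (\<forall>i<k. v i \<in> ball (q i) r) \<and> (\<forall>E\<in>F. mo.gp (E \<union> v ` {..<k}) \<and> E \<inter> v ` {..<k} = {})" for k
  proof (induction k)
    case (Suc k)
    then obtain v where v: "\<forall>i<k. v i \<in> ball (q i) r" "\<forall>E\<in>F. mo.gp (E \<union> v ` {..<k}) \<and> E \<inter> v ` {..<k} = {}" by (elim exE conjE)
    have "\<exists>x\<in>ball (q k) r. \<forall>E\<in>(\<lambda>E. E \<union> v ` {..<k}) ` F. mo.gp (insert x E) \<and> x \<notin> E"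
      by (rule mo.gp_generic) (use F v r in auto)
    then obtain x where x: "x \<in> ball (q k) r" "\<And>E. E \<in> F \<Longrightarrow> mo.gp (insert x (E \<union> v ` {..<k})) \<and> x \<notin> E \<union> v ` {..<k}" by auto
    have i: "v(k := x) ` {..<Suc k} = insert x (v ` {..<k})" by (auto simp: lessThan_Suc)
    show ?case
      by (rule exI[of _ "v(k := x)"]; unfold i; use v x in \<open>auto simp: less_Suc_eq\<close>)
  qed (use F in auto)
  from this[of m] show ?thesis unfolding inbox_def by blast
qed

text \<open>\<open>u\<close> and \<open>v\<close> need not be in joint general position; a generic
  labelling in the same box mediates between them.\<close>

lemma box_chain:
  assumes b: "isbox q r" "inbox q r u" "inbox q r v" and g: "mo.gp (u ` I)" "mo.gp (v ` I)"
  shows "mo.chain (u ` I) (Fl u v) (v ` I)"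
proof -
  have r: "0 < r" using b unfolding isbox_def by simp
  have "\<exists>w. inbox q r w \<and> (\<forall>E\<in>{u ` I, v ` I}. mo.gp (E \<union> w ` I) \<and> E \<inter> w ` I = {})"
    by (rule box_generic) (use g r in auto)
  then obtain w where w: "inbox q r w" "\<forall>E\<in>{u ` I, v ` I}. mo.gp (E \<union> w ` I) \<and> E \<inter> w ` I = {}" by (elim exE conjE)
  have 1: "mo.chain (u ` I) (Fl u w) (w ` I)" by (rule box_chain_disjoint[OF b(1,2) w(1)]) (use w in auto)
  have 2: "mo.chain (w ` I) (Fl w v) (v ` I)" by (rule box_chain_disjoint[OF b(1) w(1) b(3)]) (use w in \<open>auto simp: Un_commute\<close>)
  from mo.chain_trans[OF 2 1] show ?thesis unfolding box_tri(1)[OF b(1,2) w(1) b(3)] .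
qed

lemma chain_signs:
  assumes "mo.chain S g S1" "mo.gp S2" "S2 \<subseteq> S1 \<union> uminus ` S1" "S1 \<subseteq> S2 \<union> uminus ` S2"
  shows "mo.chain S g S2"
  using assms
proof (induction "card (S2 - S1)" arbitrary: S1 rule: less_induct)
  case less
  have n: "- x \<notin> S2" if "x \<in> S2" for x using mo.gp_neg_notin(1)[OF less.prems(2) that] .
  show ?case
  proof (cases "S2 \<subseteq> S1")
    case True
    have "S1 \<subseteq> S2"
    proof
      fix x assume x: "x \<in> S1"
      have "x \<notin> uminus ` S2"
      proof
        assume "x \<in> uminus ` S2"
        then have "- x \<in> S1" using True by auto
        moreover have "mo.gp S1" using mo.chain_props[OF less.prems(1)] by simp
        ultimately show False using mo.gp_neg_notin(1) x by blast
      qed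
      then show "x \<in> S2" using x less.prems(4) by blast
    qed
    then show ?thesis using True less.prems(1) by simp
  next
    case False
    then obtain x where x: "x \<in> S2" "x \<notin> S1" by blast
    then have mx: "- x \<in> S1" using less.prems(3) by force
    let ?S = "insert x (S1 - {- x})"
    have "mo.chain S g ?S" using mo.chain_flip[OF less.prems(1) mx] by simp
    moreover have "card (S2 - ?S) < card (S2 - S1)"
      by (rule psubset_card_mono) (use mo.gp_finite[OF less.prems(2)] x n[OF x(1)] in auto)
    moreover have "S2 \<subseteq> ?S \<union> uminus ` ?S"
    proof
      fix y assume y: "y \<in> S2"
      then have "y \<noteq> - x" using n[OF x(1)] by auto
      then show "y \<in> ?S \<union> uminus ` ?S" using y less.prems(3) by force
    qed
    moreover have "?S \<subseteq> S2 \<union> uminus ` S2" using less.prems(4) x by auto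
    ultimately show ?thesis using less.hyps less.prems(2) by blast
  qed
qed

text \<open>Where two boxes meet, one configuration has two labellings, which differ by a
  permutation and signs. The chain is continued to a generic labelling \<open>v\<close> close to
  \<open>q\<close>; permuting and negating \<open>v\<close> in the same way yields a labelling in
  the second box, and only sign changes are needed to reach it.\<close>

lemma chain_relabel:
  assumes b: "isbox q0 r" "inbox q0 r q" "inbox q0 r u" and c: "lab c q" and u: "mo.gp (u ` I)" "mo.chain B (x + Fl q u) (u ` I)"
    and b': "isbox q1 r'" "inbox q1 r' q'" and c': "lab c q'"
  shows "\<exists>u'. inbox q1 r' u' \<and> mo.gp (u' ` I) \<and> mo.chain B (x + Fl q' u') (u' ` I)"
proof -
  obtain \<pi> e where pe: "bij_betw \<pi> I I" "\<And>i. e i = 1 \<or> e i = - 1" "\<And>i. i < m \<Longrightarrow> q' i = e i *\<^sub>R q (\<pi> i)"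
    using lab_relabel[OF c c'] by blast
  have pI: "\<pi> i < m" if "i < m" for i using pe(1) that by (auto simp: bij_betw_def)
  \<comment> \<open>A radius for which displacements stay in both boxes. The element 1 keeps the set
    nonempty.\<close>
  define \<rho> where "\<rho> = Min (insert 1 ((\<lambda>i. r - dist (q0 i) (q i)) ` I \<union> (\<lambda>i. r' - dist (q1 i) (q' i)) ` I))"
  have "0 < \<rho>" unfolding \<rho>_def using b(2) b'(2) by (subst Min_gr_iff) (auto simp: inbox_def)
  have rho: "\<rho> \<le> r - dist (q0 i) (q i)" "\<rho> \<le> r' - dist (q1 i) (q' i)" if "i < m" for i
    unfolding \<rho>_def by (rule Min_le; use that in auto)+
  obtain v where v: "inbox q \<rho> v" "mo.gp (v ` I)"
    using box_generic[of "{{}}" \<rho> q] mo.gp_subset[OF u(1), of "{}"] \<open>0 < \<rho>\<close> by auto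
  have vb: "inbox q0 r v" unfolding inbox_def
  proof (intro allI impI)
    fix i assume i: "i < m"
    have "dist (q0 i) (v i) \<le> dist (q0 i) (q i) + dist (q i) (v i)" by (rule dist_triangle)
    then show "v i \<in> ball (q0 i) r" using rho(1)[OF i] v(1) i by (force simp: inbox_def)
  qed
  define u' where "u' i = e i *\<^sub>R v (\<pi> i)" for i
  have eq: "dist (q' i) (u' i) = dist (q (\<pi> i)) (v (\<pi> i))" if "i < m" for i
    using pe(2)[of i] unfolding pe(3)[OF that] u'_def by (auto simp: dist_minus)
  have ub: "inbox q1 r' u'" unfolding inbox_def
  proof (intro allI impI)
    fix i assume i: "i < m"
    have "dist (q1 i) (u' i) \<le> dist (q1 i) (q' i) + dist (q' i) (u' i)" by (rule dist_triangle)
    moreover have "dist (q' i) (u' i) < \<rho>" using v(1) pI[OF i] unfolding eq[OF i] by (simp add: inbox_def)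
    ultimately show "u' i \<in> ball (q1 i) r'" using rho(2)[OF i] by simp
  qed
  have pm: "u' i = v (\<pi> i) \<or> u' i = - v (\<pi> i)" for i using pe(2)[of i] unfolding u'_def by auto
  have s1: "u' ` I \<subseteq> v ` I \<union> uminus ` v ` I"
  proof
    fix y assume "y \<in> u' ` I"
    then obtain i where i: "i < m" "y = u' i" by auto
    then have "v (\<pi> i) \<in> v ` I" using pI by auto
    then show "y \<in> v ` I \<union> uminus ` v ` I" using pm[of i] i by auto
  qed
  have s2: "v ` I \<subseteq> u' ` I \<union> uminus ` u' ` I"
  proof
    fix y assume "y \<in> v ` I"
    then obtain j where j: "j < m" "y = v j" by auto
    then obtain i where i: "i < m" "\<pi> i = j" using pe(1) unfolding bij_betw_def by (metis imageE lessThan_iff)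
    then have "y = u' i \<or> y = - u' i" using pm[of i] j by auto
    then show "y \<in> u' ` I \<union> uminus ` u' ` I" using i by auto
  qed
  have gu: "mo.gp (u' ` I)"
  proof (rule mo.gp_pm[OF v(2) s1])
    fix y assume "y \<in> u' ` I"
    show "- y \<notin> u' ` I"
    proof
      assume "- y \<in> u' ` I"
      then obtain i j where ij: "i < m" "j < m" "y = u' i" "- y = u' j" using \<open>y \<in> u' ` I\<close> by auto
      have a: "adml u'" by (rule isbox_adml[OF b'(1) ub])
      have "cross3 (u' i) (u' j) = 0" unfolding ij(3,4)[symmetric] by simp
      then have "i = j" using a ij unfolding adml_def by blast
      then have "u' i + u' i = 0" using ij by (metis add.right_inverse)
      then have "2 *\<^sub>R u' i = 0" unfolding scaleR_2 .
      then have "u' i = 0" unfolding scaleR_eq_0_iff by simp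
      then show False using adml_nz[OF a ij(1)] by simp
    qed
  qed
  have "Fl q' u' = Fl q v"
  proof -
    have "cfg (lin q' u' t) = cfg (\<lambda>i. e i *\<^sub>R lin q v t (\<pi> i))" for t
      unfolding cfg_def using pe(3) by (intro arg_cong[where f = "image pr"] image_cong) (auto simp: lin_def u'_def algebra_simps)
    also have "cfg (\<lambda>i. e i *\<^sub>R lin q v t (\<pi> i)) = cfg (lin q v t)" for t by (rule cfg_relabel[OF pe(1,2)])
    finally show ?thesis unfolding Fl_def by simp
  qed
  moreover have "mo.chain B (x + Fl q u + Fl u v) (v ` I)"
    by (rule mo.chain_trans[OF box_chain[OF b(1,3) vb u(1) v(2)] u(2)])
  moreover have "x + Fl q u + Fl u v = x + Fl q v" using box_tri(1)[OF b vb] by (simp add: add.assoc)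
  ultimately have "mo.chain B (x + Fl q' u') (v ` I)" by simp
  from chain_signs[OF this gu s1 s2] ub gu show ?thesis by blast
qed

lemma Fp_interval:
  assumes p: "pathin C p" and s: "0 \<le> s" "s \<le> t" "t \<le> 1"
  shows "Fp (\<lambda>x. p (t * x)) = Fp (\<lambda>x. p (s * x)) + Fp (\<lambda>x. p (s + (t - s) * x))"
proof -
  have sub: "s + (t - s) * x \<in> {0..1}" if "x \<in> {0..1}" for x
  proof -
    have "s + (t - s) * x = (1 - x) * s + x * t" by (simp add: algebra_simps)
    then show ?thesis using that s convex_bound_le[of s 1 t "1 - x" x] by auto
  qed
  have 1: "pathin C (\<lambda>x. p (a * x))" if "0 \<le> a" "a \<le> 1" for a
    unfolding pathin_def
    by (rule continuous_map_comp_on[OF p[unfolded pathin_def]]) (use that in \<open>auto intro!: continuous_intros mult_le_one\<close>)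
  have 2: "pathin C (\<lambda>x. p (s + (t - s) * x))" unfolding pathin_def
  proof (rule continuous_map_comp_on[OF p[unfolded pathin_def]])
    show "continuous_on {0..1} (\<lambda>x. s + (t - s) * x)" by (intro continuous_intros)
    show "(\<lambda>x. s + (t - s) * x) ` {0..1} \<subseteq> {0..1}" using sub by blast
  qed
  define \<phi> where "\<phi> x = (if x \<le> 1/2 then s * (2 * x) else s + (t - s) * (2 * x - 1))" for x
  have j: "path_join (\<lambda>x. p (s * x)) (\<lambda>x. p (s + (t - s) * x)) = (\<lambda>x. p (\<phi> x))"
    by (auto simp: path_join_def \<phi>_def fun_eq_iff)
  have "path_homotopic C (\<lambda>x. p (\<phi> x)) (\<lambda>x. p (t * x))"
  proof (rule path_homotopic_reparam[OF p])
    have "continuous_map (top_of_set {0..1}) euclideanreal (\<lambda>x. if x \<le> 1/2 then s * (2 * x) else s + (t - s) * (2 * x - 1))"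
    proof (rule continuous_map_glue)
      show "s * (2 * x) = s + (t - s) * (2 * x - 1)" if "x = 1/2" for x unfolding that by simp
    qed (auto intro!: continuous_intros)
    then show "continuous_on {0..1} \<phi>" unfolding \<phi>_def by simp
    show "\<phi> ` {0..1} \<subseteq> {0..1}"
    proof
      fix y assume "y \<in> \<phi> ` {0..1}"
      then obtain x where x: "x \<in> {0..1}" "y = \<phi> x" by blast
      show "y \<in> {0..1}"
      proof (cases "x \<le> 1/2")
        case True
        moreover have "0 \<le> x" "s \<le> 1" using x s by auto
        ultimately have "s * (2 * x) \<le> 1 * 1" using True s by (intro mult_mono) auto
        then show ?thesis using x s True by (simp add: \<phi>_def)
      next
        case False
        then show ?thesis using x sub[of "2 * x - 1"] by (simp add: \<phi>_def)
      qed
    qed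
    show "continuous_on {0..1} (\<lambda>x. t * x)" by (intro continuous_intros)
    show "(\<lambda>x. t * x) ` {0..1} \<subseteq> {0..1}" using s by (auto intro: mult_le_one)
    show "\<phi> 0 = t * 0" "\<phi> 1 = t * 1" by (simp_all add: \<phi>_def)
  qed
  from Fp_homotopic[OF this] have "Fp (path_join (\<lambda>x. p (s * x)) (\<lambda>x. p (s + (t - s) * x))) = Fp (\<lambda>x. p (t * x))" unfolding j .
  moreover have "pathin C (\<lambda>x. p (s * x))" using 1 s by simp
  ultimately show ?thesis using Fp_join[OF _ 2, of "\<lambda>x. p (s * x)"] by simp
qed

text \<open>The labels along the path form a continuous section in the box, and by convexity this
  section is deformed into the straight path with the same ends.\<close>

lemma Fp_box:
  assumes b: "isbox q r" and p: "pathin C p" and s: "0 \<le> s" "s \<le> t" "t \<le> 1" and sub: "p ` {s..t} \<subseteq> nbox q r"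
    and u: "lab (p s) u" "inbox q r u" and v: "lab (p t) v" "inbox q r v"
  shows "Fp (\<lambda>x. p (s + (t - s) * x)) = Fl u v"
proof -
  have e: "s + (t - s) * x \<in> {s..t}" if "x \<in> {0..1}" for x
    using that s mult_left_le[of x "t - s"] by auto
  have "continuous_map (top_of_set {0..1}) C (\<lambda>x. p (s + (t - s) * x))"
    by (rule continuous_map_comp_on[OF p[unfolded pathin_def]]) (use e s in \<open>fastforce intro!: continuous_intros\<close>)+
  from box_section[OF b this] obtain w where w: "\<And>x. x \<in> {0..1} \<Longrightarrow> lab (p (s + (t - s) * x)) (w x) \<and> inbox q r (w x)" "\<And>i. i < m \<Longrightarrow> continuous_on {0..1} (\<lambda>x. w x i)"
    using e sub by fastforce
  have w0: "w 0 i = u i" "w 1 i = v i" if "i < m" for i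
    using lab_unique[OF b _ _ u that, of "w 0"] lab_unique[OF b _ _ v that, of "w 1"] w(1)[of 0] w(1)[of 1] by auto
  have 1: "path_homotopic C (\<lambda>x. cfg (w x)) (\<lambda>x. cfg (lin u v x))"
  proof (rule straight_homotopy)
    fix y x :: real assume yx: "0 \<le> y" "y \<le> 1" "0 \<le> x" "x \<le> 1"
    have "(\<lambda>i. (1 - y) *\<^sub>R w x i + y *\<^sub>R lin u v x i) = (\<lambda>i. (1 - y) *\<^sub>R w x i + (y * (1 - x)) *\<^sub>R u i + (y * x) *\<^sub>R v i)"
      by (simp add: lin_def algebra_simps)
    moreover have "inbox q r (\<lambda>i. (1 - y) *\<^sub>R w x i + (y * (1 - x)) *\<^sub>R u i + (y * x) *\<^sub>R v i)"
    proof (rule inbox_conv)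
      show "0 \<le> y * (1 - x)" "0 \<le> y * x" using yx by simp_all
      show "1 - y + y * (1 - x) + y * x = 1" by (simp add: algebra_simps)
    qed (use w(1)[of x] u v yx in auto)
    ultimately show "adml (\<lambda>i. (1 - y) *\<^sub>R w x i + y *\<^sub>R lin u v x i)" using isbox_adml[OF b] by simp
  qed (use w w0 in \<open>auto simp: lin_def intro!: continuous_intros\<close>)
  have "path_homotopic C (\<lambda>x. cfg (w x)) (\<lambda>x. p (s + (t - s) * x))"
    by (rule path_homotopic_eq[OF path_homotopic_pathin(1)[OF 1]]) (use w(1) in \<open>auto simp: lab_def\<close>)
  from Fp_homotopic[OF this] Fp_homotopic[OF 1] show ?thesis unfolding Fl_def by simp
qed

lemma path_box:
  assumes p: "pathin C p" and t: "0 \<le> t" "t \<le> 1"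
  shows "\<exists>q r d. lab (p t) q \<and> isbox q r \<and> 0 < d \<and> (\<forall>x. 0 \<le> x \<longrightarrow> x \<le> 1 \<longrightarrow> \<bar>x - t\<bar> < d \<longrightarrow> p x \<in> nbox q r)"
proof -
  have "p t \<in> topspace C" using continuous_map_image_subset_topspace[OF p[unfolded pathin_def]] t by auto
  then obtain q where q: "lab (p t) q" using ex_lab by blast
  then obtain r where r: "isbox q r" using ex_isbox[of q] unfolding lab_def by blast
  have "p t \<in> nbox q r" using nbox_center[OF q] r by (simp add: isbox_def)
  moreover have "openin (top_of_set {0..1}) {x \<in> topspace (top_of_set {0..1}). p x \<in> nbox q r}"
    by (rule openin_continuous_map_preimage[OF p[unfolded pathin_def] openin_nbox])
  ultimately obtain d where "d > 0" "\<And>x. x \<in> {0..1} \<Longrightarrow> dist x t < d \<Longrightarrow> p x \<in> nbox q r"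
    using t unfolding openin_euclidean_subtopology_iff by auto
  then show ?thesis using q r by (auto simp: dist_real_def)
qed

text \<open>Bolzano's principle takes the place of a subdivision of the loop: near each time the
  path stays in one box, where it is a straight path up to homotopy. The configurations on the path,
  including \<open>c0\<close>, need not be generic; short straight paths to generic ones compensate
  for this.\<close>

lemma loops_are_chains: "\<exists>b. \<forall>g\<in>H. mo.chain b g b"
proof -
  obtain q0 where q0: "lab c0 q0" using ex_lab c by blast
  then obtain r0 where r0: "isbox q0 r0" using ex_isbox by (auto simp: lab_def)
  have r0p: "0 < r0" using r0 by (simp add: isbox_def)
  have "mo.gp {}" by (simp add: mo.gp_def adm_def)
  then obtain ub where ub: "inbox q0 r0 ub" "mo.gp (ub ` I)" using box_generic[of "{{}}" r0 q0] r0p by auto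
  have i0: "inbox q0 r0 q0" using r0p by (simp add: inbox_def)
  let ?B = "ub ` I" and ?d = "Fl q0 ub"
  have cB: "mo.chain ?B 0 ?B"
  proof (rule mo.chain_refl[OF ub(2)])
    show "card ?B = m" using isbox_adml[OF r0 ub(1)] adml_iff by (simp add: card_image)
  qed
  have main: "mo.chain ?B (- ?d + Fp p + ?d) ?B" if l: "loop_at C c0 p" for p
  proof -
    have p: "pathin C p" "p 0 = c0" "p 1 = c0" using l by (auto simp: loop_at_def)
    \<comment> \<open>The part of the loop up to time \<open>t\<close>, prolonged by a short path
      inside a box to a generic configuration, is the value of a chain that starts at
      \<open>?B\<close>.\<close>
    define Psi where "Psi t \<longleftrightarrow> (\<exists>Q R q u. isbox Q R \<and> inbox Q R q \<and> inbox Q R u \<and> lab (p t) q \<and> mo.gp (u ` I)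
       \<and> mo.chain ?B (- ?d + Fp (\<lambda>x. p (t * x)) + Fl q u) (u ` I))" for t
    have "Psi 0" unfolding Psi_def
      using r0 i0 ub q0 p cB Fp_const[OF c] by (intro exI[of _ q0] exI[of _ r0] exI[of _ ub]) simp
    moreover have "0 \<le> (0::real) \<longrightarrow> (1::real) \<le> 1 \<longrightarrow> Psi 0 \<longrightarrow> Psi 1"
    proof (rule Bolzano[of 0 1 "\<lambda>a b. 0 \<le> a \<longrightarrow> b \<le> 1 \<longrightarrow> Psi a \<longrightarrow> Psi b"])
      fix x :: real assume x: "0 \<le> x" "x \<le> 1"
      obtain Q R d where Q: "lab (p x) Q" "isbox Q R" "0 < d" "\<And>y. 0 \<le> y \<Longrightarrow> y \<le> 1 \<Longrightarrow> \<bar>y - x\<bar> < d \<Longrightarrow> p y \<in> nbox Q R"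
        using path_box[OF p(1) x] by blast
      have "Psi t" if st: "s \<le> x" "x \<le> t" "t - s < d" "0 \<le> s" "t \<le> 1" and P: "Psi s" for s t
      proof -
        have sub: "p ` {s..t} \<subseteq> nbox Q R" using st Q(4) by auto
        have "p s \<in> nbox Q R" using sub st by auto
        then obtain w where w: "lab (p s) w" "inbox Q R w" using nbox_lab[OF Q(2)] by blast
        have "p t \<in> nbox Q R" using sub st by auto
        then obtain w' where w': "lab (p t) w'" "inbox Q R w'" using nbox_lab[OF Q(2)] by blast
        obtain q0 r q u where P: "isbox q0 r" "inbox q0 r q" "inbox q0 r u" "lab (p s) q" "mo.gp (u ` I)"
           "mo.chain ?B (- ?d + Fp (\<lambda>x. p (s * x)) + Fl q u) (u ` I)" using P unfolding Psi_def by blast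
        obtain u' where u': "inbox Q R u'" "mo.gp (u' ` I)" "mo.chain ?B (- ?d + Fp (\<lambda>x. p (s * x)) + Fl w u') (u' ` I)"
          using chain_relabel[OF P(1-6) Q(2) w(2,1)] by blast
        have "Fp (\<lambda>x. p (t * x)) = Fp (\<lambda>x. p (s * x)) + Fl w w'"
          using Fp_interval[OF p(1) st(4) _ st(5)] Fp_box[OF Q(2) p(1) st(4) _ st(5) sub w w'] st by simp
        then have "- ?d + Fp (\<lambda>x. p (s * x)) + Fl w u' = - ?d + Fp (\<lambda>x. p (t * x)) + Fl w' u'"
          using box_tri(1)[OF Q(2) w(2) w'(2) u'(1)] by (simp add: add.assoc)
        then show "Psi t" using u' Q(2) w' unfolding Psi_def by metis
      qed
      then show "\<exists>d>0. \<forall>a b. a \<le> x \<and> x \<le> b \<and> b - a < d \<longrightarrow> 0 \<le> a \<longrightarrow> b \<le> 1 \<longrightarrow> Psi a \<longrightarrow> Psi b"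
        using Q(3) by blast
    qed auto
    ultimately have "Psi 1" by simp
    then obtain Q R q u where P: "isbox Q R" "inbox Q R q" "inbox Q R u" "lab c0 q" "mo.gp (u ` I)"
           "mo.chain ?B (- ?d + Fp (\<lambda>x. p (1 * x)) + Fl q u) (u ` I)" using p(3) unfolding Psi_def by auto
    from chain_relabel[OF P(1-6) r0 i0 q0] obtain u' where u': "inbox q0 r0 u'" "mo.gp (u' ` I)" "mo.chain ?B (- ?d + Fp p + Fl q0 u') (u' ` I)"
      by auto
    from mo.chain_trans[OF box_chain[OF r0 u'(1) ub(1) u'(2) ub(2)] u'(3)]
    show ?thesis using box_tri(1)[OF r0 i0 u'(1) ub(1)] by (simp add: add.assoc)
  qed
  have "mo.chain ?B g ?B" if g: "g \<in> H" for g
  proof -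
    \<comment> \<open>\<open>main\<close> produces conjugates by \<open>?d\<close>. It is applied to
      a loop for the conjugate of \<open>g\<close> that undoes this.\<close>
    have "?d \<in> H" unfolding Fl_def by (rule Fp_H[OF seg_pathin[OF box_tri(2)[OF r0 i0 ub(1) i0]]])
    then have "?d + g + - ?d \<in> H" using g add_H minus_H by blast
    then obtain p where p: "loop_at C c0 p" "Fp p = ?d + g + - ?d" using H_loop by blast
    have "- ?d + (?d + g + - ?d) + ?d = g" by (simp add: add.assoc)
    then show ?thesis using main[OF p(1)] unfolding p(2) by simp
  qed
  then show ?thesis by blast
qed

theorem H_abelian:
  assumes m: "m \<ge> 3"
    and comm: "(\<forall>a\<in>H. \<forall>b\<in>H. \<forall>c\<in>H. (a + b + - a + - b) + c = c + (a + b + - a + - b)) \<or>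
      m \<ge> 5 \<and> (\<forall>a\<in>H. \<forall>b\<in>H. \<forall>c\<in>H. \<forall>d\<in>H. (a + b + - a + - b) + (c + d + - c + - d) = (c + d + - c + - d) + (a + b + - a + - b))"
    and "g \<in> H" "h \<in> H"
  shows "g + h = h + g"
proof -
  have "mo.adjrel (=)" using comm
  proof
    assume "\<forall>a\<in>H. \<forall>b\<in>H. \<forall>c\<in>H. (a + b + - a + - b) + c = c + (a + b + - a + - b)"
    then show ?thesis by (intro mo.adjrel_nil) blast
  next
    assume *: "m \<ge> 5 \<and> (\<forall>a\<in>H. \<forall>b\<in>H. \<forall>c\<in>H. \<forall>d\<in>H. (a + b + - a + - b) + (c + d + - c + - d) = (c + d + - c + - d) + (a + b + - a + - b))"
    then show ?thesis by (intro mo.adjrel_met) blast+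
  qed
  then interpret moves_adj D m mv H by unfold_locales (use m loops_are_chains in auto)
  show ?thesis using H_commute assms(3,4) .
qed

end

section \<open>Monodromy and noncommuting loops\<close>

context conf
begin

text \<open>The total space of the covering of \<open>S\<close> whose fibre consists of the
  \<open>2 * m\<close> unit vectors that represent the tokens of \<open>h z\<close>.\<close>

definition points :: "'a set \<Rightarrow> ('a \<Rightarrow> (real^3) set set) \<Rightarrow> ('a \<times> (real^3)) set" where
  "points S h = {(z, x). z \<in> S \<and> norm x = 1 \<and> pr x \<in> h z}"

text \<open>Where \<open>h\<close> takes values in one set \<open>nbox Q R\<close>, the sheets are
  indexed by a label and a sign.\<close>

lemma points_covering:
  fixes S :: "'a::real_normed_vector set"
  assumes h: "continuous_map (top_of_set S) C h" and m: "0 < m"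
  shows "covering_space (points S h) fst S"
  unfolding covering_space_def
proof (intro conjI ballI)
  let ?E = "points S h"
  have top: "h z \<in> topspace C" if "z \<in> S" for z
    using continuous_map_image_subset_topspace[OF h] that by auto
  show "continuous_on ?E fst" by (intro continuous_intros)
  show "fst ` ?E = S"
  proof
    show "S \<subseteq> fst ` ?E"
    proof
      fix z assume z: "z \<in> S"
      then obtain w where w: "lab (h z) w" using ex_lab top by blast
      then have "(z, w 0) \<in> ?E" using z m unfolding points_def lab_def by (auto simp: cfg_def)
      then show "z \<in> fst ` ?E" by force
    qed
  qed (auto simp: points_def)
  fix z assume z: "z \<in> S"
  then obtain Q where Q: "lab (h z) Q" using ex_lab top by blast
  then obtain R where R: "isbox Q R" using ex_isbox[of Q] unfolding lab_def by blast
  define T where "T = {y \<in> S. h y \<in> nbox Q R}"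
  have "openin (top_of_set S) {y \<in> topspace (top_of_set S). h y \<in> nbox Q R}"
    by (rule openin_continuous_map_preimage[OF h openin_nbox])
  then have oT: "openin (top_of_set S) T" unfolding T_def by simp
  then obtain A where A: "open A" "T = S \<inter> A" by (auto simp: openin_open)
  have zT: "z \<in> T" using z nbox_center[OF Q, of R] R unfolding T_def isbox_def by blast
  have "continuous_map (top_of_set T) C h"
    by (rule continuous_map_from_subtopology_mono[OF h]) (auto simp: T_def)
  from box_section[OF R this] obtain u where u: "\<And>y. y \<in> T \<Longrightarrow> lab (h y) (u y) \<and> inbox Q R (u y)" and
    uc: "\<And>i. i < m \<Longrightarrow> continuous_on T (\<lambda>y. u y i)" unfolding T_def by blast
  have pts: "x \<in> {u y j, - u y j}" if "pr x = pr (u y j)" "norm x = 1" "y \<in> T" "j < m" for x y j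
    using pr_eq_unit[of "u y j" x] u[OF that(3)] that unfolding lab_def by auto
  have ex: "\<exists>j<m. pr x = pr (u y j)" if "(y, x) \<in> ?E" "y \<in> T" for x y
    using u[OF that(2)] that(1) unfolding points_def lab_def cfg_def by auto
  \<comment> \<open>The sheet of token \<open>i\<close> with sign \<open>s\<close>. A ball around
    the corresponding signed centre cuts it out of the total space, which makes it open.\<close>
  define V where "V = (\<lambda>(i, s). (\<lambda>y. (y, s *\<^sub>R u y i)) ` T)"
  have inE: "(y, s *\<^sub>R u y i) \<in> ?E" if "y \<in> T" "i < m" "s = 1 \<or> s = - 1" for y i s
    using u[OF that(1)] that unfolding points_def lab_def cfg_def T_def by auto
  have V: "V (i, s) = ?E \<inter> (A \<times> ball (s *\<^sub>R Q i) R)" if i: "i < m" and s: "s = 1 \<or> s = - 1" for i s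
  proof -
    have b: "x \<in> ball (s *\<^sub>R Q i) R \<longleftrightarrow> s *\<^sub>R x \<in> ball (Q i) R" for x
      using s by (auto simp: dist_norm norm_minus_commute add.commute)
    have ss: "s *\<^sub>R s *\<^sub>R x = x" for x :: "real^3" using s by auto
    show ?thesis
    proof (intro equalityI subsetI)
      fix p assume "p \<in> V (i, s)"
      then obtain y where y: "y \<in> T" "p = (y, s *\<^sub>R u y i)" unfolding V_def by auto
      have "u y i \<in> ball (Q i) R" using u[OF y(1)] i unfolding inbox_def by blast
      then have "s *\<^sub>R u y i \<in> ball (s *\<^sub>R Q i) R" unfolding b ss .
      then show "p \<in> ?E \<inter> (A \<times> ball (s *\<^sub>R Q i) R)" using inE[OF y(1) i s] y A by auto
    next
      fix p assume p: "p \<in> ?E \<inter> (A \<times> ball (s *\<^sub>R Q i) R)"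
      then obtain y x where yx: "p = (y, x)" "(y, x) \<in> ?E" "y \<in> T" "norm x = 1" "s *\<^sub>R x \<in> ball (Q i) R"
        using A b by (auto simp: points_def)
      obtain j where j: "j < m" "pr x = pr (u y j)" using ex yx by blast
      then have xu: "x \<in> {u y j, - u y j}" using pts yx by blast
      have uj: "u y j \<in> ball (Q j) R" using u[OF yx(3)] j unfolding inbox_def by blast
      have "cross3 (s *\<^sub>R x) (u y j) = 0" using xu s by auto
      then have ji: "i = j" using isbox_cross[OF R i j(1) _ yx(5) uj] by blast
      have "norm (u y j) = 1" using u[OF yx(3)] j unfolding lab_def by blast
      then have "s *\<^sub>R x = u y j" using R xu s yx(5) uj ji by (intro unit_ball_pm[of _ "Q j" R]) (auto simp: isbox_def)
      then have "x = s *\<^sub>R u y i" using ss[of x] ji by simp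
      then show "p \<in> V (i, s)" using yx unfolding V_def by auto
    qed
  qed
  show "\<exists>T. z \<in> T \<and> openin (top_of_set S) T \<and> (\<exists>v. \<Union>v = ?E \<inter> fst -` T \<and> (\<forall>u\<in>v. openin (top_of_set ?E) u) \<and> pairwise disjnt v \<and>
    (\<forall>u\<in>v. \<exists>q. homeomorphism u T fst q))"
  proof (intro exI[of _ T] conjI exI[of _ "V ` (I \<times> {1, - 1})"] zT oT)
    show "\<Union> (V ` (I \<times> {1, - 1})) = ?E \<inter> fst -` T"
    proof (intro equalityI subsetI)
      fix p assume "p \<in> \<Union> (V ` (I \<times> {1, - 1}))"
      then obtain i s where iv: "i < m" "s = 1 \<or> s = - 1" "p \<in> V (i, s)" by auto
      then show "p \<in> ?E \<inter> fst -` T" using inE[OF _ iv(1,2)] unfolding V_def by auto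
    next
      fix p assume "p \<in> ?E \<inter> fst -` T"
      then obtain y x where yx: "p = (y, x)" "(y, x) \<in> ?E" "y \<in> T" "norm x = 1" by (cases p) (auto simp: points_def)
      obtain j where j: "j < m" "pr x = pr (u y j)" using ex yx by blast
      then have "x \<in> {u y j, - u y j}" using pts yx by blast
      then have "x = 1 *\<^sub>R u y j \<or> x = (- 1) *\<^sub>R u y j" by auto
      then have "p \<in> V (j, 1) \<or> p \<in> V (j, - 1)" using yx unfolding V_def by auto
      then show "p \<in> \<Union> (V ` (I \<times> {1, - 1}))" using j by blast
    qed
    show "\<forall>u\<in>V ` (I \<times> {1, - 1}). openin (top_of_set ?E) u"
    proof
      fix U assume "U \<in> V ` (I \<times> {1, - 1})"
      then obtain i s where iv: "i < m" "s = 1 \<or> s = - 1" "U = V (i, s)" by auto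
      show "openin (top_of_set ?E) U" unfolding iv(3) V[OF iv(1,2)] using A by (intro openin_open_Int open_Times) auto
    qed
    show "pairwise disjnt (V ` (I \<times> {1, - 1}))" unfolding pairwise_def
    proof (intro ballI impI)
      fix U U' assume *: "U \<in> V ` (I \<times> {1, - 1})" "U' \<in> V ` (I \<times> {1, - 1})" "U \<noteq> U'"
      obtain i s where iv: "i < m" "s = 1 \<or> s = - 1" "U = V (i, s)" using *(1) by auto
      obtain j t where jt: "j < m" "t = 1 \<or> t = - 1" "U' = V (j, t)" using *(2) by auto
      show "disjnt U U'"
      proof (rule ccontr)
        assume "\<not> disjnt U U'"
        then obtain p where p: "p \<in> V (i, s)" "p \<in> V (j, t)" unfolding iv(3) jt(3) disjnt_iff by blast
        then obtain y where y: "y \<in> T" "s *\<^sub>R u y i = t *\<^sub>R u y j" unfolding V_def by auto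
        have a: "adml (u y)" using u[OF y(1)] unfolding lab_def by blast
        have "s *\<^sub>R s *\<^sub>R u y i = s *\<^sub>R t *\<^sub>R u y j" using y(2) by simp
        then have "u y i = u y j \<or> u y i = - u y j" using iv(2) jt(2) by auto
        then have "cross3 (u y i) (u y j) = 0" by auto
        then have ij: "i = j" using a iv(1) jt(1) unfolding adml_def by blast
        then have "s = t" using y(2) adml_nz[OF a jt(1)] by simp
        then show False using ij *(3) iv(3) jt(3) by simp
      qed
    qed
    show "\<forall>U\<in>V ` (I \<times> {1, - 1}). \<exists>q. homeomorphism U T fst q"
    proof
      fix U assume "U \<in> V ` (I \<times> {1, - 1})"
      then obtain i s where iv: "i < m" "s = 1 \<or> s = - 1" "U = V (i, s)" by auto
      have U: "U = (\<lambda>y. (y, s *\<^sub>R u y i)) ` T" unfolding iv(3) V_def by simp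
      show "\<exists>q. homeomorphism U T fst q"
      proof (intro exI[of _ "\<lambda>y. (y, s *\<^sub>R u y i)"] homeomorphismI)
        show "continuous_on T (\<lambda>y. (y, s *\<^sub>R u y i))" using uc[OF iv(1)] by (intro continuous_intros)
        show "continuous_on U fst" by (intro continuous_intros)
      qed (auto simp: U)
    qed
  qed
qed

text \<open>In the square of the homotopy, \<open>x\<close> lifts the side \<open>s = 0\<close>. The
  other three sides are lifted by a constant, by \<open>y\<close> and by a constant, as the ends
  stay fixed. Both lifts start at the same point and lie over homotopic paths, so they end at the
  same point.\<close>

lemma monodromy:
  assumes hom: "path_homotopic C p q" and m: "0 < m"
    and x: "continuous_on {0..1} x" "\<And>t. 0 \<le> t \<Longrightarrow> t \<le> 1 \<Longrightarrow> norm (x t) = 1 \<and> pr (x t) \<in> p t"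
    and y: "continuous_on {0..1} y" "\<And>t. 0 \<le> t \<Longrightarrow> t \<le> 1 \<Longrightarrow> norm (y t) = 1 \<and> pr (y t) \<in> q t"
    and e: "x 0 = y 0"
  shows "x 1 = y 1"
proof -
  let ?S = "{0..1} \<times> {0..1} :: (real \<times> real) set"
  obtain h where h: "continuous_map (top_of_set ?S) C h" "\<forall>t\<in>{0..1}. h (0, t) = p t" "\<forall>t\<in>{0..1}. h (1, t) = q t"
     "\<forall>s\<in>{0..1}. h (s, 0) = p 0 \<and> h (s, 1) = p 1" using hom unfolding path_homotopic_iff by blast
  note cov = points_covering[OF h(1) m]
  define k1 where "k1 = (\<lambda>t::real. ((0::real, t), x t))"
  define a where "a = (\<lambda>t::real. ((t, 0::real), x 0))"
  define b where "b = (\<lambda>t::real. ((1::real, t), y t))"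
  define d where "d = (\<lambda>t::real. ((1 - t, 1::real), y 1))"
  define k2 where "k2 = a +++ (b +++ d)"
  have pa: "path k1" "path a" "path b" "path d" unfolding path_def k1_def a_def b_def d_def
    by (intro continuous_intros x y)+
  have en: "pathfinish a = pathstart b" "pathfinish b = pathstart d" unfolding a_def b_def d_def pathstart_def pathfinish_def using e by auto
  have p2: "path k2" unfolding k2_def using pa en by simp
  have q1: "q 1 = p 1" using path_homotopic_ends[OF hom] by simp
  have im: "path_image k1 \<subseteq> points ?S h" "path_image a \<subseteq> points ?S h" "path_image b \<subseteq> points ?S h" "path_image d \<subseteq> points ?S h"
    unfolding path_image_def k1_def a_def b_def d_def points_def using h(2,3,4) x(2) y(2) q1 by auto
  have im2: "path_image k2 \<subseteq> points ?S h" unfolding k2_def using im en by (simp add: path_image_join)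
  have pf: "path (fst \<circ> k)" if "path k" for k :: "real \<Rightarrow> (real \<times> real) \<times> (real^3)"
    using that by (intro path_continuous_image continuous_intros)
  have if': "path_image (fst \<circ> k) \<subseteq> ?S" if "path_image k \<subseteq> points ?S h" for k :: "real \<Rightarrow> (real \<times> real) \<times> (real^3)"
    using that unfolding path_image_def points_def by fastforce
  have st: "pathstart k1 = pathstart k2" unfolding k2_def pathstart_join by (simp add: k1_def a_def pathstart_def)
  have fi: "pathfinish k1 = ((0, 1), x 1)" "pathfinish k2 = ((0, 1), y 1)" unfolding k2_def pathfinish_join by (simp_all add: k1_def d_def pathfinish_def)
  have "simply_connected ?S" by (intro convex_imp_simply_connected convex_Times) auto
  then have "homotopic_paths ?S (fst \<circ> k1) (fst \<circ> k2)"
    unfolding simply_connected_eq_homotopic_paths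
    using pf[OF pa(1)] pf[OF p2] if'[OF im(1)] if'[OF im2] st fi by (auto simp: pathstart_compose pathfinish_compose)
  from covering_space_monodromy[OF cov pf[OF pa(1)] if'[OF im(1)] pf[OF p2] if'[OF im2] this pa(1) im(1) _ p2 im2 _ st]
  have "pathfinish k1 = pathfinish k2" by simp
  then show ?thesis unfolding fi by simp
qed

definition reach :: "(nat \<Rightarrow> real^3) \<Rightarrow> (nat \<Rightarrow> real^3) \<Rightarrow> bool" where
  "reach u v \<longleftrightarrow> (\<exists>x. (\<forall>i<m. continuous_on {0..1::real} (\<lambda>t. x t i)) \<and> (\<forall>t\<in>{0..1}. adml (x t)) \<and> (\<forall>i<m. x 0 i = u i \<and> x 1 i = v i))"

lemma reach_trans: assumes "reach u v" "reach v w" shows "reach u w"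
proof -
  obtain x where x: "\<forall>i<m. continuous_on {0..1::real} (\<lambda>t. x t i)" "\<forall>t\<in>{0..1}. adml (x t)" "\<forall>i<m. x 0 i = u i \<and> x 1 i = v i"
    using assms(1) unfolding reach_def by blast
  obtain y where y: "\<forall>i<m. continuous_on {0..1::real} (\<lambda>t. y t i)" "\<forall>t\<in>{0..1}. adml (y t)" "\<forall>i<m. y 0 i = v i \<and> y 1 i = w i"
    using assms(2) unfolding reach_def by blast
  define z where "z t i = path_join (\<lambda>t. x t i) (\<lambda>t. y t i) t" for t i
  have "continuous_on {0..1} (\<lambda>t. z t i)" if i: "i < m" for i
  proof -
    have "pathin euclidean (path_join (\<lambda>t. x t i) (\<lambda>t. y t i))"
      by (rule pathin_join) (use x y i in \<open>auto simp: pathin_def\<close>)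
    then show ?thesis unfolding z_def pathin_def by simp
  qed
  moreover have "adml (z t)" if "t \<in> {0..1}" for t
  proof -
    have "z t = (if t \<le> 1/2 then x (2 * t) else y (2 * t - 1))" by (auto simp: z_def path_join_def fun_eq_iff)
    then show ?thesis using x(2) y(2) that by auto
  qed
  moreover have "\<forall>i<m. z 0 i = u i \<and> z 1 i = w i" unfolding z_def using x(3) y(3) by simp
  ultimately show ?thesis unfolding reach_def by blast
qed

text \<open>The straight segment from \<open>u k\<close> to \<open>b\<close> may hit a token or a
  puncture, so the token makes a detour over a generic point \<open>z\<close>.\<close>

lemma reach_upd: assumes k: "k < m" and u: "adml u" "adml (u(k := b))" shows "reach u (u(k := b))"
proof -
  let ?T = "u ` (I - {k})"
  have inj: "inj_on u (I - {k})" and T: "adm D ?T"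
    using u(1) unfolding adml_iff adm_def by (auto intro: inj_on_subset)
  have c1: "cross3 (u k) e \<noteq> 0" if "e \<in> ?T \<union> D" for e
    using u(1) that k unfolding adml_def by auto
  have c2: "cross3 b e \<noteq> 0" if e: "e \<in> ?T \<union> D" for e
  proof -
    consider "\<exists>i<m. i \<noteq> k \<and> e = u i" | "e \<in> D" using e by auto
    then show ?thesis
    proof cases
      case 1
      then obtain i where "i < m" "i \<noteq> k" "e = u i" by blast
      then show ?thesis using u(2) k unfolding adml_def by (metis fun_upd_apply)
    next
      case 2
      then show ?thesis using u(2) k unfolding adml_def by (metis fun_upd_same)
    qed
  qed
  \<comment> \<open>\<open>z\<close> avoids all planes spanned by an end of the motion and by a
    resting token or a puncture.\<close>
  have "\<exists>z\<in>UNIV. \<forall>n\<in>cross3 (u k) ` (?T \<union> D) \<union> cross3 b ` (?T \<union> D). inner n z \<noteq> 0"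
    by (rule hyperplane_avoid) (use c1 c2 fin_D in \<open>auto simp: image_iff\<close>)
  then obtain z where z: "\<forall>n\<in>cross3 (u k) ` (?T \<union> D) \<union> cross3 b ` (?T \<union> D). inner n z \<noteq> 0" by blast
  have d: "dt e a z \<noteq> 0" if "e \<in> ?T \<union> D" "a = u k \<or> a = b" for e a
  proof -
    have "dt z a e \<noteq> 0" using z that by (auto simp: dt_def inner_commute)
    then show ?thesis by (rule dt_nz)
  qed
  have cl: "clr (?T \<union> D) a z z" if "a = u k \<or> a = b" for a
  proof -
    have "clr {e} a z z" if "e \<in> ?T \<union> D" for e by (rule clr_dt[OF d]) (use that \<open>a = u k \<or> a = b\<close> in auto)
    then show ?thesis unfolding clr_def sep_def by blast
  qed
  have r: "reach (u(k := a)) (u(k := a'))" if "clr (?T \<union> D) a a' a'" for a a'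
    unfolding reach_def
  proof (intro exI[of _ "lin (u(k := a)) (u(k := a'))"] conjI ballI allI impI)
    fix t :: real assume t: "t \<in> {0..1}"
    then have "(1 - t) *\<^sub>R a + t *\<^sub>R a' \<in> cone3 a a' a'" by (intro cone3I[of "1 - t" t 0]) auto
    from clr_mono[OF that this this this] show "adml (lin (u(k := a)) (u(k := a')) t)"
      unfolding lin_upd by (rule adml_upd[OF k inj T])
  qed (auto simp: lin_def intro!: continuous_intros)
  have 1: "reach (u(k := u k)) (u(k := z))" by (rule r[OF cl]) simp
  have "clr (?T \<union> D) b z z" by (rule cl) simp
  from clr_mono[OF this, of z b b] have 2: "reach (u(k := z)) (u(k := b))" by (intro r) simp
  show ?thesis using reach_trans[OF 1 2] unfolding fun_upd_triv .
qed

text \<open>Token \<open>i\<close> steps aside to a free point \<open>z\<close>, token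
  \<open>j\<close> takes its place, and token \<open>i\<close> moves on to the place of
  \<open>j\<close>.\<close>

lemma reach_swap: assumes ij: "i < m" "j < m" "i \<noteq> j" and w: "adml w" shows "reach w (w(i := w j, j := w i))"
proof -
  have "\<exists>n. n \<noteq> 0 \<and> inner n y = 0" for y :: "real^3"
    using orthogonal_to_vector_exists[of y] by (auto simp: orthogonal_def inner_commute)
  then obtain f where f: "\<And>y::real^3. f y \<noteq> 0" "\<And>y. inner (f y) y = 0" by metis
  have "\<exists>z\<in>UNIV. \<forall>n\<in>f ` (w ` I \<union> D). inner n z \<noteq> 0"
    by (rule hyperplane_avoid) (use f(1) fin_D in \<open>auto simp: image_iff\<close>)
  then obtain z where z: "\<forall>n\<in>f ` (w ` I \<union> D). inner n z \<noteq> 0" by blast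
  have c: "cross3 z y \<noteq> 0" if y: "y \<in> w ` I \<union> D" for y
  proof
    assume "cross3 z y = 0"
    moreover have "y \<noteq> 0" using y adml_nz[OF w] D_nz by auto
    ultimately obtain k where "z = k *\<^sub>R y" by (auto simp: cross3_eq_0_iff)
    then have "inner (f y) z = 0" using f(2) by simp
    then show False using z y by blast
  qed
  have cw: "cross3 z (w a) \<noteq> 0" "cross3 (w a) z \<noteq> 0" if "a < m" for a
    using c[of "w a"] that cross3_commute_0[of "w a" z] by auto
  have cD: "cross3 z d \<noteq> 0" if "d \<in> D" for d using c that by blast
  have ww: "cross3 (w a) (w b) \<noteq> 0" if "a < m" "b < m" "a \<noteq> b" for a b using w that unfolding adml_def by blast
  have wD: "cross3 (w a) d \<noteq> 0" if "a < m" "d \<in> D" for a d using w that unfolding adml_def by blast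
  have a1: "adml (w(i := z))" unfolding adml_def using cw cD ww wD ij by auto
  have a2: "adml (w(i := z, j := w i))" unfolding adml_def using cw cD ww wD ij by auto
  have a3: "adml (w(i := w j, j := w i))" unfolding adml_def using ww wD ij by auto
  have e: "(w(i := z, j := w i))(i := w j) = w(i := w j, j := w i)" using ij by auto
  have "reach w (w(i := z))" by (rule reach_upd[OF ij(1) w a1])
  moreover have "reach (w(i := z)) (w(i := z, j := w i))" by (rule reach_upd[OF ij(2) a1 a2])
  moreover have "reach (w(i := z, j := w i)) (w(i := w j, j := w i))" using reach_upd[OF ij(1) a2, of "w j"] a3 unfolding e by blast
  ultimately show ?thesis using reach_trans by blast
qed

lemma cfg_cong: "(\<And>i. i < m \<Longrightarrow> u i = v i) \<Longrightarrow> cfg u = cfg v"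
  unfolding cfg_def by (intro arg_cong[where f = "image pr"] image_cong) auto

lemma swap_loop:
  assumes ij: "i < m" "j < m" "i \<noteq> j" and w: "adml w"
  shows "\<exists>x. (\<forall>i<m. continuous_on {0..1} (\<lambda>t. sgn (x t i))) \<and> (\<forall>t\<in>{0..1}. adml (x t)) \<and>
    (\<forall>k<m. x 0 k = w k \<and> x 1 k = (w(i := w j, j := w i)) k) \<and> loop_at C (cfg w) (\<lambda>t. cfg (x t))"
proof -
  obtain x where x: "\<forall>i<m. continuous_on {0..1::real} (\<lambda>t. x t i)" "\<forall>t\<in>{0..1}. adml (x t)"
    "\<forall>k<m. x 0 k = w k \<and> x 1 k = (w(i := w j, j := w i)) k"
    using reach_swap[OF assms] unfolding reach_def by blast
  have "pathin C (\<lambda>t. cfg (x t))" unfolding pathin_def by (rule continuous_map_cfg) (use x in auto)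
  moreover have "cfg (x 0) = cfg w" by (rule cfg_cong) (use x(3) in auto)
  moreover have "cfg (x 1) = cfg (w(i := w j, j := w i))" by (rule cfg_cong) (use x(3) in auto)
  moreover have "(w(i := w j, j := w i)) ` I = w ` I" using ij by (auto simp: image_iff)
  ultimately have "loop_at C (cfg w) (\<lambda>t. cfg (x t))" unfolding loop_at_def by (simp add: cfg_def)
  moreover have "continuous_on {0..1} (\<lambda>t. sgn (x t i))" if i: "i < m" for i
    unfolding sgn_div_norm using x(1) i adml_nz x(2) by (intro continuous_intros) auto
  ultimately show ?thesis using x(2,3) by blast
qed

text \<open>The loops exchange the first two and the next two labels. Following the token that
  starts at \<open>w 0\<close> through the two products leads to \<open>w 2\<close> and to
  \<open>w 1\<close>, while homotopic loops would lead to the same point.\<close>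

theorem noncommuting_loops:
  assumes m: "3 \<le> m" and c: "c \<in> topspace C"
  shows "\<exists>g h. loop_at C c g \<and> loop_at C c h \<and> \<not> path_homotopic C (path_join g h) (path_join h g)"
proof -
  obtain w where w: "adml w" "c = cfg w" using ex_lab[OF c] unfolding lab_def by blast
  obtain x where x: "\<forall>i<m. continuous_on {0..1} (\<lambda>t. sgn (x t i))" "\<forall>t\<in>{0..1}. adml (x t)"
    "\<forall>k<m. x 0 k = w k \<and> x 1 k = (w(0 := w 1, 1 := w 0)) k" "loop_at C (cfg w) (\<lambda>t. cfg (x t))"
    using swap_loop[of 0 1 w] m w by auto
  obtain y where y: "\<forall>i<m. continuous_on {0..1} (\<lambda>t. sgn (y t i))" "\<forall>t\<in>{0..1}. adml (y t)"
    "\<forall>k<m. y 0 k = w k \<and> y 1 k = (w(1 := w 2, 2 := w 1)) k" "loop_at C (cfg w) (\<lambda>t. cfg (y t))"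
    using swap_loop[of 1 2 w] m w by auto
  have "\<not> path_homotopic C (path_join (\<lambda>t. cfg (x t)) (\<lambda>t. cfg (y t))) (path_join (\<lambda>t. cfg (y t)) (\<lambda>t. cfg (x t)))"
  proof
    assume h: "path_homotopic C (path_join (\<lambda>t. cfg (x t)) (\<lambda>t. cfg (y t))) (path_join (\<lambda>t. cfg (y t)) (\<lambda>t. cfg (x t)))"
    have cont: "continuous_on {0..1} (path_join f g)" if "continuous_on {0..1} f" "continuous_on {0..1} g" "f 1 = g 0" for f g :: "real \<Rightarrow> real^3"
      using pathin_join[of euclidean f g] that unfolding pathin_def by simp
    have lift: "norm (path_join (\<lambda>t. sgn (u t i)) (\<lambda>t. sgn (v t j)) t) = 1 \<and>
        pr (path_join (\<lambda>t. sgn (u t i)) (\<lambda>t. sgn (v t j)) t) \<in> path_join (\<lambda>t. cfg (u t)) (\<lambda>t. cfg (v t)) t"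
      if uv: "\<forall>t\<in>{0..1}. adml (u t)" "\<forall>t\<in>{0..1}. adml (v t)" "i < m" "j < m" and t: "0 \<le> t" "t \<le> 1" for u v i j t
    proof -
      have *: "norm (sgn (u t i)) = 1 \<and> pr (sgn (u t i)) \<in> cfg (u t)" if "adml (u t)" "i < m" for u i and t :: real
        using adml_nz[OF that] that(2) by (auto simp: norm_sgn cfg_def)
      show ?thesis using *[of u "2 * t" i] *[of v "2 * t - 1" j] uv t by (auto simp: path_join_def)
    qed
    \<comment> \<open>In the first product the token arrives at \<open>w 1\<close> and continues as
      token 1 of \<open>y\<close>. In the second it returns to \<open>w 0\<close> as token 0 of
      \<open>y\<close> and is then carried to \<open>w 1\<close> by \<open>x\<close>.\<close>
    have "path_join (\<lambda>t. sgn (x t 0)) (\<lambda>t. sgn (y t 1)) 1 = path_join (\<lambda>t. sgn (y t 0)) (\<lambda>t. sgn (x t 0)) 1"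
    proof (rule monodromy[OF h])
      show "continuous_on {0..1} (path_join (\<lambda>t. sgn (x t 0)) (\<lambda>t. sgn (y t 1)))"
        "continuous_on {0..1} (path_join (\<lambda>t. sgn (y t 0)) (\<lambda>t. sgn (x t 0)))"
        using m x(1,3) y(1,3) by (auto intro!: cont)
      fix t :: real assume t: "0 \<le> t" "t \<le> 1"
      show "norm (path_join (\<lambda>t. sgn (x t 0)) (\<lambda>t. sgn (y t 1)) t) = 1 \<and>
          pr (path_join (\<lambda>t. sgn (x t 0)) (\<lambda>t. sgn (y t 1)) t) \<in> path_join (\<lambda>t. cfg (x t)) (\<lambda>t. cfg (y t)) t"
        by (rule lift[OF x(2) y(2) _ _ t]) (use m in auto)
      show "norm (path_join (\<lambda>t. sgn (y t 0)) (\<lambda>t. sgn (x t 0)) t) = 1 \<and>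
          pr (path_join (\<lambda>t. sgn (y t 0)) (\<lambda>t. sgn (x t 0)) t) \<in> path_join (\<lambda>t. cfg (y t)) (\<lambda>t. cfg (x t)) t"
        by (rule lift[OF y(2) x(2) _ _ t]) (use m in auto)
    qed (use m x(3) y(3) in auto)
    then have "sgn (w 2) = sgn (w 1)" using x(3) y(3) m by simp
    then have "pr (w 2) = pr (w 1)" by (simp add: pr_def)
    then show False using adml_pr(2)[OF w(1), of 2 1] m by simp
  qed
  then show ?thesis using x(4) y(4) w(2) by blast
qed

end

subsection \<open>The lower central and derived series\<close>

text \<open>The locale \<open>moves\<close> takes values in a type of class
  \<open>group_add\<close>, whereas \<open>G/N\<close> is a group on a carrier set. Permutations of
  an arbitrary type form a type of this class that contains a copy of it.\<close>

typedef 'a sym = "{f :: 'a \<Rightarrow> 'a. bij f}" morphisms apply_sym sym_of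
  by (rule exI[of _ id]) simp

lemma bij_apply_sym: "bij (apply_sym f)"
  using apply_sym[of f] by simp

lemma apply_sym_of: "bij f \<Longrightarrow> apply_sym (sym_of f) = f"
  by (simp add: sym_of_inverse)

instantiation sym :: (type) group_add
begin

definition "0 = sym_of (id :: 'a \<Rightarrow> 'a)"
definition "f + g = sym_of (apply_sym f \<circ> apply_sym g)" for f g :: "'a sym"
definition "- f = sym_of (inv_into UNIV (apply_sym f))" for f :: "'a sym"
definition "f - g = f + - g" for f g :: "'a sym"

instance
proof
  have zero: "apply_sym (0 :: 'a sym) = id" unfolding zero_sym_def by (rule apply_sym_of) simp
  have plus: "apply_sym (f + g) = apply_sym f \<circ> apply_sym g" for f g :: "'a sym"
    unfolding plus_sym_def by (rule apply_sym_of) (intro bij_comp bij_apply_sym)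
  have minus: "apply_sym (- f) = inv_into UNIV (apply_sym f)" for f :: "'a sym"
    unfolding uminus_sym_def by (rule apply_sym_of) (intro bij_imp_bij_inv bij_apply_sym)
  fix f g h :: "'a sym"
  show "f + g + h = f + (g + h)" "0 + f = f" "f + 0 = f"
    unfolding apply_sym_inject[symmetric] plus zero by (auto simp: o_assoc)
  show "- f + f = 0"
    unfolding apply_sym_inject[symmetric] plus zero minus using bij_apply_sym[of f] by (simp add: bij_is_inj)
  show "f + - g = f - g" by (simp add: minus_sym_def)
qed

end

lemma apply_sym_plus: "apply_sym (f + g) = apply_sym f \<circ> apply_sym g"
  unfolding plus_sym_def by (rule apply_sym_of) (intro bij_comp bij_apply_sym)

text \<open>Cayley's theorem realizes a quotient group inside a type of class \<open>group_add\<close>.\<close>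
definition left_mult :: "('a, 'b) monoid_scheme \<Rightarrow> 'a \<Rightarrow> 'a sym" where
  "left_mult G x = sym_of (\<lambda>a. if a \<in> carrier G then x \<otimes>\<^bsub>G\<^esub> a else a)"

lemma comm_zero_iff: "(a + b + - a + - b = 0) \<longleftrightarrow> a + b = b + (a::'g::group_add)"
proof -
  have "a + b + - a + - b = (a + b) - (b + a)" by (simp add: diff_conv_add_uminus minus_add add.assoc del: add_uminus_conv_diff)
  then show ?thesis by simp
qed

context group
begin

lemma apply_left_mult:
  assumes x: "x \<in> carrier G"
  shows "apply_sym (left_mult G x) = (\<lambda>a. if a \<in> carrier G then x \<otimes> a else a)"
  unfolding left_mult_def
proof (rule apply_sym_of, rule bijI')
  fix a b
  show "((if a \<in> carrier G then x \<otimes> a else a) = (if b \<in> carrier G then x \<otimes> b else b)) = (a = b)"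
    using x m_closed by auto
  show "\<exists>a. b = (if a \<in> carrier G then x \<otimes> a else a)"
  proof (cases "b \<in> carrier G")
    case True
    then show ?thesis using x by (intro exI[of _ "inv x \<otimes> b"]) (simp add: m_assoc[symmetric])
  qed auto
qed

lemma left_mult_mult: "x \<in> carrier G \<Longrightarrow> y \<in> carrier G \<Longrightarrow> left_mult G (x \<otimes> y) = left_mult G x + left_mult G y"
  unfolding apply_sym_inject[symmetric] apply_sym_plus by (simp add: apply_left_mult fun_eq_iff m_assoc)

lemma left_mult_inject: assumes "x \<in> carrier G" "y \<in> carrier G" "left_mult G x = left_mult G y" shows "x = y"
proof -
  have "apply_sym (left_mult G x) \<one> = apply_sym (left_mult G y) \<one>" using assms(3) by simp
  then show ?thesis using assms(1,2) by (simp add: apply_left_mult)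
qed

lemma quotient_map:
  assumes N: "N \<lhd> G"
  obtains f :: "'a \<Rightarrow> 'a set sym" where "\<And>x y. x \<in> carrier G \<Longrightarrow> y \<in> carrier G \<Longrightarrow> f (x \<otimes> y) = f x + f y"
    and "\<And>x. x \<in> carrier G \<Longrightarrow> f (inv x) = - f x" and "\<And>x. x \<in> carrier G \<Longrightarrow> f x = 0 \<longleftrightarrow> x \<in> N"
proof -
  interpret N: normal N G by (rule N)
  interpret Q: group "G Mod N" by (rule N.factorgroup_is_group)
  define f where "f x = left_mult (G Mod N) (N #> x)" for x
  have cl: "N #> x \<in> carrier (G Mod N)" if "x \<in> carrier G" for x
    using that by (auto simp: FactGroup_def RCOSETS_def)
  have m: "f (x \<otimes> y) = f x + f y" if "x \<in> carrier G" "y \<in> carrier G" for x y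
    unfolding f_def using Q.left_mult_mult[OF cl cl] that by (simp add: N.rcos_sum[symmetric])
  have o: "f \<one> = 0" using m[of \<one> \<one>] by (simp, metis add_0_right add_left_cancel)
  have i: "f (inv x) = - f x" if "x \<in> carrier G" for x
    using m[of x "inv x"] that o by (simp add: minus_unique)
  have "f x = 0 \<longleftrightarrow> x \<in> N" if x: "x \<in> carrier G" for x
  proof -
    have "f x = 0 \<longleftrightarrow> N #> x = N #> \<one>"
      unfolding o[symmetric] f_def using Q.left_mult_inject[OF cl[OF x] cl[OF one_closed]] by metis
    also have "\<dots> \<longleftrightarrow> x \<in> N"
      using x coset_join1[of N x] coset_join2[of x N] N.is_subgroup N.subset by (auto simp: coset_mult_one)
    finally show ?thesis .
  qed
  with m i show thesis by (rule that)
qed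

text \<open>Conjugating a commutator conjugates both of its entries, so the generators are permuted
  by conjugation.\<close>

lemma lower_central_normal: "lower_central G i \<lhd> G"
proof (induction i)
  case (Suc i)
  show ?case
  proof (cases i)
    case (Suc j)
    let ?S = "{x \<otimes> y \<otimes> inv x \<otimes> inv y |x y. x \<in> lower_central G i \<and> y \<in> carrier G}"
    interpret N: normal "lower_central G i" G by (rule Suc.IH)
    have "generate G ?S \<lhd> G"
    proof (rule normal_generateI)
      show "?S \<subseteq> carrier G" using N.subset by auto
      fix h g assume h: "h \<in> ?S" and g: "g \<in> carrier G"
      then obtain x y where xy: "x \<in> lower_central G i" "y \<in> carrier G" "h = x \<otimes> y \<otimes> inv x \<otimes> inv y" by blast
      have x: "x \<in> carrier G" using xy N.subset by auto
      have "g \<otimes> h \<otimes> inv g = (g \<otimes> x \<otimes> inv g) \<otimes> (g \<otimes> y \<otimes> inv g) \<otimes> inv (g \<otimes> x \<otimes> inv g) \<otimes> inv (g \<otimes> y \<otimes> inv g)"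
      proof -
        have "inv g \<otimes> (g \<otimes> z) = z" if "z \<in> carrier G" for z using g that by (simp add: m_assoc[symmetric])
        then show ?thesis unfolding xy(3) using g x xy(2) by (simp add: m_assoc inv_mult_group)
      qed
      moreover have "g \<otimes> x \<otimes> inv g \<in> lower_central G i" using N.inv_op_closed2[OF g xy(1)] .
      ultimately show "g \<otimes> h \<otimes> inv g \<in> ?S" using g xy(2) by blast
    qed
    then show ?thesis unfolding Suc by simp
  qed (simp add: normal_self)
qed (simp add: normal_self)

lemma lower_central_subgroup: "subgroup (lower_central G i) G"
  by (rule normal_imp_subgroup[OF lower_central_normal])

lemma lower_central_2: "x \<in> carrier G \<Longrightarrow> y \<in> carrier G \<Longrightarrow> x \<otimes> y \<otimes> inv x \<otimes> inv y \<in> lower_central G 2"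
  unfolding numeral_2_eq_2 lower_central.simps by (intro generate.incl) auto

lemma lower_central_3: "x \<in> lower_central G 2 \<Longrightarrow> y \<in> carrier G \<Longrightarrow> x \<otimes> y \<otimes> inv x \<otimes> inv y \<in> lower_central G 3"
  unfolding numeral_2_eq_2 numeral_3_eq_3 lower_central.simps(3)[of G "Suc 0"] by (intro generate.incl) auto

text \<open>Each term determines the next one, so a single equality makes the series
  constant.\<close>

lemma lower_central_stable:
  assumes "\<And>x y. x \<in> carrier G \<Longrightarrow> y \<in> carrier G \<Longrightarrow> x \<otimes> y \<otimes> inv x \<otimes> inv y \<in> lower_central G 3"
  shows "lower_central G 2 = lower_central G 3" "lower_central G (i + 2) = lower_central G 2"
proof -
  let ?S = "\<lambda>K. {x \<otimes> y \<otimes> inv x \<otimes> inv y |x y. x \<in> K \<and> y \<in> carrier G}"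
  have l: "lower_central G 2 = generate G (?S (carrier G))" "lower_central G 3 = generate G (?S (lower_central G 2))"
    "lower_central G (Suc i + 2) = generate G (?S (lower_central G (i + 2)))" for i
    by (simp_all only: numeral_2_eq_2 numeral_3_eq_3 lower_central.simps add_Suc_right add_Suc add_0_right)
  have s: "lower_central G 2 \<subseteq> carrier G" using subgroup.subset[OF lower_central_subgroup] .
  show 1: "lower_central G 2 = lower_central G 3"
  proof
    show "lower_central G 2 \<subseteq> lower_central G 3"
      unfolding l(1) by (rule generate_subgroup_incl[OF _ lower_central_subgroup]) (use assms in auto)
    show "lower_central G 3 \<subseteq> lower_central G 2"
      unfolding l(2) by (rule generate_subgroup_incl[OF _ lower_central_subgroup]) (use s lower_central_2 in auto)
  qed
  show "lower_central G (i + 2) = lower_central G 2"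
  proof (induction i)
    case (Suc i)
    show ?case unfolding l(3) Suc using 1 unfolding l(2) ..
  qed (simp only: add_0)
qed

lemma derived_comm: "x \<in> K \<Longrightarrow> y \<in> K \<Longrightarrow> x \<otimes> y \<otimes> inv x \<otimes> inv y \<in> derived G K"
  unfolding derived_def by (intro generate.incl) auto

lemma derived_series_stable:
  assumes "\<And>x y. x \<in> carrier G \<Longrightarrow> y \<in> carrier G \<Longrightarrow> x \<otimes> y \<otimes> inv x \<otimes> inv y \<in> derived_series G 2"
  shows "derived_series G 1 = derived_series G 2" "derived_series G (Suc i) = derived_series G 1"
proof -
  let ?D = "derived G (carrier G)"
  have s: "derived_series G 1 = ?D" "derived_series G 2 = derived G ?D" by (simp_all add: derived_series_def numeral_2_eq_2)
  have "subgroup (derived G ?D) G" by (intro derived_is_subgroup derived_in_carrier) simp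
  then have "generate G (derived_set G (carrier G)) \<subseteq> derived G ?D"
    by (rule generate_subgroup_incl[rotated]) (use assms in \<open>auto simp: s\<close>)
  then have "?D \<subseteq> derived G ?D" by (simp only: derived_def[of G "carrier G"])
  moreover have "derived G ?D \<subseteq> ?D" by (intro mono_derived derived_in_carrier) simp
  ultimately show 1: "derived_series G 1 = derived_series G 2" unfolding s by simp
  show "derived_series G (Suc i) = derived_series G 1"
  proof (induction i)
    case (Suc i)
    then have "derived_series G (Suc (Suc i)) = derived G ?D" using s(1) by (simp add: derived_series_def)
    then show ?case using 1 s by simp
  qed simp
qed

end

section \<open>Application to the braid group\<close>

context conf
begin

text \<open>The alternatives say that \<open>G/N\<close> is nilpotent of class at most 2, or that it
  is metabelian with \<open>m \<ge> 5\<close>. In both cases \<open>G/N\<close> is shown to be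
  abelian through its copy in a group of permutations.\<close>

lemma commutator_in_normal:
  assumes c: "c \<in> topspace C" and m: "m \<ge> 3" and N: "N \<lhd> fundamental_group C c"
    and comm: "(\<forall>x\<in>carrier (fundamental_group C c). \<forall>y\<in>carrier (fundamental_group C c). \<forall>z\<in>carrier (fundamental_group C c). K (K x y) z \<in> N) \<or>
     m \<ge> 5 \<and> (\<forall>x\<in>carrier (fundamental_group C c). \<forall>y\<in>carrier (fundamental_group C c). \<forall>z\<in>carrier (fundamental_group C c).
       \<forall>w\<in>carrier (fundamental_group C c). K (K x y) (K z w) \<in> N)"
    and K: "\<And>x y. K x y = x \<otimes>\<^bsub>fundamental_group C c\<^esub> y \<otimes>\<^bsub>fundamental_group C c\<^esub> inv\<^bsub>fundamental_group C c\<^esub> x \<otimes>\<^bsub>fundamental_group C c\<^esub> inv\<^bsub>fundamental_group C c\<^esub> y"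
    and xy: "x \<in> carrier (fundamental_group C c)" "y \<in> carrier (fundamental_group C c)"
  shows "K x y \<in> N"
proof -
  define G where "G = fundamental_group C c"
  interpret G: group G unfolding G_def by (rule group_fundamental_group[OF c])
  obtain f :: "_ \<Rightarrow> (real \<Rightarrow> (real^3) set set) set set sym" where f: "\<And>x y. x \<in> carrier G \<Longrightarrow> y \<in> carrier G \<Longrightarrow> f (x \<otimes>\<^bsub>G\<^esub> y) = f x + f y"
    "\<And>x. x \<in> carrier G \<Longrightarrow> f (inv\<^bsub>G\<^esub> x) = - f x" "\<And>x. x \<in> carrier G \<Longrightarrow> f x = 0 \<longleftrightarrow> x \<in> N"
    using G.quotient_map[OF N[folded G_def]] by blast
  have Kc: "K x y \<in> carrier G" if "x \<in> carrier G" "y \<in> carrier G" for x y using that unfolding K G_def[symmetric] by simp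
  have fK: "f (K x y) = f x + f y + - f x + - f y" if "x \<in> carrier G" "y \<in> carrier G" for x y
    using that unfolding K G_def[symmetric] by (simp add: f)
  have KN: "K x y \<in> N \<longleftrightarrow> f x + f y = f y + f x" if "x \<in> carrier G" "y \<in> carrier G" for x y
    using f(3)[OF Kc[OF that]] fK[OF that] comm_zero_iff[of "f x" "f y"] by simp
  interpret F: conf_hom m D P c f
  proof unfold_locales
    fix g h assume gh: "loop_at C c g" "loop_at C c h"
    then have "loop_class C c g \<in> carrier G" "loop_class C c h \<in> carrier G" unfolding G_def fundamental_group_carrier by blast+
    then show "f (loop_class C c (path_join g h)) = f (loop_class C c g) + f (loop_class C c h)"
      using f(1) fundamental_group_mult[OF gh] unfolding G_def by metis
  qed (rule c)
  have H: "F.H = f ` carrier G"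
  proof
    show "F.H \<subseteq> f ` carrier G" unfolding F.H_def G_def using fundamental_group_carrier[of _ C c] by blast
    show "f ` carrier G \<subseteq> F.H" unfolding F.H_def G_def using fundamental_group_carrier[of _ C c] by auto
  qed
  have "f x + f y = f y + f x"
  proof (rule F.H_abelian[OF m])
    show "f x \<in> F.H" "f y \<in> F.H" unfolding H using xy by (auto simp: G_def)
    show "(\<forall>a\<in>F.H. \<forall>b\<in>F.H. \<forall>c\<in>F.H. (a + b + - a + - b) + c = c + (a + b + - a + - b)) \<or>
      m \<ge> 5 \<and> (\<forall>a\<in>F.H. \<forall>b\<in>F.H. \<forall>c\<in>F.H. \<forall>d\<in>F.H. (a + b + - a + - b) + (c + d + - c + - d) = (c + d + - c + - d) + (a + b + - a + - b))"
      using comm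
    proof (elim disjE conjE)
      assume a: "\<forall>x\<in>carrier (fundamental_group C c). \<forall>y\<in>carrier (fundamental_group C c). \<forall>z\<in>carrier (fundamental_group C c). K (K x y) z \<in> N"
      have "f x + f y + - f x + - f y + f z = f z + (f x + f y + - f x + - f y)" if "x \<in> carrier G" "y \<in> carrier G" "z \<in> carrier G" for x y z
        using a that KN[OF Kc[OF that(1,2)] that(3)] fK[OF that(1,2)] unfolding G_def by simp
      then show ?thesis unfolding H by blast
    next
      assume a: "\<forall>x\<in>carrier (fundamental_group C c). \<forall>y\<in>carrier (fundamental_group C c). \<forall>z\<in>carrier (fundamental_group C c).
         \<forall>w\<in>carrier (fundamental_group C c). K (K x y) (K z w) \<in> N" and m5: "5 \<le> m"
      have "f x + f y + - f x + - f y + (f z + f w + - f z + - f w) = f z + f w + - f z + - f w + (f x + f y + - f x + - f y)"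
        if "x \<in> carrier G" "y \<in> carrier G" "z \<in> carrier G" "w \<in> carrier G" for x y z w
        using a that KN[OF Kc[OF that(1,2)] Kc[OF that(3,4)]] fK[OF that(1,2)] fK[OF that(3,4)] unfolding G_def by simp
      then show ?thesis unfolding H using m5 by blast
    qed
  qed
  then show ?thesis using KN xy unfolding G_def by blast
qed

lemma noncommuting_elements:
  assumes "3 \<le> m" "c \<in> topspace C"
  shows "\<exists>x\<in>carrier (fundamental_group C c). \<exists>y\<in>carrier (fundamental_group C c).
    x \<otimes>\<^bsub>fundamental_group C c\<^esub> y \<noteq> y \<otimes>\<^bsub>fundamental_group C c\<^esub> x"
proof -
  obtain g h where gh: "loop_at C c g" "loop_at C c h" "\<not> path_homotopic C (path_join g h) (path_join h g)"
    using noncommuting_loops[OF assms] by blast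
  then show ?thesis
    using loop_class_eq[OF loop_at_join[OF gh(1,2)] loop_at_join[OF gh(2,1)]]
    by (intro bexI[of _ "loop_class C c g"] bexI[of _ "loop_class C c h"])
      (auto simp: fundamental_group_mult fundamental_group_carrier)
qed

end

lemma ex_conf:
  assumes "P \<subseteq> topspace RP2" "finite P" "P \<noteq> {}"
  shows "\<exists>D. conf D P"
proof -
  have "\<forall>p\<in>P. \<exists>v. norm v = 1 \<and> pr v = p" using assms(1) unfolding topspace_RP2 by auto
  then obtain f where f: "\<And>p. p \<in> P \<Longrightarrow> norm (f p) = 1 \<and> pr (f p) = p" by metis
  have "conf (f ` P) P"
  proof
    show "norm d = 1" if "d \<in> f ` P" for d using f that by auto
    show "cross3 d e \<noteq> 0" if de: "d \<in> f ` P" "e \<in> f ` P" "d \<noteq> e" for d e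
    proof -
      obtain p q where pq: "p \<in> P" "q \<in> P" "d = f p" "e = f q" using de by auto
      then have "norm d = 1" "norm e = 1" "pr d = p" "pr e = q" using f by auto
      moreover from this have "d \<noteq> 0" "e \<noteq> 0" by auto
      ultimately show ?thesis using pr_eq_iff[of d e] pq de(3) by auto
    qed
    show "P = pr ` f ` P" using f by (auto simp: image_image)
  qed (use assms in auto)
  then show ?thesis by blast
qed

theorem theoremC:
  fixes n m :: nat and P :: "(real^3) set set" and c :: "(real^3) set set"
  assumes "n \<ge> 1"
    and "P \<subseteq> topspace RP2" and "finite P" and "card P = n"
    and "c \<in> topspace (unordered_conf (punctured_RP2 P) m)"
  shows "(m \<ge> 3 \<longrightarrow>
            lower_central (braid_group_RP2 P m c) 2 = lower_central (braid_group_RP2 P m c) 3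
          \<and> \<not> residually_nilpotent (braid_group_RP2 P m c))
       \<and> (m \<ge> 5 \<longrightarrow>
            derived_series (braid_group_RP2 P m c) 1 = derived_series (braid_group_RP2 P m c) 2
          \<and> \<not> residually_solvable (braid_group_RP2 P m c))"
proof -
  have "P \<noteq> {}" using assms(1,4) by auto
  then obtain D where "conf D P" using ex_conf assms(2,3) by blast
  then interpret conf m D P .
  let ?G = "braid_group_RP2 P m c"
  have G: "?G = fundamental_group C c" unfolding braid_group_RP2_def ..
  interpret G: group ?G unfolding G by (rule group_fundamental_group[OF assms(5)])
  \<comment> \<open>A nontrivial commutator. Once a series is constant from its first commutator
    term on, this element lies in all of its terms, and their intersection is not trivial.\<close>
  have ab: "\<exists>k. k \<noteq> \<one>\<^bsub>?G\<^esub> \<and> (\<exists>x\<in>carrier ?G. \<exists>y\<in>carrier ?G. k = x \<otimes>\<^bsub>?G\<^esub> y \<otimes>\<^bsub>?G\<^esub> inv\<^bsub>?G\<^esub> x \<otimes>\<^bsub>?G\<^esub> inv\<^bsub>?G\<^esub> y)" if m: "3 \<le> m"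
  proof -
    obtain x y where xy: "x \<in> carrier ?G" "y \<in> carrier ?G" "x \<otimes>\<^bsub>?G\<^esub> y \<noteq> y \<otimes>\<^bsub>?G\<^esub> x"
      using noncommuting_elements[OF m assms(5)] unfolding G by blast
    have "x \<otimes>\<^bsub>?G\<^esub> y \<otimes>\<^bsub>?G\<^esub> inv\<^bsub>?G\<^esub> x \<otimes>\<^bsub>?G\<^esub> inv\<^bsub>?G\<^esub> y \<noteq> \<one>\<^bsub>?G\<^esub>"
    proof
      assume "x \<otimes>\<^bsub>?G\<^esub> y \<otimes>\<^bsub>?G\<^esub> inv\<^bsub>?G\<^esub> x \<otimes>\<^bsub>?G\<^esub> inv\<^bsub>?G\<^esub> y = \<one>\<^bsub>?G\<^esub>"
      then have "(x \<otimes>\<^bsub>?G\<^esub> y) \<otimes>\<^bsub>?G\<^esub> inv\<^bsub>?G\<^esub> (y \<otimes>\<^bsub>?G\<^esub> x) = \<one>\<^bsub>?G\<^esub>"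
        using xy(1,2) by (simp add: G.inv_mult_group G.m_assoc)
      then show False using xy G.inv_equality[of "x \<otimes>\<^bsub>?G\<^esub> y" "inv\<^bsub>?G\<^esub> (y \<otimes>\<^bsub>?G\<^esub> x)"] by simp
    qed
    then show ?thesis using xy by blast
  qed
  show ?thesis
  proof (intro conjI impI)
    assume m: "3 \<le> m"
    have st: "x \<otimes>\<^bsub>?G\<^esub> y \<otimes>\<^bsub>?G\<^esub> inv\<^bsub>?G\<^esub> x \<otimes>\<^bsub>?G\<^esub> inv\<^bsub>?G\<^esub> y \<in> lower_central ?G 3" if "x \<in> carrier ?G" "y \<in> carrier ?G" for x y
    proof (rule commutator_in_normal[OF assms(5) m, folded G, of _ "\<lambda>x y. x \<otimes>\<^bsub>?G\<^esub> y \<otimes>\<^bsub>?G\<^esub> inv\<^bsub>?G\<^esub> x \<otimes>\<^bsub>?G\<^esub> inv\<^bsub>?G\<^esub> y"])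
      show "lower_central ?G 3 \<lhd> ?G" by (rule G.lower_central_normal)
    qed (use G.lower_central_2 G.lower_central_3 that in auto)
    note stable = G.lower_central_stable[OF st]
    show "lower_central ?G 2 = lower_central ?G 3" by (rule stable(1))
    obtain k where k: "k \<noteq> \<one>\<^bsub>?G\<^esub>" "k \<in> lower_central ?G 2" "k \<in> carrier ?G"
      using ab[OF m] G.lower_central_2 by auto
    have "k \<in> lower_central ?G i" if "1 \<le> i" for i
    proof (cases "i = 1")
      case False
      then have "i = (i - 2) + 2" using that by simp
      then show ?thesis using stable(2)[of "i - 2"] k(2) by metis
    qed (use k in simp)
    then show "\<not> residually_nilpotent ?G" unfolding residually_nilpotent_def using k(1) by auto
  next
    assume m: "5 \<le> m"
    then have m3: "3 \<le> m" by simp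
    have s: "derived_series ?G 2 = derived ?G (derived ?G (carrier ?G))" by (simp add: derived_series_def numeral_2_eq_2)
    have st: "x \<otimes>\<^bsub>?G\<^esub> y \<otimes>\<^bsub>?G\<^esub> inv\<^bsub>?G\<^esub> x \<otimes>\<^bsub>?G\<^esub> inv\<^bsub>?G\<^esub> y \<in> derived_series ?G 2" if "x \<in> carrier ?G" "y \<in> carrier ?G" for x y
    proof (rule commutator_in_normal[OF assms(5) m3, folded G, of _ "\<lambda>x y. x \<otimes>\<^bsub>?G\<^esub> y \<otimes>\<^bsub>?G\<^esub> inv\<^bsub>?G\<^esub> x \<otimes>\<^bsub>?G\<^esub> inv\<^bsub>?G\<^esub> y"])
      show "derived_series ?G 2 \<lhd> ?G" unfolding s by (intro G.derived_is_normal G.normal_self)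
    qed (use m G.derived_comm that in \<open>auto simp: s\<close>)
    note stable = G.derived_series_stable[OF st]
    show "derived_series ?G 1 = derived_series ?G 2" by (rule stable(1))
    obtain k where k: "k \<noteq> \<one>\<^bsub>?G\<^esub>" "k \<in> derived_series ?G 1" "k \<in> carrier ?G"
      using ab[OF m3] G.derived_comm[of _ "carrier ?G"] by (auto simp: derived_series_def)
    have "k \<in> derived_series ?G i" for i
    proof (cases i)
      case 0
      then show ?thesis using k by (simp add: derived_series_def)
    qed (use stable(2) k(2) in metis)
    then show "\<not> residually_solvable ?G" unfolding residually_solvable_def using k(1) by auto
  qed
qed

end
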